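(* Let $k,p$ satisfy $k=\omega(\log n)$ and $p=\omega(\log n/n)$. Suppose there exist a solver $\mathcal B_1$ for Search $\mathsf{sympLPN}(n,n,p)$ running in time $T_1$ and a solver $\mathcal B_2$ for Search $\mathsf{LSN}(k,n,p)$ running in time $T_2$, both succeeding with probability $1/\mathrm{poly}(n)$. Then there exists an algorithm $\mathcal A$ running in time $T_1+T_2+\mathrm{poly}(n)$ which inverts the function family described in the context, i.e. $\Pr_{\mathcal A,I,x}[f_I(\mathcal A(I,f_I(x)))=f_I(x)]=1/\mathrm{poly}(n)$, where $I\sim\mathsf{Gen}(1^n)$ and $x\sim\mathsf{Sample}(I)$.
   Context: Symplectic inner product on $\mathbb{Z}_2^{2n}$: $(\mathbf a,\mathbf b)\odot(\mathbf a',\mathbf b')=\mathbf a\cdot\mathbf b'+\mathbf a'\cdot\mathbf b\pmod2$; a matrix is isotropic if its columns are pairwise symplectically orthogonal. $\mathcal{D}_p^{\otimes n}$: random $\mathbf e\in\mathbb{Z}_2^{2n}$ with independent pairs $(e_j,e_{n+j})$, each $(0,0)$ w.p. $1-p$ and each of $(0,1),(1,0),(1,1)$ w.p. $p/3$. Weight of $\mathbf e\in\mathbb{Z}_2^{2n}$: number of $j$ with $(e_j,e_{n+j})\ne(0,0)$; $\mathcal W_d$: vectors of weight at most $d$. Search $\mathsf{sympLPN}(n,n,p)$: given $(\mathbf A,\mathbf A\mathbf x+\mathbf e)$ with $\mathbf A\in\mathbb{Z}_2^{2n\times n}$ uniform among full-rank isotropic matrices, $\mathbf x\sim\mathbb{Z}_2^n$,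 $\mathbf e\sim\mathcal{D}_p^{\otimes n}$, output $\mathbf x$ (success probability $1/\mathrm{poly}(n)$). Search $\mathsf{LSN}(k,n,p)$: given $([\mathbf A|\mathbf B],\mathbf A\mathbf r+\mathbf B\mathbf y+\mathbf e)$ with $\mathbf A\in\mathbb{Z}_2^{2n\times n}$, $\mathbf B\in\mathbb{Z}_2^{2n\times k}$ uniformly random subject to $\mathbf A,\mathbf B$ isotropic and $[\mathbf A|\mathbf B]$ full rank, $\mathbf r\sim\mathbb{Z}_2^n$, $\mathbf y\sim\mathbb{Z}_2^k$, $\mathbf e\sim\mathcal{D}_p^{\otimes n}$, output $\mathbf y$. Function family: $\mathsf{Gen}(1^n)$ outputs $I=(\mathbf A,\mathbf B)$ as in $\mathsf{LSN}$; domain $\mathbb{Z}_2^n\times\mathbb{Z}_2^k\times\mathcal W_{2.01np}$; $\mathsf{Sample}(I)$ outputs $(\mathbf r,\mathbf y,\mathbf e)$, $\mathbf r\sim\mathbb{Z}_2^n$, $\mathbf y\sim\mathbb{Z}_2^k$, $\mathbf e\sim\mathcal{D}_p^{\otimes n}$ (replaced by $\mathbf 0$ if its weight exceeds $2.01np$); $f_I(\mathbf r,\mathbf y,\mathbf e)=(\mathbf A,\mathbf B,\mathbf A\mathbf r+\mathbf B\mathbf y+\mathbf e)$. *)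

theory Defs
  imports "HOL-Probability.Probability" "HOL-Library.Landau_Symbols"
begin

section \<open>Linear algebra over Z_2 (vectors = bool lists, matrices = lists of columns)\<close>

definition vadd :: "bool list \<Rightarrow> bool list \<Rightarrow> bool list" where
  "vadd u v = map2 (\<noteq>) u v"

definition dotp :: "bool list \<Rightarrow> bool list \<Rightarrow> bool" where
  "dotp u v = odd (length (filter id (map2 (\<and>) u v)))"

definition mat_vec :: "nat \<Rightarrow> bool list list \<Rightarrow> bool list \<Rightarrow> bool list" where
  "mat_vec m M x = foldr (\<lambda>(c, b) acc. if b then vadd c acc else acc) (zip M x) (replicate m False)"

definition sympl :: "nat \<Rightarrow> bool list \<Rightarrow> bool list \<Rightarrow> bool" where
  "sympl n u v = (dotp (take n u) (drop n v) \<noteq> dotp (take n v) (drop n u))"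

definition is_mat :: "nat \<Rightarrow> nat \<Rightarrow> bool list list \<Rightarrow> bool" where
  "is_mat m c M \<longleftrightarrow> length M = c \<and> (\<forall>col\<in>set M. length col = m)"

definition isotropic :: "nat \<Rightarrow> bool list list \<Rightarrow> bool" where
  "isotropic n M \<longleftrightarrow> (\<forall>i<length M. \<forall>j<length M. \<not> sympl n (M ! i) (M ! j))"

definition full_rank :: "nat \<Rightarrow> bool list list \<Rightarrow> bool" where
  "full_rank m M \<longleftrightarrow> (\<forall>x. length x = length M \<and> mat_vec m M x = replicate m False \<longrightarrow> x = replicate (length M) False)"

definition weight :: "nat \<Rightarrow> bool list \<Rightarrow> nat" where
  "weight n e = card {j. j < n \<and> (e ! j \<or> e ! (n + j))}"

definition uniform_vec :: "nat \<Rightarrow> bool list pmf" where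
  "uniform_vec n = pmf_of_set {xs. length xs = n}"

definition noise_pair :: "real \<Rightarrow> (bool \<times> bool) pmf" where
  "noise_pair p = do { b \<leftarrow> bernoulli_pmf p;
      if b then pmf_of_set {(False, True), (True, False), (True, True)} else return_pmf (False, False) }"

fun noise_pairs :: "real \<Rightarrow> nat \<Rightarrow> (bool \<times> bool) list pmf" where
  "noise_pairs p 0 = return_pmf []"
| "noise_pairs p (Suc m) = do { x \<leftarrow> noise_pair p; xs \<leftarrow> noise_pairs p m; return_pmf (x # xs) }"

definition noise :: "real \<Rightarrow> nat \<Rightarrow> bool list pmf" where
  "noise p n = map_pmf (\<lambda>ps. map fst ps @ map snd ps) (noise_pairs p n)"

definition lagr_mats :: "nat \<Rightarrow> bool list list set" where
  "lagr_mats n = {A. is_mat (2*n) n A \<and> isotropic n A \<and> full_rank (2*n) A}"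

definition lsn_mats :: "nat \<Rightarrow> nat \<Rightarrow> (bool list list \<times> bool list list) set" where
  "lsn_mats k n = {(A, B). is_mat (2*n) n A \<and> is_mat (2*n) k B \<and> isotropic n A \<and> isotropic n B
        \<and> full_rank (2*n) (A @ B)}"

definition enc_bits :: "bool list \<Rightarrow> bool list" where
  "enc_bits bs = concat (map (\<lambda>b. [True, b]) bs) @ [False]"

definition enc_mat :: "bool list list \<Rightarrow> bool list" where
  "enc_mat M = concat (map (\<lambda>c. True # enc_bits c) M) @ [False]"

datatype instr =
    Push nat bool
  | Pop nat              \<comment> \<open>pop stack r (no-op if empty)\<close>
  | JmpEmpty nat nat
  | JmpTrue nat nat
  | Jmp nat
  | Coin nat
  | Halt

type_synonym config = "nat \<times> (nat \<Rightarrow> bool list) \<times> bool list"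

definition halted :: "instr list \<Rightarrow> config \<Rightarrow> bool" where
  "halted P c \<longleftrightarrow> fst c \<ge> length P \<or> P ! fst c = Halt"

fun step :: "instr list \<Rightarrow> config \<Rightarrow> config" where
  "step P (pc, R, tp) = (case P ! pc of
       Push r b \<Rightarrow> (Suc pc, R(r := b # R r), tp)
     | Pop r \<Rightarrow> (Suc pc, R(r := tl (R r)), tp)
     | JmpEmpty r l \<Rightarrow> (if R r = [] then l else Suc pc, R, tp)
     | JmpTrue r l \<Rightarrow> (if R r \<noteq> [] \<and> hd (R r) then l else Suc pc, R, tp)
     | Jmp l \<Rightarrow> (l, R, tp)
     | Coin r \<Rightarrow> (Suc pc, R(r := (tp \<noteq> [] \<and> hd tp) # R r), tl tp)
     | Halt \<Rightarrow> (pc, R, tp))"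

fun exec :: "instr list \<Rightarrow> nat \<Rightarrow> config \<Rightarrow> config option" where
  "exec P 0 c = (if halted P c then Some c else None)"
| "exec P (Suc t) c = (if halted P c then Some c else exec P t (step P c))"

definition init :: "bool list \<Rightarrow> bool list \<Rightarrow> config" where
  "init x tp = (0, (\<lambda>_. [])(0 := x), tp)"

definition run :: "instr list \<Rightarrow> nat \<Rightarrow> bool list \<Rightarrow> bool list \<Rightarrow> bool list option" where
  "run P t x tp = map_option (\<lambda>c. fst (snd c) 0) (exec P t (init x tp))"

definition runs_in_time :: "instr list \<Rightarrow> (nat \<Rightarrow> nat) \<Rightarrow> (nat \<Rightarrow> bool list set) \<Rightarrow> bool" where
  "runs_in_time P T W \<longleftrightarrow> (\<forall>n. \<forall>x\<in>W n. \<forall>tp. exec P (T n) (init x tp) \<noteq> None)"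

text \<open>Success probability: instance (input, secret) drawn from D, uniform random tape of
  length t (enough for t steps); success iff P halts within t steps with output accepted by Good.\<close>
definition success_prob :: "instr list \<Rightarrow> nat \<Rightarrow> (bool list \<times> 's) pmf \<Rightarrow> ('s \<Rightarrow> bool list \<Rightarrow> bool) \<Rightarrow> real" where
  "success_prob P t D Good = measure_pmf.prob
     (do { (x, s) \<leftarrow> D; tp \<leftarrow> pmf_of_set {l. length l = t}; return_pmf (x, s, tp) })
     {(x, s, tp). case run P t x tp of Some out \<Rightarrow> Good s out | None \<Rightarrow> False}"

definition inv_poly :: "(nat \<Rightarrow> real) \<Rightarrow> bool" where
  "inv_poly f \<longleftrightarrow> (\<exists>c::real. \<exists>d::nat. c > 0 \<and> (\<forall>\<^sub>F n in sequentially. f n \<ge> 1 / (c * real n ^ d)))"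

definition symplpn_dist :: "real \<Rightarrow> nat \<Rightarrow> (bool list \<times> bool list) pmf" where
  "symplpn_dist p n = do { A \<leftarrow> pmf_of_set (lagr_mats n); x \<leftarrow> uniform_vec n; e \<leftarrow> noise p n;
      return_pmf (enc_mat A @ enc_bits (vadd (mat_vec (2*n) A x) e), x) }"

definition symplpn_inputs :: "nat \<Rightarrow> bool list set" where
  "symplpn_inputs n = {enc_mat A @ enc_bits z | A z. is_mat (2*n) n A \<and> length z = 2*n}"

definition lsn_dist :: "nat \<Rightarrow> real \<Rightarrow> nat \<Rightarrow> (bool list \<times> bool list) pmf" where
  "lsn_dist k p n = do { (A, B) \<leftarrow> pmf_of_set (lsn_mats k n); r \<leftarrow> uniform_vec n; y \<leftarrow> uniform_vec k;
      e \<leftarrow> noise p n;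
      return_pmf (enc_mat A @ enc_mat B @ enc_bits (vadd (vadd (mat_vec (2*n) A r) (mat_vec (2*n) B y)) e), y) }"

definition lsn_inputs :: "nat \<Rightarrow> nat \<Rightarrow> bool list set" where
  "lsn_inputs k n = {enc_mat A @ enc_mat B @ enc_bits z | A B z.
       is_mat (2*n) n A \<and> is_mat (2*n) k B \<and> length z = 2*n}"

definition wbound :: "real \<Rightarrow> nat \<Rightarrow> real" where
  "wbound p n = 201/100 * real n * p"

text \<open>I ~ Gen(1^n), x ~ Sample(I); the input to the inverter is the encoding of f_I(x) = (A,B,z),
  and the secret kept is I = (A,B) together with z = f_I(x).\<close>
definition inv_dist :: "nat \<Rightarrow> real \<Rightarrow> nat \<Rightarrow> (bool list \<times> (bool list list \<times> bool list list \<times> bool list)) pmf" where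
  "inv_dist k p n = do { (A, B) \<leftarrow> pmf_of_set (lsn_mats k n); r \<leftarrow> uniform_vec n; y \<leftarrow> uniform_vec k;
      e0 \<leftarrow> noise p n;
      let e = (if real (weight n e0) > wbound p n then replicate (2*n) False else e0);
      let z = vadd (vadd (mat_vec (2*n) A r) (mat_vec (2*n) B y)) e;
      return_pmf (enc_mat A @ enc_mat B @ enc_bits z, (A, B, z)) }"

text \<open>The inverter succeeds iff it outputs (the encoding of) a domain element (r,y,e)
  with f_I(r,y,e) = f_I(x), i.e. Ar+By+e = z.\<close>
definition inv_good :: "nat \<Rightarrow> real \<Rightarrow> nat \<Rightarrow> (bool list list \<times> bool list list \<times> bool list) \<Rightarrow> bool list \<Rightarrow> bool" where
  "inv_good k p n s out \<longleftrightarrow> (case s of (A, B, z) \<Rightarrow>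
     (\<exists>r y e. out = enc_bits r @ enc_bits y @ enc_bits e \<and> length r = n \<and> length y = k
        \<and> length e = 2*n \<and> real (weight n e) \<le> wbound p n
        \<and> vadd (vadd (mat_vec (2*n) A r) (mat_vec (2*n) B y)) e = z))"

end

(* Running the two solvers one after the other does not suffice, since their successes may depend on the instance
  in a correlated way.  The inverter rerandomises the instance before each call.  Before the call of the LSN solver
  it multiplies A by a random matrix, and before the call of the sympLPN solver it applies random transvections
  v -> v + w(v,u)u to A, guessing the bits w(Ar,u) by which the right-hand side changes.  The transvection walk on
  Lagrangian frames has a spectral gap (a Garland-type local-to-global argument over chains of isotropic subspaces), so
  logarithmically many rounds decouple the two events and the guessed bits cost only a polynomial factor.
  The unknown error has the same weight in both calls, whereas the solvers may succeed only for two different weights: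
  uniform noise on a random set of trailing sites raises the weight to any target up to 2n/3 with inverse polynomial
  probability (the weight moves by at most one per site), and random site permutations and label rotations make the
  error uniform among those of its weight.  For p >= 1/2 the domain contains all errors, and r = 0, y = 0, e = z works. *)
theory Submission
 imports Defs "HOL-Real_Asymp.Real_Asymp"
begin

text \<open>The time bound pays for one run of each solver, so no call can be repeated or tested,
  and both calls share the same \<open>A\<close> and the same error: a single joint event has to be
  bounded from below. A symplectic map applied to the whole instance would carry the error along.
  Hence only weight-preserving site maps act on the right-hand side, while transvections move
  \<open>A\<close> alone; they change \<open>Ar\<close> by a multiple of one known vector, which is
  the bit to be guessed. The decoupling is asymmetric. The second call sees a random basis, so its
  success probability q depends on the span of \<open>A\<close> only, and the walk K contracts such
  functions towards their mean. The success probability p of the first call may depend on the basis;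
  still E(p K^s q) >= E(p) E(q) - \<kappa>^s, because K is self-adjoint and can be moved from p to
  q. The number s of rounds has to be a multiple of log n. Drawing it geometrically spares its
  computation and hits it with probability 2^-(s+1), which is inverse polynomial. The same number
  fixes the rate 2^-s at which the added noise stops.\<close>

type_synonym bits = "bool list"

abbreviation ret :: "'a \<Rightarrow> 'a pmf" where "ret \<equiv> return_pmf"
abbreviation colen :: "nat \<Rightarrow> 'a list list \<Rightarrow> bool" where "colen m M \<equiv> \<forall>c\<in>set M. length c = m"

abbreviation unif :: "nat \<Rightarrow> bits pmf" where "unif \<equiv> uniform_vec"
abbreviation fsup :: "'a pmf \<Rightarrow> bool" where "fsup D \<equiv> finite (set_pmf D)"

lemmas bind_ret = bind_return_pmf
lemmas bind_pmfs = bind_assoc_pmf bind_return_pmf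

section \<open>Tape-free probabilistic semantics of the machine\<close>

type_synonym mstate = "nat \<times> (nat => bits)"

abbreviation coin::"bool pmf" where "coin == pmf_of_set UNIV"

fun pstep::"instr list => mstate => mstate pmf" where
 "pstep P (pc, R) = (case P ! pc of
   Push r b => ret (Suc pc, R(r := b # R r))
   | Pop r => ret (Suc pc, R(r := tl (R r)))
   | JmpEmpty r l => ret (if R r = [] then l else Suc pc, R)
   | JmpTrue r l => ret (if R r ~= [] & hd (R r) then l else Suc pc, R)
   | Jmp l => ret (l, R)
   | Coin r => map_pmf (%b. (Suc pc, R(r := b # R r))) coin
   | Halt => ret (pc, R))"

definition mhalted::"instr list => mstate => bool" where
 "mhalted P c \<longleftrightarrow> fst c >= length P | P ! fst c = Halt"

text \<open>\<open>reach P c T D\<close>: some stopping time bounded by \<open>T\<close>, depending only on the coins seen so far,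
 takes the machine from \<open>c\<close> to a configuration distributed as \<open>D\<close>.\<close>

inductive reach::"instr list => mstate => nat => mstate pmf => bool" for P where
 reach_refl: "reach P c T (ret c)"
| reach_step: "~ mhalted P c ==> (!!c'. c' : set_pmf (pstep P c) ==> reach P c' T (f c')) ==>
   reach P c (Suc T) (bind_pmf (pstep P c) f)"

lemma reach_mono: "reach P c T D ==> T <= T' ==> reach P c T' D"
proof (induction arbitrary: T' rule: reach.induct)
 case (reach_refl c T)
 thus ?case by (simp add: reach.reach_refl)
next
 case (reach_step c T f)
 then obtain T'' where "T' = Suc T''" "T <= T''" by (cases T') auto
 thus ?case using reach_step by (auto intro!: reach.reach_step)
qed

lemma reach_trans:
 assumes "reach P c T D" "!!c'. c' : set_pmf D ==> reach P c' T' (f c')"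
 shows "reach P c (T + T') (bind_pmf D f)"
 using assms
proof (induction arbitrary: f rule: reach.induct)
 case (reach_refl c T)
 thus ?case by (auto simp: bind_ret intro: reach_mono)
next
 case (reach_step c T g)
 have "reach P c (Suc (T + T')) (bind_pmf (pstep P c) (%x. bind_pmf (g x) f))"
 proof (rule reach.reach_step[OF reach_step.hyps(1)])
  fix c' assume c': "c' : set_pmf (pstep P c)"
  show "reach P c' (T + T') (bind_pmf (g c') f)"
   using c' reach_step.prems by (intro reach_step.IH[OF c']) (metis set_bind_pmf UN_I)
 qed
 thus ?case by (simp add: bind_assoc_pmf)
qed

lemma reach_step1:
 assumes "~ mhalted P c" "pstep P c = ret c'" "reach P c' T D"
 shows "reach P c (Suc T) D"
 using reach_step[of P c T "%_. D"] assms by (auto simp: bind_ret)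

subsection \<open>Relating it to runs on a random tape\<close>

definition forget_tape::"config => mstate" where
 "forget_tape c = (fst c, fst (snd c))"

lemma mhalted_forget: "halted P (pc, R, tp) = mhalted P (pc, R)"
 by (simp add: halted_def mhalted_def)

lemma set_coin: "set_pmf coin = UNIV"
 by (simp add: set_pmf_of_set)

lemma reach_exec_halts:
 assumes "reach P c T D" "!!c'. c' : set_pmf D ==> mhalted P c'" "T <= t"
 shows "exec P t (fst c, snd c, tp) ~= None"
 using assms
proof (induction arbitrary: t tp rule: reach.induct)
 case (reach_refl c T)
 hence "halted P (fst c, snd c, tp)" by (simp add: mhalted_forget)
 thus ?case by (cases t) auto
next
 case (reach_step c T f)
 obtain pc R where c: "c = (pc, R)" by force
 obtain t' where t: "t = Suc t'" "T <= t'" using reach_step.prems by (cases t) auto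
 obtain pc' R' tp' where "step P (pc, R, tp) = (pc', R', tp')" by (metis prod.collapse)
 then obtain c' where s: "step P (pc, R, tp) = (fst c', snd c', tp')" by (metis fst_conv snd_conv)
 \<comment> \<open>The machine reads an exhausted tape as \<open>False\<close>, itself a possible
   coin outcome, so halting follows for tapes of every length.\<close>
 have c': "c' : set_pmf (pstep P c)"
 proof -
  have "(fst c', snd c') : set_pmf (pstep P (pc, R))"
   using s reach_step.hyps(1) by (cases "P ! pc") (auto simp: c mhalted_def set_coin image_iff prod_eq_iff intro: exI[where x = "tp ~= [] & hd tp"] split: if_splits)
  thus ?thesis by (simp add: c)
 qed
 have "exec P t' (fst c', snd c', tp') ~= None"
 proof (rule reach_step.IH[OF c' _ t(2)])
  fix d assume "d : set_pmf (f c')"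
  thus "mhalted P d" using c' by (intro reach_step.prems(1)) auto
 qed
 thus ?case using reach_step.hyps(1) by (simp add: t s c mhalted_forget del: step.simps)
qed

section \<open>Uniform bit vectors as independent coins\<close>

lemma set_lists_length_Suc:
 "{xs::bits. length xs = Suc n} = (%(b, xs). b # xs) ` (UNIV \<times> {xs. length xs = n})"
 by (auto simp: length_Suc_conv image_iff)

lemma finite_len: "finite {xs::bits. length xs = n}"
 using finite_lists_length_eq[of "UNIV::bool set" n] by simp

lemma len_nonempty: "{xs::bits. length xs = n} ~= {}"
proof -
 have "replicate n False : {xs::bits. length xs = n}" by simp
 thus ?thesis by blast
qed

lemma card_len: "card {xs::bits. length xs = n} = 2^n"
 using card_lists_length_eq[of "UNIV::bool set" n] by (simp add: card_UNIV_bool)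

lemma set_uniform_vec: "set_pmf (unif n) = {xs. length xs = n}"
 unfolding uniform_vec_def by (rule set_pmf_of_set[OF len_nonempty finite_len])

lemma uniform_vec_0: "unif 0 = ret []"
 by (simp add: uniform_vec_def pmf_of_set_singleton)

lemma uniform_vec_Suc:
 "unif (Suc n) = do { b <- coin; xs <- unif n; ret (b # xs) }"
proof -
 have "unif (Suc n) = pmf_of_set ((%(b, xs). b # xs) ` (UNIV \<times> {xs::bits. length xs = n}))"
  by (simp add: uniform_vec_def set_lists_length_Suc)
 also have "... = map_pmf (%(b, xs). b # xs) (pmf_of_set (UNIV \<times> {xs. length xs = n}))"
  using finite_len len_nonempty
  by (intro map_pmf_of_set_inj[symmetric]) (auto simp: inj_on_def)
 also have "pmf_of_set (UNIV \<times> {xs. length xs = n}) = pair_pmf coin (unif n)"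
  using finite_len len_nonempty unfolding uniform_vec_def
  by (intro pmf_eqI) (auto simp: pmf_pair pmf_of_set[OF len_nonempty finite_len] pmf_of_set card_len
   card_cartesian_product indicator_def)
 finally show ?thesis
  by (simp add: pair_pmf_def map_pmf_def bind_pmfs)
qed

text \<open>A step reads at most one tape bit, so a tape of at least \<open>T\<close> bits is never
  exhausted, every bit read is fresh, and the unread rest integrates out.\<close>

lemma reach_tape:
 assumes "reach P c T D" "!!c'. c' : set_pmf D ==> mhalted P c'" "T <= t" "T <= l"
 shows "map_pmf (%tp. map_option forget_tape (exec P t (fst c, snd c, tp))) (unif l) = map_pmf Some D"
 using assms
proof (induction arbitrary: t l rule: reach.induct)
 case (reach_refl c T)
 hence h: "halted P (fst c, snd c, tp)" for tp by (simp add: mhalted_forget)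
 have "exec P t (fst c, snd c, tp) = Some (fst c, snd c, tp)" for tp using h by (cases t) auto
 thus ?case by (simp add: forget_tape_def map_pmf_const)
next
 case (reach_step c T f)
 obtain pc R where c: "c = (pc, R)" by force
 obtain t' where t: "t = Suc t'" "T <= t'" using reach_step.prems by (cases t) auto
 obtain l' where l: "l = Suc l'" "T <= l'" using reach_step.prems by (cases l) auto
 have nh: "~ halted P (pc, R, tp)" for tp using reach_step.hyps(1) by (simp add: c mhalted_forget)
 have pcl: "P ! pc ~= Halt" using reach_step.hyps(1) by (auto simp: c mhalted_def)
 have IH: "map_pmf (%tp. map_option forget_tape (exec P t' (fst c', snd c', tp))) (unif l'') = map_pmf Some (f c')"
  if "c' : set_pmf (pstep P c)" "T <= l''" for c' l''
 proof (rule reach_step.IH[OF that(1) _ t(2) that(2)])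
  fix d assume "d : set_pmf (f c')"
  thus "mhalted P d" using that(1) by (intro reach_step.prems(1)) auto
 qed
 show ?case
 proof (cases "EX r. P ! pc = Coin r")
  case True
  then obtain r where r: "P ! pc = Coin r" by blast
  have "map_pmf (%tp. map_option forget_tape (exec P t (fst c, snd c, tp))) (unif l)
   = bind_pmf coin (%b. map_pmf (%tp. map_option forget_tape (exec P t' (Suc pc, R(r := b # R r), tp))) (unif l'))"
   by (simp add: t l c nh r uniform_vec_Suc map_pmf_def bind_pmfs)
  also have "... = bind_pmf coin (%b. map_pmf Some (f (Suc pc, R(r := b # R r))))"
  proof (intro bind_pmf_cong refl)
   fix b assume "b : set_pmf coin"
   have "(Suc pc, R(r := b # R r)) : set_pmf (pstep P c)" by (auto simp: c r set_coin)
   from IH[OF this l(2)] show "map_pmf (%tp. map_option forget_tape (exec P t' (Suc pc, R(r := b # R r), tp))) (unif l')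
   = map_pmf Some (f (Suc pc, R(r := b # R r)))" by simp
  qed
  also have "... = map_pmf Some (bind_pmf (pstep P c) f)"
   by (simp add: c r map_bind_pmf bind_map_pmf)
  finally show ?thesis .
 next
  case False
  have "EX pc' R'. pstep P c = ret (pc', R') & (ALL tp. step P (pc, R, tp) = (pc', R', tp))"
   using False pcl by (auto simp: c split: instr.splits)
  then obtain pc' R' where s: "pstep P c = ret (pc', R')" "!!tp. step P (pc, R, tp) = (pc', R', tp)"
   by blast
  have "map_pmf (%tp. map_option forget_tape (exec P t (fst c, snd c, tp))) (unif l)
   = map_pmf (%tp. map_option forget_tape (exec P t' (pc', R', tp))) (unif l)"
   by (simp add: t c nh s(2) del: step.simps)
  also have "... = map_pmf Some (f (pc', R'))"
   using IH[of "(pc', R')" l] s(1) reach_step.prems by simp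
  finally show ?thesis using s(1) by (simp add: bind_ret)
 qed
qed

text \<open>Solvers are known only through \<open>runs_in_time\<close>, which speaks of tapes. As
  that bound holds for all tapes and every sequence of coins begins some tape, no branch of the coin
  tree outlives \<open>t\<close>. This turns a solver into something that can be composed.\<close>

lemma exec_reach:
 assumes "!!tp. exec P t (pc, R, tp) ~= None"
 shows "EX D. reach P (pc, R) t D & (ALL c':set_pmf D. mhalted P c')"
 using assms
proof (induction t arbitrary: pc R)
 case 0
 hence "halted P (pc, R, [])" by (metis exec.simps(1))
 thus ?case using reach_refl[of P "(pc, R)" 0] by (force simp: mhalted_forget)
next
 case (Suc t)
 show ?case
 proof (cases "mhalted P (pc, R)")
  case True
  thus ?thesis using reach_refl[of P "(pc, R)" "Suc t"] by force
 next
  case False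
  have ex: "exec P t (step P (pc, R, tp)) ~= None" for tp
   using Suc.prems[of tp] False by (simp add: mhalted_forget)
  have nH: "P ! pc ~= Halt" using False by (auto simp: mhalted_def)
  have "EX D. reach P c' t D & (ALL c'':set_pmf D. mhalted P c'')" if c': "c' : set_pmf (pstep P (pc, R))" for c'
  proof -
   \<comment> \<open>A tape that starts with the coin leading to \<open>c'\<close> reproduces this
     branch.\<close>
   have "EX tp0. step P (pc, R, tp0) = (fst c', snd c', tp)" for tp
   proof (cases "P ! pc")
   case (Coin r)
   then obtain b where "c' = (Suc pc, R(r := b # R r))" using c' by auto
   thus ?thesis by (intro exI[of _ "b # tp"]) (simp add: Coin)
   qed (use c' nH in auto)
   hence "exec P t (fst c', snd c', tp) ~= None" for tp using ex by metis
   from Suc.IH[OF this] show ?thesis by simp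
  qed
  then obtain f where f: "!!c'. c' : set_pmf (pstep P (pc, R)) ==> reach P c' t (f c') & (ALL c'':set_pmf (f c'). mhalted P c'')"
   by metis
  have "reach P (pc, R) (Suc t) (bind_pmf (pstep P (pc, R)) f)"
   using f False by (intro reach_step) auto
  thus ?thesis using f by (intro exI[of _ "bind_pmf (pstep P (pc, R)) f"]) auto
 qed
qed

text \<open>A run without a result counts as \<open>[]\<close>, which encodes no vector and is
  therefore a failure.\<close>

definition outd::"instr list => nat => bits => bits pmf" where
 "outd P t x = map_pmf (%tp. case run P t x tp of Some out => out | None => []) (unif t)"

definition start::"bits => nat => bits" where
 "start x = (%_. [])(0 := x)"

lemma run_eq: "run P t x tp = map_option (%c. snd c 0) (map_option forget_tape (exec P t (0, start x, tp)))"
 by (simp add: run_def init_def start_def forget_tape_def option.map_comp comp_def)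

lemma reach_outd:
 assumes "reach P (0, start x) T D" "!!c'. c' : set_pmf D ==> mhalted P c'" "T <= t"
 shows "map_pmf (%c. snd c 0) D = outd P t x"
proof -
 have "outd P t x = map_pmf (%c. case map_option (%c. snd c 0) c of Some out => out | None => [])
   (map_pmf (%tp. map_option forget_tape (exec P t (fst (0::nat, start x), snd (0::nat, start x), tp))) (unif t))"
  by (simp add: outd_def run_eq pmf.map_comp comp_def)
 also have "... = map_pmf (%c. case map_option (%c. snd c 0) c of Some out => out | None => []) (map_pmf Some D)"
  by (subst reach_tape[OF assms(1,2) assms(3) assms(3)]) auto
 finally show ?thesis by (simp add: pmf.map_comp comp_def)
qed

lemma success_prob_outd:
 assumes "!!x s tp. (x, s) : set_pmf D ==> exec P t (init x tp) ~= None"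
 shows "success_prob P t D Good = measure_pmf.expectation D (%(x, s). measure_pmf.prob (outd P t x) {out. Good s out})"
proof -
 have "success_prob P t D Good = measure_pmf.prob (bind_pmf D (%(x, s). map_pmf (%tp. (x, s, tp)) (unif t)))
   {(x, s, tp). case run P t x tp of Some out => Good s out | None => False}"
  by (simp add: success_prob_def map_pmf_def uniform_vec_def case_prod_beta')
 also have "... = measure_pmf.expectation D (%(x, s). measure_pmf.prob (map_pmf (%tp. (x, s, tp)) (unif t))
   {(x, s, tp). case run P t x tp of Some out => Good s out | None => False})"
  by (subst measure_pmf_bind[THEN eq_reflection, THEN meta_eq_to_obj_eq] , 
   subst measure_pmf.measure_bind[where N="count_space UNIV"])
   (auto simp: case_prod_beta' measure_pmf_in_subprob_algebra)
 also have "... = measure_pmf.expectation D (%(x, s). measure_pmf.prob (outd P t x) {out. Good s out})"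
 proof (intro integral_cong_AE)
  show "AE xs in measure_pmf D. (case xs of (x, s) => measure_pmf.prob (map_pmf (%tp. (x, s, tp)) (unif t))
   {(x, s, tp). case run P t x tp of Some out => Good s out | None => False}) =
   (case xs of (x, s) => measure_pmf.prob (outd P t x) {out. Good s out})"
  proof (intro AE_pmfI, clarify)
   fix x s assume xs: "(x, s) : set_pmf D"
   have "EX y. run P t x tp = Some y" for tp
   using assms[OF xs, of tp] by (auto simp: run_def)
   hence "(case run P t x tp of Some out => Good s out | None => False) =
   Good s (case run P t x tp of Some out => out | None => [])" for tp
   by (metis option.simps(5))
   thus "measure_pmf.prob (map_pmf (%tp. (x, s, tp)) (unif t))
   {(x, s, tp). case run P t x tp of Some out => Good s out | None => False} =
   measure_pmf.prob (outd P t x) {out. Good s out}"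
   by (simp add: outd_def vimage_def)
  qed
 qed auto
 finally show ?thesis .
qed

section \<open>A structured language and its compilation\<close>

datatype com = CSkip | CPush nat bool | CPop nat | CFlip nat | CSeq com com | CIf nat com com | CWhile nat com

fun clen::"com => nat" where
 "clen CSkip = 0"
| "clen (CPush r b) = 1"
| "clen (CPop r) = 1"
| "clen (CFlip r) = 1"
| "clen (CSeq c1 c2) = clen c1 + clen c2"
| "clen (CIf r c1 c2) = clen c1 + clen c2 + 2"
| "clen (CWhile r c) = clen c + 2"

fun comp::"nat => com => instr list" where
 "comp a CSkip = []"
| "comp a (CPush r b) = [Push r b]"
| "comp a (CPop r) = [Pop r]"
| "comp a (CFlip r) = [Coin r]"
| "comp a (CSeq c1 c2) = comp a c1 @ comp (a + clen c1) c2"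
| "comp a (CIf r c1 c2) = JmpTrue r (a + clen c2 + 2) # comp (Suc a) c2 @
   Jmp (a + clen c1 + clen c2 + 2) # comp (a + clen c2 + 2) c1"
| "comp a (CWhile r c) = JmpEmpty r (a + clen c + 2) # comp (Suc a) c @ [Jmp a]"

lemma length_comp [simp]: "length (comp a c) = clen c"
 by (induction a c rule: comp.induct) auto

definition code_at::"instr list => nat => instr list => bool" where
 "code_at P a Q \<longleftrightarrow> (EX X Y. P = X @ Q @ Y & length X = a)"

lemma code_at_append: "code_at P a (Q1 @ Q2) \<longleftrightarrow> code_at P a Q1 & code_at P (a + length Q1) Q2"
proof
 assume "code_at P a (Q1 @ Q2)"
 then obtain X Y where P: "P = X @ (Q1 @ Q2) @ Y" "length X = a" by (auto simp: code_at_def)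
 have "code_at P a Q1" unfolding code_at_def by (intro exI[of _ X] exI[of _ "Q2 @ Y"]) (simp add: P)
 moreover have "code_at P (a + length Q1) Q2"
  unfolding code_at_def by (intro exI[of _ "X @ Q1"] exI[of _ Y]) (simp add: P)
 ultimately show "code_at P a Q1 & code_at P (a + length Q1) Q2" by blast
next
 assume "code_at P a Q1 & code_at P (a + length Q1) Q2"
 then obtain X Y X' Y' where P: "P = X @ Q1 @ Y" "length X = a" "P = X' @ Q2 @ Y'" "length X' = a + length Q1"
  unfolding code_at_def by blast
 have "X' = X @ Q1" using P by (metis append_assoc append_eq_append_conv length_append)
 thus "code_at P a (Q1 @ Q2)"
  unfolding code_at_def using P by (intro exI[of _ X] exI[of _ Y']) simp
qed

lemma code_at_Cons: "code_at P a (i # Q) \<longleftrightarrow> a < length P & P ! a = i & code_at P (Suc a) Q"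
proof -
 have "code_at P a [i] \<longleftrightarrow> a < length P & P ! a = i"
 proof
  assume "a < length P & P ! a = i"
  thus "code_at P a [i]" unfolding code_at_def
   by (intro exI[of _ "take a P"] exI[of _ "drop (Suc a) P"]) (use id_take_nth_drop[of a P] in auto)
 qed (auto simp: code_at_def nth_append)
 thus ?thesis using code_at_append[of P a "[i]" Q] by simp
qed

text \<open>Quantifying over the surrounding program and the address makes a fragment relocatable.
  Control always leaves it at its end, so composition needs no argument about jumps.\<close>

definition does::"com => (nat => bits) => nat => (nat => bits) pmf => bool" where
 "does c R T D \<longleftrightarrow> (ALL P a. code_at P a (comp a c) --> reach P (a, R) T (map_pmf (Pair (a + clen c)) D))"

lemma doesD: "does c R T D ==> code_at P a (comp a c) ==> e = a + clen c ==> reach P (a, R) T (map_pmf (Pair e) D)"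
 by (simp add: does_def)

lemma does_mono: "does c R T D ==> T <= T' ==> does c R T' D"
 by (auto simp: does_def intro: reach_mono)

lemma does_skip: "does CSkip R 0 (ret R)"
 by (simp add: does_def reach_refl)

lemma does_push: "does (CPush r b) R 1 (ret (R(r := b # R r)))"
 by (auto simp: does_def code_at_Cons mhalted_def intro!: reach_step1 reach_refl)

lemma does_pop: "does (CPop r) R 1 (ret (R(r := tl (R r))))"
 by (auto simp: does_def code_at_Cons mhalted_def intro!: reach_step1 reach_refl)

lemma does_flip: "does (CFlip r) R 1 (map_pmf (%b. R(r := b # R r)) coin)"
proof -
 have "reach P (a, R) 1 (map_pmf (Pair (Suc a)) (map_pmf (%b. R(r := b # R r)) coin))"
  if "a < length P" "P ! a = Coin r" for P a
  using reach_step[of P "(a, R)" 0 ret] that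
  by (auto simp: mhalted_def reach_refl bind_return_pmf' pmf.map_comp comp_def)
 thus ?thesis by (simp add: does_def code_at_Cons)
qed

lemma does_seq:
 assumes "does c1 R T1 D" "!!R'. R' : set_pmf D ==> does c2 R' T2 (f R')"
 shows "does (CSeq c1 c2) R (T1 + T2) (bind_pmf D f)"
 unfolding does_def
proof (intro allI impI)
 fix P a assume "code_at P a (comp a (CSeq c1 c2))"
 hence c: "code_at P a (comp a c1)" "code_at P (a + clen c1) (comp (a + clen c1) c2)"
  by (simp_all add: code_at_append)
 have "reach P (a, R) (T1 + T2) (bind_pmf (map_pmf (Pair (a + clen c1)) D)
   (%(pc, R'). map_pmf (Pair (a + clen (CSeq c1 c2))) (f R')))"
  using assms c by (intro reach_trans) (auto intro!: doesD)
 thus "reach P (a, R) (T1 + T2) (map_pmf (Pair (a + clen (CSeq c1 c2))) (bind_pmf D f))"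
  by (simp add: bind_map_pmf map_bind_pmf)
qed

lemma does_seq_det:
 assumes "does c1 R T1 (ret R')" "does c2 R' T2 D"
 shows "does (CSeq c1 c2) R (T1 + T2) D"
 using does_seq[OF assms(1), of c2 T2 "%_. D"] assms(2) by (simp add: bind_ret)

lemma does_if_true:
 assumes "R r ~= []" "hd (R r)" "does c1 R T D"
 shows "does (CIf r c1 c2) R (T + 1) D"
 unfolding does_def
proof (intro allI impI)
 fix P a assume c: "code_at P a (comp a (CIf r c1 c2))"
 hence c1: "code_at P (a + clen c2 + 2) (comp (a + clen c2 + 2) c1)"
  and i: "a < length P" "P ! a = JmpTrue r (a + clen c2 + 2)"
  by (simp_all add: code_at_append code_at_Cons)
 have "reach P (a + clen c2 + 2, R) T (map_pmf (Pair (a + clen c2 + 2 + clen c1)) D)"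
  using assms(3) c1 by (rule doesD) simp
 moreover have "pstep P (a, R) = ret (a + clen c2 + 2, R)"
  using i assms by simp
 ultimately have "reach P (a, R) (Suc T) (map_pmf (Pair (a + clen c2 + 2 + clen c1)) D)"
  using i by (intro reach_step1) (auto simp: mhalted_def)
 thus "reach P (a, R) (T + 1) (map_pmf (Pair (a + clen (CIf r c1 c2))) D)"
  by (simp add: algebra_simps)
qed

lemma does_if_false:
 assumes "~ (R r ~= [] & hd (R r))" "does c2 R T D"
 shows "does (CIf r c1 c2) R (T + 2) D"
 unfolding does_def
proof (intro allI impI)
 fix P a assume c: "code_at P a (comp a (CIf r c1 c2))"
 hence c2: "code_at P (Suc a) (comp (Suc a) c2)"
  and i: "a < length P" "P ! a = JmpTrue r (a + clen c2 + 2)"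
  and j: "Suc a + clen c2 < length P" "P ! (Suc a + clen c2) = Jmp (a + clen c1 + clen c2 + 2)"
  by (simp_all add: code_at_append code_at_Cons)
 let ?e = "a + clen c1 + clen c2 + 2"
 have "reach P (Suc a, R) T (map_pmf (Pair (Suc a + clen c2)) D)"
  using assms(2) c2 by (rule doesD) simp
 hence "reach P (Suc a, R) (T + 1) (bind_pmf (map_pmf (Pair (Suc a + clen c2)) D) (%(pc, R'). ret (?e, R')))"
  using j by (intro reach_trans) (auto simp: mhalted_def intro!: reach_step1 reach_refl)
 moreover have "pstep P (a, R) = ret (Suc a, R)" using i assms by simp
 ultimately have "reach P (a, R) (Suc (T + 1)) (bind_pmf (map_pmf (Pair (Suc a + clen c2)) D) (%(pc, R'). ret (?e, R')))"
  using i by (intro reach_step1) (auto simp: mhalted_def)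
 thus "reach P (a, R) (T + 2) (map_pmf (Pair (a + clen (CIf r c1 c2))) D)"
  by (simp add: bind_map_pmf map_pmf_def bind_pmfs algebra_simps)
qed

lemma does_while_stop:
 assumes "R r = []"
 shows "does (CWhile r c) R 1 (ret R)"
 unfolding does_def
proof (intro allI impI)
 fix P a assume "code_at P a (comp a (CWhile r c))"
 thus "reach P (a, R) 1 (map_pmf (Pair (a + clen (CWhile r c))) (ret R))"
  using assms by (auto simp: code_at_Cons mhalted_def intro!: reach_step1 reach_refl)
qed

lemma does_while_step:
 assumes "R r ~= []" "does c R T1 D" "!!R'. R' : set_pmf D ==> does (CWhile r c) R' T2 (f R')"
 shows "does (CWhile r c) R (T1 + T2 + 2) (bind_pmf D f)"
 unfolding does_def
proof (intro allI impI)
 fix P a assume ca: "code_at P a (comp a (CWhile r c))"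
 hence c2: "code_at P (Suc a) (comp (Suc a) c)"
  and i: "a < length P" "P ! a = JmpEmpty r (a + clen c + 2)"
  and j: "Suc a + clen c < length P" "P ! (Suc a + clen c) = Jmp a"
  by (simp_all add: code_at_append code_at_Cons)
 let ?e = "a + clen (CWhile r c)"
 have "reach P (Suc a, R) T1 (map_pmf (Pair (Suc a + clen c)) D)"
  using assms(2) c2 by (rule doesD) simp
 hence "reach P (Suc a, R) (T1 + Suc T2) (bind_pmf (map_pmf (Pair (Suc a + clen c)) D)
   (%(pc, R'). map_pmf (Pair ?e) (f R')))"
 proof (rule reach_trans)
  fix c' assume "c' : set_pmf (map_pmf (Pair (Suc a + clen c)) D)"
  then obtain R' where R': "c' = (Suc a + clen c, R')" "R' : set_pmf D" by auto
  have "reach P (a, R') T2 (map_pmf (Pair ?e) (f R'))" using assms(3)[OF R'(2)] ca by (rule doesD) simp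
  thus "reach P c' (Suc T2) (case c' of (pc, R') => map_pmf (Pair ?e) (f R'))"
   using j by (auto simp: R' mhalted_def intro!: reach_step1)
 qed
 moreover have "pstep P (a, R) = ret (Suc a, R)" using i assms by simp
 ultimately have "reach P (a, R) (Suc (T1 + Suc T2)) (bind_pmf (map_pmf (Pair (Suc a + clen c)) D)
   (%(pc, R'). map_pmf (Pair ?e) (f R')))"
  using i by (intro reach_step1) (auto simp: mhalted_def)
 thus "reach P (a, R) (T1 + T2 + 2) (map_pmf (Pair ?e) (bind_pmf D f))"
  by (simp add: bind_map_pmf map_bind_pmf algebra_simps)
qed

lemma does_while_step_det:
 assumes "R r ~= []" "does c R T1 (ret R')" "does (CWhile r c) R' T2 D"
 shows "does (CWhile r c) R (T1 + T2 + 2) D"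
 using does_while_step[OF assms(1,2), of T2 "%_. D"] assms(3) by (simp add: bind_ret)

subsection \<open>Total programs: branching on a popped bit and bounded repetition\<close>

text \<open>A repetition runs as often as its counter is long on entry. Programs thus always
  terminate, their meaning is a distribution on stores without fixed points, and running time
  becomes a syntactic bound.\<close>

datatype prog = Skip | PPush nat bool | Flip nat | Seq prog prog (infixr ";;" 60) | Case nat prog prog | Rep nat prog

fun iter::"nat => ('s => 's pmf) => 's => 's pmf" where
 "iter 0 f s = ret s"
| "iter (Suc k) f s = bind_pmf (f s) (iter k f)"

text \<open>\<open>Case\<close> treats an empty stack like a popped \<open>False\<close>.\<close>

fun sem::"prog => (nat => bits) => (nat => bits) pmf" where
 "sem Skip s = ret s"
| "sem (PPush r b) s = ret (s(r := b # s r))"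
| "sem (Flip r) s = map_pmf (%b. s(r := b # s r)) coin"
| "sem (Seq p q) s = bind_pmf (sem p s) (sem q)"
| "sem (Case r p q) s = (if s r ~= [] & hd (s r) then sem p (s(r := tl (s r))) else sem q (s(r := tl (s r))))"
| "sem (Rep r p) s = iter (length (s r)) (sem p) s"

lemmas sem_seq = sem.simps(4)

fun regs::"prog => nat set" where
 "regs Skip = {}"
| "regs (PPush r b) = {r}"
| "regs (Flip r) = {r}"
| "regs (Seq p q) = regs p \<union> regs q"
| "regs (Case r p q) = {r} \<union> regs p \<union> regs q"
| "regs (Rep r p) = {r} \<union> regs p"

fun loops::"prog => nat set" where
 "loops (Seq p q) = loops p \<union> loops q"
| "loops (Case r p q) = loops p \<union> loops q"
| "loops (Rep r p) = {r} \<union> loops p"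
| "loops _ = {}"

fun pushes::"prog => nat set" where
 "pushes Skip = {}"
| "pushes (PPush r b) = {r}"
| "pushes (Flip r) = {r}"
| "pushes (Seq p q) = pushes p \<union> pushes q"
| "pushes (Case r p q) = pushes p \<union> pushes q"
| "pushes (Rep r p) = pushes p"

text \<open>Here \<open>m\<close> bounds all loop counters. One turn of a repetition needs 7 and 6
  steps to move a counter bit away and back and 3 for the loop itself; 20 is a round upper bound for
  these 16.\<close>

fun cost::"prog => nat => nat" where
 "cost Skip m = 0"
| "cost (PPush r b) m = 1"
| "cost (Flip r) m = 1"
| "cost (Seq p q) m = cost p m + cost q m"
| "cost (Case r p q) m = 3 + cost p m + cost q m"
| "cost (Rep r p) m = m*(cost p m + 20) + 3"

text \<open>Even registers from 1000 on are reserved for the private stacks of repetitions. Odd ones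
  stay visible because input and output of the two solvers live in 1001 and 1003.\<close>

definition visible::"prog => bool" where
 "visible p \<longleftrightarrow> (ALL r:regs p. r < 1000 | odd r)"

text \<open>A repetition at nesting depth \<open>d\<close> first copies its counter to a private stack, so that
 the body sees, and may even modify, the original.\<close>

definition hid::"nat => nat" where "hid d = 1000 + 4*d"
definition tmp::"nat => nat" where "tmp d = 1002 + 4*d"

fun depth::"prog => nat" where
 "depth (Seq p q) = max (depth p) (depth q)"
| "depth (Case r p q) = max (depth p) (depth q)"
| "depth (Rep r p) = Suc (depth p)"
| "depth _ = 0"

abbreviation cmove::"nat => nat => com" where
 "cmove x y == CIf x (CSeq (CPop x) (CPush y True)) (CSeq (CPop x) (CPush y False))"

fun tr::"nat => prog => com" where
 "tr d Skip = CSkip"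
| "tr d (PPush r b) = CPush r b"
| "tr d (Flip r) = CFlip r"
| "tr d (Seq p q) = CSeq (tr d p) (tr d q)"
| "tr d (Case r p q) = CIf r (CSeq (CPop r) (tr d p)) (CSeq (CPop r) (tr d q))"
| "tr d (Rep r p) = CSeq (CWhile r (CSeq (cmove r (tmp d)) (CPush (hid d) True)))
   (CSeq (CWhile (tmp d) (cmove (tmp d) r))
   (CWhile (hid d) (CSeq (CPop (hid d)) (tr (Suc d) p))))"

lemma does_cmove:
 assumes "R x = b # xs" "x ~= y"
 shows "does (cmove x y) R 4 (ret (R(x := xs, y := b # R y)))"
proof -
 have *: "does (CSeq (CPop x) (CPush y b)) R (1 + 1) (ret (R(x := xs, y := b # R y)))"
  using does_push[of y b "R(x := tl (R x))"] does_pop[of x R] assms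
  by (intro does_seq_det[of "CPop x" R 1 "R(x := tl (R x))"]) auto
 show ?thesis
 proof (cases b)
  case True
  hence "does (cmove x y) R (1 + 1 + 1) (ret (R(x := xs, y := b # R y)))"
   using does_if_true[of R x, OF _ _ *] assms by simp
  thus ?thesis by (rule does_mono) simp
 next
  case False
  hence "does (cmove x y) R (1 + 1 + 2) (ret (R(x := xs, y := b # R y)))"
   using does_if_false[of R x, OF _ *] assms by simp
  thus ?thesis by (rule does_mono) simp
 qed
qed

lemma does_loopA:
 assumes "R r = xs" "r ~= t" "r ~= h" "t ~= h" "R h = replicate k True"
 shows "does (CWhile r (CSeq (cmove r t) (CPush h True))) R (7*length xs + 1)
   (ret (R(r := [], t := rev xs @ R t, h := replicate (length xs + k) True)))"
 using assms
proof (induction xs arbitrary: R k)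
 case Nil
 hence "R(r := [], t := rev [] @ R t, h := replicate (length [] + k) True) = R" by auto
 thus ?case using does_while_stop[of R r] Nil by (simp del: fun_upd_apply)
next
 case (Cons b xs)
 let ?R = "R(r := xs, t := b # R t, h := True # R h)"
 have 1: "does (CSeq (cmove r t) (CPush h True)) R (4 + 1) (ret ?R)"
  using does_push[of h True "R(r := xs, t := b # R t)"] Cons.prems
  by (intro does_seq_det[OF does_cmove]) auto
 have 2: "does (CWhile r (CSeq (cmove r t) (CPush h True))) ?R (7*length xs + 1)
   (ret (?R(r := [], t := rev xs @ ?R t, h := replicate (length xs + Suc k) True)))"
  using Cons.prems by (intro Cons.IH) auto
 have 3: "?R(r := [], t := rev xs @ ?R t, h := replicate (length xs + Suc k) True) =
  R(r := [], t := rev (b # xs) @ R t, h := replicate (length (b # xs) + k) True)"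
  using Cons.prems by (auto simp: fun_eq_iff)
 show ?case using does_while_step_det[OF _ 1 2] Cons.prems unfolding 3 by (auto intro: does_mono simp del: fun_upd_apply)
qed

lemma does_loopB:
 assumes "R t = xs" "r ~= t"
 shows "does (CWhile t (cmove t r)) R (6*length xs + 1) (ret (R(t := [], r := rev xs @ R r)))"
 using assms
proof (induction xs arbitrary: R)
 case Nil
 hence "R(t := [], r := rev [] @ R r) = R" by auto
 thus ?case using does_while_stop[of R t] Nil by (simp del: fun_upd_apply)
next
 case (Cons b xs)
 let ?R = "R(t := xs, r := b # R r)"
 have 1: "does (cmove t r) R 4 (ret ?R)" using Cons.prems by (intro does_cmove) auto
 have 2: "does (CWhile t (cmove t r)) ?R (6*length xs + 1) (ret (?R(t := [], r := rev xs @ ?R r)))"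
  using Cons.prems by (intro Cons.IH) auto
 have 3: "?R(t := [], r := rev xs @ ?R r) = R(t := [], r := rev (b # xs) @ R r)"
  using Cons.prems by (auto simp: fun_eq_iff)
 show ?case using does_while_step_det[OF _ 1 2] Cons.prems unfolding 3 by (auto intro: does_mono simp del: fun_upd_apply)
qed

section \<open>Registers that a program leaves alone\<close>

definition hfree::"nat => (nat => bits) => bool" where
 "hfree d R \<longleftrightarrow> (ALL d'>=d. R (hid d') = [] & R (tmp d') = [])"

definition loops_le::"prog => nat => (nat => bits) => bool" where
 "loops_le p m R \<longleftrightarrow> (ALL r:loops p. length (R r) <= m)"

lemma iter_invariant:
 assumes "s' : set_pmf (iter k f s)" "I s" "!!s s'. I s ==> s' : set_pmf (f s) ==> I s'"
 shows "I s'"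
 using assms(1,2)
proof (induction k arbitrary: s)
 case (Suc k)
 thus ?case using assms(3) by auto
qed auto

lemma sem_other: "s' : set_pmf (sem p s) ==> r \<notin> regs p ==> s' r = s r"
proof (induction p arbitrary: s s')
 case (Rep x p)
 show ?case
 proof (rule iter_invariant[where I = "%s'. s' r = s r" and f = "sem p" and k = "length (s x)" and s = s])
  fix u u' assume "u r = s r" "u' : set_pmf (sem p u)"
  thus "u' r = s r" using Rep.IH[of u' u] Rep.prems by simp
 qed (use Rep.prems in auto)
next
 case (Seq p q)
 thus ?case by fastforce
next
 case (Case x p q)
 hence "s' r = (s(x := tl (s x))) r"
  using Case.IH(1)[of s' "s(x := tl (s x))"] Case.IH(2)[of s' "s(x := tl (s x))"]
  by (simp only: sem.simps regs.simps split: if_splits) auto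
 thus ?case using Case.prems by simp
qed auto

lemma sem_not_pushed: "s' : set_pmf (sem p s) ==> r \<notin> pushes p ==> length (s' r) <= length (s r)"
proof (induction p arbitrary: s s')
 case (Rep x p)
 show ?case
 proof (rule iter_invariant[where I = "%s'. length (s' r) <= length (s r)" and f = "sem p" and k = "length (s x)" and s = s])
  fix u u' assume "length (u r) <= length (s r)" "u' : set_pmf (sem p u)"
  thus "length (u' r) <= length (s r)" using Rep.IH[of u' u] Rep.prems by simp
 qed (use Rep.prems in auto)
next
 case (Seq p q)
 then obtain t where "t : set_pmf (sem p s)" "s' : set_pmf (sem q t)" by auto
 thus ?case using Seq.IH[of t s] Seq.IH(2)[of s' t] Seq.prems by (auto intro: order_trans)
next
 case (Case x p q)
 have "length ((s(x := tl (s x))) r) <= length (s r)" by auto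
 moreover have "length (s' r) <= length ((s(x := tl (s x))) r)"
  using Case.IH(1)[of s' "s(x := tl (s x))"] Case.IH(2)[of s' "s(x := tl (s x))"] Case.prems
  by (simp only: sem.simps pushes.simps split: if_splits) auto
 ultimately show ?case by linarith
qed auto

lemma hid_neq [simp]: "hid d ~= tmp d'" "tmp d ~= hid d'" "hid d = hid d' \<longleftrightarrow> d = d'" "tmp d = tmp d' \<longleftrightarrow> d = d'"
 by (auto simp: hid_def tmp_def) presburger+

lemma iter_upd:
 assumes "!!s. f (s(h := x)) = map_pmf (%s'. s'(h := x)) (f s)"
 shows "iter k f (s(h := x)) = map_pmf (%s'. s'(h := x)) (iter k f s)"
proof (induction k arbitrary: s)
 case (Suc k)
 thus ?case by (simp add: assms bind_map_pmf map_bind_pmf del: fun_upd_apply)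
qed simp

lemma sem_upd: "r \<notin> regs p ==> sem p (s(r := x)) = map_pmf (%s'. s'(r := x)) (sem p s)"
proof (induction p arbitrary: s)
 case (Seq p q)
 thus ?case by (simp add: bind_map_pmf map_bind_pmf del: fun_upd_apply)
next
 case (Case y p q)
 have "(s(r := x))(y := tl ((s(r := x)) y)) = (s(y := tl (s y)))(r := x)" "(s(r := x)) y = s y"
  using Case.prems by auto
 thus ?case using Case.IH[of "s(y := tl (s y))"] Case.prems by (simp del: fun_upd_apply)
next
 case (Rep y p)
 have "(s(r := x)) y = s y" using Rep.prems by auto
 thus ?case by (simp only: sem.simps) (rule iter_upd, rule Rep.IH, use Rep.prems in simp)
qed (auto simp: fun_upd_twist pmf.map_comp comp_def)

lemma visible_hidden: "visible p ==> hid d \<notin> regs p" "visible p ==> tmp d \<notin> regs p"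
 by (force simp: visible_def hid_def tmp_def)+

text \<open>The meaning \<open>iter\<close> does not know the counter \<open>h\<close>. Since the
  body ignores \<open>h\<close>, updates of \<open>h\<close> commute with \<open>sem p\<close>, and
  both sides agree once \<open>h\<close> is cleared.\<close>

lemma does_rep_loop:
 assumes h: "h \<notin> regs p" "R h = replicate k True"
  and body: "!!R. I R ==> does c R T (sem p R)"
  and pres: "!!R R'. I R ==> R' : set_pmf (sem p R) ==> I R'"
  and ignore: "!!R x. I R ==> I (R(h := x))"
  and "I R"
 shows "does (CWhile h (CSeq (CPop h) c)) R (k*(T + 3) + 1) (map_pmf (%s. s(h := [])) (iter k (sem p) R))"
 using h(2) \<open>I R\<close>
proof (induction k arbitrary: R)
 case 0
 hence "R(h := []) = R" by auto
 thus ?case using does_while_stop[of R h] 0 by (simp del: fun_upd_apply)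
next
 case (Suc k)
 let ?R = "R(h := replicate k True)"
 let ?C = "CWhile h (CSeq (CPop h) c)"
 have 1: "does (CSeq (CPop h) c) R (1 + T) (sem p ?R)"
  using does_pop[of h R] Suc.prems by (intro does_seq_det[of _ _ _ ?R] body ignore) auto
 have 2: "does ?C R' (k*(T + 3) + 1) (map_pmf (%s. s(h := [])) (iter k (sem p) R'))"
  if R': "R' : set_pmf (sem p ?R)" for R'
  using sem_other[OF R' h(1)] pres[OF ignore[OF Suc.prems(2)] R'] by (intro Suc.IH) auto
 have 3: "bind_pmf (sem p ?R) (%R'. map_pmf (%s. s(h := [])) (iter k (sem p) R')) =
   map_pmf (%s. s(h := [])) (iter (Suc k) (sem p) R)"
  using h(1) by (simp add: sem_upd iter_upd bind_map_pmf map_bind_pmf pmf.map_comp comp_def)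
 have "does ?C R (1 + T + (k*(T + 3) + 1) + 2) (map_pmf (%s. s(h := [])) (iter (Suc k) (sem p) R))"
  using does_while_step[OF _ 1 2] Suc.prems unfolding 3 by auto
 thus ?case by (rule does_mono) auto
qed

text \<open>Registers that steer a loop are never pushed to, so they only shrink and the bound
  \<open>m\<close> on entry persists through sequences and turns. The running time therefore depends
  on \<open>m\<close> alone.\<close>

lemma does_tr:
 assumes "hfree d R" "loops_le p m R" "visible p" "loops p \<inter> pushes p = {}"
 shows "does (tr d p) R (cost p m) (sem p R)"
 using assms
proof (induction p arbitrary: d R)
 case Skip
 thus ?case by (simp add: does_skip)
next
 case (PPush r b)
 thus ?case by (simp add: does_push[simplified])
next
 case (Flip r)
 thus ?case by (simp add: does_flip[simplified])
next
 case (Seq p q)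
 have "does (CSeq (tr d p) (tr d q)) R (cost p m + cost q m) (bind_pmf (sem p R) (sem q))"
 proof (intro does_seq)
  show "does (tr d p) R (cost p m) (sem p R)"
   using Seq.prems by (intro Seq.IH) (auto simp: loops_le_def visible_def)
 next
  fix R' assume R': "R' : set_pmf (sem p R)"
  have "R' (hid d') = R (hid d')" "R' (tmp d') = R (tmp d')" for d'
   using Seq.prems(3) by (intro sem_other[OF R'] visible_hidden; simp add: visible_def)+
  hence "hfree d R'" using Seq.prems(1) by (simp add: hfree_def)
  moreover have "loops_le q m R'"
   unfolding loops_le_def
  proof
   fix r assume r: "r : loops q"
   hence "r \<notin> pushes p" "length (R r) <= m" using Seq.prems by (auto simp: loops_le_def)
   thus "length (R' r) <= m" using sem_not_pushed[OF R'] le_trans by blast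
  qed
  ultimately show "does (tr d q) R' (cost q m) (sem q R')"
   using Seq.prems by (intro Seq.IH) (auto simp: visible_def)
 qed
 thus ?case by simp
next
 case (Case r p q)
 let ?R = "R(r := tl (R r))"
 have hf: "hfree d ?R" using Case.prems(1) by (auto simp: hfree_def)
 have le: "length (?R x) <= length (R x)" for x by auto
 have "length (?R x) <= m" if "x : loops p \<union> loops q" for x
  using Case.prems(2) that le[of x] by (force simp: loops_le_def)
 hence ll: "loops_le p m ?R" "loops_le q m ?R" by (auto simp: loops_le_def)
 have p: "does (CSeq (CPop r) (tr d p)) R (1 + cost p m) (sem p ?R)"
  using Case.prems by (intro does_seq_det[OF does_pop] Case.IH hf ll) (auto simp: visible_def)
 have q: "does (CSeq (CPop r) (tr d q)) R (1 + cost q m) (sem q ?R)"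
  using Case.prems by (intro does_seq_det[OF does_pop] Case.IH hf ll) (auto simp: visible_def)
 show ?case
 proof (cases "R r ~= [] & hd (R r)")
  case True
  hence "does (tr d (Case r p q)) R (1 + cost p m + 1) (sem p ?R)"
   using does_if_true[of R r, OF _ _ p] by simp
  hence "does (tr d (Case r p q)) R (cost (Case r p q) m) (sem p ?R)" by (rule does_mono) simp
  thus ?thesis using True by (simp only: sem.simps if_True simp_thms)
 next
  case False
  have "does (tr d (Case r p q)) R (1 + cost q m + 2) (sem q ?R)"
   using does_if_false[OF False q] by simp
  hence "does (tr d (Case r p q)) R (cost (Case r p q) m) (sem q ?R)" by (rule does_mono) simp
  thus ?thesis using False by (simp only: sem.simps if_False)
 qed
next
 case (Rep r p)
 let ?h = "hid d" and ?t = "tmp d"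
 define k where "k = length (R r)"
 have k: "k <= m" using Rep.prems by (auto simp: loops_le_def k_def)
 have neq: "r ~= ?h" "r ~= ?t" "?t ~= ?h"
  using visible_hidden[OF Rep.prems(3), of d] by auto
 have empty: "R ?h = []" "R ?t = []" using Rep.prems(1) by (auto simp: hfree_def)
 have hr: "?h \<notin> regs p" using visible_hidden[OF Rep.prems(3), of d] by auto
 let ?R1 = "R(r := [], ?t := rev (R r), ?h := replicate k True)"
 let ?R2 = "R(?h := replicate k True)"
 have A: "does (CWhile r (CSeq (cmove r ?t) (CPush ?h True))) R (7*k + 1) (ret ?R1)"
  using does_loopA[of R r "R r" ?t ?h 0] neq empty by (simp add: k_def)
 have B: "does (CWhile ?t (cmove ?t r)) ?R1 (6*k + 1) (ret ?R2)"
 proof -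
  have "?R1(?t := [], r := rev (rev (R r)) @ ?R1 r) = ?R2"
   using neq empty by (auto simp: fun_eq_iff)
  thus ?thesis using does_loopB[of ?R1 ?t "rev (R r)" r] neq by (simp add: k_def)
 qed
 define I where "I = (%R. hfree (Suc d) R & loops_le p m R)"
 have C: "does (CWhile ?h (CSeq (CPop ?h) (tr (Suc d) p))) ?R2 (k*(cost p m + 3) + 1)
   (map_pmf (%s. s(?h := [])) (iter k (sem p) ?R2))"
 proof (rule does_rep_loop[where I = I])
  show "does (tr (Suc d) p) R (cost p m) (sem p R)" if "I R" for R
   using that Rep.prems by (intro Rep.IH) (auto simp: I_def visible_def)
  show "I R'" if "I R" "R' : set_pmf (sem p R)" for R R'
   unfolding I_def
  proof
   have "R' (hid d') = R (hid d')" "R' (tmp d') = R (tmp d')" for d'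
   using Rep.prems(3) by (intro sem_other[OF that(2)] visible_hidden; simp add: visible_def)+
   thus "hfree (Suc d) R'" using that(1) by (simp add: hfree_def I_def)
   show "loops_le p m R'"
   unfolding loops_le_def
   proof
   fix r assume r: "r : loops p"
   hence "r \<notin> pushes p" "length (R r) <= m" using Rep.prems that by (auto simp: loops_le_def I_def)
   thus "length (R' r) <= m" using sem_not_pushed[OF that(2)] le_trans by blast
   qed
  qed
  show "I (R(?h := x))" if "I R" for R x
   using that unfolding I_def hfree_def loops_le_def
  proof (intro conjI ballI)
   fix r assume "r : loops p"
   moreover have "loops p \<subseteq> regs p" by (induction p) auto
   ultimately have "r ~= ?h" using hr by auto
   thus "length ((R(?h := x)) r) <= m" using that \<open>r : loops p\<close> by (auto simp: I_def loops_le_def)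
  qed (auto simp: I_def hfree_def)
  show "I ?R2"
   unfolding I_def
  proof
   show "hfree (Suc d) ?R2" using Rep.prems(1) by (auto simp: hfree_def)
   have "loops p \<subseteq> regs p" by (induction p) auto
   thus "loops_le p m ?R2" using Rep.prems(2) hr by (auto simp: loops_le_def)
  qed
 qed (use hr in auto)
 have "map_pmf (%s. s(?h := [])) (iter k (sem p) ?R2) = map_pmf (%s. s(?h := [])) (iter k (sem p) R)"
  by (subst iter_upd) (use hr in "auto simp: sem_upd pmf.map_comp comp_def")
 also have "... = iter k (sem p) (R(?h := []))"
  by (rule iter_upd[symmetric]) (use hr in "auto simp: sem_upd")
 also have "R(?h := []) = R" using empty by auto
 finally have "does (tr d (Rep r p)) R ((7*k + 1) + ((6*k + 1) + (k*(cost p m + 3) + 1))) (iter k (sem p) R)"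
  using does_seq_det[OF A does_seq_det[OF B C]] by (simp del: fun_upd_apply)
 moreover have "(7*k + 1) + ((6*k + 1) + (k*(cost p m + 3) + 1)) <= cost (Rep r p) m"
 proof -
  have "k*(cost p m + 16) <= m*(cost p m + 16)" using k by (rule mult_le_mono1)
  thus ?thesis by (simp add: algebra_simps)
 qed
 ultimately show ?case by (auto simp: k_def intro: does_mono)
qed

section \<open>Embedding machines as subroutines\<close>

text \<open>A length together with the code as a function of its load address, since jumps are
  absolute. Compiled programs and embedded solvers share this form.\<close>

type_synonym block = "nat \<times> (nat => instr list)"

definition wfb::"block => bool" where
 "wfb Q \<longleftrightarrow> (ALL a. length (snd Q a) = fst Q)"

definition doesb::"block => (nat => bits) => nat => (nat => bits) pmf => bool" where
 "doesb Q R T D \<longleftrightarrow> (ALL P a. code_at P a (snd Q a) --> reach P (a, R) T (map_pmf (Pair (a + fst Q)) D))"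

definition bseq::"block => block => block" (infixr "\<then>" 55) where
 "bseq Q1 Q2 = (fst Q1 + fst Q2, %a. snd Q1 a @ snd Q2 (a + fst Q1))"

definition blk::"prog => block" where
 "blk p = (clen (tr 0 p), %a. comp a (tr 0 p))"

lemma wfb_blk [simp]: "wfb (blk p)" by (simp add: wfb_def blk_def)
lemma wfb_bseq [simp]: "wfb Q1 ==> wfb Q2 ==> wfb (Q1 \<then> Q2)" by (simp add: wfb_def bseq_def)

lemma doesb_bseq:
 assumes "wfb Q1" "doesb Q1 R T1 D" "!!R'. R' : set_pmf D ==> doesb Q2 R' T2 (f R')"
 shows "doesb (Q1 \<then> Q2) R (T1 + T2) (bind_pmf D f)"
 unfolding doesb_def
proof (intro allI impI)
 fix P a assume "code_at P a (snd (Q1 \<then> Q2) a)"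
 hence c: "code_at P a (snd Q1 a)" "code_at P (a + fst Q1) (snd Q2 (a + fst Q1))"
  using assms(1) by (simp_all add: bseq_def code_at_append wfb_def)
 let ?e = "a + fst (Q1 \<then> Q2)"
 have "reach P (a, R) (T1 + T2) (bind_pmf (map_pmf (Pair (a + fst Q1)) D) (%(pc, R'). map_pmf (Pair ?e) (f R')))"
 proof (rule reach_trans)
  show "reach P (a, R) T1 (map_pmf (Pair (a + fst Q1)) D)" using assms(2) c(1) by (simp add: doesb_def)
  fix c' assume "c' : set_pmf (map_pmf (Pair (a + fst Q1)) D)"
  then obtain R' where R': "c' = (a + fst Q1, R')" "R' : set_pmf D" by auto
  have "reach P (a + fst Q1, R') T2 (map_pmf (Pair (a + fst Q1 + fst Q2)) (f R'))"
   using assms(3)[OF R'(2)] c(2) by (simp add: doesb_def)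
  thus "reach P c' T2 (case c' of (pc, R') => map_pmf (Pair ?e) (f R'))"
   by (simp add: R'(1) bseq_def add.assoc)
 qed
 thus "reach P (a, R) (T1 + T2) (map_pmf (Pair ?e) (bind_pmf D f))"
  by (simp add: bind_map_pmf map_bind_pmf)
qed

lemma doesb_blk:
 assumes "hfree 0 R" "loops_le p m R" "visible p" "loops p \<inter> pushes p = {}"
 shows "doesb (blk p) R (cost p m) (sem p R)"
 using does_tr[OF assms] by (simp add: doesb_def does_def blk_def)

lemma doesb_outd:
 assumes "doesb Q (start x) T D" "wfb Q" "T <= t"
 shows "outd (snd Q 0) t x = map_pmf (%R. R 0) D" "exec (snd Q 0) t (init x tp) ~= None"
proof -
 let ?P = "snd Q 0"
 have "code_at ?P 0 (snd Q 0)" unfolding code_at_def by (intro exI[of _ "[]"]) simp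
 hence r: "reach ?P (0, start x) T (map_pmf (Pair (fst Q)) D)"
  using assms(1) unfolding doesb_def by (metis add_0)
 have h: "mhalted ?P c" if "c : set_pmf (map_pmf (Pair (fst Q)) D)" for c
  using that assms(2) by (auto simp: mhalted_def wfb_def)
 show "outd ?P t x = map_pmf (%R. R 0) D"
  using reach_outd[OF r h assms(3)] by (simp add: pmf.map_comp comp_def)
 show "exec ?P t (init x tp) ~= None"
  using reach_exec_halts[OF r h assms(3), of tp] by (simp add: init_def start_def)
qed

text \<open>A subroutine uses the registers \<open>b\<close>, \<open>b + 4\<close>, \<open>b + 8\<close>, ...; the bases 1001 and 1003
 keep two subroutines apart from each other and from the private stacks of repetitions.\<close>

definition emb::"nat => (nat => bits) => (nat => bits) => nat => bits" where
 "emb b R0 R = (%i. if b <= i & 4 dvd (i - b) then R ((i - b) div 4) else R0 i)"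

lemma emb_at [simp]: "emb b R0 R (b + 4*r) = R r"
 by (simp add: emb_def)

lemma emb_upd [simp]: "(emb b R0 R)(b + 4*r := x) = emb b R0 (R(r := x))"
 by (auto simp: emb_def fun_eq_iff)

text \<open>A machine halts by \<open>Halt\<close> or by leaving its program. Both become a jump to
  the first address behind the block, the second through the clipping
  \<open>min l n\<close>.\<close>

fun rinstr::"nat => nat => nat => instr => instr" where
 "rinstr b a n (Push r x) = Push (b + 4*r) x"
| "rinstr b a n (Pop r) = Pop (b + 4*r)"
| "rinstr b a n (JmpEmpty r l) = JmpEmpty (b + 4*r) (a + min l n)"
| "rinstr b a n (JmpTrue r l) = JmpTrue (b + 4*r) (a + min l n)"
| "rinstr b a n (Jmp l) = Jmp (a + min l n)"
| "rinstr b a n (Coin r) = Coin (b + 4*r)"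
| "rinstr b a n Halt = Jmp (a + n)"

definition sub::"nat => instr list => block" where
 "sub b B = (length B, %a. map (rinstr b a (length B)) B)"

lemma wfb_sub [simp]: "wfb (sub b B)" by (simp add: wfb_def sub_def)

lemma code_at_nth: "code_at P a Q ==> i < length Q ==> a + i < length P & P ! (a + i) = Q ! i"
 by (auto simp: code_at_def nth_append)

text \<open>The simulation is step by step; the one extra step pays for the jump that replaces
  \<open>Halt\<close>.\<close>

lemma reach_sub:
 assumes c: "code_at P a (map (rinstr b a (length B)) B)"
  and "reach B c T D" "!!c'. c' : set_pmf D ==> mhalted B c'"
 shows "reach P (a + min (fst c) (length B), emb b R0 (snd c)) (Suc T)
  (map_pmf (%c. (a + length B, emb b R0 (snd c))) D)"
 using assms(2,3)
proof (induction rule: reach.induct)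
 case (reach_refl c T)
 hence h: "mhalted B c" by simp
 show ?case
 proof (cases "fst c < length B")
  case True
  hence "P ! (a + fst c) = Jmp (a + length B)" "a + fst c < length P"
   using h code_at_nth[OF c, of "fst c"] by (auto simp: mhalted_def)
  thus ?thesis using True by (auto simp: mhalted_def intro!: reach_step1 reach.reach_refl)
 next
  case False
  thus ?thesis by (auto intro: reach.reach_refl)
 qed
next
 case (reach_step c T f)
 obtain pc R where cc: "c = (pc, R)" by force
 have pc: "pc < length B" and nh: "B ! pc ~= Halt" using reach_step.hyps(1) by (auto simp: cc mhalted_def)
 have i: "a + pc < length P" "P ! (a + pc) = rinstr b a (length B) (B ! pc)"
  using code_at_nth[OF c, of pc] pc by auto
 let ?g = "%c. (a + min (fst c) (length B), emb b R0 (snd c))"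
 have st: "pstep P (?g c) = map_pmf ?g (pstep B c)"
  using pc nh i by (cases "B ! pc") (auto simp: cc pmf.map_comp comp_def Suc_le_eq)
 have nh': "~ mhalted P (?g c)"
  using pc nh i by (cases "B ! pc") (auto simp: cc mhalted_def)
 have IH: "reach P (?g c') (Suc T) (map_pmf (%c. (a + length B, emb b R0 (snd c))) (f c'))"
  if c': "c' : set_pmf (pstep B c)" for c'
 proof (rule reach_step.IH[OF c'])
  fix d assume "d : set_pmf (f c')"
  thus "mhalted B d" using c' by (intro reach_step.prems) auto
 qed
 \<comment> \<open>The continuation must be a function of the embedded configuration, so the
   original one is chosen back. Clipping merges program counters in general, but all successors of
   one configuration have the same counter, whence \<open>ginj\<close>.\<close>
 define F where "F = (%d. map_pmf (%c. (a + length B, emb b R0 (snd c))) (f (SOME c'. c' : set_pmf (pstep B c) & ?g c' = d)))"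
 have ginj: "c' = c''" if "c' : set_pmf (pstep B c)" "c'' : set_pmf (pstep B c)" "?g c' = ?g c''" for c' c''
 proof -
  have "snd c' = snd c''"
  proof
   fix r show "snd c' r = snd c'' r"
   using that(3) emb_at[of b R0 "snd c'" r] emb_at[of b R0 "snd c''" r] by simp
  qed
  moreover have "fst c' = fst c''"
   using that(1,2) nh by (cases "B ! pc") (auto simp: cc)
  ultimately show ?thesis by (simp add: prod_eq_iff)
 qed
 have F: "F (?g c') = map_pmf (%c. (a + length B, emb b R0 (snd c))) (f c')" if "c' : set_pmf (pstep B c)" for c'
 proof -
  have "(SOME d. d : set_pmf (pstep B c) & ?g d = ?g c') = c'"
   by (rule some_equality) (use that ginj in blast)+
  thus ?thesis by (simp add: F_def)
 qed
 have "reach P (?g c) (Suc (Suc T)) (bind_pmf (pstep P (?g c)) F)"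
 proof (rule reach.reach_step[OF nh'])
  fix d assume "d : set_pmf (pstep P (?g c))"
  then obtain c' where "c' : set_pmf (pstep B c)" "d = ?g c'" unfolding st by auto
  thus "reach P d (Suc T) (F d)" using IH F by metis
 qed
 also have "bind_pmf (pstep P (?g c)) F = bind_pmf (pstep B c) (%c'. F (?g c'))"
  by (simp only: st bind_map_pmf)
 also have "... = bind_pmf (pstep B c) (%c'. map_pmf (%c. (a + length B, emb b R0 (snd c))) (f c'))"
  by (intro bind_pmf_cong refl F)
 also have "... = map_pmf (%c. (a + length B, emb b R0 (snd c))) (bind_pmf (pstep B c) f)"
  by (simp add: map_bind_pmf)
 finally show ?case .
qed

lemma doesb_sub:
 assumes "!!tp. exec B t (init x tp) ~= None" "!!r. r ~= 0 ==> R (b + 4*r) = []" "R b = x"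
 shows "EX D. doesb (sub b B) R (Suc t) D & map_pmf (%R'. R' b) D = outd B t x &
  (ALL R':set_pmf D. ALL r. ~ (b <= r & 4 dvd (r - b)) --> R' r = R r)"
proof -
 have "exec B t (0, start x, tp) ~= None" for tp using assms(1)[of tp] by (simp add: init_def start_def)
 from exec_reach[OF this] obtain D where D: "reach B (0, start x) t D" "!!c. c : set_pmf D ==> mhalted B c"
  by blast
 let ?D = "map_pmf (%c. emb b R (snd c)) D"
 have R: "emb b R (start x) = R"
 proof
  fix i
  show "emb b R (start x) i = R i"
  proof (cases "b <= i & 4 dvd (i - b)")
   case True
   then obtain r where "i = b + 4*r" by (metis dvdE le_add_diff_inverse)
   thus ?thesis using assms(2)[of r] assms(3) by (cases "r = 0") (auto simp: start_def emb_def)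
  qed (auto simp: emb_def)
 qed
 have "doesb (sub b B) R (Suc t) ?D"
  unfolding doesb_def
 proof (intro allI impI)
  fix P a assume "code_at P a (snd (sub b B) a)"
  hence "code_at P a (map (rinstr b a (length B)) B)" by (simp add: sub_def)
  from reach_sub[OF this D] have "reach P (a, emb b R (start x)) (Suc t) (map_pmf (%c. (a + length B, emb b R (snd c))) D)"
   by force
  thus "reach P (a, R) (Suc t) (map_pmf (Pair (a + fst (sub b B))) ?D)"
   by (simp add: R sub_def pmf.map_comp comp_def)
 qed
 moreover have "map_pmf (%R'. R' b) ?D = outd B t x"
  using reach_outd[OF D order_refl] emb_at[of b R _ 0] by (simp add: pmf.map_comp comp_def)
 ultimately show ?thesis by (intro exI[of _ ?D]) (auto simp: emb_def)
qed

section \<open>Macros\<close>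

declare fun_upd_apply [simp del] fun_upd_same [simp] fun_upd_other [simp]
lemmas upd_eq = fun_eq_iff fun_upd_apply

lemma iter_add: "iter (j + k) f s = bind_pmf (iter j f s) (iter k f)"
proof (induction j arbitrary: s)
 case (Suc j)
 show ?case by (simp add: bind_assoc_pmf) (intro bind_pmf_cong refl Suc)
qed (simp add: bind_ret)

lemma iter_cong:
 assumes "I s" "!!s. I s ==> f s = g s" "!!s s'. I s ==> s' : set_pmf (g s) ==> I s'"
 shows "iter k f s = iter k g s"
 using assms(1)
proof (induction k arbitrary: s)
 case (Suc k)
 show ?case using Suc.prems by (auto simp: assms(2) intro!: bind_pmf_cong Suc.IH assms(3)[of s])
qed simp

lemma iter_iter: "iter j (iter k f) s = iter (j*k) f s"
 by (induction j arbitrary: s) (auto simp: iter_add intro!: bind_pmf_cong)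

text \<open>Counters are unary and of size linear in n; nesting them counts up to products such as n
  times 2n, the number of entries of a matrix.\<close>

definition RepL::"nat list => prog => prog" where
 "RepL cs p = foldr Rep cs p"

lemma RepL_simps [simp]: "RepL [] p = p" "RepL (c # cs) p = Rep c (RepL cs p)"
 by (simp_all add: RepL_def)

lemma regs_RepL [simp]: "regs (RepL cs p) = set cs \<union> regs p"
 by (induction cs) auto
lemma loops_RepL [simp]: "loops (RepL cs p) = set cs \<union> loops p"
 by (induction cs) auto
lemma pushes_RepL [simp]: "pushes (RepL cs p) = pushes p"
 by (induction cs) auto

lemma reglen_cong:
 "(!!c. c : set cs ==> s' c = s c) ==> (\<Prod>c\<leftarrow>cs. length (s' c)) = (\<Prod>c\<leftarrow>cs. length (s c))"
 by (induction cs) auto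

lemma sem_RepL:
 assumes "set cs \<inter> regs p = {}"
 shows "sem (RepL cs p) s = iter (\<Prod>c\<leftarrow>cs. length (s c)) (sem p) s"
 using assms
proof (induction cs arbitrary: s)
 case (Cons c cs)
 let ?I = "%s'. ALL x:set (c # cs). s' x = s x"
 have inv: "?I s''" if "?I s'" "s'' : set_pmf (sem p s')" for s' s''
 proof
  fix x assume x: "x : set (c # cs)"
  hence "x \<notin> regs p" using Cons.prems by auto
  thus "s'' x = s x" using sem_other[OF that(2)] that(1) x by auto
 qed
 have "sem (RepL (c # cs) p) s = iter (length (s c)) (iter (\<Prod>c\<leftarrow>cs. length (s c)) (sem p)) s"
  unfolding RepL_simps sem.simps
 proof (rule iter_cong[where I = ?I])
  fix s' assume I: "?I s'"
  hence "(\<Prod>c\<leftarrow>cs. length (s' c)) = (\<Prod>c\<leftarrow>cs. length (s c))" by (intro reglen_cong) auto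
  moreover have "sem (RepL cs p) s' = iter (\<Prod>c\<leftarrow>cs. length (s' c)) (sem p) s'"
   using Cons by auto
  ultimately show "sem (RepL cs p) s' = iter (\<Prod>c\<leftarrow>cs. length (s c)) (sem p) s'" by simp
 next
  fix s' s'' assume "?I s'" "s'' : set_pmf (iter (\<Prod>c\<leftarrow>cs. length (s c)) (sem p) s')"
  thus "?I s''" using iter_invariant[where I = ?I and f = "sem p"] inv by blast
 qed auto
 thus ?case by (simp add: iter_iter)
next
 case Nil
 have "iter 0 (sem p) = ret" by (auto simp: fun_eq_iff)
 thus ?case by (simp add: bind_return_pmf')
qed


text \<open>Moving reverses the order, so data alternate between a stored and a reversed form.
  \<open>cpy\<close> moves twice and keeps the order.\<close>

definition mv::"nat list => nat => nat => prog" where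
 "mv cs x y = RepL cs (Case x (PPush y True) (PPush y False))"

definition dr::"nat list => nat => prog" where
 "dr cs x = RepL cs (Case x Skip Skip)"

definition cpy::"nat list => nat => nat => nat => prog" where
 "cpy cs x w y = mv cs x w ;; RepL cs (Case w (PPush x True ;; PPush y True) (PPush x False ;; PPush y False))"

definition fls::"nat => nat => prog" where
 "fls c x = Rep c (Flip x)"

definition zero::"nat => nat => prog" where
 "zero c x = Rep c (PPush x False)"

definition xors::"nat => nat => nat => nat => prog" where
 "xors c x a t = Rep c (Case x (Case a (PPush t False) (PPush t True)) (Case a (PPush t True) (PPush t False)))"

definition mvc::"nat => nat => nat => nat => nat => nat => prog" where
 "mvc c h M v acc t = Rep c (Case v (xors h M acc t ;; mv [h] t acc) (dr [h] M))"

text \<open>A stack is filled from its bottom: the terminator is pushed first and the entries follow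
  from last to first. This is why vectors and columns wait in reversed order before they are
  encoded.\<close>

definition ebits::"nat => nat => nat => prog" where
 "ebits c x y = PPush y False ;; Rep c (Case x (PPush y True ;; PPush y True) (PPush y False ;; PPush y True))"

definition emat::"nat => nat => nat => nat => prog" where
 "emat c h x y = PPush y False ;; Rep c (ebits h x y ;; PPush y True)"

definition dec::"nat => nat => nat => prog" where
 "dec c x y = Rep c (Case x (Case x (PPush y True) (PPush y False)) (PPush y False))"

abbreviation reglen::"(nat => bits) => nat list => nat" where
 "reglen s cs == (\<Prod>c\<leftarrow>cs. length (s c))"

lemma iter_mv:
 assumes "x ~= y" "s x = xs @ ys"
 shows "iter (length xs) (sem (Case x (PPush y True) (PPush y False))) s = ret (s(x := ys, y := rev xs @ s y))"
 using assms(2)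
proof (induction xs arbitrary: s)
 case Nil
 hence "s(x := ys, y := rev [] @ s y) = s" by (auto simp: upd_eq)
 thus ?case by simp
next
 case (Cons b xs)
 let ?s = "s(x := xs @ ys, y := b # s y)"
 have step: "sem (Case x (PPush y True) (PPush y False)) s = ret ?s"
  using Cons.prems assms(1) by (cases b) auto
 have IH: "iter (length xs) (sem (Case x (PPush y True) (PPush y False))) ?s = ret (?s(x := ys, y := rev xs @ ?s y))"
  using assms(1) by (intro Cons.IH) simp
 have eq: "?s(x := ys, y := rev xs @ ?s y) = s(x := ys, y := rev (b # xs) @ s y)"
  using assms(1) by (auto simp: upd_eq)
 show ?case by (simp only: iter.simps length_Cons bind_ret step IH eq)
qed

lemma sem_mv:
 assumes "x ~= y" "s x = xs @ ys" "length xs = reglen s cs" "x \<notin> set cs" "y \<notin> set cs"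
 shows "sem (mv cs x y) s = ret (s(x := ys, y := rev xs @ s y))"
 unfolding mv_def using assms by (subst sem_RepL) (auto simp: iter_mv[of x y s xs ys, OF assms(1,2)] simp flip: assms(3) simp del: sem.simps)

lemma iter_dr:
 assumes "s x = xs @ ys"
 shows "iter (length xs) (sem (Case x Skip Skip)) s = ret (s(x := ys))"
 using assms
proof (induction xs arbitrary: s)
 case Nil
 hence "s(x := ys) = s" by (auto simp: upd_eq)
 thus ?case by simp
next
 case (Cons b xs)
 thus ?case using Cons.IH[of "s(x := xs @ ys)"] by (simp add: bind_ret)
qed

lemma sem_dr:
 assumes "s x = xs @ ys" "length xs = reglen s cs" "x \<notin> set cs"
 shows "sem (dr cs x) s = ret (s(x := ys))"
 unfolding dr_def using assms by (subst sem_RepL) (auto simp: iter_dr[of s x xs ys, OF assms(1)] simp flip: assms(2) simp del: sem.simps)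

lemma iter_cpy:
 assumes "w ~= x" "x ~= y" "w ~= y" "s w = xs @ ys"
 shows "iter (length xs) (sem (Case w (PPush x True ;; PPush y True) (PPush x False ;; PPush y False))) s =
   ret (s(w := ys, x := rev xs @ s x, y := rev xs @ s y))"
 using assms(4)
proof (induction xs arbitrary: s)
 case Nil
 hence "s(w := ys, x := rev [] @ s x, y := rev [] @ s y) = s" by (auto simp: upd_eq)
 thus ?case by simp
next
 case (Cons b xs)
 let ?s = "s(w := xs @ ys, x := b # s x, y := b # s y)"
 have step: "sem (Case w (PPush x True ;; PPush y True) (PPush x False ;; PPush y False)) s = ret ?s"
  using Cons.prems assms(1-3) by (cases b) (auto simp: bind_ret)
 have IH: "iter (length xs) (sem (Case w (PPush x True ;; PPush y True) (PPush x False ;; PPush y False))) ?s =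
   ret (?s(w := ys, x := rev xs @ ?s x, y := rev xs @ ?s y))"
  using assms(1-3) by (intro Cons.IH) simp
 have eq: "?s(w := ys, x := rev xs @ ?s x, y := rev xs @ ?s y) = s(w := ys, x := rev (b # xs) @ s x, y := rev (b # xs) @ s y)"
  using assms(1-3) by (auto simp: upd_eq)
 show ?case by (simp only: iter.simps length_Cons bind_ret step IH eq)
qed

lemma sem_cpy:
 assumes "w ~= x" "x ~= y" "w ~= y" "s x = xs @ ys" "length xs = reglen s cs" "set cs \<inter> {x, y, w} = {}"
 shows "sem (cpy cs x w y) s = ret (s(y := xs @ s y))"
proof -
 let ?s = "s(x := ys, w := rev xs @ s w)"
 have 1: "sem (mv cs x w) s = ret ?s" using assms by (intro sem_mv) auto
 have "reglen ?s cs = reglen s cs"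
  using assms(6) by (intro reglen_cong) (auto simp: fun_upd_apply)
 hence rl: "reglen ?s cs = length (rev xs)" using assms(5) by simp
 have 2: "sem (RepL cs (Case w (PPush x True ;; PPush y True) (PPush x False ;; PPush y False))) ?s =
  ret (?s(w := s w, x := rev (rev xs) @ ?s x, y := rev (rev xs) @ ?s y))"
  by (subst sem_RepL, use assms(6) in force, subst rl) (rule iter_cpy; use assms(1-4) in simp)
 have 3: "?s(w := s w, x := rev (rev xs) @ ?s x, y := rev (rev xs) @ ?s y) = s(y := xs @ s y)"
  using assms(1-4) by (auto simp: upd_eq)
 show ?thesis unfolding cpy_def sem.simps 1 bind_ret 2 3 ..
qed

lemma uniform_vec_snoc: "unif (Suc n) = do { b <- coin; xs <- unif n; ret (xs @ [b]) }"
proof -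
 have rev: "map_pmf rev (unif m) = unif m" for m
  unfolding uniform_vec_def
 proof (subst map_pmf_of_set_inj)
  show "pmf_of_set (rev ` {xs::bits. length xs = m}) = pmf_of_set {xs. length xs = m}"
   by (rule arg_cong[where f = pmf_of_set]) (auto intro: image_eqI[where x = "rev _"])
 qed (auto simp: finite_len intro: exI[of _ "replicate m False"])
 have "unif (Suc n) = map_pmf rev (unif (Suc n))" by (simp add: rev)
 also have "... = do { b <- coin; xs <- map_pmf rev (unif n); ret (xs @ [b]) }"
  by (simp add: uniform_vec_Suc map_pmf_def bind_pmfs)
 finally show ?thesis by (simp add: rev)
qed

lemma uniform_vec_rev: "map_pmf rev (unif n) = unif n"
proof (induction n)
 case (Suc n)
 have "map_pmf rev (unif (Suc n)) = do { b <- coin; xs <- map_pmf rev (unif n); ret (xs @ [b]) }"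
  by (simp add: uniform_vec_Suc map_pmf_def bind_pmfs)
 thus ?case by (simp add: Suc uniform_vec_snoc)
qed (simp add: uniform_vec_0)

lemma sem_fls:
 assumes "c ~= x"
 shows "sem (fls c x) s = map_pmf (%v. s(x := v @ s x)) (unif (length (s c)))"
proof -
 have "iter k (sem (Flip x)) s = map_pmf (%v. s(x := v @ s x)) (unif k)" for k s
 proof (induction k arbitrary: s)
  case (Suc k)
  have "iter (Suc k) (sem (Flip x)) s = bind_pmf coin (%b. iter k (sem (Flip x)) (s(x := b # s x)))"
   by (simp add: bind_map_pmf)
  thus ?case
   by (simp only: Suc uniform_vec_snoc) (simp add: map_pmf_def bind_pmfs)
 qed (simp add: uniform_vec_0)
 thus ?thesis by (simp add: fls_def)
qed

lemma sem_zero: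
 assumes "c ~= x"
 shows "sem (zero c x) s = ret (s(x := replicate (length (s c)) False @ s x))"
proof -
 have "iter k (sem (PPush x False)) s = ret (s(x := replicate k False @ s x))" for k s
 proof (induction k arbitrary: s)
  case (Suc k)
  show ?case using Suc[of "s(x := False # s x)"] by (simp add: bind_ret replicate_app_Cons_same)
 qed simp
 thus ?thesis by (simp add: zero_def)
qed

lemma iter_xors:
 assumes "x ~= a" "x ~= t" "a ~= t" "s x = xs @ xr" "s a = as @ ar" "length as = length xs"
 shows "iter (length xs) (sem (Case x (Case a (PPush t False) (PPush t True)) (Case a (PPush t True) (PPush t False)))) s =
   ret (s(x := xr, a := ar, t := rev (vadd xs as) @ s t))"
 using assms(4-6)
proof (induction xs arbitrary: s as)
 case Nil
 hence "s(x := xr, a := ar, t := rev (vadd [] as) @ s t) = s" by (auto simp: vadd_def upd_eq)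
 thus ?case by simp
next
 case (Cons b xs s as')
 then obtain b' as where as': "as' = b' # as" "length as = length xs" by (cases as') auto
 let ?s = "s(x := xs @ xr, a := as @ ar, t := (b ~= b') # s t)"
 have step: "sem (Case x (Case a (PPush t False) (PPush t True)) (Case a (PPush t True) (PPush t False))) s = ret ?s"
  using Cons.prems assms(1-3) as' by (cases b; cases b') (auto simp: fun_upd_twist)
 have IH: "iter (length xs) (sem (Case x (Case a (PPush t False) (PPush t True)) (Case a (PPush t True) (PPush t False)))) ?s =
   ret (?s(x := xr, a := ar, t := rev (vadd xs as) @ ?s t))"
  using assms(1-3) as' by (intro Cons.IH) auto
 have eq: "?s(x := xr, a := ar, t := rev (vadd xs as) @ ?s t) = s(x := xr, a := ar, t := rev (vadd (b # xs) as') @ s t)"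
  using assms(1-3) by (auto simp: as' vadd_def upd_eq)
 show ?case by (simp only: iter.simps length_Cons bind_ret step IH eq)
qed

lemma sem_xors:
 assumes "distinct [c, x, a, t]" "s x = xs @ xr" "s a = as @ ar" "length xs = length (s c)" "length as = length (s c)"
 shows "sem (xors c x a t) s = ret (s(x := xr, a := ar, t := rev (vadd xs as) @ s t))"
 using iter_xors[of x a t s xs xr as ar] assms by (simp add: xors_def del: sem.simps(5))

fun addcols::"bits => bits list => bits => bits" where
 "addcols a (c # cs) (b # bs) = addcols (if b then vadd c a else a) cs bs"
| "addcols a _ _ = a"

lemma length_vadd [simp]: "length (vadd u v) = min (length u) (length v)"
 by (simp add: vadd_def)

lemma sem_mvc:
 assumes "distinct [c, h, M, v, acc, t]" "s M = concat cols @ mr" "s v = bs @ vr" "s acc = a @ ar"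
  "length cols = length (s c)" "length bs = length (s c)" "ALL col:set cols. length col = length (s h)" "length a = length (s h)"
 shows "sem (mvc c h M v acc t) s = ret (s(M := mr, v := vr, acc := addcols a cols bs @ ar))"
proof -
 let ?B = "Case v (xors h M acc t ;; mv [h] t acc) (dr [h] M)"
 have "iter (length cols) (sem ?B) s = ret (s(M := mr, v := vr, acc := addcols a cols bs @ ar))"
  if "s M = concat cols @ mr" "s v = bs @ vr" "s acc = a @ ar" "length bs = length cols"
   "ALL col:set cols. length col = length (s h)" "length a = length (s h)" for s
  using that
 proof (induction cols arbitrary: s bs a)
  case Nil
  hence "s(M := mr, v := vr, acc := addcols a [] bs @ ar) = s" by (auto simp: upd_eq)
  thus ?case by simp
 next
  case (Cons col cols s bs' a)
  then obtain b bs where bs': "bs' = b # bs" "length bs = length cols" by (cases bs') auto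
  let ?a = "if b then vadd col a else a"
  let ?s = "s(M := concat cols @ mr, v := bs @ vr, acc := ?a @ ar)"
  have step: "sem ?B s = ret ?s"
  proof (cases b)
   case True
   let ?s1 = "s(v := bs @ vr)"
   let ?s2 = "?s1(M := concat cols @ mr, acc := ar, t := rev (vadd col a) @ s t)"
   have 1: "sem (xors h M acc t) ?s1 = ret (?s1(M := concat cols @ mr, acc := ar, t := rev (vadd col a) @ ?s1 t))"
   using assms(1) Cons.prems by (intro sem_xors) auto
   have "t ~= v" using assms(1) by auto
   hence t: "?s1 t = s t" by simp
   have 2: "sem (mv [h] t acc) ?s2 = ret (?s2(t := s t, acc := rev (rev (vadd col a)) @ ?s2 acc))"
   using assms(1) Cons.prems by (intro sem_mv) auto
   have 3: "?s2(t := s t, acc := rev (rev (vadd col a)) @ ?s2 acc) = ?s"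
   using assms(1) True by (auto simp: upd_eq)
   have 4: "sem ?B s = bind_pmf (sem (xors h M acc t) ?s1) (sem (mv [h] t acc))"
   using Cons.prems True bs' by simp
   show ?thesis by (simp only: 4 1 bind_ret t 2 3)
  next
   case False
   let ?s1 = "s(v := bs @ vr)"
   have "sem (dr [h] M) ?s1 = ret (?s1(M := concat cols @ mr))"
   using assms(1) Cons.prems by (intro sem_dr[where xs = col]) auto
   moreover have "?s1(M := concat cols @ mr) = ?s"
   using assms(1) False Cons.prems(3) by (auto simp: upd_eq)
   moreover have "sem ?B s = sem (dr [h] M) ?s1" using Cons.prems False bs' by simp
   ultimately show ?thesis by simp
  qed
  have "iter (length cols) (sem ?B) ?s = ret (?s(M := mr, v := vr, acc := addcols ?a cols bs @ ar))"
   using assms(1) Cons.prems bs' by (intro Cons.IH) auto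
  moreover have "?s(M := mr, v := vr, acc := addcols ?a cols bs @ ar) = s(M := mr, v := vr, acc := addcols a (col # cols) bs' @ ar)"
   using assms(1) bs' by (auto simp: upd_eq)
  ultimately show ?case by (simp only: iter.simps length_Cons bind_ret step)
 qed
 from this[of s] assms show ?thesis by (simp add: mvc_def del: sem.simps(5))
qed

lemma enc_bits_Nil: "enc_bits [] = [False]" and enc_bits_Cons: "enc_bits (b # bs) = True # b # enc_bits bs"
 by (simp_all add: enc_bits_def)

lemma enc_mat_Nil: "enc_mat [] = [False]" and enc_mat_Cons: "enc_mat (c # cs) = True # enc_bits c @ enc_mat cs"
 by (simp_all add: enc_mat_def)

lemma sem_ebits:
 assumes "distinct [c, x, y]" "s x = rev xs @ xr" "length xs = length (s c)"
 shows "sem (ebits c x y) s = ret (s(x := xr, y := enc_bits xs @ s y))"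
proof -
 let ?B = "Case x (PPush y True ;; PPush y True) (PPush y False ;; PPush y True)"
 have "iter (length xs) (sem ?B) s = ret (s(x := xr, y := enc_bits (xs @ zs) @ yr))"
  if "s x = rev xs @ xr" "s y = enc_bits zs @ yr" for s zs yr
  using that
 proof (induction xs arbitrary: s zs rule: rev_induct)
  case Nil
  hence "s(x := xr, y := enc_bits ([] @ zs) @ yr) = s" by (auto simp: upd_eq)
  thus ?case by simp
 next
  case (snoc b xs)
  let ?s = "s(x := rev xs @ xr, y := enc_bits (b # zs) @ yr)"
  have "sem ?B s = ret ?s"
   using snoc.prems assms(1) by (cases b) (auto simp: bind_ret enc_bits_Cons)
  moreover have "iter (length xs) (sem ?B) ?s = ret (?s(x := xr, y := enc_bits (xs @ b # zs) @ yr))"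
   using assms(1) by (intro snoc.IH) auto
  moreover have "?s(x := xr, y := enc_bits (xs @ b # zs) @ yr) = s(x := xr, y := enc_bits ((xs @ [b]) @ zs) @ yr)"
   using assms(1) by (auto simp: upd_eq)
  ultimately show ?case by (simp only: iter.simps length_append_singleton bind_ret)
 qed
 from this[of "s(y := False # s y)" "[]" "s y"] assms show ?thesis
  by (simp add: ebits_def bind_ret enc_bits_Nil del: sem.simps(5))
qed

abbreviation rcat::"'a list list => 'a list" where "rcat xss == rev (concat xss)"

lemma sem_emat:
 assumes "distinct [c, h, x, y]" "s x = rcat cols @ xr" "length cols = length (s c)"
  "ALL col:set cols. length col = length (s h)"
 shows "sem (emat c h x y) s = ret (s(x := xr, y := enc_mat cols @ s y))"
proof -
 let ?B = "ebits h x y ;; PPush y True"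
 have "iter (length cols) (sem ?B) s = ret (s(x := xr, y := enc_mat (cols @ zs) @ yr))"
  if "s x = rcat cols @ xr" "s y = enc_mat zs @ yr" "ALL col:set cols. length col = length (s h)" for s zs yr
  using that
 proof (induction cols arbitrary: s zs rule: rev_induct)
  case Nil
  hence "s(x := xr, y := enc_mat ([] @ zs) @ yr) = s" by (auto simp: upd_eq)
  thus ?case by simp
 next
  case (snoc b xs)
  let ?s = "s(x := rcat xs @ xr, y := enc_mat (b # zs) @ yr)"
  have "sem (ebits h x y) s = ret (s(x := rcat xs @ xr, y := enc_bits b @ s y))"
   using snoc.prems assms(1) by (intro sem_ebits) auto
  hence "sem ?B s = ret ?s"
   using snoc.prems assms(1) by (simp add: bind_ret enc_mat_Cons)
  moreover have "iter (length xs) (sem ?B) ?s = ret (?s(x := xr, y := enc_mat (xs @ b # zs) @ yr))"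
   using assms(1) snoc.prems by (intro snoc.IH) auto
  moreover have "?s(x := xr, y := enc_mat (xs @ b # zs) @ yr) = s(x := xr, y := enc_mat ((xs @ [b]) @ zs) @ yr)"
   using assms(1) by (auto simp: upd_eq)
  ultimately show ?case by (simp only: iter.simps length_append_singleton bind_ret)
 qed
 from this[of "s(y := False # s y)" "[]" "s y"] assms show ?thesis
  by (simp add: emat_def bind_ret enc_mat_Nil del: sem_seq[of "ebits h x y"])
qed

text \<open>Solvers may answer anything, so decoding is total: malformed or missing entries read as
  \<open>False\<close>, and always \<open>k\<close> bits come out, which keeps all later lengths
  right.\<close>

fun decode::"nat => bits => bits" where
 "decode 0 xs = []"
| "decode (Suc k) xs = (if xs ~= [] & hd xs then (tl xs ~= [] & hd (tl xs)) # decode k (tl (tl xs)) else False # decode k (tl xs))"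

lemma length_decode [simp]: "length (decode k xs) = k"
 by (induction k xs rule: decode.induct) auto

lemma decode_enc_bits: "length y = k ==> decode k (enc_bits y @ zs) = y"
proof (induction y arbitrary: k)
 case (Cons b y)
 thus ?case by (cases k) (auto simp: enc_bits_Cons)
qed auto

lemma sem_dec:
 assumes "distinct [c, x, y]"
 shows "EX zs. sem (dec c x y) s = ret (s(x := zs, y := rev (decode (length (s c)) (s x)) @ s y))"
proof -
 let ?B = "Case x (Case x (PPush y True) (PPush y False)) (PPush y False)"
 have "EX zs. iter k (sem ?B) s = ret (s(x := zs, y := rev (decode k (s x)) @ s y))" for k s
 proof (induction k arbitrary: s)
  case 0
  thus ?case by (intro exI[of _ "s x"]) simp
 next
  case (Suc k)
  define b where "b = (s x ~= [] & hd (s x))"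
  define s' where "s' = (if b then s(x := tl (tl (s x)), y := (tl (s x) ~= [] & hd (tl (s x))) # s y) else s(x := tl (s x), y := False # s y))"
  have st: "sem ?B s = ret s'"
   using assms by (auto simp: s'_def b_def fun_upd_twist)
  obtain zs where "iter k (sem ?B) s' = ret (s'(x := zs, y := rev (decode k (s' x)) @ s' y))"
   using Suc by blast
  moreover have "s'(x := zs, y := rev (decode k (s' x)) @ s' y) = s(x := zs, y := rev (decode (Suc k) (s x)) @ s y)"
   using assms by (auto simp: s'_def b_def upd_eq)
  ultimately show ?case by (intro exI[of _ zs]) (simp only: iter.simps bind_ret st)
 qed
 thus ?thesis by (simp add: dec_def del: sem.simps(5))
qed

section \<open>The randomising routines\<close>

abbreviation (input) "rN == (2::nat)"
abbreviation (input) "rK == (3::nat)"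
abbreviation (input) "rH == (4::nat)"
abbreviation (input) "rL == (5::nat)"
abbreviation (input) "rQ1 == (6::nat)"
abbreviation (input) "rQ2 == (7::nat)"
abbreviation (input) "rA == (10::nat)"
abbreviation (input) "rA' == (11::nat)"
abbreviation (input) "rB == (12::nat)"
abbreviation (input) "rB' == (13::nat)"
abbreviation (input) "rZ == (14::nat)"
abbreviation (input) "rZ' == (15::nat)"
abbreviation (input) "rW == (16::nat)"
abbreviation (input) "rW' == (17::nat)"
abbreviation (input) "rV == (18::nat)"
abbreviation (input) "racc == (19::nat)"
abbreviation (input) "rt == (20::nat)"
abbreviation (input) "rv == (21::nat)"
abbreviation (input) "rm == (22::nat)"
abbreviation (input) "rm' == (23::nat)"
abbreviation (input) "ra == (24::nat)"
abbreviation (input) "rb == (25::nat)"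
abbreviation (input) "ra' == (26::nat)"
abbreviation (input) "rb' == (27::nat)"
abbreviation (input) "rfa == (28::nat)"
abbreviation (input) "rfb == (29::nat)"
abbreviation (input) "rU == (30::nat)"
abbreviation (input) "rU' == (31::nat)"
abbreviation (input) "rJ == (32::nat)"
abbreviation (input) "rJ' == (33::nat)"
abbreviation (input) "rf == (34::nat)"
abbreviation (input) "rg == (35::nat)"
abbreviation (input) "ry == (36::nat)"
abbreviation (input) "ry' == (37::nat)"
abbreviation (input) "rr == (38::nat)"
abbreviation (input) "rr' == (39::nat)"
abbreviation (input) "rc == (40::nat)"
abbreviation (input) "rM == (41::nat)"
abbreviation (input) "rp == (42::nat)"
abbreviation (input) "rq == (43::nat)"

lemma sem_Seq: "sem (p ;; q) = (%s. bind_pmf (sem p s) (sem q))"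
 by auto

text \<open>The columns of a matrix are kept concatenated in \<open>rV\<close> in reverse order; a round moves
 them to \<open>rW\<close> and processes one column after the other back to \<open>rV\<close>.\<close>

lemma iter_cols:
 assumes body: "!!s c rest. P s ==> s rW = c @ rest ==> length c = k ==>
   f s = ret (s(rW := rest, rV := rev (g c) @ s rV))"
  and stable: "!!s x y. P s ==> P (s(rW := x, rV := y))"
 shows "P s ==> s rW = concat cols @ rest ==> colen k cols ==>
  iter (length cols) f s = ret (s(rW := rest, rV := rcat (map g cols) @ s rV))"
proof (induction cols arbitrary: s)
 case Nil
 hence "s(rW := rest, rV := rcat (map g []) @ s rV) = s" by (auto simp: upd_eq)
 thus ?case by simp
next
 case (Cons c cols)
 let ?s = "s(rW := concat cols @ rest, rV := rev (g c) @ s rV)"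
 have step: "f s = ret ?s" using Cons.prems by (intro body) auto
 have IH: "iter (length cols) f ?s = ret (?s(rW := rest, rV := rcat (map g cols) @ ?s rV))"
  using Cons.prems by (intro Cons.IH stable) auto
 have eq: "?s(rW := rest, rV := rcat (map g cols) @ ?s rV) = s(rW := rest, rV := rcat (map g (c # cols)) @ s rV)"
  by (auto simp: upd_eq)
 show ?case by (simp only: iter.simps length_Cons bind_ret step IH eq)
qed

subsection \<open>Label rotation and riffle\<close>

text \<open>On the pair (a, b) of a site the marked map is (a, b) -> (b, a + b). It has order three
  and determinant one: it permutes the three nonzero labels cyclically and preserves the symplectic
  form.\<close>

definition rotate_a::"bool \<times> bool \<times> bool => bool" where
 "rotate_a = (%(m, a, b). if m then b else a)"
definition rotate_b::"bool \<times> bool \<times> bool => bool" where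
 "rotate_b = (%(m, a, b). if m then a ~= b else b)"

text \<open>The mask is reversed because the program meets the sites of a column from last to
  first.\<close>

definition rotc::"nat => bits => bits => bits" where
 "rotc n m c = map rotate_a (zip (rev m) (zip (take n c) (drop n c))) @
   map rotate_b (zip (rev m) (zip (take n c) (drop n c)))"

text \<open>One step of the inverse riffle shuffle, in which every card draws a bit and the pile is
  stably sorted by it.\<close>

definition part::"bits => 'a list => 'a list" where
 "part m xs = map snd (filter fst (zip m xs)) @ map snd (filter (Not \<circ> fst) (zip m xs))"

definition rifc::"nat => bits => bits => bits" where
 "rifc n m c = part m (take n c) @ part m (drop n c)"

definition rotbody::prog where
 "rotbody = Case rm (PPush rm' True ;;
   Case ra (Case rb (PPush ra' True ;; PPush rb' False) (PPush ra' False ;; PPush rb' True))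
   (Case rb (PPush ra' True ;; PPush rb' True) (PPush ra' False ;; PPush rb' False)))
  (PPush rm' False ;; Case ra (PPush ra' True) (PPush ra' False) ;; Case rb (PPush rb' True) (PPush rb' False))"

definition rotcol::prog where
 "rotcol = mv [rN] rW ra ;; mv [rN] rW rb ;; Rep rN rotbody ;; mv [rN] rm' rm ;; mv [rN] ra' rV ;; mv [rN] rb' rV"

lemma iter_rotbody:
 assumes "s rm = ms @ mr" "s ra = as @ ar" "s rb = bs @ br" "length as = length ms" "length bs = length ms"
 shows "iter (length ms) (sem rotbody) s = ret (s(rm := mr, rm' := rev ms @ s rm', ra := ar, rb := br,
   ra' := rev (map rotate_a (zip ms (zip as bs))) @ s ra', rb' := rev (map rotate_b (zip ms (zip as bs))) @ s rb'))"
 using assms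
proof (induction ms arbitrary: s as bs)
 case Nil
 hence "s(rm := mr, rm' := rev [] @ s rm', ra := ar, rb := br,
   ra' := rev (map rotate_a (zip [] (zip as bs))) @ s ra', rb' := rev (map rotate_b (zip [] (zip as bs))) @ s rb') = s"
  by (auto simp: upd_eq)
 thus ?case by simp
next
 case (Cons m ms s as' bs')
 then obtain a as b bs where ab: "as' = a # as" "bs' = b # bs" by (cases as'; cases bs') auto
 let ?s = "s(rm := ms @ mr, rm' := m # s rm', ra := as @ ar, rb := bs @ br,
   ra' := rotate_a (m, a, b) # s ra', rb' := rotate_b (m, a, b) # s rb')"
 have step: "sem rotbody s = ret ?s"
  using Cons.prems ab by (cases m; cases a; cases b)
   (simp_all add: rotbody_def bind_ret rotate_a_def rotate_b_def upd_eq)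
 have IH: "iter (length ms) (sem rotbody) ?s = ret (?s(rm := mr, rm' := rev ms @ ?s rm', ra := ar, rb := br,
   ra' := rev (map rotate_a (zip ms (zip as bs))) @ ?s ra', rb' := rev (map rotate_b (zip ms (zip as bs))) @ ?s rb'))"
  using Cons.prems ab by (intro Cons.IH) auto
 have eq: "?s(rm := mr, rm' := rev ms @ ?s rm', ra := ar, rb := br,
   ra' := rev (map rotate_a (zip ms (zip as bs))) @ ?s ra', rb' := rev (map rotate_b (zip ms (zip as bs))) @ ?s rb') =
   s(rm := mr, rm' := rev (m # ms) @ s rm', ra := ar, rb := br,
   ra' := rev (map rotate_a (zip (m # ms) (zip as' bs'))) @ s ra', rb' := rev (map rotate_b (zip (m # ms) (zip as' bs'))) @ s rb')"
  by (auto simp: upd_eq ab)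
 show ?case by (simp only: iter.simps length_Cons bind_ret step IH eq)
qed

lemma sem_rotcol:
 assumes "length (s rN) = n" "s rW = c @ rest" "length c = 2*n" "s rm = ms @ mr" "length ms = n"
 shows "sem rotcol s = ret (s(rW := rest, rV := rev (rotc n ms c) @ s rV))"
proof -
 have c: "c = take n c @ drop n c" "length (take n c) = n" "length (drop n c) = n" using assms by auto
 define as bs where "as = take n c" and "bs = drop n c"
 have W: "s rW = as @ bs @ rest" and l: "length as = n" "length bs = n" using assms c by (auto simp: as_def bs_def)
 have z: "map f (zip (rev ms) (zip as bs)) = rev (map f (zip ms (zip (rev as) (rev bs))))" for f::"bool \<times> bool \<times> bool => bool"
  using l assms(5) zip_rev[of as bs] zip_rev[of ms "rev (zip as bs)"] by (simp add: rev_map)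
 let ?s1 = "s(rW := rest, ra := rev as @ s ra, rb := rev bs @ s rb)"
 have "iter (length ms) (sem rotbody) ?s1 = ret (?s1(rm := mr, rm' := rev ms @ ?s1 rm', ra := s ra, rb := s rb,
   ra' := rev (map rotate_a (zip ms (zip (rev as) (rev bs)))) @ ?s1 ra', rb' := rev (map rotate_b (zip ms (zip (rev as) (rev bs)))) @ ?s1 rb'))"
  using assms l by (intro iter_rotbody) auto
 hence R: "sem (Rep rN rotbody) ?s1 = ret (?s1(rm := mr, rm' := rev ms @ ?s1 rm', ra := s ra, rb := s rb,
   ra' := rev (map rotate_a (zip ms (zip (rev as) (rev bs)))) @ ?s1 ra', rb' := rev (map rotate_b (zip ms (zip (rev as) (rev bs)))) @ ?s1 rb'))"
  using assms by simp
 have 1: "sem (mv [rN] rW ra) s = ret (s(rW := bs @ rest, ra := rev as @ s ra))"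
  using assms l W by (intro sem_mv) auto
 let ?s0 = "s(rW := bs @ rest, ra := rev as @ s ra)"
 have 2: "sem (mv [rN] rW rb) ?s0 = ret ?s1"
  using assms l by (subst sem_mv[where xs = bs and ys = rest]) (auto simp: upd_eq)
 have "sem rotcol s = sem (mv [rN] rm' rm ;; mv [rN] ra' rV ;; mv [rN] rb' rV)
   (?s1(rm := mr, rm' := rev ms @ ?s1 rm', ra := s ra, rb := s rb,
   ra' := rev (map rotate_a (zip ms (zip (rev as) (rev bs)))) @ ?s1 ra', rb' := rev (map rotate_b (zip ms (zip (rev as) (rev bs)))) @ ?s1 rb'))"
  unfolding rotcol_def sem_seq 1 bind_ret 2 R ..
 also have "... = ret (s(rW := rest, rV := rev (rotc n ms c) @ s rV))"
  using assms l by (simp add: bind_ret sem_mv[where xs = "rev ms"] sem_mv[where xs = "rev (map f xs)" for f xs])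
   (auto simp: upd_eq rotc_def as_def[symmetric] bs_def[symmetric] z)
 finally show ?thesis .
qed

text \<open>Only one output stack is filled, so the two groups need separate passes; the first pass
  saves the entries and the mask for the second.\<close>

definition pass1::prog where
 "pass1 = Case rm (PPush rm' True ;; Case rW (PPush rW' True ;; PPush rV True) (PPush rW' False ;; PPush rV False))
   (PPush rm' False ;; Case rW (PPush rW' True) (PPush rW' False))"
definition pass2::prog where
 "pass2 = Case rm (PPush rm' True ;; Case rW Skip Skip)
   (PPush rm' False ;; Case rW (PPush rV True) (PPush rV False))"
definition rifhalf::prog where
 "rifhalf = Rep rN pass1 ;; mv [rN] rm' rm ;; mv [rN] rW' rW ;; Rep rN pass2 ;; mv [rN] rm' rm"

lemma iter_pass1:
 assumes "s rm = ms @ mr" "s rW = xs @ wr" "length xs = length ms"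
 shows "iter (length ms) (sem pass1) s = ret (s(rm := mr, rm' := rev ms @ s rm', rW := wr, rW' := rev xs @ s rW',
   rV := rev (map snd (filter fst (zip ms xs))) @ s rV))"
 using assms
proof (induction ms arbitrary: s xs)
 case Nil
 hence "s(rm := mr, rm' := rev [] @ s rm', rW := wr, rW' := rev xs @ s rW',
   rV := rev (map snd (filter fst (zip [] xs))) @ s rV) = s" by (auto simp: upd_eq)
 thus ?case by simp
next
 case (Cons m ms s xs')
 then obtain x xs where xs': "xs' = x # xs" by (cases xs') auto
 let ?s = "s(rm := ms @ mr, rm' := m # s rm', rW := xs @ wr, rW' := x # s rW', rV := (if m then x # s rV else s rV))"
 have step: "sem pass1 s = ret ?s"
  using Cons.prems xs' by (cases m; cases x) (simp_all add: pass1_def bind_ret upd_eq)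
 have IH: "iter (length ms) (sem pass1) ?s = ret (?s(rm := mr, rm' := rev ms @ ?s rm', rW := wr, rW' := rev xs @ ?s rW',
   rV := rev (map snd (filter fst (zip ms xs))) @ ?s rV))"
  using Cons.prems xs' by (intro Cons.IH) auto
 have eq: "?s(rm := mr, rm' := rev ms @ ?s rm', rW := wr, rW' := rev xs @ ?s rW',
   rV := rev (map snd (filter fst (zip ms xs))) @ ?s rV) =
   s(rm := mr, rm' := rev (m # ms) @ s rm', rW := wr, rW' := rev xs' @ s rW',
   rV := rev (map snd (filter fst (zip (m # ms) xs'))) @ s rV)"
  by (auto simp: upd_eq xs')
 show ?case by (simp only: iter.simps length_Cons bind_ret step IH eq)
qed

lemma iter_pass2:
 assumes "s rm = ms @ mr" "s rW = xs @ wr" "length xs = length ms"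
 shows "iter (length ms) (sem pass2) s = ret (s(rm := mr, rm' := rev ms @ s rm', rW := wr,
   rV := rev (map snd (filter (Not \<circ> fst) (zip ms xs))) @ s rV))"
 using assms
proof (induction ms arbitrary: s xs)
 case Nil
 hence "s(rm := mr, rm' := rev [] @ s rm', rW := wr,
   rV := rev (map snd (filter (Not \<circ> fst) (zip [] xs))) @ s rV) = s" by (auto simp: upd_eq)
 thus ?case by simp
next
 case (Cons m ms s xs')
 then obtain x xs where xs': "xs' = x # xs" by (cases xs') auto
 let ?s = "s(rm := ms @ mr, rm' := m # s rm', rW := xs @ wr, rV := (if m then s rV else x # s rV))"
 have step: "sem pass2 s = ret ?s"
  using Cons.prems xs' by (cases m; cases x) (simp_all add: pass2_def bind_ret upd_eq)
 have IH: "iter (length ms) (sem pass2) ?s = ret (?s(rm := mr, rm' := rev ms @ ?s rm', rW := wr,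
   rV := rev (map snd (filter (Not \<circ> fst) (zip ms xs))) @ ?s rV))"
  using Cons.prems xs' by (intro Cons.IH) auto
 have eq: "?s(rm := mr, rm' := rev ms @ ?s rm', rW := wr,
   rV := rev (map snd (filter (Not \<circ> fst) (zip ms xs))) @ ?s rV) =
   s(rm := mr, rm' := rev (m # ms) @ s rm', rW := wr,
   rV := rev (map snd (filter (Not \<circ> fst) (zip (m # ms) xs'))) @ s rV)"
  by (auto simp: upd_eq xs')
 show ?case by (simp only: iter.simps length_Cons bind_ret step IH eq)
qed

lemma sem_rifhalf:
 assumes "length (s rN) = n" "s rW = xs @ rest" "length xs = n" "s rm = ms @ mr" "length ms = n"
 shows "sem rifhalf s = ret (s(rW := rest, rV := rev (part ms xs) @ s rV))"
proof -
 have R1: "sem (Rep rN pass1) s = ret (s(rm := mr, rm' := rev ms @ s rm', rW := rest, rW' := rev xs @ s rW',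
   rV := rev (map snd (filter fst (zip ms xs))) @ s rV))"
  using iter_pass1[of s ms mr xs rest] assms by simp
 let ?s = "s(rV := rev (map snd (filter fst (zip ms xs))) @ s rV)"
 have R2: "sem (Rep rN pass2) ?s = ret (?s(rm := mr, rm' := rev ms @ ?s rm', rW := rest,
   rV := rev (map snd (filter (Not \<circ> fst) (zip ms xs))) @ ?s rV))"
  using iter_pass2[of ?s ms mr xs rest] assms by simp
 have M: "sem (mv [rN] rm' rm ;; mv [rN] rW' rW) (s(rm := mr, rm' := rev ms @ s rm', rW := rest, rW' := rev xs @ s rW',
   rV := rev (map snd (filter fst (zip ms xs))) @ s rV)) = ret ?s"
  using assms by (simp add: bind_ret sem_mv[where xs = "rev ms"] sem_mv[where xs = "rev xs"])
   (auto simp: upd_eq)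
 have M2: "sem (mv [rN] rm' rm) (?s(rm := mr, rm' := rev ms @ ?s rm', rW := rest,
   rV := rev (map snd (filter (Not \<circ> fst) (zip ms xs))) @ ?s rV)) =
   ret (s(rW := rest, rV := rev (part ms xs) @ s rV))"
  using assms by (simp add: sem_mv[where xs = "rev ms"]) (auto simp: upd_eq part_def)
 have "sem rifhalf s = bind_pmf (sem (Rep rN pass1) s) (%s. bind_pmf (sem (mv [rN] rm' rm ;; mv [rN] rW' rW) s)
   (%s. bind_pmf (sem (Rep rN pass2) s) (sem (mv [rN] rm' rm))))"
  by (simp only: rifhalf_def sem_Seq bind_assoc_pmf)
 thus ?thesis by (simp only: R1 R2 M M2 bind_ret)
qed

lemma sem_rifcol:
 assumes "length (s rN) = n" "s rW = c @ rest" "length c = 2*n" "s rm = ms @ mr" "length ms = n"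
 shows "sem (rifhalf ;; rifhalf) s = ret (s(rW := rest, rV := rev (rifc n ms c) @ s rV))"
proof -
 define as bs where "as = take n c" and "bs = drop n c"
 have W: "s rW = as @ bs @ rest" and l: "length as = n" "length bs = n" using assms by (auto simp: as_def bs_def)
 have "sem (rifhalf ;; rifhalf) s = ret (s(rW := rest, rV := rev (part ms bs) @ rev (part ms as) @ s rV))"
  using assms l W by (simp add: bind_ret sem_rifhalf[where xs = as and n = n and rest = "bs @ rest" and ms = ms and mr = mr]
   sem_rifhalf[where xs = bs and n = n and rest = "rest" and ms = ms and mr = mr])
 thus ?thesis by (simp add: rifc_def as_def bs_def)
qed

text \<open>One mask serves all columns: the body puts the mask back after each of them, so that
  matrices and right-hand side undergo the same site map.\<close>

definition round::"nat => prog => prog" where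
 "round q body = fls rN rm ;; mv [q, rH] rV rW ;; Rep q body ;; dr [rN] rm"

lemma sem_round:
 assumes body: "!!s c rest ms mr. length (s rN) = n ==> s rW = c @ rest ==> length c = 2*n ==> s rm = ms @ mr ==> length ms = n ==>
   sem body s = ret (s(rW := rest, rV := rev (g ms c) @ s rV))"
  and q: "q = rQ1 | q = rQ2" "length (s q) = length cols"
  and s: "length (s rN) = n" "length (s rH) = 2*n" "s rW = []" "s rV = rcat cols"
   "colen (2*n) cols"
 shows "sem (round q body) s = map_pmf (%ms. s(rV := rcat (map (g ms) cols))) (unif n)"
proof -
 have len: "length (concat cols) = length cols*(2*n)"
  using s(5) by (induction cols) auto
 have "sem (mv [q, rH] rV rW ;; Rep q body ;; dr [rN] rm) (s(rm := ms @ s rm)) =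
   ret (s(rV := rcat (map (g ms) cols)))" if ms: "length ms = n" for ms
 proof -
  let ?s = "s(rm := ms @ s rm, rV := [], rW := concat cols)"
  have 1: "sem (mv [q, rH] rV rW) (s(rm := ms @ s rm)) = ret ?s"
  proof -
   have "(s(rm := ms @ s rm))(rV := [], rW := rev (rcat cols) @ (s(rm := ms @ s rm)) rW) = ?s"
   using s(3) by (simp add: upd_eq)
   moreover have "sem (mv [q, rH] rV rW) (s(rm := ms @ s rm)) =
   ret ((s(rm := ms @ s rm))(rV := [], rW := rev (rcat cols) @ (s(rm := ms @ s rm)) rW))"
   by (intro sem_mv) (use q s(2,4) len in auto)
   ultimately show ?thesis by simp
  qed
  have "iter (length cols) (sem body) ?s = ret (?s(rW := [], rV := rcat (map (g ms) cols) @ ?s rV))"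
   by (rule iter_cols[where P = "%u. length (u rN) = n & u rm = ms @ s rm" and k = "2*n"])
   (use s ms in "auto intro!: body")
  hence 2: "sem (Rep q body) ?s = ret (?s(rW := [], rV := rcat (map (g ms) cols)))"
   using q by auto
  have 3: "sem (dr [rN] rm) (?s(rW := [], rV := rcat (map (g ms) cols))) = ret (s(rV := rcat (map (g ms) cols)))"
  proof -
   have "(?s(rW := [], rV := rcat (map (g ms) cols)))(rm := s rm) = s(rV := rcat (map (g ms) cols))"
   using s(3) by (simp add: upd_eq)
   moreover have "sem (dr [rN] rm) (?s(rW := [], rV := rcat (map (g ms) cols))) =
   ret ((?s(rW := [], rV := rcat (map (g ms) cols)))(rm := s rm))"
   by (intro sem_dr[where xs = ms]) (use s(1) ms in auto)
   ultimately show ?thesis by simp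
  qed
  show ?thesis by (simp only: sem_seq 1 2 3 bind_ret)
 qed
 note rest = this
 have "sem (round q body) s = bind_pmf (unif n) (%ms. sem (mv [q, rH] rV rW ;; Rep q body ;; dr [rN] rm) (s(rm := ms @ s rm)))"
  by (simp only: round_def sem_seq[of "fls rN rm"] sem_fls[of rN rm, simplified] s(1) bind_map_pmf)
 also have "... = bind_pmf (unif n) (%ms. ret (s(rV := rcat (map (g ms) cols))))"
  by (intro bind_pmf_cong refl rest) (simp add: set_uniform_vec)
 finally show ?thesis by (simp add: map_pmf_def)
qed

fun vecs::"nat => nat => bits list pmf" where
 "vecs 0 n = ret []"
| "vecs (Suc k) n = do { v <- unif n; vs <- vecs k n; ret (v # vs) }"

lemma iter_round:
 assumes step: "!!s cols. P s ==> s rV = rcat cols ==> length cols = q ==> colen (2*n) cols ==>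
   f s = map_pmf (%ms. s(rV := rcat (map (g ms) cols))) (unif n)"
  and stable: "!!s x. P s ==> P (s(rV := x))"
  and len: "!!ms c. length ms = n ==> length c = 2*n ==> length (g ms c) = 2*n"
 shows "P s ==> s rV = rcat cols ==> length cols = q ==> colen (2*n) cols ==>
  iter k f s = map_pmf (%mss. s(rV := rcat (map (fold g mss) cols))) (vecs k n)"
proof (induction k arbitrary: s cols)
 case 0
 hence "s(rV := rcat (map (fold g []) cols)) = s" by (auto simp: upd_eq)
 thus ?case by simp
next
 case (Suc k)
 have "iter (Suc k) f s = bind_pmf (unif n) (%ms. iter k f (s(rV := rcat (map (g ms) cols))))"
  using Suc.prems by (simp add: step bind_map_pmf)
 also have "... = bind_pmf (unif n) (%ms. map_pmf (%mss. s(rV := rcat (map (fold g mss) (map (g ms) cols)))) (vecs k n))"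
  using Suc.prems len by (intro bind_pmf_cong refl) (subst Suc.IH[where cols = "map (g _) cols"], auto simp: set_uniform_vec stable)
 also have "... = map_pmf (%mss. s(rV := rcat (map (fold g mss) cols))) (vecs (Suc k) n)"
  by (simp add: map_pmf_def bind_pmfs comp_def)
 finally show ?case .
qed

lemma length_part: "length m = length xs ==> length (part m xs) = length xs"
 using sum_length_filter_compl[of fst "zip m xs"] by (simp add: part_def comp_def)

lemma length_rotc [simp]: "length m = n ==> length c = 2*n ==> length (rotc n m c) = 2*n"
 by (simp add: rotc_def)

lemma length_rifc [simp]: "length m = n ==> length c = 2*n ==> length (rifc n m c) = 2*n"
 by (simp add: rifc_def length_part)

text \<open>With n rounds of each kind the loss is only of order n^2/2^n, see
  \<open>shconst\<close>.\<close>

definition shuffle::"nat => prog" where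
 "shuffle q = Rep rN (round q rotcol) ;; Rep rN (round q (rifhalf ;; rifhalf))"

definition shuf::"nat => bits list => bits list => bits => bits" where
 "shuf n ms ms' c = fold (rifc n) ms' (fold (rotc n) ms c)"

lemma set_vecs: "mss : set_pmf (vecs k n) ==> length mss = k & (colen n mss)"
 by (induction k arbitrary: mss) (auto simp: set_uniform_vec)

lemma length_fold_rotc: "colen n ms ==> length c = 2*n ==> length (fold (rotc n) ms c) = 2*n"
 by (induction ms arbitrary: c) auto

lemma length_fold_rifc: "colen n ms ==> length c = 2*n ==> length (fold (rifc n) ms c) = 2*n"
 by (induction ms arbitrary: c) auto

lemma sem_shuffle:
 assumes q: "q = rQ1 | q = rQ2" "length (s q) = length cols"
  and s: "length (s rN) = n" "length (s rH) = 2*n" "s rW = []" "s rV = rcat cols"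
   "colen (2*n) cols"
 shows "sem (shuffle q) s = do { ms <- vecs n n; ms' <- vecs n n; ret (s(rV := rcat (map (shuf n ms ms') cols))) }"
proof -
 let ?P = "%u::nat => bits. length (u q) = length cols & length (u rN) = n & length (u rH) = 2*n & u rW = []"
 have 1: "iter n (sem (round q rotcol)) s = map_pmf (%ms. s(rV := rcat (map (fold (rotc n) ms) cols))) (vecs n n)"
 proof (rule iter_round[where P = ?P and q = "length cols"])
  fix s cols' assume "?P s" "s rV = rcat cols'" "length cols' = length cols" "colen (2*n) cols'"
  thus "sem (round q rotcol) s = map_pmf (%ms. s(rV := rcat (map (rotc n ms) cols'))) (unif n)"
   using q(1) by (intro sem_round sem_rotcol) auto
 next
  show "?P (u(rV := x))" if "?P u" for u x using that q(1) by auto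
 qed (use q(2) s in simp_all)
 have 2: "iter n (sem (round q (rifhalf ;; rifhalf))) (s(rV := rcat cols')) =
   map_pmf (%ms. s(rV := rcat (map (fold (rifc n) ms) cols'))) (vecs n n)"
  if cols': "length cols' = length cols" "colen (2*n) cols'" for cols'
 proof -
  have "iter n (sem (round q (rifhalf ;; rifhalf))) (s(rV := rcat cols')) =
   map_pmf (%ms. (s(rV := rcat cols'))(rV := rcat (map (fold (rifc n) ms) cols'))) (vecs n n)"
  proof (rule iter_round[where P = ?P and q = "length cols"])
   fix s cols' assume "?P s" "s rV = rcat cols'" "length cols' = length cols" "colen (2*n) cols'"
   thus "sem (round q (rifhalf ;; rifhalf)) s = map_pmf (%ms. s(rV := rcat (map (rifc n ms) cols'))) (unif n)"
   using q(1) by (intro sem_round sem_rifcol) auto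
  next
   show "?P (u(rV := x))" if "?P u" for u x using that q(1) by auto
   show "?P (s(rV := rcat cols'))" using q s(1-3) by auto
  qed (use cols' in simp_all)
  thus ?thesis by simp
 qed
 have "sem (shuffle q) s = bind_pmf (vecs n n) (%ms. iter n (sem (round q (rifhalf ;; rifhalf)))
   (s(rV := rcat (map (fold (rotc n) ms) cols))))"
  using s q by (auto simp: shuffle_def 1 bind_map_pmf)
 also have "... = bind_pmf (vecs n n) (%ms. map_pmf (%ms'. s(rV := rcat (map (shuf n ms ms') cols))) (vecs n n))"
 proof (intro bind_pmf_cong refl)
  fix ms assume "ms : set_pmf (vecs n n)"
  hence "ALL c:set (map (fold (rotc n) ms) cols). length c = 2*n"
   using s(5) set_vecs length_fold_rotc by auto
  from 2[OF _ this] show "iter n (sem (round q (rifhalf ;; rifhalf))) (s(rV := rcat (map (fold (rotc n) ms) cols))) =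
   map_pmf (%ms'. s(rV := rcat (map (shuf n ms ms') cols))) (vecs n n)"
   by (simp add: shuf_def[abs_def] comp_def)
 qed
 finally show ?thesis by (simp add: map_pmf_def)
qed

subsection \<open>Noise on a random suffix of the sites\<close>

definition coin2::"bool => (bool \<times> bool) pmf" where
 "coin2 fl = (if fl then do { a <- coin; b <- coin; ret (a, b) } else ret (False, False))"

text \<open>The flag stays on until l coins come up all \<open>True\<close>, one trial of
  probability 2^-l per site. While it is on, the site receives a uniform label, zero included.
  \<open>nzv\<close> reverses the list, so that the noisy sites form a suffix.\<close>

fun nzl::"nat => nat => bool => (bool \<times> bool) list pmf" where
 "nzl l 0 fl = ret []"
| "nzl l (Suc n) fl = do { v <- unif l; x <- coin2 (fl & ~ list_all id v);
   xs <- nzl l n (fl & ~ list_all id v); ret (x # xs) }"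

definition nzv::"nat => nat => bits pmf" where
 "nzv l n = map_pmf (%ps. rev (map fst ps) @ rev (map snd ps)) (nzl l n True)"

text \<open>A coin of bias 2^-l made from l fair ones.\<close>

definition ones::prog where
 "ones = PPush rg True ;; Rep rL (Flip rc ;; Case rc Skip (Case rg (PPush rg False) (PPush rg False)))"

definition nzstep::prog where
 "nzstep = ones ;; Case rg (Case rf (PPush rf False) (PPush rf False)) Skip ;;
   Case rf (PPush rf True ;; Flip rfa ;; Flip rfb) (PPush rf False ;; PPush rfa False ;; PPush rfb False)"

definition noiser::prog where
 "noiser = PPush rf True ;; Rep rN nzstep ;; Case rf Skip Skip ;;
   xors rN rfa racc rt ;; xors rN rfb racc rt ;; mv [rH] rt racc"

lemma sem_ones: "sem ones s = map_pmf (%v. s(rg := list_all id v # s rg)) (unif (length (s rL)))"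
proof -
 let ?B = "Flip rc ;; Case rc Skip (Case rg (PPush rg False) (PPush rg False))"
 have it: "iter k (sem ?B) (s(rg := b # gr)) = map_pmf (%v. s(rg := (b & list_all id v) # gr)) (unif k)" for k b s gr
 proof (induction k arbitrary: b)
  case (Suc k)
  have step: "sem ?B (s(rg := b # gr)) = map_pmf (%c. s(rg := (b & c) # gr)) coin"
   by (simp add: map_pmf_def bind_pmfs)
   (intro bind_pmf_cong refl, auto simp: upd_eq)
  show ?case
   by (simp only: iter.simps step bind_map_pmf Suc)
   (simp add: uniform_vec_Suc map_pmf_def bind_pmfs conj_assoc)
 qed (simp add: uniform_vec_0)
 show ?thesis using it[of "length (s rL)" s True "s rg"] by (simp add: ones_def bind_ret)
qed

lemma sem_nzstep:
 assumes "s rf = fl # fr"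
 shows "sem nzstep s = do { v <- unif (length (s rL)); (a, b) <- coin2 (fl & ~ list_all id v);
   ret (s(rf := (fl & ~ list_all id v) # fr, rfa := a # s rfa, rfb := b # s rfb)) }"
proof -
 have *: "sem (Case rg (Case rf (PPush rf False) (PPush rf False)) Skip ;;
   Case rf (PPush rf True ;; Flip rfa ;; Flip rfb) (PPush rf False ;; PPush rfa False ;; PPush rfb False)) (s(rg := all # s rg)) =
   do { (a, b) <- coin2 (fl & ~ all); ret (s(rf := (fl & ~ all) # fr, rfa := a # s rfa, rfb := b # s rfb)) }" for all
  using assms by (cases all; cases fl)
   (auto simp: coin2_def bind_ret map_pmf_def bind_assoc_pmf upd_eq intro!: bind_pmf_cong)
 show ?thesis
  by (simp only: nzstep_def sem_seq[of ones] sem_ones bind_map_pmf *)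
qed

lemma sem_nzloop:
 assumes "s rf = fl # fr"
 shows "bind_pmf (iter n (sem nzstep) s) (sem (Case rf Skip Skip)) = map_pmf (%ps. s(rf := fr,
   rfa := rev (map fst ps) @ s rfa, rfb := rev (map snd ps) @ s rfb)) (nzl (length (s rL)) n fl)"
 using assms
proof (induction n arbitrary: s fl)
 case 0
 have "s(rf := fr) = s(rf := fr, rfa := s rfa, rfb := s rfb)" by (auto simp: upd_eq)
 thus ?case using 0 by (simp add: bind_ret)
next
 case (Suc n)
 have IH: "bind_pmf (iter n (sem nzstep) (s(rf := fl' # fr, rfa := a # s rfa, rfb := b # s rfb))) (sem (Case rf Skip Skip)) =
   map_pmf (%ps. s(rf := fr, rfa := rev (map fst ((a, b) # ps)) @ s rfa, rfb := rev (map snd ((a, b) # ps)) @ s rfb)) (nzl (length (s rL)) n fl')" for fl' a b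
  by (subst Suc.IH) (auto simp: upd_eq intro!: map_pmf_cong)
 have "bind_pmf (iter (Suc n) (sem nzstep) s) (sem (Case rf Skip Skip)) =
  do { v <- unif (length (s rL)); (a, b) <- coin2 (fl & ~ list_all id v);
   bind_pmf (iter n (sem nzstep) (s(rf := (fl & ~ list_all id v) # fr, rfa := a # s rfa, rfb := b # s rfb))) (sem (Case rf Skip Skip)) }"
  by (simp only: iter.simps sem_nzstep[of s fl fr, OF Suc.prems] bind_assoc_pmf case_prod_beta' bind_ret)
 thus ?case unfolding IH
  by (simp add: map_pmf_def bind_pmfs case_prod_beta' del: sem.simps(5))
qed

lemma set_nzl: "ps : set_pmf (nzl l n fl) ==> length ps = n"
 by (induction n arbitrary: ps fl) auto

lemma vadd_append: "length a = length c ==> vadd (a @ b) (c @ d) = vadd a c @ vadd b d"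
 by (simp add: vadd_def)

lemma sem_noiser:
 assumes "length (s rN) = n" "length (s rH) = 2*n" "s racc = c @ ar" "length c = 2*n" "s rfa = []" "s rfb = []"
 shows "sem noiser s = map_pmf (%f. s(racc := vadd f c @ ar)) (nzv (length (s rL)) n)"
proof -
 define ca cb where "ca = take n c" and "cb = drop n c"
 have c: "c = ca @ cb" "length ca = n" "length cb = n" using assms by (auto simp: ca_def cb_def)
 let ?R = "xors rN rfa racc rt ;; xors rN rfb racc rt ;; mv [rH] rt racc"
 let ?s = "s(rf := True # s rf)"
 have rest: "sem ?R (s(rfa := fa, rfb := fb)) = ret (s(racc := vadd (fa @ fb) c @ ar))"
  if f: "length fa = n" "length fb = n" for fa fb
 proof -
  let ?s0 = "s(rfa := fa, rfb := fb)"
  let ?s1 = "s(rfb := fb, racc := cb @ ar, rt := rev (vadd fa ca) @ s rt)"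
  let ?s2 = "s(racc := ar, rt := rev (vadd fb cb) @ rev (vadd fa ca) @ s rt)"
  have "?s0(rfa := [], racc := cb @ ar, rt := rev (vadd fa ca) @ ?s0 rt) = ?s1"
   using assms by (simp add: upd_eq)
  moreover have "sem (xors rN rfa racc rt) ?s0 = ret (?s0(rfa := [], racc := cb @ ar, rt := rev (vadd fa ca) @ ?s0 rt))"
   by (rule sem_xors[where as = ca]) (use assms c f in auto)
  ultimately have 1: "sem (xors rN rfa racc rt) ?s0 = ret ?s1" by simp
  have "?s1(rfb := [], racc := ar, rt := rev (vadd fb cb) @ ?s1 rt) = ?s2"
   using assms by (simp add: upd_eq)
  moreover have "sem (xors rN rfb racc rt) ?s1 = ret (?s1(rfb := [], racc := ar, rt := rev (vadd fb cb) @ ?s1 rt))"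
   by (rule sem_xors[where as = cb]) (use assms c f in auto)
  ultimately have 2: "sem (xors rN rfb racc rt) ?s1 = ret ?s2" by simp
  have "?s2(rt := s rt, racc := rev (rev (vadd fb cb) @ rev (vadd fa ca)) @ ?s2 racc) = s(racc := vadd (fa @ fb) c @ ar)"
   using f c by (simp add: upd_eq vadd_append)
  moreover have "sem (mv [rH] rt racc) ?s2 = ret (?s2(rt := s rt, racc := rev (rev (vadd fb cb) @ rev (vadd fa ca)) @ ?s2 racc))"
   by (rule sem_mv) (use assms c f in auto)
  ultimately have 3: "sem (mv [rH] rt racc) ?s2 = ret (s(racc := vadd (fa @ fb) c @ ar))" by simp
  show ?thesis by (simp only: sem_seq 1 2 3 bind_ret)
 qed
 have "sem noiser s = bind_pmf (bind_pmf (iter n (sem nzstep) ?s) (sem (Case rf Skip Skip))) (sem ?R)"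
  using assms(1) by (simp add: noiser_def bind_pmfs sem_Seq)
 also have "... = bind_pmf (nzl (length (s rL)) n True) (%ps. sem ?R (s(rfa := rev (map fst ps), rfb := rev (map snd ps))))"
  by (subst sem_nzloop[where fl = True and fr = "s rf"], simp)
   (auto simp: bind_map_pmf assms upd_eq intro!: bind_pmf_cong arg_cong[where f = "sem _"])
 also have "... = bind_pmf (nzl (length (s rL)) n True) (%ps. ret (s(racc := vadd (rev (map fst ps) @ rev (map snd ps)) c @ ar)))"
  by (intro bind_pmf_cong refl rest) (auto dest: set_nzl)
 finally show ?thesis by (simp add: nzv_def map_pmf_def bind_pmfs)
qed

subsection \<open>Transvections\<close>

text \<open>Swapping the halves of \<open>u\<close> turns the dot product into the symplectic
  product, so this is the transvection along \<open>u\<close>.\<close>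

definition tvf::"nat => bits => bits => bits" where
 "tvf n u c = (if dotp c (drop n u @ take n u) then vadd u c else c)"

text \<open>The zero vector, drawn at least half of the time, gives the identity. This laziness
  makes the walk positive semidefinite, so that only an upper bound on its spectrum has to be
  found.\<close>

definition luz::"nat => bits pmf" where
 "luz n = do { b <- coin; if b then do { p <- unif n; q <- unif n; ret (p @ q) }
   else ret (replicate (2*n) False) }"

text \<open>The error hidden in the second component is not transformed; \<open>g\<close> is the
  guess of whether \<open>u\<close> enters \<open>Ar\<close>.\<close>

fun tvr::"nat => nat => bits list \<times> bits => (bits list \<times> bits) pmf" where
 "tvr n 0 Az = ret Az"
| "tvr n (Suc k) Az = do { u <- luz n; g <- coin;
   tvr n k (map (tvf n u) (fst Az), if g then vadd u (snd Az) else snd Az) }"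

definition drawu::prog where
 "drawu = Flip rc ;; Case rc (fls rN rp ;; fls rN rq) (zero rN rp ;; zero rN rq)"
definition buildu::prog where
 "buildu = cpy [rN] rp rt rJ ;; cpy [rN] rq rt rJ ;; cpy [rN] rq rt rU ;; cpy [rN] rp rt rU ;; dr [rN] rp ;; dr [rN] rq"
definition dotbody::prog where
 "dotbody = Case rW (PPush rW' True ;; Case rJ (PPush rJ' True ;; Case rf (PPush rf False) (PPush rf True)) (PPush rJ' False))
   (PPush rW' False ;; Case rJ (PPush rJ' True) (PPush rJ' False))"
definition addbody::prog where
 "addbody = Case rU (PPush rU' True ;; Case rW (PPush rV False) (PPush rV True))
   (PPush rU' False ;; Case rW (PPush rV True) (PPush rV False))"
definition addu::prog where
 "addu = Case rf (Rep rH addbody ;; mv [rH] rU' rU) (mv [rH] rW rV)"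
definition tvcol::prog where
 "tvcol = PPush rf False ;; Rep rH dotbody ;; mv [rH] rJ' rJ ;; mv [rH] rW' rW ;; addu"
definition tvround::prog where
 "tvround = drawu ;; buildu ;; mv [rQ1, rH] rV rW ;; Rep rN tvcol ;; Flip rf ;; addu ;; dr [rH] rU ;; dr [rH] rJ"

lemma dotp_Nil [simp]: "dotp [] v = False" by (simp add: dotp_def)
lemma dotp_Cons [simp]: "dotp (a # u) (b # v) = ((a & b) ~= dotp u v)"
 by (cases "a & b") (auto simp: dotp_def)

lemma iter_dotbody:
 assumes "s rW = c @ wr" "s rJ = j @ jr" "length j = length c" "s rf = b # fr"
 shows "iter (length c) (sem dotbody) s = ret (s(rW := wr, rW' := rev c @ s rW', rJ := jr, rJ' := rev j @ s rJ',
   rf := (b ~= dotp c j) # fr))"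
 using assms
proof (induction c arbitrary: s j b)
 case Nil
 hence "s(rW := wr, rW' := rev [] @ s rW', rJ := jr, rJ' := rev j @ s rJ', rf := (b ~= dotp [] j) # fr) = s"
  by (auto simp: upd_eq)
 thus ?case by simp
next
 case (Cons x c s j' b)
 then obtain y j where j': "j' = y # j" by (cases j') auto
 let ?s = "s(rW := c @ wr, rW' := x # s rW', rJ := j @ jr, rJ' := y # s rJ', rf := (b ~= (x & y)) # fr)"
 have step: "sem dotbody s = ret ?s"
  using Cons.prems j' by (cases x; cases y; cases b) (simp_all add: dotbody_def bind_ret upd_eq)
 have IH: "iter (length c) (sem dotbody) ?s = ret (?s(rW := wr, rW' := rev c @ ?s rW', rJ := jr, rJ' := rev j @ ?s rJ',
   rf := ((b ~= (x & y)) ~= dotp c j) # fr))"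
  using Cons.prems j' by (intro Cons.IH) auto
 have eq: "?s(rW := wr, rW' := rev c @ ?s rW', rJ := jr, rJ' := rev j @ ?s rJ', rf := ((b ~= (x & y)) ~= dotp c j) # fr) =
   s(rW := wr, rW' := rev (x # c) @ s rW', rJ := jr, rJ' := rev j' @ s rJ', rf := (b ~= dotp (x # c) j') # fr)"
  by (auto simp: upd_eq j')
 show ?case by (simp only: iter.simps length_Cons bind_ret step IH eq)
qed

lemma iter_addbody:
 assumes "s rU = u @ ur" "s rW = c @ wr" "length c = length u"
 shows "iter (length u) (sem addbody) s = ret (s(rU := ur, rU' := rev u @ s rU', rW := wr, rV := rev (vadd u c) @ s rV))"
 using assms
proof (induction u arbitrary: s c)
 case Nil
 hence "s(rU := ur, rU' := rev [] @ s rU', rW := wr, rV := rev (vadd [] c) @ s rV) = s"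
  by (auto simp: upd_eq vadd_def)
 thus ?case by simp
next
 case (Cons x u s c')
 then obtain y c where c': "c' = y # c" by (cases c') auto
 let ?s = "s(rU := u @ ur, rU' := x # s rU', rW := c @ wr, rV := (x ~= y) # s rV)"
 have step: "sem addbody s = ret ?s"
  using Cons.prems c' by (cases x; cases y) (simp_all add: addbody_def bind_ret upd_eq)
 have IH: "iter (length u) (sem addbody) ?s = ret (?s(rU := ur, rU' := rev u @ ?s rU', rW := wr, rV := rev (vadd u c) @ ?s rV))"
  using Cons.prems c' by (intro Cons.IH) auto
 have eq: "?s(rU := ur, rU' := rev u @ ?s rU', rW := wr, rV := rev (vadd u c) @ ?s rV) =
   s(rU := ur, rU' := rev (x # u) @ s rU', rW := wr, rV := rev (vadd (x # u) c') @ s rV)"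
  by (auto simp: upd_eq c' vadd_def)
 show ?case by (simp only: iter.simps length_Cons bind_ret step IH eq)
qed

lemma sem_addu:
 assumes "length (s rH) = h" "s rU = u @ ur" "length u = h" "s rW = c @ wr" "length c = h" "s rf = b # fr"
 shows "sem addu s = ret (s(rf := fr, rW := wr, rV := rev (if b then vadd u c else c) @ s rV))"
proof (cases b)
 case True
 let ?s0 = "s(rf := fr)"
 let ?s1 = "s(rf := fr, rU := ur, rU' := rev u @ s rU', rW := wr, rV := rev (vadd u c) @ s rV)"
 have "iter (length u) (sem addbody) ?s0 = ret (?s0(rU := ur, rU' := rev u @ ?s0 rU', rW := wr, rV := rev (vadd u c) @ ?s0 rV))"
  by (rule iter_addbody) (use assms in auto)
 hence 1: "sem (Rep rH addbody) ?s0 = ret ?s1" using assms by simp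
 have "?s1(rU' := s rU', rU := rev (rev u) @ ?s1 rU) = s(rf := fr, rW := wr, rV := rev (vadd u c) @ s rV)"
  using assms by (simp add: upd_eq)
 moreover have "sem (mv [rH] rU' rU) ?s1 = ret (?s1(rU' := s rU', rU := rev (rev u) @ ?s1 rU))"
  by (rule sem_mv) (use assms in auto)
 ultimately have 2: "sem (mv [rH] rU' rU) ?s1 = ret (s(rf := fr, rW := wr, rV := rev (vadd u c) @ s rV))" by simp
 have "sem addu s = sem (Rep rH addbody ;; mv [rH] rU' rU) ?s0" using assms True by (simp add: addu_def)
 thus ?thesis using True by (simp only: sem_seq 1 2 bind_ret if_True)
next
 case False
 hence "sem addu s = sem (mv [rH] rW rV) (s(rf := fr))" using assms by (simp add: addu_def)
 also have "... = ret ((s(rf := fr))(rW := wr, rV := rev c @ (s(rf := fr)) rV))"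
  by (rule sem_mv) (use assms in auto)
 finally show ?thesis using False by simp
qed

lemma sem_tvcol:
 assumes "length (s rH) = 2*n" "s rU = u @ ur" "length u = 2*n" "s rW = c @ wr" "length c = 2*n"
  "s rJ = (drop n u @ take n u) @ jr"
 shows "sem tvcol s = ret (s(rW := wr, rV := rev (tvf n u c) @ s rV))"
proof -
 let ?j = "drop n u @ take n u"
 let ?s0 = "s(rf := False # s rf)"
 let ?s1 = "s(rf := dotp c ?j # s rf, rW := wr, rW' := rev c @ s rW', rJ := jr, rJ' := rev ?j @ s rJ')"
 let ?s2 = "s(rf := dotp c ?j # s rf, rW := wr, rW' := rev c @ s rW')"
 let ?s3 = "s(rf := dotp c ?j # s rf)"
 have "iter (length c) (sem dotbody) ?s0 = ret (?s0(rW := wr, rW' := rev c @ ?s0 rW', rJ := jr, rJ' := rev ?j @ ?s0 rJ',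
   rf := (False ~= dotp c ?j) # s rf))"
  by (rule iter_dotbody) (use assms in auto)
 moreover have "?s0(rW := wr, rW' := rev c @ ?s0 rW', rJ := jr, rJ' := rev ?j @ ?s0 rJ', rf := (False ~= dotp c ?j) # s rf) = ?s1"
  by (simp add: upd_eq)
 ultimately have 1: "sem (Rep rH dotbody) ?s0 = ret ?s1" using assms by simp
 have "?s1(rJ' := s rJ', rJ := rev (rev ?j) @ ?s1 rJ) = ?s2" using assms(6) by (simp add: upd_eq)
 moreover have "sem (mv [rH] rJ' rJ) ?s1 = ret (?s1(rJ' := s rJ', rJ := rev (rev ?j) @ ?s1 rJ))"
  by (rule sem_mv) (use assms in auto)
 ultimately have 2: "sem (mv [rH] rJ' rJ) ?s1 = ret ?s2" by simp
 have "?s2(rW' := s rW', rW := rev (rev c) @ ?s2 rW) = ?s3" using assms(4) by (simp add: upd_eq)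
 moreover have "sem (mv [rH] rW' rW) ?s2 = ret (?s2(rW' := s rW', rW := rev (rev c) @ ?s2 rW))"
  by (rule sem_mv) (use assms in auto)
 ultimately have 3: "sem (mv [rH] rW' rW) ?s2 = ret ?s3" by simp
 have "sem addu ?s3 = ret (?s3(rf := s rf, rW := wr, rV := rev (if dotp c ?j then vadd u c else c) @ ?s3 rV))"
  by (rule sem_addu) (use assms in auto)
 moreover have "?s3(rf := s rf, rW := wr, rV := rev (if dotp c ?j then vadd u c else c) @ ?s3 rV) = s(rW := wr, rV := rev (tvf n u c) @ s rV)"
  by (simp add: upd_eq tvf_def)
 ultimately have 4: "sem addu ?s3 = ret (s(rW := wr, rV := rev (tvf n u c) @ s rV))" by simp
 show ?thesis by (simp only: tvcol_def sem.simps(2,4) 1 2 3 4 bind_ret)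
qed

lemma sem_drawu:
 assumes "length (s rN) = n"
 shows "sem drawu s = map_pmf (%u. s(rp := take n u @ s rp, rq := drop n u @ s rq)) (luz n)"
proof -
 have 1: "sem (fls rN rp ;; fls rN rq) s = do { p <- unif n; q <- unif n; ret (s(rp := take n (p @ q) @ s rp, rq := drop n (p @ q) @ s rq)) }"
  using assms by (auto simp: sem_fls bind_map_pmf map_pmf_def bind_pmfs set_uniform_vec intro!: bind_pmf_cong)
 have 2: "sem (zero rN rp ;; zero rN rq) s = ret (s(rp := take n (replicate (2*n) False) @ s rp, rq := drop n (replicate (2*n) False) @ s rq))"
  using assms by (simp add: sem_zero bind_ret)
 have "sem drawu s = bind_pmf coin (%b. if b then sem (fls rN rp ;; fls rN rq) s else sem (zero rN rp ;; zero rN rq) s)"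
  unfolding drawu_def by (simp add: bind_map_pmf if_distrib cong: if_cong)
 thus ?thesis unfolding 1 2
  by (auto simp: luz_def map_pmf_def bind_pmfs intro!: bind_pmf_cong)
qed

lemma set_luz: "u : set_pmf (luz n) ==> length u = 2*n"
 by (auto simp: luz_def set_uniform_vec split: if_splits)

lemma sem_buildu:
 assumes "length (s rN) = n" "s rp = p" "s rq = q" "length p = n" "length q = n"
 shows "sem buildu s = ret (s(rp := [], rq := [], rJ := q @ p @ s rJ, rU := p @ q @ s rU))"
proof -
 let ?s1 = "s(rJ := p @ s rJ)" and ?s2 = "s(rJ := q @ p @ s rJ)"
 let ?s3 = "?s2(rU := q @ s rU)" and ?s4 = "?s2(rU := p @ q @ s rU)"
 let ?s5 = "?s4(rp := [])"
 have 1: "sem (cpy [rN] rp rt rJ) s = ret ?s1"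
  by (rule sem_cpy[where ys = "[]"]) (use assms in auto)
 have 2: "sem (cpy [rN] rq rt rJ) ?s1 = ret ?s2"
  using sem_cpy[of rt rq rJ ?s1 q "[]" "[rN]"] assms by simp
 have 3: "sem (cpy [rN] rq rt rU) ?s2 = ret ?s3"
  using sem_cpy[of rt rq rU ?s2 q "[]" "[rN]"] assms by simp
 have 4: "sem (cpy [rN] rp rt rU) ?s3 = ret ?s4"
  using sem_cpy[of rt rp rU ?s3 p "[]" "[rN]"] assms by simp
 have 5: "sem (dr [rN] rp) ?s4 = ret ?s5"
  using sem_dr[of ?s4 rp p "[]" "[rN]"] assms by simp
 have 6: "sem (dr [rN] rq) ?s5 = ret (?s5(rq := []))"
  using sem_dr[of ?s5 rq q "[]" "[rN]"] assms by simp
 have "?s5(rq := []) = s(rp := [], rq := [], rJ := q @ p @ s rJ, rU := p @ q @ s rU)"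
  by (simp add: upd_eq)
 thus ?thesis by (simp only: buildu_def sem_seq 1 2 3 4 5 6 bind_ret)
qed

lemma length_rect: "colen m cols ==> length (concat cols) = length cols*m"
 by (induction cols) auto

definition tvstate::"nat => (nat => bits) => bool" where
 "tvstate n s \<longleftrightarrow> length (s rN) = n & length (s rH) = 2*n & length (s rQ1) = Suc n & s rW = [] &
   s rp = [] & s rq = [] & s rU = [] & s rJ = []"

lemma sem_tvround:
 assumes "tvstate n s" "s rV = rcat (cols @ [z])" "length cols = n" "colen (2*n) (cols @ [z])"
 shows "sem tvround s = do { u <- luz n; g <- coin;
  ret (s(rV := rcat (map (tvf n u) cols @ [if g then vadd u z else z]))) }"
proof -
 have st: "length (s rN) = n" "length (s rH) = 2*n" "length (s rQ1) = Suc n" "s rW = []" "s rp = []" "s rq = []" "s rU = []" "s rJ = []"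
  using assms(1) by (auto simp: tvstate_def)
 have lz: "length z = 2*n" and lc: "colen (2*n) cols" using assms(4) by auto
 have len: "length (concat cols) = n*(2*n)"
  using length_rect[OF lc] assms(3) by simp
 let ?R = "buildu ;; mv [rQ1, rH] rV rW ;; Rep rN tvcol ;; Flip rf ;; addu ;; dr [rH] rU ;; dr [rH] rJ"
 have rest: "sem ?R (s(rp := take n u @ s rp, rq := drop n u @ s rq)) = bind_pmf coin (%g.
   ret (s(rV := rcat (map (tvf n u) cols @ [if g then vadd u z else z]))))"
  if u: "length u = 2*n" for u
 proof -
  let ?s0 = "s(rp := take n u @ s rp, rq := drop n u @ s rq)"
  let ?s1 = "s(rJ := drop n u @ take n u, rU := u)"
  let ?s2 = "s(rJ := drop n u @ take n u, rU := u, rV := [], rW := concat cols @ z)"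
  let ?s3 = "s(rJ := drop n u @ take n u, rU := u, rV := rcat (map (tvf n u) cols), rW := z)"
  let ?f = "s(rV := rcat (map (tvf n u) cols @ [if g then vadd u z else z]))"
  have "?s0(rp := [], rq := [], rJ := drop n u @ take n u @ ?s0 rJ, rU := take n u @ drop n u @ ?s0 rU) = ?s1"
   using st by (simp add: upd_eq)
  hence 1: "sem buildu ?s0 = ret ?s1"
   using sem_buildu[of ?s0 n "take n u" "drop n u"] st u by simp
  have "?s1(rV := [], rW := rev (rcat (cols @ [z])) @ ?s1 rW) = ?s2"
   using st by (simp add: upd_eq)
  moreover have "sem (mv [rQ1, rH] rV rW) ?s1 = ret (?s1(rV := [], rW := rev (rcat (cols @ [z])) @ ?s1 rW))"
   by (rule sem_mv) (use st assms(2) len lz in auto)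
  ultimately have 2: "sem (mv [rQ1, rH] rV rW) ?s1 = ret ?s2" by simp
  have "iter (length cols) (sem tvcol) ?s2 = ret (?s2(rW := z, rV := rcat (map (tvf n u) cols) @ ?s2 rV))"
   by (rule iter_cols[where P = "%x. length (x rH) = 2*n & x rU = u & x rJ = drop n u @ take n u" and k = "2*n"])
   (use st u lc in "auto intro!: sem_tvcol")
  moreover have "?s2(rW := z, rV := rcat (map (tvf n u) cols) @ ?s2 rV) = ?s3" by (simp add: upd_eq)
  ultimately have 3: "sem (Rep rN tvcol) ?s2 = ret ?s3" using st assms(3) by simp
  have 4: "sem (addu ;; dr [rH] rU ;; dr [rH] rJ) (?s3(rf := g # ?s3 rf)) =
   ret (s(rV := rcat (map (tvf n u) cols @ [if g then vadd u z else z])))" for g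
  proof -
   let ?s4 = "?s3(rf := g # ?s3 rf)"
   let ?s5 = "s(rJ := drop n u @ take n u, rU := u, rV := rcat (map (tvf n u) cols @ [if g then vadd u z else z]))"
   have "sem addu ?s4 = ret (?s4(rf := s rf, rW := [], rV := rev (if g then vadd u z else z) @ ?s4 rV))"
   by (rule sem_addu[where ur = "[]"]) (use st u lz in auto)
   moreover have "?s4(rf := s rf, rW := [], rV := rev (if g then vadd u z else z) @ ?s4 rV) = ?s5"
   using st by (simp add: upd_eq)
   ultimately have a: "sem addu ?s4 = ret ?s5" by simp
   have b: "sem (dr [rH] rU) ?s5 = ret (?s5(rU := []))"
   by (rule sem_dr[where xs = u]) (use st u in auto)
   have c: "sem (dr [rH] rJ) (?s5(rU := [])) = ret (?s5(rU := [], rJ := []))"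
   by (rule sem_dr[where xs = "drop n u @ take n u"]) (use st u in auto)
   have d: "?s5(rU := [], rJ := []) = s(rV := rcat (map (tvf n u) cols @ [if g then vadd u z else z]))"
   using st by (simp add: upd_eq)
   show ?thesis by (simp only: sem_seq a b c d bind_ret)
  qed
  have "sem ?R ?s0 = bind_pmf coin (%g. sem (addu ;; dr [rH] rU ;; dr [rH] rJ) (?s3(rf := g # ?s3 rf)))"
   by (simp only: sem_seq[of buildu] sem_seq[of "mv _ _ _"] sem_seq[of "Rep _ _"] sem_seq[of "Flip _"]
   sem.simps(3) 1 2 3 bind_ret bind_map_pmf)
  thus ?thesis by (simp only: 4)
 qed
 have "sem tvround s = bind_pmf (luz n) (%u. sem ?R (s(rp := take n u @ s rp, rq := drop n u @ s rq)))"
  by (simp only: tvround_def sem_seq[of drawu] sem_drawu[of s n, OF st(1)] bind_map_pmf)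
 also have "... = bind_pmf (luz n) (%u. bind_pmf coin (%g.
   ret (s(rV := rcat (map (tvf n u) cols @ [if g then vadd u z else z])))))"
  by (intro bind_pmf_cong refl rest set_luz)
 finally show ?thesis .
qed

lemma length_tvf [simp]: "length u = m ==> length c = m ==> length (tvf n u c) = m"
 by (simp add: tvf_def)

lemma sem_tvrounds:
 assumes "tvstate n s" "s rV = rcat (cols @ [z])" "length cols = n" "colen (2*n) (cols @ [z])"
 shows "sem (Rep rL tvround) s = map_pmf (%(cols, z). s(rV := rcat (cols @ [z]))) (tvr n (length (s rL)) (cols, z))"
proof -
 have "iter k (sem tvround) s = map_pmf (%(cols, z). s(rV := rcat (cols @ [z]))) (tvr n k (cols, z))" for k
  using assms
 proof (induction k arbitrary: s cols z)
  case 0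
  hence "s(rV := rcat (cols @ [z])) = s" by (auto simp: upd_eq)
  thus ?case by simp
 next
  case (Suc k)
  have "iter (Suc k) (sem tvround) s = do { u <- luz n; g <- coin;
   iter k (sem tvround) (s(rV := rcat (map (tvf n u) cols @ [if g then vadd u z else z]))) }"
   by (simp only: iter.simps sem_tvround[OF Suc.prems] bind_pmfs)
  also have "... = do { u <- luz n; g <- coin;
   map_pmf (%(cols, z). s(rV := rcat (cols @ [z]))) (tvr n k (map (tvf n u) cols, if g then vadd u z else z)) }"
  proof (intro bind_pmf_cong refl)
   fix u g assume "u : set_pmf (luz n)"
   hence u: "length u = 2*n" by (rule set_luz)
   show "iter k (sem tvround) (s(rV := rcat (map (tvf n u) cols @ [if g then vadd u z else z]))) =
   map_pmf (%(cols, z). s(rV := rcat (cols @ [z]))) (tvr n k (map (tvf n u) cols, if g then vadd u z else z))"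
   using Suc.prems u by (subst Suc.IH[where cols = "map (tvf n u) cols" and z = "if g then vadd u z else z"])
   (auto simp: tvstate_def)
  qed
  finally show ?case by (simp add: map_bind_pmf cong: if_cong)
 qed
 thus ?thesis by simp
qed

subsection \<open>Random number of rounds, random change of basis\<close>

text \<open>The number of initial heads among n tosses. A prescribed s < n comes up with probability
  2^-(s+1).\<close>

fun geol::"bool => nat => nat pmf" where
 "geol fl 0 = ret 0"
| "geol fl (Suc n) = bind_pmf coin (%c. if c & fl then map_pmf Suc (geol True n) else geol False n)"

definition geor::prog where
 "geor = PPush rf True ;; Rep rN (Flip rc ;; Case rc (Case rf (PPush rf True ;; PPush rL True) (PPush rf False))
   (Case rf (PPush rf False) (PPush rf False))) ;; Case rf Skip Skip"

lemma sem_geor: "sem geor s = map_pmf (%l. s(rL := replicate l True @ s rL)) (geol True (length (s rN)))"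
proof -
 let ?B = "Flip rc ;; Case rc (Case rf (PPush rf True ;; PPush rL True) (PPush rf False)) (Case rf (PPush rf False) (PPush rf False))"
 have it: "bind_pmf (iter k (sem ?B) (s(rf := fl # fr))) (sem (Case rf Skip Skip)) =
   map_pmf (%l. s(rf := fr, rL := replicate l True @ s rL)) (geol fl k)" for k fl fr s
 proof (induction k arbitrary: fl s)
  case 0
  thus ?case by (simp add: bind_ret) (simp add: upd_eq)
 next
  case (Suc k)
  have step: "sem ?B (s(rf := fl # fr)) = map_pmf (%c. (if c & fl then s(rL := True # s rL) else s)(rf := (c & fl) # fr)) coin"
   by (simp add: map_pmf_def bind_pmfs)
   (intro bind_pmf_cong refl, auto simp: upd_eq bind_ret)
  have "bind_pmf (iter (Suc k) (sem ?B) (s(rf := fl # fr))) (sem (Case rf Skip Skip)) =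
   bind_pmf coin (%c. map_pmf (%l. (if c & fl then s(rL := True # s rL) else s)(rf := fr, rL := replicate l True @ (if c & fl then s(rL := True # s rL) else s) rL)) (geol (c & fl) k))"
   by (simp only: iter.simps step bind_map_pmf bind_assoc_pmf Suc)
  also have "... = map_pmf (%l. s(rf := fr, rL := replicate l True @ s rL)) (geol fl (Suc k))"
  proof -
   have "map_pmf (%l. (if c & fl then s(rL := True # s rL) else s)(rf := fr, rL := replicate l True @ (if c & fl then s(rL := True # s rL) else s) rL)) (geol (c & fl) k) =
   map_pmf (%l. s(rf := fr, rL := replicate l True @ s rL)) (if c & fl then map_pmf Suc (geol True k) else geol False k)" for c
   proof (cases "c & fl")
   case True
   thus ?thesis
   by (simp add: pmf.map_comp comp_def) (intro map_pmf_cong refl, simp add: upd_eq replicate_app_Cons_same)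
   next
   case False
   hence "(c & fl) = False" by simp
   thus ?thesis by (simp only: if_False)
   qed
   thus ?thesis by (simp only: geol.simps map_bind_pmf)
  qed
  finally show ?case .
 qed
 have "sem geor s = bind_pmf (iter (length (s rN)) (sem ?B) (s(rf := True # s rf))) (sem (Case rf Skip Skip))"
  by (simp only: geor_def sem.simps(2,4,6) bind_ret) simp
 also have "... = map_pmf (%l. s(rf := s rf, rL := replicate l True @ s rL)) (geol True (length (s rN)))"
  by (rule it)
 finally show ?thesis by simp
qed

definition mixcol::prog where
 "mixcol = cpy [rN, rH] rA rA' rM ;; fls rN rv ;; zero rH racc ;; mvc rN rH rM rv racc rt ;; mv [rH] racc rV"

lemma length_addcols: "colen m cols ==> length a = m ==> length (addcols a cols bs) = m"
 by (induction a cols bs rule: addcols.induct) auto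

definition zeros::"nat => bits" where "zeros m = replicate m False"

lemma length_zeros [simp]: "length (zeros m) = m" by (simp add: zeros_def)

lemma sem_mixcol:
 assumes "length (s rN) = n" "length (s rH) = 2*n" "s rA = concat A" "is_mat (2*n) n A" "s rM = []" "s rv = []" "s racc = []"
 shows "sem mixcol s = map_pmf (%v. s(rV := rev (addcols (zeros (2*n)) A v) @ s rV)) (unif n)"
proof -
 have A: "length A = n" "colen (2*n) A" "length (concat A) = n*(2*n)"
  using assms(4) length_rect[of A "2*n"] by (auto simp: is_mat_def)
 let ?s1 = "s(rM := concat A)"
 have 1: "sem (cpy [rN, rH] rA rA' rM) s = ret ?s1"
  using sem_cpy[of rA' rA rM s "concat A" "[]" "[rN, rH]"] assms A by simp
 have 2: "sem (fls rN rv) ?s1 = map_pmf (%v. ?s1(rv := v)) (unif n)"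
  using assms by (simp add: sem_fls)
 have 3: "sem (zero rH racc ;; mvc rN rH rM rv racc rt ;; mv [rH] racc rV) (?s1(rv := v)) =
   ret (s(rV := rev (addcols (zeros (2*n)) A v) @ s rV))" if v: "length v = n" for v
 proof -
  let ?s2 = "?s1(rv := v, racc := zeros (2*n))"
  let ?a = "addcols (zeros (2*n)) A v"
  let ?s3 = "s(racc := ?a)"
  have a: "sem (zero rH racc) (?s1(rv := v)) = ret ?s2"
   using assms by (simp add: sem_zero zeros_def)
  have "sem (mvc rN rH rM rv racc rt) ?s2 = ret (?s2(rM := [], rv := [], racc := ?a @ []))"
   by (rule sem_mvc) (use assms A v in auto)
  moreover have "?s2(rM := [], rv := [], racc := ?a @ []) = ?s3" using assms by (simp add: upd_eq)
  ultimately have b: "sem (mvc rN rH rM rv racc rt) ?s2 = ret ?s3" by simp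
  have "sem (mv [rH] racc rV) ?s3 = ret (?s3(racc := [], rV := rev ?a @ ?s3 rV))"
   by (rule sem_mv) (use assms A length_addcols in auto)
  moreover have "?s3(racc := [], rV := rev ?a @ ?s3 rV) = s(rV := rev ?a @ s rV)" using assms by (simp add: upd_eq)
  ultimately have c: "sem (mv [rH] racc rV) ?s3 = ret (s(rV := rev ?a @ s rV))" by simp
  show ?thesis by (simp only: sem_seq a b c bind_ret)
 qed
 have "sem mixcol s = bind_pmf (unif n) (%v. sem (zero rH racc ;; mvc rN rH rM rv racc rt ;; mv [rH] racc rV) (?s1(rv := v)))"
  by (simp only: mixcol_def sem_seq[of "cpy _ _ _ _"] sem_seq[of "fls _ _"] 1 2 bind_ret bind_map_pmf)
 also have "... = bind_pmf (unif n) (%v. ret (s(rV := rev (addcols (zeros (2*n)) A v) @ s rV)))"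
  by (intro bind_pmf_cong refl 3) (simp add: set_uniform_vec)
 finally show ?thesis by (simp add: map_pmf_def)
qed

lemma sem_mix:
 assumes "length (s rN) = n" "length (s rH) = 2*n" "s rA = concat A" "is_mat (2*n) n A" "s rM = []" "s rv = []" "s racc = []"
 shows "sem (Rep rN mixcol) s = map_pmf (%us. s(rV := rcat (map (addcols (zeros (2*n)) A) us) @ s rV)) (vecs n n)"
proof -
 have "iter k (sem mixcol) s = map_pmf (%us. s(rV := rcat (map (addcols (zeros (2*n)) A) us) @ s rV)) (vecs k n)" for k
  using assms
 proof (induction k arbitrary: s)
  case (Suc k)
  have "iter (Suc k) (sem mixcol) s = bind_pmf (unif n) (%v. iter k (sem mixcol) (s(rV := rev (addcols (zeros (2*n)) A v) @ s rV)))"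
   by (simp only: iter.simps sem_mixcol[OF Suc.prems] bind_map_pmf)
  also have "... = bind_pmf (unif n) (%v. map_pmf (%us. s(rV := rcat (map (addcols (zeros (2*n)) A) (v # us)) @ s rV)) (vecs k n))"
   using Suc.prems by (intro bind_pmf_cong refl) (subst Suc.IH; simp)
  finally show ?case by (simp add: map_pmf_def bind_pmfs)
 qed simp
 thus ?thesis using assms by simp
qed

subsection \<open>Parsing the input\<close>

text \<open>\<open>rg\<close> signals that the item has been read; \<open>rf\<close> tells whether the head is inside a column.\<close>

definition parsestep::"nat => nat => prog" where
 "parsestep x c = Case rg (PPush rg True) (Case rf
   (Case 0 (Case 0 (PPush x True) (PPush x False) ;; PPush rf True) (PPush rf False))
   (Case 0 (PPush c True ;; PPush rf True) (PPush rg True)))"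

text \<open>The remaining input serves as the counter. An item takes no more turns than its encoding
  has bits, and once \<open>rg\<close> is set the remaining turns are idle.\<close>

definition parse::"nat => nat => prog" where
 "parse x c = Rep 0 (parsestep x c) ;; Case rg Skip Skip ;; Case rf Skip Skip"

context
 fixes x c::nat
 assumes xc: "distinct [x, c, 0, rf, rg]"
begin

lemma parse_bits:
 assumes "s rg = []" "s rf = [True]" "s 0 = enc_bits v @ rest"
 shows "iter (length v + 1 + j) (sem (parsestep x c)) s = iter j (sem (parsestep x c)) (s(0 := rest, x := rev v @ s x, rf := [False]))"
 using assms
proof (induction v arbitrary: s)
 case Nil
 have "sem (parsestep x c) s = ret (s(0 := rest, x := rev [] @ s x, rf := [False]))"
  using Nil xc by (simp add: parsestep_def enc_bits_Nil upd_eq)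
 thus ?case by (simp add: bind_ret)
next
 case (Cons b v)
 let ?s = "s(0 := enc_bits v @ rest, x := b # s x)"
 have "sem (parsestep x c) s = ret ?s"
  using Cons.prems xc by (cases b) (simp_all add: parsestep_def enc_bits_Cons bind_ret upd_eq)
 moreover have "iter (length v + 1 + j) (sem (parsestep x c)) ?s = iter j (sem (parsestep x c)) (?s(0 := rest, x := rev v @ ?s x, rf := [False]))"
  using Cons.prems xc by (intro Cons.IH) auto
 moreover have "?s(0 := rest, x := rev v @ ?s x, rf := [False]) = s(0 := rest, x := rev (b # v) @ s x, rf := [False])"
  using xc by (auto simp: upd_eq)
 ultimately show ?case by (simp add: bind_ret)
qed

lemma parse_done:
 assumes "s rg = [True]"
 shows "iter j (sem (parsestep x c)) s = ret s"
proof (induction j)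
 case (Suc j)
 have "sem (parsestep x c) s = ret s"
  using assms xc by (simp add: parsestep_def upd_eq)
 thus ?case using Suc by (simp add: bind_ret)
qed simp

fun msteps::"bits list => nat" where
 "msteps [] = 1" | "msteps (col # M) = length col + 2 + msteps M"

lemma msteps_le: "msteps M <= length (enc_mat M @ rest)"
proof -
 have "length (enc_bits v) = 2*length v + 1" for v by (induction v) (auto simp: enc_bits_Nil enc_bits_Cons)
 thus ?thesis by (induction M) (auto simp: enc_mat_Nil enc_mat_Cons)
qed

lemma parse_mat:
 assumes "s rg = []" "s rf = [] | s rf = [False]" "s 0 = enc_mat M @ rest"
 shows "iter (msteps M + j) (sem (parsestep x c)) s =
  ret (s(0 := rest, x := rcat M @ s x, c := replicate (length M) True @ s c, rf := [], rg := [True]))"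
 using assms
proof (induction M arbitrary: s)
 case Nil
 have st: "sem (parsestep x c) s = ret (s(0 := rest, rf := [], rg := [True]))"
  using Nil xc by (auto simp add: parsestep_def enc_mat_Nil upd_eq)
 have "iter j (sem (parsestep x c)) (s(0 := rest, rf := [], rg := [True])) = ret (s(0 := rest, rf := [], rg := [True]))"
  by (rule parse_done) simp
 moreover have "s(0 := rest, x := rcat [] @ s x, c := replicate (length []) True @ s c, rf := [], rg := [True]) = s(0 := rest, rf := [], rg := [True])"
  using xc by (auto simp: upd_eq)
 ultimately show ?case using st by (simp add: bind_ret)
next
 case (Cons col M)
 let ?s = "s(0 := enc_bits col @ enc_mat M @ rest, c := True # s c, rf := [True])"
 let ?s1 = "?s(0 := enc_mat M @ rest, x := rev col @ ?s x, rf := [False])"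
 have 1: "sem (parsestep x c) s = ret ?s"
  using Cons.prems xc by (auto simp add: parsestep_def enc_mat_Cons bind_ret upd_eq)
 have 2: "iter (length col + 1 + (msteps M + j)) (sem (parsestep x c)) ?s = iter (msteps M + j) (sem (parsestep x c)) ?s1"
  using Cons.prems xc by (intro parse_bits) auto
 have 3: "iter (msteps M + j) (sem (parsestep x c)) ?s1 =
   ret (?s1(0 := rest, x := rcat M @ ?s1 x, c := replicate (length M) True @ ?s1 c, rf := [], rg := [True]))"
  using Cons.prems xc by (intro Cons.IH) auto
 have 4: "?s1(0 := rest, x := rcat M @ ?s1 x, c := replicate (length M) True @ ?s1 c, rf := [], rg := [True]) =
   s(0 := rest, x := rcat (col # M) @ s x, c := replicate (length (col # M)) True @ s c, rf := [], rg := [True])"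
  using xc by (auto simp: upd_eq replicate_app_Cons_same)
 have n: "msteps (col # M) + j = Suc (length col + 1 + (msteps M + j))" by simp
 show ?case by (simp only: n iter.simps 1 bind_ret 2 3 4)
qed

lemma sem_parse_mat:
 assumes "s rg = []" "s rf = []" "s 0 = enc_mat M @ rest"
 shows "sem (parse x c) s = ret (s(0 := rest, x := rcat M @ s x, c := replicate (length M) True @ s c))"
proof -
 obtain j where j: "length (s 0) = msteps M + j"
  using msteps_le[of M rest] assms(3) le_Suc_ex by metis
 let ?s = "s(0 := rest, x := rcat M @ s x, c := replicate (length M) True @ s c, rf := [], rg := [True])"
 have "sem (Rep 0 (parsestep x c)) s = ret ?s"
  unfolding sem.simps(6) j by (rule parse_mat) (use assms in auto)
 moreover have "sem (Case rg Skip Skip ;; Case rf Skip Skip) ?s = ret (s(0 := rest, x := rcat M @ s x, c := replicate (length M) True @ s c))"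
  using assms xc by (simp add: bind_ret) (auto simp: upd_eq)
 ultimately show ?thesis unfolding parse_def sem_seq[of "Rep _ _"] by (simp only: bind_ret)
qed

text \<open>A vector is parsed like a column whose leading flag has been consumed, hence the initial
  \<open>True\<close> in \<open>rf\<close>.\<close>

lemma sem_parse_vec:
 assumes "s rg = []" "s rf = [True]" "s 0 = enc_bits v"
 shows "sem (parse x c) s = ret (s(0 := [], x := rev v @ s x, rf := []))"
proof -
 have le: "length (enc_bits v) = 2*length v + 1" by (induction v) (auto simp: enc_bits_Nil enc_bits_Cons)
 let ?s = "s(0 := [], x := rev v @ s x, rf := [False])"
 have b: "iter (length v + 1 + length v) (sem (parsestep x c)) s = iter (length v) (sem (parsestep x c)) ?s"
  using parse_bits[of s v "[]" "length v"] assms by simp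
 have fin: "sem (Case rg Skip Skip ;; Case rf Skip Skip) s' = ret (s(0 := [], x := rev v @ s x, rf := []))"
  if "s' = ?s | s' = ?s(rf := [], rg := [True])" for s'
  using that assms xc by (auto simp add: bind_ret upd_eq)
 \<comment> \<open>Behind the vector the empty input reads as \<open>False\<close> and sets
   \<open>rg\<close>. For the empty vector no turn is left for this, which explains the two possible
   states.\<close>
 have "EX s'. (s' = ?s | s' = ?s(rf := [], rg := [True])) & iter (length v) (sem (parsestep x c)) ?s = ret s'"
 proof (cases "length v")
  case (Suc j)
  have "sem (parsestep x c) ?s = ret (?s(rf := [], rg := [True]))"
   using assms xc by (simp add: parsestep_def upd_eq)
  moreover have "iter j (sem (parsestep x c)) (?s(rf := [], rg := [True])) = ret (?s(rf := [], rg := [True]))"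
   by (rule parse_done) simp
  ultimately show ?thesis unfolding Suc by (intro exI[of _ "?s(rf := [], rg := [True])"]) (simp add: bind_ret)
 qed auto
 then obtain s' where s': "s' = ?s | s' = ?s(rf := [], rg := [True])" "iter (length v) (sem (parsestep x c)) ?s = ret s'"
  by blast
 have "length (s 0) = length v + 1 + length v" using assms le by simp
 hence "sem (Rep 0 (parsestep x c)) s = ret s'" using b s' by simp
 thus ?thesis unfolding parse_def sem_seq[of "Rep _ _"] by (simp only: bind_ret fin[OF s'(1)])
qed

end

definition parser::prog where
 "parser = parse rA' rN ;; parse rB' rK ;; PPush rf True ;; parse rZ' rc"

definition parsed::"bits list => bits list => bits => nat => bits" where
 "parsed A B z = (%_. [])(rN := replicate (length A) True, rK := replicate (length B) True,
   rA' := rcat A, rB' := rcat B, rZ' := rev z)"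

lemma sem_parser:
 "sem parser (start (enc_mat A @ enc_mat B @ enc_bits z)) = ret (parsed A B z)"
proof -
 let ?s0 = "start (enc_mat A @ enc_mat B @ enc_bits z)"
 let ?s1 = "?s0(0 := enc_mat B @ enc_bits z, rA' := rcat A @ ?s0 rA', rN := replicate (length A) True @ ?s0 rN)"
 let ?s2 = "?s1(0 := enc_bits z, rB' := rcat B @ ?s1 rB', rK := replicate (length B) True @ ?s1 rK)"
 let ?s3 = "?s2(rf := True # ?s2 rf)"
 let ?s4 = "?s3(0 := [], rZ' := rev z @ ?s3 rZ', rf := [])"
 have 1: "sem (parse rA' rN) ?s0 = ret ?s1" by (rule sem_parse_mat) (auto simp: start_def)
 have 2: "sem (parse rB' rK) ?s1 = ret ?s2" by (rule sem_parse_mat) (auto simp: start_def)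
 have 3: "sem (parse rZ' rc) ?s3 = ret ?s4" by (rule sem_parse_vec) (auto simp: start_def)
 have 4: "?s4 = parsed A B z" by (auto simp: start_def parsed_def upd_eq)
 show ?thesis by (simp only: parser_def sem.simps(2,4) 1 2 3 4 bind_ret)
qed

text \<open>Besides the column height 2n in \<open>rH\<close> these are the numbers of columns of
  \<open>[A|z]\<close> in \<open>rQ1\<close> and of \<open>[A|B|z]\<close> in \<open>rQ2\<close>,
  and the random number of rounds in \<open>rL\<close>.\<close>

definition counters::prog where
 "counters = Rep rN (PPush rH True ;; PPush rH True ;; PPush rQ1 True ;; PPush rQ2 True) ;;
   Rep rK (PPush rQ2 True) ;; PPush rQ1 True ;; PPush rQ2 True ;; geor"

definition counted::"bits list => bits list => bits => nat => nat => bits" where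
 "counted A B z l = (parsed A B z)(rH := replicate (2*length A) True, rQ1 := replicate (Suc (length A)) True,
   rQ2 := replicate (Suc (length A + length B)) True, rL := replicate l True)"

lemma sem_setup:
 "sem counters (parsed A B z) = map_pmf (counted A B z) (geol True (length A))"
proof -
 have r1: "iter k (sem (PPush rH True ;; PPush rH True ;; PPush rQ1 True ;; PPush rQ2 True)) s =
   ret (s(rH := replicate (2*k) True @ s rH, rQ1 := replicate k True @ s rQ1, rQ2 := replicate k True @ s rQ2))" for k s
 proof (induction k arbitrary: s)
  case 0
  thus ?case by (simp add: upd_eq)
 next
  case (Suc k)
  thus ?case by (simp add: bind_ret) (auto simp: upd_eq replicate_app_Cons_same)
 qed
 have r2: "iter k (sem (PPush rQ2 True)) s = ret (s(rQ2 := replicate k True @ s rQ2))" for k s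
 proof (induction k arbitrary: s)
  case (Suc k)
  thus ?case by (simp add: bind_ret replicate_app_Cons_same)
 qed (simp add: upd_eq)
 have len: "length (parsed A B z rN) = length A" "length (parsed A B z rK) = length B" by (simp_all add: parsed_def)
 let ?s = "(parsed A B z)(rH := replicate (2*length A) True, rQ1 := replicate (Suc (length A)) True,
   rQ2 := replicate (Suc (length A + length B)) True)"
 have "sem counters (parsed A B z) = sem geor ?s"
  unfolding counters_def sem.simps(4,6) r1 bind_ret
  by (simp add: len r2 bind_ret)
   (rule arg_cong[where f = "sem geor"], auto simp: upd_eq parsed_def replicate_add[symmetric] add.commute)
 thus ?thesis by (simp add: sem_geor len counted_def[abs_def] parsed_def)
qed

subsection \<open>The stages of the inverter\<close>

definition std::"nat => nat => nat => bits list => bits => bits => (nat => bits) => bool" where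
 "std n k l A b z s \<longleftrightarrow> length (s rN) = n & length (s rK) = k & length (s rH) = 2*n & length (s rQ1) = Suc n &
   length (s rQ2) = Suc (n + k) & length (s rL) = l & s rA = concat A & s rB = b & s rZ = z &
   (ALL r:{0, rA', rB', rZ', rW, rV, racc, rt, rv, rfa, rfb, rU, rJ, ry', rr, rr', rM, rp, rq}. s r = [])"

definition orient::prog where
 "orient = mv [rN, rH] rA' rA ;; mv [rK, rH] rB' rB ;; mv [rH] rZ' rZ"

lemma sem_orient:
 assumes "is_mat (2*n) n A" "is_mat (2*n) k B" "length z = 2*n"
 shows "EX s. sem orient (counted A B z l) = ret s & std n k l A (concat B) z s & s ry = [] & (ALL i>=1000. s i = [])"
proof -
 have A: "length A = n" "colen (2*n) A" "length (concat A) = n*(2*n)"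
  and B: "length B = k" "colen (2*n) B" "length (concat B) = k*(2*n)"
  using assms(1,2) length_rect[of A "2*n"] length_rect[of B "2*n"] by (auto simp: is_mat_def)
 let ?s = "counted A B z l"
 let ?s1 = "?s(rA' := [], rA := concat A)"
 let ?s2 = "?s1(rB' := [], rB := concat B)"
 let ?s3 = "?s2(rZ' := [], rZ := z)"
 have 1: "sem (mv [rN, rH] rA' rA) ?s = ret ?s1"
  using A by (subst sem_mv[where xs = "rcat A" and ys = "[]"]) (auto simp: counted_def parsed_def)
 have 2: "sem (mv [rK, rH] rB' rB) ?s1 = ret ?s2"
  using A B by (subst sem_mv[where xs = "rcat B" and ys = "[]"]) (auto simp: counted_def parsed_def)
 have 3: "sem (mv [rH] rZ' rZ) ?s2 = ret ?s3"
  using A B assms by (subst sem_mv[where xs = "rev z" and ys = "[]"]) (auto simp: counted_def parsed_def)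
 have "sem orient ?s = ret ?s3"
  by (simp only: orient_def sem_seq 1 2 3 bind_ret)
 moreover have "std n k l A (concat B) z ?s3" "?s3 ry = []" "ALL i>=1000. ?s3 i = []"
  using A B by (auto simp: std_def counted_def parsed_def fun_upd_apply)
 ultimately show ?thesis by blast
qed

definition mix::"nat => bits list => bits list => bits list" where
 "mix n A us = map (addcols (zeros (2*n)) A) us"

text \<open>Only \<open>y\<close> is wanted from this call. Hence \<open>A\<close> may be replaced
  by random vectors of its span, not always a basis, and \<open>Ar\<close> may be shifted by a
  random vector of that span.\<close>

definition in2::"nat => nat => bits list => bits list => bits => bits pmf" where
 "in2 n l A B z = do { us <- vecs n n; x <- unif n; f <- nzv l n; ms <- vecs n n; ms' <- vecs n n;
   ret (enc_mat (map (shuf n ms ms') (mix n A us)) @ enc_mat (map (shuf n ms ms') B) @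
   enc_bits (shuf n ms ms' (vadd f (addcols z A x)))) }"

abbreviation emit2::prog where "emit2 == ebits rH rV 1001 ;; emat rK rH rV 1001 ;; emat rN rH rV 1001"

abbreviation shem2::prog where "shem2 == mv [rH] racc rV ;; shuffle rQ2 ;; emit2"

definition stage2::prog where
 "stage2 = Rep rN mixcol ;; cpy [rK, rH] rB rB' rM ;; mv [rK, rH] rM rV ;; cpy [rH] rZ rZ' racc ;;
   cpy [rN, rH] rA rA' rM ;; fls rN rv ;; mvc rN rH rM rv racc rt ;; noiser ;; shem2"

lemma length_nzv: "f : set_pmf (nzv l n) ==> length f = 2*n"
 by (auto simp: nzv_def dest: set_nzl)

lemma length_shuf: "ms : set_pmf (vecs n n) ==> ms' : set_pmf (vecs n n) ==> length c = 2*n ==> length (shuf n ms ms' c) = 2*n"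
 unfolding shuf_def using set_vecs[of ms n n] set_vecs[of ms' n n]
 by (intro length_fold_rifc length_fold_rotc) auto

lemma sem_encode2:
 assumes "length (s rN) = n" "length (s rK) = k" "length (s rH) = 2*n" "s rV = rcat (A @ B @ [z])"
  "is_mat (2*n) n A" "is_mat (2*n) k B" "length z = 2*n"
 shows "sem (emit2) s =
  ret (s(rV := [], 1001 := enc_mat A @ enc_mat B @ enc_bits z @ s 1001))"
proof -
 let ?s1 = "s(rV := rcat (A @ B), 1001 := enc_bits z @ s 1001)"
 let ?s2 = "s(rV := rcat A, 1001 := enc_mat B @ enc_bits z @ s 1001)"
 have 1: "sem (ebits rH rV 1001) s = ret ?s1"
  by (rule sem_ebits) (use assms in auto)
 have "sem (emat rK rH rV 1001) ?s1 = ret (?s1(rV := rcat A, 1001 := enc_mat B @ ?s1 1001))"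
  by (rule sem_emat) (use assms in "auto simp: is_mat_def")
 hence 2: "sem (emat rK rH rV 1001) ?s1 = ret ?s2" by (simp add: fun_upd_twist)
 have "sem (emat rN rH rV 1001) ?s2 = ret (?s2(rV := [], 1001 := enc_mat A @ ?s2 1001))"
  by (rule sem_emat) (use assms in "auto simp: is_mat_def")
 hence 3: "sem (emat rN rH rV 1001) ?s2 = ret (s(rV := [], 1001 := enc_mat A @ enc_mat B @ enc_bits z @ s 1001))"
  by (simp add: fun_upd_twist)
 show ?thesis by (simp only: sem_seq 1 2 3 bind_ret)
qed

lemma sem_stage2:
 assumes st: "std n k l A (concat B) z s" and mats: "is_mat (2*n) n A" "is_mat (2*n) k B" "length z = 2*n"
  and s1: "s 1001 = []"
 shows "sem stage2 s = map_pmf (%i. s(1001 := i)) (in2 n l A B z)"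
proof -
 have c: "length (s rN) = n" "length (s rK) = k" "length (s rH) = 2*n" "length (s rQ2) = Suc (n + k)" "length (s rL) = l"
  "s rA = concat A" "s rB = concat B" "s rZ = z" "s rW = []" "s rV = []" "s racc = []" "s rv = []" "s rfa = []" "s rfb = []" "s rM = []"
  using st by (auto simp: std_def)
 have A: "length A = n" "colen (2*n) A" "length (concat A) = n*(2*n)"
  and B: "length B = k" "colen (2*n) B" "length (concat B) = k*(2*n)"
  using mats length_rect[of A "2*n"] length_rect[of B "2*n"] by (auto simp: is_mat_def)
 let ?m = "%us. mix n A us"
 have 1: "sem (Rep rN mixcol) s = map_pmf (%us. s(rV := rcat (?m us))) (vecs n n)"
  using sem_mix[of s n A] c mats by (simp add: mix_def)
 have main: "sem (cpy [rK, rH] rB rB' rM ;; mv [rK, rH] rM rV ;; cpy [rH] rZ rZ' racc ;;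
   cpy [rN, rH] rA rA' rM ;; fls rN rv ;; mvc rN rH rM rv racc rt ;; noiser ;; shem2) (s(rV := rcat (?m us))) =
   do { x <- unif n; f <- nzv l n; ms <- vecs n n; ms' <- vecs n n;
   ret (s(1001 := enc_mat (map (shuf n ms ms') (?m us)) @ enc_mat (map (shuf n ms ms') B) @
   enc_bits (shuf n ms ms' (vadd f (addcols z A x))))) }" if us: "us : set_pmf (vecs n n)" for us
 proof -
  let ?A = "?m us"
  have A': "length ?A = n" "ALL c:set ?A. length c = 2*n"
   using set_vecs[OF us] A length_addcols[of A "2*n" "zeros (2*n)"] by (auto simp: mix_def)
  let ?t0 = "s(rV := rcat ?A)"
  let ?t1 = "?t0(rM := concat B)"
  let ?t2 = "s(rV := rcat (?A @ B))"
  let ?t3 = "?t2(racc := z)"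
  let ?t4 = "?t3(rM := concat A)"
  have 2: "sem (cpy [rK, rH] rB rB' rM) ?t0 = ret ?t1"
   using sem_cpy[of rB' rB rM ?t0 "concat B" "[]" "[rK, rH]"] c B by simp
  have "sem (mv [rK, rH] rM rV) ?t1 = ret (?t1(rM := [], rV := rcat B @ ?t1 rV))"
   by (rule sem_mv) (use c B in auto)
  moreover have "?t1(rM := [], rV := rcat B @ ?t1 rV) = ?t2" using c by (simp add: upd_eq)
  ultimately have 3: "sem (mv [rK, rH] rM rV) ?t1 = ret ?t2" by simp
  have 4: "sem (cpy [rH] rZ rZ' racc) ?t2 = ret ?t3"
   using sem_cpy[of rZ' rZ racc ?t2 z "[]" "[rH]"] c mats by simp
  have 5: "sem (cpy [rN, rH] rA rA' rM) ?t3 = ret ?t4"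
   using sem_cpy[of rA' rA rM ?t3 "concat A" "[]" "[rN, rH]"] c A by simp
  have 6: "sem (fls rN rv) ?t4 = map_pmf (%v. ?t4(rv := v)) (unif n)"
   using c by (simp add: sem_fls)
  have 7: "sem (mvc rN rH rM rv racc rt) (?t4(rv := x)) = ret (?t2(racc := addcols z A x))" if x: "length x = n" for x
  proof -
   have "sem (mvc rN rH rM rv racc rt) (?t4(rv := x)) = ret ((?t4(rv := x))(rM := [], rv := [], racc := addcols z A x @ []))"
   by (rule sem_mvc) (use c A x mats in auto)
   moreover have "(?t4(rv := x))(rM := [], rv := [], racc := addcols z A x @ []) = ?t2(racc := addcols z A x)"
   using c by (simp add: upd_eq)
   ultimately show ?thesis by simp
  qed
  have 8: "sem noiser (?t2(racc := a)) = map_pmf (%f. ?t2(racc := vadd f a)) (nzv l n)" if "length a = 2*n" for a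
   using sem_noiser[of "?t2(racc := a)" n a "[]"] c that by simp
  have 9: "sem (shem2) (?t2(racc := a)) =
   do { ms <- vecs n n; ms' <- vecs n n; ret (s(1001 := enc_mat (map (shuf n ms ms') ?A) @ enc_mat (map (shuf n ms ms') B) @ enc_bits (shuf n ms ms' a))) }"
   if a: "length a = 2*n" for a
  proof -
   let ?u = "s(rV := rcat (?A @ B @ [a]))"
   have "sem (mv [rH] racc rV) (?t2(racc := a)) = ret ((?t2(racc := a))(racc := [], rV := rev a @ (?t2(racc := a)) rV))"
   by (rule sem_mv) (use c a in auto)
   moreover have "(?t2(racc := a))(racc := [], rV := rev a @ (?t2(racc := a)) rV) = ?u" using c by (simp add: upd_eq)
   ultimately have i: "sem (mv [rH] racc rV) (?t2(racc := a)) = ret ?u" by simp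
   have "sem (shuffle rQ2) ?u = do { ms <- vecs n n; ms' <- vecs n n; ret (?u(rV := rcat (map (shuf n ms ms') (?A @ B @ [a])))) }"
   by (rule sem_shuffle) (use c A' B a in auto)
   hence ii: "sem (shuffle rQ2) ?u = do { ms <- vecs n n; ms' <- vecs n n; ret (s(rV := rcat (map (shuf n ms ms') ?A @ map (shuf n ms ms') B @ [shuf n ms ms' a]))) }"
   by simp
   have iii: "sem (emit2)
   (s(rV := rcat (map (shuf n ms ms') ?A @ map (shuf n ms ms') B @ [shuf n ms ms' a]))) =
   ret (s(1001 := enc_mat (map (shuf n ms ms') ?A) @ enc_mat (map (shuf n ms ms') B) @ enc_bits (shuf n ms ms' a)))"
   if "ms : set_pmf (vecs n n)" "ms' : set_pmf (vecs n n)" for ms ms'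
   proof -
   let ?v = "s(rV := rcat (map (shuf n ms ms') ?A @ map (shuf n ms ms') B @ [shuf n ms ms' a]))"
   have "sem (emit2) ?v = ret (?v(rV := [],
   1001 := enc_mat (map (shuf n ms ms') ?A) @ enc_mat (map (shuf n ms ms') B) @ enc_bits (shuf n ms ms' a) @ ?v 1001))"
   by (rule sem_encode2) (use c A' B a length_shuf[OF that] in "auto simp: is_mat_def")
   moreover have "?v(rV := [], 1001 := enc_mat (map (shuf n ms ms') ?A) @ enc_mat (map (shuf n ms ms') B) @ enc_bits (shuf n ms ms' a) @ ?v 1001) =
   s(1001 := enc_mat (map (shuf n ms ms') ?A) @ enc_mat (map (shuf n ms ms') B) @ enc_bits (shuf n ms ms' a))"
   using c s1 by (simp add: upd_eq)
   ultimately show ?thesis by simp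
   qed
   show ?thesis
   by (simp only: sem_seq[of "mv _ _ _"] sem_seq[of "shuffle _"] i ii bind_pmfs)
   (intro bind_pmf_cong refl iii)
  qed
  have ax: "length (addcols z A x) = 2*n" for x using length_addcols[of A "2*n" z x] A mats by simp
  have "sem (cpy [rK, rH] rB rB' rM ;; mv [rK, rH] rM rV ;; cpy [rH] rZ rZ' racc ;;
   cpy [rN, rH] rA rA' rM ;; fls rN rv ;; mvc rN rH rM rv racc rt ;; noiser ;; shem2) ?t0 =
   bind_pmf (unif n) (%x. bind_pmf (sem (mvc rN rH rM rv racc rt) (?t4(rv := x))) (%t. bind_pmf (sem noiser t)
   (sem (shem2))))"
   by (simp only: sem_seq[of "cpy _ _ _ _"] sem_seq[of "mv _ _ _"] sem_seq[of "fls _ _"] sem_seq[of "mvc _ _ _ _ _ _"]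
   sem_Seq[of noiser] 2 3 4 5 6 bind_ret bind_map_pmf)
  also have "... = do { x <- unif n; f <- nzv l n; ms <- vecs n n; ms' <- vecs n n;
   ret (s(1001 := enc_mat (map (shuf n ms ms') (?m us)) @ enc_mat (map (shuf n ms ms') B) @
   enc_bits (shuf n ms ms' (vadd f (addcols z A x))))) }"
  proof (intro bind_pmf_cong refl)
   fix x assume "x : set_pmf (unif n)"
   hence x: "length x = n" by (simp add: set_uniform_vec)
   have "bind_pmf (sem (mvc rN rH rM rv racc rt) (?t4(rv := x))) (%t. bind_pmf (sem noiser t)
   (sem (shem2))) =
   bind_pmf (nzv l n) (%f. sem (shem2) (?t2(racc := vadd f (addcols z A x))))"
   by (simp only: 7[OF x] 8[OF ax] bind_ret bind_map_pmf)
   also have "... = do { f <- nzv l n; ms <- vecs n n; ms' <- vecs n n;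
   ret (s(1001 := enc_mat (map (shuf n ms ms') (?m us)) @ enc_mat (map (shuf n ms ms') B) @
   enc_bits (shuf n ms ms' (vadd f (addcols z A x))))) }"
   using ax by (intro bind_pmf_cong refl 9) (simp add: length_nzv)
   finally show "bind_pmf (sem (mvc rN rH rM rv racc rt) (?t4(rv := x))) (%t. bind_pmf (sem noiser t)
   (sem (shem2))) = ..." .
  qed
  finally show ?thesis .
 qed
 have "sem stage2 s = bind_pmf (vecs n n) (%us. sem (cpy [rK, rH] rB rB' rM ;; mv [rK, rH] rM rV ;; cpy [rH] rZ rZ' racc ;;
   cpy [rN, rH] rA rA' rM ;; fls rN rv ;; mvc rN rH rM rv racc rt ;; noiser ;; shem2) (s(rV := rcat (?m us))))"
  by (simp only: stage2_def sem_seq[of "Rep _ _"] 1 bind_map_pmf)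
 also have "... = do { us <- vecs n n; x <- unif n; f <- nzv l n; ms <- vecs n n; ms' <- vecs n n;
   ret (s(1001 := enc_mat (map (shuf n ms ms') (?m us)) @ enc_mat (map (shuf n ms ms') B) @
   enc_bits (shuf n ms ms' (vadd f (addcols z A x))))) }"
  by (intro bind_pmf_cong refl main)
 finally show ?thesis by (simp add: in2_def map_bind_pmf)
qed

text \<open>Half of the time the answer is replaced by zero. These coins produce the trivial
  preimage r = 0, y = 0, which wins when the domain contains every error.\<close>

definition guess::"nat => bits => bits pmf" where
 "guess k out = map_pmf (%c. if c then decode k out else zeros k) coin"

text \<open>Site maps and transvections act linearly on the columns and so keep the coordinates
  \<open>r\<close> that the solver has to find.\<close>

definition in1::"nat => nat => bits list => bits => bits pmf" where
 "in1 n l A z = do { f <- nzv l n; ms <- vecs n n; ms' <- vecs n n;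
   (A', z') <- tvr n l (map (shuf n ms ms') A, shuf n ms ms' (vadd f z)); ret (enc_mat A' @ enc_bits z') }"

definition guessp::"nat => nat => nat => nat => prog" where
 "guessp k q y' y = Flip rc ;; Case rc (dec k q y') (zero k y') ;; mv [k] y' y"

lemma sem_guess:
 assumes "distinct [k, q, y', y, rc]" "s y' = []"
 shows "EX X. sem (guessp k q y' y) s =
  map_pmf (%c. s(q := X c, y := (if c then decode (length (s k)) (s q) else zeros (length (s k))) @ s y)) coin"
proof -
 obtain zs where zs: "sem (dec k q y') s = ret (s(q := zs, y' := rev (decode (length (s k)) (s q)) @ s y'))"
  using sem_dec[of k q y' s] assms by auto
 let ?X = "%c. if c then zs else s q"
 have dist: "y' ~= y" "k ~= y'" "k ~= y" "k ~= q" "q ~= y'" "q ~= y" "y' ~= k" "y ~= k" "y' ~= q" "y ~= q" "y ~= y'" using assms by auto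
 have c: "sem (Case rc (dec k q y') (zero k y') ;; mv [k] y' y) (s(rc := c # s rc)) =
   ret (s(q := ?X c, y := (if c then decode (length (s k)) (s q) else zeros (length (s k))) @ s y))" for c
 proof -
  let ?y = "if c then decode (length (s k)) (s q) else zeros (length (s k))"
  let ?s1 = "s(q := ?X c, y' := rev ?y)"
  have "sem (Case rc (dec k q y') (zero k y')) (s(rc := c # s rc)) = ret ?s1"
   using zs assms dist by (cases c) (auto simp: sem_zero zeros_def)
  moreover have "sem (mv [k] y' y) ?s1 = ret (?s1(y' := [], y := rev (rev ?y) @ ?s1 y))"
   by (rule sem_mv) (use dist in auto)
  moreover have "?s1(y' := [], y := rev (rev ?y) @ ?s1 y) = s(q := ?X c, y := ?y @ s y)"
   using assms dist by (auto simp: upd_eq)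
  ultimately show ?thesis by (simp only: sem_seq bind_ret)
 qed
 have "sem (Flip rc ;; Case rc (dec k q y') (zero k y') ;; mv [k] y' y) s = bind_pmf coin (%c.
   sem (Case rc (dec k q y') (zero k y') ;; mv [k] y' y) (s(rc := c # s rc)))"
  by (simp only: sem.simps(3) sem_seq[of "Flip rc"] bind_map_pmf)
 thus ?thesis unfolding c guessp_def by (intro exI[of _ ?X]) (simp add: map_pmf_def)
qed

definition stage3::prog where
 "stage3 = guessp rK 1001 ry' ry ;; cpy [rK] ry ry' rv ;;
   mvc rK rH rB rv rZ rt ;; cpy [rN, rH] rA rA' rM ;; mv [rN, rH] rM rV ;; cpy [rH] rZ rZ' racc ;; noiser ;;
   mv [rH] racc rV ;; shuffle rQ1 ;; Rep rL tvround ;; ebits rH rV 1003 ;; emat rN rH rV 1003"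

lemma sem_encode1:
 assumes "length (s rN) = n" "length (s rH) = 2*n" "s rV = rcat (A @ [z])"
  "is_mat (2*n) n A" "length z = 2*n"
 shows "sem (ebits rH rV 1003 ;; emat rN rH rV 1003) s =
  ret (s(rV := [], 1003 := enc_mat A @ enc_bits z @ s 1003))"
proof -
 let ?s1 = "s(rV := rcat A, 1003 := enc_bits z @ s 1003)"
 have 1: "sem (ebits rH rV 1003) s = ret ?s1"
  by (rule sem_ebits) (use assms in auto)
 have "sem (emat rN rH rV 1003) ?s1 = ret (?s1(rV := [], 1003 := enc_mat A @ ?s1 1003))"
  by (rule sem_emat) (use assms in "auto simp: is_mat_def")
 hence 2: "sem (emat rN rH rV 1003) ?s1 = ret (s(rV := [], 1003 := enc_mat A @ enc_bits z @ s 1003))"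
  by (simp add: fun_upd_twist)
 show ?thesis by (simp only: sem_seq 1 2 bind_ret)
qed

lemma set_tvr:
 "(A', z') : set_pmf (tvr n l (A, z)) ==> is_mat (2*n) m A ==> length z = 2*n ==> is_mat (2*n) m A' & length z' = 2*n"
proof (induction l arbitrary: A z)
 case (Suc l)
 then obtain u g where u: "u : set_pmf (luz n)" and in': "(A', z') : set_pmf (tvr n l (map (tvf n u) A, if g then vadd u z else z))"
  by (auto cong: if_cong)
 show ?case by (rule Suc.IH[OF in']) (use set_luz[OF u] Suc.prems in "auto simp: is_mat_def")
qed auto

lemma sem_stage3:
 assumes st: "std n k l A (concat B) z s" and mats: "is_mat (2*n) n A" "is_mat (2*n) k B" "length z = 2*n"
  and s1: "s 1003 = []" "s ry = []"
 shows "EX X. sem stage3 s = do { c <- coin; let y = (if c then decode k (s 1001) else zeros k); i <- in1 n l A (addcols z B y);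
  ret (s(1001 := X c, ry := y, rB := [], rZ := addcols z B y, 1003 := i)) }"
proof -
 have c: "length (s rN) = n" "length (s rK) = k" "length (s rH) = 2*n" "length (s rQ1) = Suc n" "length (s rL) = l"
  "s rA = concat A" "s rB = concat B" "s rZ = z" "s rW = []" "s rV = []" "s racc = []" "s rv = []" "s rfa = []" "s rfb = []" "s rM = []"
  "s rp = []" "s rq = []" "s rU = []" "s rJ = []" "s ry' = []"
  using st by (auto simp: std_def)
 have A: "length A = n" "colen (2*n) A" "length (concat A) = n*(2*n)"
  and B: "length B = k" "colen (2*n) B" "length (concat B) = k*(2*n)"
  using mats length_rect[of A "2*n"] length_rect[of B "2*n"] by (auto simp: is_mat_def)
 obtain X where X: "sem (guessp rK 1001 ry' ry) s =
  map_pmf (%c. s(1001 := X c, ry := (if c then decode k (s 1001) else zeros k) @ s ry)) coin"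
  using sem_guess[of rK 1001 ry' ry s] c by auto
 let ?rest = "cpy [rK] ry ry' rv ;;
   mvc rK rH rB rv rZ rt ;; cpy [rN, rH] rA rA' rM ;; mv [rN, rH] rM rV ;; cpy [rH] rZ rZ' racc ;; noiser ;;
   mv [rH] racc rV ;; shuffle rQ1 ;; Rep rL tvround ;; ebits rH rV 1003 ;; emat rN rH rV 1003"
 have main: "sem ?rest (s(1001 := x, ry := y @ s ry)) = map_pmf (%i. s(1001 := x, ry := y, rB := [], rZ := addcols z B y, 1003 := i)) (in1 n l A (addcols z B y))"
  if y: "length y = k" for x y
 proof -
  let ?z = "addcols z B y"
  have lz: "length ?z = 2*n" using length_addcols[of B "2*n" z y] B mats by simp
  let ?b = "s(1001 := x, ry := y)"
  let ?d = "s(1001 := x, ry := y, rB := [], rZ := ?z)"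
  have b0: "s(1001 := x, ry := y @ s ry) = ?b" using s1 by simp
  have 1: "sem (cpy [rK] ry ry' rv) ?b = ret (?b(rv := y))"
   using sem_cpy[of ry' ry rv ?b y "[]" "[rK]"] c y by simp
  have "sem (mvc rK rH rB rv rZ rt) (?b(rv := y)) = ret ((?b(rv := y))(rB := [], rv := [], rZ := ?z @ []))"
   by (rule sem_mvc) (use c B y mats in auto)
  moreover have "(?b(rv := y))(rB := [], rv := [], rZ := ?z @ []) = ?d" using c by (simp add: upd_eq)
  ultimately have 2: "sem (mvc rK rH rB rv rZ rt) (?b(rv := y)) = ret ?d" by simp
  have 3: "sem (cpy [rN, rH] rA rA' rM) ?d = ret (?d(rM := concat A))"
   using sem_cpy[of rA' rA rM ?d "concat A" "[]" "[rN, rH]"] c A by simp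
  let ?e = "?d(rV := rcat A)"
  have "sem (mv [rN, rH] rM rV) (?d(rM := concat A)) = ret ((?d(rM := concat A))(rM := [], rV := rcat A @ (?d(rM := concat A)) rV))"
   by (rule sem_mv) (use c A in auto)
  moreover have "(?d(rM := concat A))(rM := [], rV := rcat A @ (?d(rM := concat A)) rV) = ?e" using c by (simp add: upd_eq)
  ultimately have 4: "sem (mv [rN, rH] rM rV) (?d(rM := concat A)) = ret ?e" by simp
  have 5: "sem (cpy [rH] rZ rZ' racc) ?e = ret (?e(racc := ?z))"
   using sem_cpy[of rZ' rZ racc ?e ?z "[]" "[rH]"] c lz by simp
  have 6: "sem noiser (?e(racc := ?z)) = map_pmf (%f. ?e(racc := vadd f ?z)) (nzv l n)"
   using sem_noiser[of "?e(racc := ?z)" n ?z "[]"] c lz by simp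
  have 7: "sem (mv [rH] racc rV ;; shuffle rQ1 ;; Rep rL tvround ;; ebits rH rV 1003 ;; emat rN rH rV 1003) (?e(racc := a)) =
   do { ms <- vecs n n; ms' <- vecs n n; (A', z') <- tvr n l (map (shuf n ms ms') A, shuf n ms ms' a);
   ret (?d(1003 := enc_mat A' @ enc_bits z')) }" if a: "length a = 2*n" for a
  proof -
   let ?u = "?d(rV := rcat (A @ [a]))"
   have "sem (mv [rH] racc rV) (?e(racc := a)) = ret ((?e(racc := a))(racc := [], rV := rev a @ (?e(racc := a)) rV))"
   by (rule sem_mv) (use c a in auto)
   moreover have "(?e(racc := a))(racc := [], rV := rev a @ (?e(racc := a)) rV) = ?u" using c by (simp add: upd_eq)
   ultimately have i: "sem (mv [rH] racc rV) (?e(racc := a)) = ret ?u" by simp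
   have "sem (shuffle rQ1) ?u = do { ms <- vecs n n; ms' <- vecs n n; ret (?u(rV := rcat (map (shuf n ms ms') (A @ [a])))) }"
   by (rule sem_shuffle) (use c A a in auto)
   hence ii: "sem (shuffle rQ1) ?u = do { ms <- vecs n n; ms' <- vecs n n; ret (?d(rV := rcat (map (shuf n ms ms') A @ [shuf n ms ms' a]))) }"
   by simp
   have iii: "sem (Rep rL tvround ;; ebits rH rV 1003 ;; emat rN rH rV 1003) (?d(rV := rcat (map (shuf n ms ms') A @ [shuf n ms ms' a]))) =
   bind_pmf (tvr n l (map (shuf n ms ms') A, shuf n ms ms' a)) (%(A', z'). ret (?d(1003 := enc_mat A' @ enc_bits z')))"
   if "ms : set_pmf (vecs n n)" "ms' : set_pmf (vecs n n)" for ms ms'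
   proof -
   let ?A = "map (shuf n ms ms') A" and ?a = "shuf n ms ms' a"
   let ?v = "?d(rV := rcat (?A @ [?a]))"
   have l: "colen (2*n) (?A @ [?a])" using A a length_shuf[OF that] by auto
   have "sem (Rep rL tvround) ?v = map_pmf (%(cols, z). ?v(rV := rcat (cols @ [z]))) (tvr n (length (?v rL)) (?A, ?a))"
   by (rule sem_tvrounds) (use c A l in "auto simp: tvstate_def")
   hence t: "sem (Rep rL tvround) ?v = map_pmf (%(cols, z). ?d(rV := rcat (cols @ [z]))) (tvr n l (?A, ?a))"
   using c by simp
   have e: "sem (ebits rH rV 1003 ;; emat rN rH rV 1003) (?d(rV := rcat (A' @ [z']))) = ret (?d(1003 := enc_mat A' @ enc_bits z'))"
   if "(A', z') : set_pmf (tvr n l (?A, ?a))" for A' z'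
   proof -
   have m: "is_mat (2*n) n A' & length z' = 2*n"
   by (rule set_tvr[OF that]) (use l A in "auto simp: is_mat_def")
   let ?w = "?d(rV := rcat (A' @ [z']))"
   have "sem (ebits rH rV 1003 ;; emat rN rH rV 1003) ?w = ret (?w(rV := [], 1003 := enc_mat A' @ enc_bits z' @ ?w 1003))"
   using sem_encode1[of ?w n A' z'] c(1,3) m by simp
   moreover have "?w(rV := [], 1003 := enc_mat A' @ enc_bits z' @ ?w 1003) = ?d(1003 := enc_mat A' @ enc_bits z')"
   using c(10) s1(1) by (simp add: upd_eq)
   ultimately show ?thesis by simp
   qed
   show ?thesis
   by (simp only: sem_seq[of "Rep _ _"] t bind_map_pmf case_prod_beta')
   (intro bind_pmf_cong refl e, simp)
   qed
   show ?thesis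
   by (simp only: sem_seq[of "mv _ _ _"] sem_seq[of "shuffle _"] i ii bind_pmfs)
   (intro bind_pmf_cong refl iii)
  qed
  have "sem ?rest ?b = bind_pmf (nzv l n) (%f. sem (mv [rH] racc rV ;; shuffle rQ1 ;; Rep rL tvround ;; ebits rH rV 1003 ;; emat rN rH rV 1003) (?e(racc := vadd f ?z)))"
   by (simp only: sem_seq[of "cpy _ _ _ _"] sem_seq[of "mvc _ _ _ _ _ _"] sem_seq[of "mv [rN, rH] _ _"] sem_seq[of noiser]
   1 2 3 4 5 6 bind_ret bind_map_pmf)
  also have "... = bind_pmf (nzv l n) (%f. do { ms <- vecs n n; ms' <- vecs n n;
   (A', z') <- tvr n l (map (shuf n ms ms') A, shuf n ms ms' (vadd f ?z)); ret (?d(1003 := enc_mat A' @ enc_bits z')) })"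
   using lz by (intro bind_pmf_cong refl 7) (simp add: length_nzv)
  finally show ?thesis unfolding b0
   by (simp add: in1_def map_bind_pmf case_prod_beta')
 qed
 have "sem stage3 s = bind_pmf coin (%c. sem ?rest (s(1001 := X c, ry := (if c then decode k (s 1001) else zeros k) @ s ry)))"
  by (simp only: stage3_def sem_seq[of "guessp _ _ _ _"] X bind_map_pmf)
 also have "... = do { c <- coin; let y = (if c then decode k (s 1001) else zeros k); i <- in1 n l A (addcols z B y);
  ret (s(1001 := X c, ry := y, rB := [], rZ := addcols z B y, 1003 := i)) }"
  unfolding Let_def by (intro bind_pmf_cong refl) (subst main, auto simp: map_pmf_def)
 finally show ?thesis by blast
qed

definition stage4::prog where
 "stage4 = guessp rN 1003 rr' rr ;; cpy [rN] rr rr' rv ;; mvc rN rH rA rv rZ rt ;;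
   mv [rH] rZ rZ' ;; ebits rH rZ' 0 ;; mv [rK] ry ry' ;; ebits rK ry' 0 ;; mv [rN] rr rr' ;; ebits rN rr' 0"

lemma sem_stage4:
 assumes st: "std n k l A b z s" and mats: "is_mat (2*n) n A" "length z = 2*n"
  and y: "s ry = y" "length y = k"
 shows "map_pmf (%s. s 0) (sem stage4 s) = map_pmf (%r. enc_bits r @ enc_bits y @ enc_bits (addcols z A r)) (guess n (s 1003))"
proof -
 have c: "length (s rN) = n" "length (s rK) = k" "length (s rH) = 2*n"
  "s rA = concat A" "s rZ = z" "s rv = []" "s ry' = []" "s rr = []" "s rr' = []" "s 0 = []" "s rZ' = []"
  using st by (auto simp: std_def)
 have A: "length A = n" "colen (2*n) A" "length (concat A) = n*(2*n)"
  using mats length_rect[of A "2*n"] by (auto simp: is_mat_def)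
 obtain X where X: "sem (guessp rN 1003 rr' rr) s =
  map_pmf (%c. s(1003 := X c, rr := (if c then decode n (s 1003) else zeros n) @ s rr)) coin"
  using sem_guess[of rN 1003 rr' rr s] c by auto
 let ?rest = "cpy [rN] rr rr' rv ;; mvc rN rH rA rv rZ rt ;;
   mv [rH] rZ rZ' ;; ebits rH rZ' 0 ;; mv [rK] ry ry' ;; ebits rK ry' 0 ;; mv [rN] rr rr' ;; ebits rN rr' 0"
 have main: "map_pmf (%s. s 0) (sem ?rest (s(1003 := x, rr := r @ s rr))) = ret (enc_bits r @ enc_bits y @ enc_bits (addcols z A r))"
  if r: "length r = n" for x r
 proof -
  let ?z = "addcols z A r"
  have lz: "length ?z = 2*n" using length_addcols[of A "2*n" z r] A mats by simp
  let ?b = "s(1003 := x, rr := r)"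
  let ?d = "s(1003 := x, rr := r, rA := [], rZ := ?z)"
  let ?e = "?d(rZ := [], rZ' := rev ?z)"
  let ?f = "?d(rZ := [], rZ' := [], 0 := enc_bits ?z)"
  let ?g = "?f(ry := [], ry' := rev y)"
  let ?h = "?f(ry := [], ry' := [], 0 := enc_bits y @ enc_bits ?z)"
  let ?i = "?h(rr := [], rr' := rev r)"
  let ?j = "?h(rr := [], rr' := [], 0 := enc_bits r @ enc_bits y @ enc_bits ?z)"
  have b0: "s(1003 := x, rr := r @ s rr) = ?b" using c by simp
  have 1: "sem (cpy [rN] rr rr' rv) ?b = ret (?b(rv := r))"
   using sem_cpy[of rr' rr rv ?b r "[]" "[rN]"] c r by simp
  have "sem (mvc rN rH rA rv rZ rt) (?b(rv := r)) = ret ((?b(rv := r))(rA := [], rv := [], rZ := ?z @ []))"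
   by (rule sem_mvc) (use c A r mats in auto)
  moreover have "(?b(rv := r))(rA := [], rv := [], rZ := ?z @ []) = ?d" using c by (simp add: upd_eq)
  ultimately have 2: "sem (mvc rN rH rA rv rZ rt) (?b(rv := r)) = ret ?d" by simp
  have 3: "sem (mv [rH] rZ rZ') ?d = ret ?e"
   using sem_mv[of rZ rZ' ?d ?z "[]" "[rH]"] c lz by simp
  have "sem (ebits rH rZ' 0) ?e = ret (?e(rZ' := [], 0 := enc_bits ?z @ ?e 0))"
   by (rule sem_ebits) (use c lz in auto)
  hence 4: "sem (ebits rH rZ' 0) ?e = ret ?f" using c by simp
  have 5: "sem (mv [rK] ry ry') ?f = ret ?g"
   using sem_mv[of ry ry' ?f y "[]" "[rK]"] c y by simp
  have "sem (ebits rK ry' 0) ?g = ret (?g(ry' := [], 0 := enc_bits y @ ?g 0))"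
   by (rule sem_ebits) (use c y in auto)
  moreover have "?g(ry' := [], 0 := enc_bits y @ ?g 0) = ?h" by (simp add: upd_eq)
  ultimately have 6: "sem (ebits rK ry' 0) ?g = ret ?h" by simp
  have 7: "sem (mv [rN] rr rr') ?h = ret ?i"
   using sem_mv[of rr rr' ?h r "[]" "[rN]"] c r by simp
  have "sem (ebits rN rr' 0) ?i = ret (?i(rr' := [], 0 := enc_bits r @ ?i 0))"
   by (rule sem_ebits) (use c r in auto)
  moreover have "?i(rr' := [], 0 := enc_bits r @ ?i 0) = ?j" by (simp add: upd_eq)
  ultimately have 8: "sem (ebits rN rr' 0) ?i = ret ?j" by simp
  have "sem ?rest ?b = ret ?j"
   by (simp only: sem_seq 1 2 3 4 5 6 7 8 bind_ret)
  thus ?thesis unfolding b0 by simp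
 qed
 have "sem stage4 s = bind_pmf coin (%c. sem ?rest (s(1003 := X c, rr := (if c then decode n (s 1003) else zeros n) @ s rr)))"
  by (simp only: stage4_def sem_seq[of "guessp _ _ _ _"] X bind_map_pmf)
 hence "map_pmf (%s. s 0) (sem stage4 s) = bind_pmf coin (%c.
   map_pmf (%s. s 0) (sem ?rest (s(1003 := X c, rr := (if c then decode n (s 1003) else zeros n) @ s rr))))"
  by (simp only: map_bind_pmf)
 also have "... = bind_pmf coin (%c. ret (enc_bits (if c then decode n (s 1003) else zeros n) @ enc_bits y @
   enc_bits (addcols z A (if c then decode n (s 1003) else zeros n))))"
  by (intro bind_pmf_cong refl main) simp
 finally show ?thesis by (simp add: guess_def map_pmf_def bind_pmfs)
qed

subsection \<open>The inverter\<close>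

definition alg::"instr list => instr list => block" where
 "alg B1 B2 = blk parser \<then> blk counters \<then> blk (orient ;; stage2) \<then> sub 1001 B2 \<then> blk stage3 \<then> sub 1003 B1 \<then> blk stage4"

text \<open>The error is recomputed from the original \<open>z\<close>, \<open>A\<close> and
  \<open>B\<close>, not from the randomised instances; so any correct pair r, y yields the original
  error. The same \<open>l\<close> enters both calls.\<close>

definition algd::"(bits => bits pmf) => (bits => bits pmf) => nat => nat => bits list => bits list => bits => bits pmf" where
 "algd O1 O2 n k A B z = do { l <- geol True n; i2 <- in2 n l A B z; o2 <- O2 i2; y <- guess k o2;
   i1 <- in1 n l A (addcols z B y); o1 <- O1 i1; r <- guess n o1;
   ret (enc_bits r @ enc_bits y @ enc_bits (addcols (addcols z B y) A r)) }"

definition outputs::"block => (nat => bits) => nat => bits pmf => bool" where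
 "outputs Q R T X \<longleftrightarrow> (EX D. doesb Q R T D & map_pmf (%R. R 0) D = X)"

lemma outputs_bseq:
 assumes "wfb Q1" "doesb Q1 R T1 D" "!!R'. R' : set_pmf D ==> outputs Q2 R' T2 (X R')"
 shows "outputs (Q1 \<then> Q2) R (T1 + T2) (bind_pmf D X)"
proof -
 obtain f where f: "!!R'. R' : set_pmf D ==> doesb Q2 R' T2 (f R') & map_pmf (%R. R 0) (f R') = X R'"
  using assms(3) unfolding outputs_def by metis
 have "doesb (Q1 \<then> Q2) R (T1 + T2) (bind_pmf D f)" using assms f by (intro doesb_bseq) auto
 moreover have "map_pmf (%R. R 0) (bind_pmf D f) = bind_pmf D X"
  unfolding map_bind_pmf using f by (intro bind_pmf_cong refl) auto
 ultimately show ?thesis unfolding outputs_def by blast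
qed

lemma set_geol: "l : set_pmf (geol fl n) ==> l <= n"
 by (induction n arbitrary: l fl) (auto split: if_splits, fastforce+)

lemmas prog_defs = parser_def parse_def parsestep_def counters_def geor_def orient_def stage2_def stage3_def stage4_def
 mixcol_def cpy_def mv_def mvc_def fls_def zero_def xors_def dr_def noiser_def nzstep_def ones_def shuffle_def round_def rotcol_def
 rotbody_def rifhalf_def pass1_def pass2_def ebits_def emat_def guessp_def dec_def tvround_def drawu_def buildu_def tvcol_def
 dotbody_def addu_def addbody_def

lemma visible_progs: "visible parser" "visible counters" "visible (orient ;; stage2)" "visible stage3" "visible stage4"
 by (simp_all add: visible_def prog_defs)

lemma loops_progs:
 "loops parser = {0}" "loops counters = {rN, rK}" "loops (orient ;; stage2) = {rN, rK, rH, rL, rQ2}"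
 "loops stage3 = {rN, rK, rH, rL, rQ1}" "loops stage4 = {rN, rK, rH}"
 by (auto simp: prog_defs)

lemma loops_pushes:
 "loops parser \<inter> pushes parser = {}" "loops counters \<inter> pushes counters = {}"
 "loops (orient ;; stage2) \<inter> pushes (orient ;; stage2) = {}" "loops stage3 \<inter> pushes stage3 = {}"
 "loops stage4 \<inter> pushes stage4 = {}"
 unfolding loops_progs by (simp_all add: prog_defs)

lemma outputs_sub:
 assumes h: "!!tp. exec B t (init x tp) ~= None" and e: "!!r. r ~= 0 ==> R (b + 4*r) = []" "R b = x"
  and rest: "!!R'. (!!r. ~ (b <= r & 4 dvd (r - b)) ==> R' r = R r) ==> outputs Q R' T (X (R' b))"
 shows "outputs (sub b B \<then> Q) R (Suc t + T) (bind_pmf (outd B t x) X)"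
proof -
 obtain D where D: "doesb (sub b B) R (Suc t) D" "map_pmf (%R'. R' b) D = outd B t x"
  "ALL R':set_pmf D. ALL r. ~ (b <= r & 4 dvd (r - b)) --> R' r = R r"
  using doesb_sub[of B t x R b, OF h e] by blast
 have "outputs (sub b B \<then> Q) R (Suc t + T) (bind_pmf D (%R'. X (R' b)))"
  using D by (intro outputs_bseq rest) auto
 thus ?thesis by (simp only: D(2)[symmetric] bind_map_pmf)
qed

lemma hfree_upd: "hfree d s ==> r < 1000 | odd r ==> hfree d (s(r := x))"
proof -
 assume "hfree d s" "r < 1000 | odd r"
 moreover from this have "hid d' ~= r" "tmp d' ~= r" for d' by (auto simp: hid_def tmp_def)
 ultimately show ?thesis by (simp add: hfree_def fun_upd_apply)
qed

lemma hfree_cong: "hfree d s ==> (!!r. even r ==> s' r = s r) ==> hfree d s'"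
 by (simp add: hfree_def hid_def tmp_def)

text \<open>Behind the parser, which loops over the input, every loop counter is at most 2n + 1; the
  largest is \<open>rQ2\<close> = n + k + 1, and k <= n.\<close>

lemma alg_outputs:
 assumes mats: "is_mat (2*n) n A" "is_mat (2*n) k B" "length z = 2*n" and kn: "k <= n"
  and t2: "!!A B z tp. is_mat (2*n) n A ==> is_mat (2*n) k B ==> length z = 2*n ==>
   exec B2 t2 (init (enc_mat A @ enc_mat B @ enc_bits z) tp) ~= None"
  and t1: "!!A z tp. is_mat (2*n) n A ==> length z = 2*n ==> exec B1 t1 (init (enc_mat A @ enc_bits z) tp) ~= None"
 defines "x == enc_mat A @ enc_mat B @ enc_bits z" and "m == 2*n + 1"
 shows "outputs (alg B1 B2) (start x)
   (cost parser (length x) + (cost counters m + (cost (orient ;; stage2) m + (Suc t2 + (cost stage3 m + (Suc t1 + cost stage4 m))))))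
   (algd (outd B1 t1) (outd B2 t2) n k A B z)"
proof -
 have lA: "length A = n" and lB: "length B = k" using mats by (auto simp: is_mat_def)
 have hf0: "hfree 0 (start x)" by (simp add: hfree_def start_def hid_def tmp_def)
 let ?D1 = "%l y. do { i1 <- in1 n l A (addcols z B y); o1 <- outd B1 t1 i1; r <- guess n o1;
   ret (enc_bits r @ enc_bits y @ enc_bits (addcols (addcols z B y) A r)) }"
 let ?D2 = "%l o2. do { y <- guess k o2; ?D1 l y }"
 let ?D3 = "%l i2. do { o2 <- outd B2 t2 i2; ?D2 l o2 }"
 let ?Q3 = "blk stage3 \<then> sub 1003 B1 \<then> blk stage4" and ?c3 = "cost stage3 m + (Suc t1 + cost stage4 m)"
 let ?Q2 = "sub 1001 B2 \<then> ?Q3" and ?c2 = "Suc t2 + (?c3)"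
 let ?Q1 = "blk (orient ;; stage2) \<then> ?Q2" and ?c1 = "cost (orient ;; stage2) m + (?c2)"
 let ?c0 = "cost counters m + (?c1)"
 have p1: "doesb (blk parser) (start x) (cost parser (length x)) (ret (parsed A B z))"
  using doesb_blk[OF hf0 _ visible_progs(1) loops_pushes(1), of "length x"] sem_parser[of A B z]
  by (simp add: x_def loops_le_def loops_progs start_def)
 have hf1: "hfree 0 (parsed A B z)"
  unfolding parsed_def by (intro hfree_upd) (auto simp: hfree_def)
 have p2: "doesb (blk counters) (parsed A B z) (cost counters m) (map_pmf (counted A B z) (geol True n))"
  using doesb_blk[OF hf1 _ visible_progs(2) loops_pushes(2), of m] sem_setup[of A B z] kn
  by (simp add: lA lB m_def loops_le_def loops_progs) (simp add: parsed_def lA lB)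
 have s4: "outputs (blk stage4) s (cost stage4 m) (map_pmf (%r. enc_bits r @ enc_bits y @ enc_bits (addcols z' A r)) (guess n (s 1003)))"
  if "std n k l A b z' s" "length z' = 2*n" "s ry = y" "length y = k" "hfree 0 s" for l b z' s y
  unfolding outputs_def using that kn sem_stage4[OF that(1) mats(1) that(2-4)]
  by (intro exI[of _ "sem stage4 s"] conjI doesb_blk visible_progs loops_pushes)
   (auto simp: std_def loops_le_def loops_progs m_def)
 have s5: "outputs (sub 1003 B1 \<then> blk stage4) s (Suc t1 + cost stage4 m) (bind_pmf (outd B1 t1 (s 1003))
   (%q. map_pmf (%r. enc_bits r @ enc_bits y @ enc_bits (addcols z' A r)) (guess n q)))"
  if s: "std n k l A b z' s" "length z' = 2*n" "s ry = y" "length y = k" "hfree 0 s"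
   "!!r. r ~= 0 ==> s (1003 + 4*r) = []" and i: "s 1003 = enc_mat A' @ enc_bits z''" "is_mat (2*n) n A'" "length z'' = 2*n"
  for l b z' s y A' z''
 proof (rule outputs_sub)
  show "exec B1 t1 (init (s 1003) tp) ~= None" for tp using t1 i by simp
  fix R'::"nat => bits" assume R': "!!r. ~ (1003 <= r & 4 dvd r - 1003) ==> R' r = s r"
  have le: "R' r = s r" if "r < 1000" for r using R' that by simp
  have ev: "R' r = s r" if "even r" for r
  proof (rule R')
   show "~ (1003 <= r & 4 dvd r - 1003)"
   using that by presburger
  qed
  show "outputs (blk stage4) R' (cost stage4 m) (map_pmf (%r. enc_bits r @ enc_bits y @ enc_bits (addcols z' A r)) (guess n (R' 1003)))"
   using s le by (intro s4[of l b z' R' y]) (auto simp: std_def intro: hfree_cong ev)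
 qed (use that in auto)
 have s6: "outputs (?Q3) s (?c3)
   (do { y <- guess k (s 1001); ?D1 l y })"
  if s: "std n k l A (concat B) z s" "hfree 0 s" "!!r. s (1003 + 4*r) = []" "s ry = []" "l <= n" for l s
 proof -
  have s3: "s 1003 = []" using s(3)[of 0] by simp
  obtain X where X: "sem stage3 s = do { c <- coin; let y = (if c then decode k (s 1001) else zeros k); i <- in1 n l A (addcols z B y);
   ret (s(1001 := X c, ry := y, rB := [], rZ := addcols z B y, 1003 := i)) }"
   using sem_stage3[OF s(1) mats s3 s(4)] by blast
  define Y where "Y = (%s'. bind_pmf (outd B1 t1 (s' 1003)) (%q. map_pmf (%r. enc_bits r @ enc_bits (s' ry) @ enc_bits (addcols (s' rZ) A r)) (guess n q)))"
  have "outputs (?Q3) s (?c3) (bind_pmf (sem stage3 s) Y)"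
  proof (rule outputs_bseq)
   show "doesb (blk stage3) s (cost stage3 m) (sem stage3 s)"
   using s kn by (intro doesb_blk visible_progs loops_pushes) (auto simp: std_def loops_le_def loops_progs m_def)
  next
   fix s' assume "s' : set_pmf (sem stage3 s)"
   then obtain c i where s': "s' = s(1001 := X c, ry := (if c then decode k (s 1001) else zeros k), rB := [],
   rZ := addcols z B (if c then decode k (s 1001) else zeros k), 1003 := i)"
   and i: "i : set_pmf (in1 n l A (addcols z B (if c then decode k (s 1001) else zeros k)))"
   unfolding X Let_def by (simp only: set_bind_pmf set_return_pmf UN_iff singleton_iff) blast
   let ?y = "if c then decode k (s 1001) else zeros k"
   have lz: "length (addcols z B ?y) = 2*n" by (rule length_addcols) (use mats in "auto simp: is_mat_def")
   from i obtain f ms ms' A' z' where i': "i = enc_mat A' @ enc_bits z'" and f: "f : set_pmf (nzv l n)"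
   and ms: "ms : set_pmf (vecs n n)" "ms' : set_pmf (vecs n n)"
   and tv: "(A', z') : set_pmf (tvr n l (map (shuf n ms ms') A, shuf n ms ms' (vadd f (addcols z B ?y))))"
   by (auto simp: in1_def)
   have "is_mat (2*n) n A' & length z' = 2*n"
   by (rule set_tvr[OF tv]) (use mats length_shuf[OF ms] lz length_nzv[OF f] in "auto simp: is_mat_def")
   moreover have "hfree 0 s'" unfolding s' by (intro hfree_upd) (use s(2) in auto)
   moreover have "std n k l A [] (s' rZ) s'" using s(1) by (auto simp: s' std_def)
   moreover have "length (s' rZ) = 2*n" "length (s' ry) = k" "s' 1003 = enc_mat A' @ enc_bits z'"
   using lz by (simp_all add: s' i')
   moreover have "s' (1003 + 4*r) = []" if "r ~= 0" for r
   proof -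
   have "1003 + 4*r ~= 1001" "1003 + 4*r ~= 1003" using that by presburger+
   thus ?thesis using s(3)[of r] by (simp add: s')
   qed
   ultimately show "outputs (sub 1003 B1 \<then> blk stage4) s' (Suc t1 + cost stage4 m) (Y s')"
   unfolding Y_def by (intro s5[of l "[]" "s' rZ" s' "s' ry" A' z']) auto
  qed simp
  also have "bind_pmf (sem stage3 s) Y = do { y <- guess k (s 1001); ?D1 l y }"
   by (simp add: X Y_def guess_def bind_pmfs Let_def bind_map_pmf map_pmf_def)
  finally show ?thesis .
 qed
 have s7: "outputs (?Q2) s (?c2)
   (do { o2 <- outd B2 t2 (s 1001); ?D2 l o2 })"
  if s: "std n k l A (concat B) z s" "hfree 0 s" "!!r. s (1003 + 4*r) = []" "!!r. r ~= 0 ==> s (1001 + 4*r) = []" "s ry = []" "l <= n"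
   and i: "s 1001 = enc_mat A' @ enc_mat B' @ enc_bits z'" "is_mat (2*n) n A'" "is_mat (2*n) k B'" "length z' = 2*n" for l s A' B' z'
 proof (rule outputs_sub)
  show "exec B2 t2 (init (s 1001) tp) ~= None" for tp using t2 i by simp
  fix R'::"nat => bits" assume R': "!!r. ~ (1001 <= r & 4 dvd r - 1001) ==> R' r = s r"
  have le: "R' r = s r" if "r < 1000" for r using R' that by simp
  have ev: "R' r = s r" if "even r" for r
  proof (rule R')
   show "~ (1001 <= r & 4 dvd r - 1001)" using that by presburger
  qed
  have o: "R' (1003 + 4*r) = s (1003 + 4*r)" for r
  proof (rule R')
   show "~ (1001 <= 1003 + 4*r & 4 dvd 1003 + 4*r - 1001)" by presburger
  qed
  show "outputs (?Q3) R' (?c3)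
   (do { y <- guess k (R' 1001); ?D1 l y })"
   using s le by (intro s6) (auto simp: std_def o intro: hfree_cong ev)
 qed (use that in auto)
 have s8: "outputs (?Q1) (counted A B z l)
   (?c1)
   (do { i2 <- in2 n l A B z; ?D3 l i2 })" if l: "l <= n" for l
 proof -
  obtain s where s: "sem orient (counted A B z l) = ret s" "std n k l A (concat B) z s" "s ry = []" "!!i. i >= 1000 ==> s i = []"
   using sem_orient[OF mats] by blast
  have sem2: "sem (orient ;; stage2) (counted A B z l) = map_pmf (%i. s(1001 := i)) (in2 n l A B z)"
   using s sem_stage2[OF s(2) mats] by (simp add: bind_ret)
  have hf: "hfree 0 (counted A B z l)"
   unfolding counted_def parsed_def by (intro hfree_upd) (auto simp: hfree_def)
  have d: "doesb (blk (orient ;; stage2)) (counted A B z l) (cost (orient ;; stage2) m) (map_pmf (%i. s(1001 := i)) (in2 n l A B z))"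
  proof -
   have "loops_le (orient ;; stage2) m (counted A B z l)"
   unfolding loops_le_def loops_progs using l kn by (auto simp: m_def counted_def parsed_def lA lB)
   from doesb_blk[OF hf this visible_progs(3) loops_pushes(3)] show ?thesis by (simp only: sem2)
  qed
  let ?K = "%i2. do { ?D3 l i2 }"
  have "outputs (?Q1) (counted A B z l)
   (?c1)
   (bind_pmf (map_pmf (%i. s(1001 := i)) (in2 n l A B z)) (%s. ?K (s 1001)))"
  proof (rule outputs_bseq[OF _ d])
   fix s' assume "s' : set_pmf (map_pmf (%i. s(1001 := i)) (in2 n l A B z))"
   then obtain i where s': "s' = s(1001 := i)" and i: "i : set_pmf (in2 n l A B z)" by auto
   from i obtain us xx f ms ms' where us: "us : set_pmf (vecs n n)" and f: "f : set_pmf (nzv l n)"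
   and ms: "ms : set_pmf (vecs n n)" "ms' : set_pmf (vecs n n)"
   and i': "i = enc_mat (map (shuf n ms ms') (mix n A us)) @ enc_mat (map (shuf n ms ms') B) @
   enc_bits (shuf n ms ms' (vadd f (addcols z A xx)))"
   by (auto simp: in2_def)
   have lens: "is_mat (2*n) n (map (shuf n ms ms') (mix n A us))" "is_mat (2*n) k (map (shuf n ms ms') B)"
   "length (shuf n ms ms' (vadd f (addcols z A xx))) = 2*n"
   using mats length_shuf[OF ms] set_vecs[OF us] length_nzv[OF f] length_addcols[of A "2*n" "zeros (2*n)"] length_addcols[of A "2*n" z]
   by (auto simp: is_mat_def mix_def)
   show "outputs (?Q2) s' (?c2) (?K (s' 1001))"
   by (rule s7[OF _ _ _ _ _ l _ lens])
   (use s in "auto simp: s' i' std_def fun_upd_apply hfree_def hid_def tmp_def")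
  qed simp
  thus ?thesis by (simp add: bind_map_pmf)
 qed
 have s9: "outputs (blk counters \<then> ?Q1) (parsed A B z)
   (?c0)
   (algd (outd B1 t1) (outd B2 t2) n k A B z)"
 proof -
  let ?K = "%l. do { i2 <- in2 n l A B z; ?D3 l i2 }"
  have "outputs (blk counters \<then> ?Q1) (parsed A B z)
   (?c0)
   (bind_pmf (map_pmf (counted A B z) (geol True n)) (%s. ?K (length (s rL))))"
  proof (rule outputs_bseq[OF _ p2])
   fix s assume "s : set_pmf (map_pmf (counted A B z) (geol True n))"
   then obtain l where l: "s = counted A B z l" "l <= n" using set_geol by auto
   have "length (s rL) = l" by (simp add: l counted_def)
   thus "outputs (?Q1) s
   (?c1) (?K (length (s rL)))"
   using s8[OF l(2)] l(1) by simp
  qed simp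
  thus ?thesis by (simp add: bind_map_pmf algd_def counted_def)
 qed
 have "outputs (blk parser \<then> blk counters \<then> ?Q1) (start x)
  (cost parser (length x) + (?c0))
  (bind_pmf (ret (parsed A B z)) (%_. algd (outd B1 t1) (outd B2 t2) n k A B z))"
  by (rule outputs_bseq[OF _ p1]) (use s9 in auto)
 thus ?thesis by (simp add: alg_def bind_ret)
qed

subsection \<open>Polynomial time\<close>

text \<open>The base n + 1 is at least one also for n = 0, so bounds can be padded to a common
  exponent and are closed under sums and products.\<close>

definition polyb::"(nat => nat) => bool" where
 "polyb f \<longleftrightarrow> (EX c d. ALL n. f n <= c*(n + 1)^d)"

lemma polyb_const [simp]: "polyb (%n. c)"
 unfolding polyb_def by (intro exI[of _ c] exI[of _ 0]) simp

lemma polyb_id [simp]: "polyb (%n. n)"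
 unfolding polyb_def by (intro exI[of _ 1]) auto

lemma polyb_add [simp]: assumes "polyb f" "polyb g" shows "polyb (%n. f n + g n)"
proof -
 obtain c d c' d' where 1: "!!n. f n <= c*(n + 1)^d" "!!n. g n <= c'*(n + 1)^d'"
  using assms unfolding polyb_def by blast
 have "f n + g n <= (c + c')*(n + 1)^(d + d')" for n
 proof -
  have "c*(n + 1)^d <= c*(n + 1)^(d + d')" "c'*(n + 1)^d' <= c'*(n + 1)^(d + d')"
   by (intro mult_left_mono power_increasing; simp)+
  thus ?thesis using 1[of n] unfolding distrib_right by linarith
 qed
 thus ?thesis unfolding polyb_def by blast
qed

lemma polyb_mult [simp]: assumes "polyb f" "polyb g" shows "polyb (%n. f n*g n)"
proof -
 obtain c d c' d' where 1: "!!n. f n <= c*(n + 1)^d" "!!n. g n <= c'*(n + 1)^d'"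
  using assms unfolding polyb_def by blast
 have "f n*g n <= (c*c')*(n + 1)^(d + d')" for n
  using mult_mono[OF 1(1)[of n] 1(2)[of n]] by (simp add: power_add mult_ac)
 thus ?thesis unfolding polyb_def by blast
qed

lemma polyb_Suc [simp]: "polyb f ==> polyb (%n. Suc (f n))"
 using polyb_add[of f "%_. 1"] by simp

lemma polyb_cost [simp]: "polyb g ==> polyb (%n. cost p (g n))"
 by (induction p) auto

lemma polybD:
 assumes "polyb f" shows "EX c d. ALL n. f n <= c*n^d + c"
proof -
 obtain c d where 1: "!!n. f n <= c*(n + 1)^d" using assms unfolding polyb_def by blast
 have "f n <= (c*2^d)*n^d + c*2^d" for n
 proof (cases "n = 0")
  case True
  have "f n <= c" using 1[of n] True by simp
  also have "c <= c*2^d" by simp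
  finally show ?thesis by simp
 next
  case False
  hence "(n + 1)^d <= (2*n)^d" by (intro power_mono) auto
  hence "c*(n + 1)^d <= c*(2^d*n^d)" unfolding power_mult_distrib by (rule mult_le_mono2)
  thus ?thesis using 1[of n] unfolding mult.assoc by linarith
 qed
 thus ?thesis by blast
qed

lemma length_enc_bits: "length (enc_bits v) = 2*length v + 1"
 by (induction v) (auto simp: enc_bits_Nil enc_bits_Cons)

lemma length_enc_mat: "is_mat m c M ==> length (enc_mat M) = c*(2*m + 2) + 1"
 by (induction M arbitrary: c) (auto simp: is_mat_def enc_mat_Nil enc_mat_Cons length_enc_bits)

lemma cost_mono: "m <= m' ==> cost p m <= cost p m'"
 by (induction p) (auto intro!: add_mono mult_mono)

text \<open>Each solver occurs once in \<open>alg\<close>, hence the coefficient one of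
  \<open>T1\<close> and \<open>T2\<close>. The rest is polynomial in n, since k <= n bounds the
  input length and all counters.\<close>

lemma alg_correct:
 assumes B1: "runs_in_time B1 T1 symplpn_inputs" and B2: "runs_in_time B2 T2 (%n. lsn_inputs (k n) n)" and kn: "ALL n. k n <= n"
 shows "EX P c d. ALL n A B z. is_mat (2*n) n A --> is_mat (2*n) (k n) B --> length z = 2*n -->
   (ALL tp. exec P (T1 n + T2 n + c*n^d + c) (init (enc_mat A @ enc_mat B @ enc_bits z) tp) ~= None) &
   outd P (T1 n + T2 n + c*n^d + c) (enc_mat A @ enc_mat B @ enc_bits z) = algd (outd B1 (T1 n)) (outd B2 (T2 n)) n (k n) A B z"
proof -
 define M where "M = (%n::nat. n*(2*(2*n) + 2) + 1 + (n*(2*(2*n) + 2) + 1) + (2*(2*n) + 1))"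
 define f where "f = (%n::nat. cost parser (M n) + (cost counters (2*n + 1) + (cost (orient ;; stage2) (2*n + 1) +
   (Suc 0 + (cost stage3 (2*n + 1) + (Suc 0 + cost stage4 (2*n + 1)))))))"
 have "polyb f" unfolding f_def M_def by (simp del: cost.simps)
 then obtain c d where cd: "!!n. f n <= c*n^d + c" using polybD by blast
 have wf: "wfb (alg B1 B2)" by (simp add: alg_def)
 show ?thesis
 proof (rule exI[of _ "snd (alg B1 B2) 0"], rule exI[of _ c], rule exI[of _ d], intro allI impI)
  fix n::nat and A B::"bits list" and z::"bits"
  assume m: "is_mat (2*n) n A" "is_mat (2*n) (k n) B" "length z = 2*n"
  let ?x = "enc_mat A @ enc_mat B @ enc_bits z"
  let ?T = "cost parser (length ?x) + (cost counters (2*n + 1) + (cost (orient ;; stage2) (2*n + 1) + (Suc (T2 n) + (cost stage3 (2*n + 1) + (Suc (T1 n) + cost stage4 (2*n + 1))))))"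
  have "outputs (alg B1 B2) (start ?x) ?T (algd (outd B1 (T1 n)) (outd B2 (T2 n)) n (k n) A B z)"
  proof (rule alg_outputs[OF m])
   fix A B::"bits list" and z tp::"bits" assume "is_mat (2*n) n A" "is_mat (2*n) (k n) B" "length z = 2*n"
   hence "enc_mat A @ enc_mat B @ enc_bits z : lsn_inputs (k n) n" unfolding lsn_inputs_def by blast
   thus "exec B2 (T2 n) (init (enc_mat A @ enc_mat B @ enc_bits z) tp) ~= None"
   using B2 unfolding runs_in_time_def by blast
  next
   fix A::"bits list" and z tp::"bits" assume "is_mat (2*n) n A" "length z = 2*n"
   hence "enc_mat A @ enc_bits z : symplpn_inputs n" unfolding symplpn_inputs_def by blast
   thus "exec B1 (T1 n) (init (enc_mat A @ enc_bits z) tp) ~= None"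
   using B1 unfolding runs_in_time_def by blast
  qed (use kn in auto)
  then obtain D where D: "doesb (alg B1 B2) (start ?x) ?T D" "map_pmf (%R. R 0) D = algd (outd B1 (T1 n)) (outd B2 (T2 n)) n (k n) A B z"
   unfolding outputs_def by blast
  have "length ?x <= M n"
   using kn m length_enc_mat[OF m(1)] length_enc_mat[OF m(2)] mult_le_mono1[of "k n" n "2*(2*n) + 2"]
   by (simp add: M_def length_enc_bits)
  hence "?T <= T1 n + T2 n + c*n^d + c"
   using cd[of n] cost_mono[of "length ?x" "M n" parser] unfolding f_def by linarith
  from doesb_outd[OF D(1) wf this] D(2)
  show "(ALL tp. exec (snd (alg B1 B2) 0) (T1 n + T2 n + c*n^d + c) (init ?x tp) ~= None) &
   outd (snd (alg B1 B2) 0) (T1 n + T2 n + c*n^d + c) ?x = algd (outd B1 (T1 n)) (outd B2 (T2 n)) n (k n) A B z"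
   by simp
 qed
qed

declare fun_upd_apply [simp] fun_upd_other [simp del]

section \<open>Symplectic linear algebra\<close>

lemma vadd_Nil [simp]: "vadd [] v = []" "vadd u [] = []" by (simp_all add: vadd_def)
lemma vadd_Cons [simp]: "vadd (a # u) (b # v) = (a ~= b) # vadd u v" by (simp add: vadd_def)

lemma vadd_comm: "vadd u v = vadd v u"
 by (induction u v rule: list_induct2') auto

lemma vadd_assoc: "vadd (vadd u v) w = vadd u (vadd v w)"
proof (induction u arbitrary: v w)
 case (Cons a u)
 thus ?case by (cases v; cases w) auto
qed simp

lemma vadd_left_comm: "vadd u (vadd v w) = vadd v (vadd u w)"
 by (metis vadd_assoc vadd_comm)

lemmas vadd_ac = vadd_assoc vadd_comm vadd_left_comm

lemma vadd_zeros [simp]: "length v = m ==> vadd (zeros m) v = v" "length v = m ==> vadd v (zeros m) = v"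
 by (induction v arbitrary: m) (auto simp: zeros_def)

lemma vadd_self [simp]: "length v = m ==> vadd v v = zeros m"
 by (induction v arbitrary: m) (auto simp: zeros_def)

lemma vadd_cancel [simp]: "length u = length v ==> vadd u (vadd u v) = v"
 by (simp add: vadd_assoc[symmetric])

lemma vadd_eq_zeros: "length u = m ==> length v = m ==> vadd u v = zeros m \<longleftrightarrow> u = v"
 by (metis vadd_cancel vadd_zeros(2) vadd_self)

lemma zeros_0 [simp]: "zeros 0 = []" and zeros_Suc [simp]: "zeros (Suc m) = False # zeros m"
 by (simp_all add: zeros_def)

lemma dotp_comm: "dotp u v = dotp v u"
 by (induction u v rule: list_induct2') (auto simp: dotp_def)

lemma dotp_vadd: "length u = length v ==> length w = length v ==> dotp (vadd u v) w = (dotp u w ~= dotp v w)"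
proof (induction u v arbitrary: w rule: list_induct2)
 case (Cons a u b v)
 thus ?case by (cases w) auto
qed (simp add: dotp_def)

lemma dotp_zeros [simp]: "dotp (zeros m) v = False"
proof (induction v arbitrary: m)
 case (Cons a v)
 thus ?case by (cases m) auto
qed (simp add: dotp_def)

lemma take_vadd: "take n (vadd u v) = vadd (take n u) (take n v)"
 by (simp add: vadd_def take_map take_zip)
lemma drop_vadd: "drop n (vadd u v) = vadd (drop n u) (drop n v)"
 by (simp add: vadd_def drop_map drop_zip)

lemma sympl_vadd:
 assumes "length u = 2*n" "length v = 2*n" "length w = 2*n"
 shows "sympl n (vadd u v) w = (sympl n u w ~= sympl n v w)"
 using assms by (simp add: sympl_def take_vadd drop_vadd dotp_vadd dotp_comm[of _ "vadd _ _"] dotp_comm[of "take n w"]) blast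

lemma sympl_sym: "sympl n u v = sympl n v u"
 by (auto simp: sympl_def)

lemma sympl_self [simp]: "~ sympl n u u"
 by (simp add: sympl_def)

lemma sympl_vadd2:
 assumes "length u = 2*n" "length v = 2*n" "length w = 2*n"
 shows "sympl n w (vadd u v) = (sympl n w u ~= sympl n w v)"
 using sympl_vadd[OF assms] by (simp add: sympl_sym)

lemma sympl_zeros [simp]: "~ sympl n (zeros (2*n)) v"
proof -
 have "take n (zeros (2*n)) = zeros n" "drop n (zeros (2*n)) = zeros n" by (simp_all add: zeros_def)
 thus ?thesis by (simp add: sympl_def dotp_comm[of "take n v"])
qed

lemma sympl_zeros2 [simp]: "~ sympl n v (zeros (2*n))"
 using sympl_zeros sympl_sym by blast

lemma dotp_nondeg:
 assumes "u ~= zeros (length u)" shows "EX v. length v = length u & dotp u v"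
 using assms
proof (induction u)
 case (Cons a u)
 show ?case
 proof (cases a)
  case True
  thus ?thesis by (intro exI[of _ "True # zeros (length u)"]) (simp add: dotp_comm[of u])
 next
  case False
  then obtain v where "length v = length u" "dotp u v" using Cons by auto
  thus ?thesis by (intro exI[of _ "False # v"]) simp
 qed
qed simp

lemma sympl_nondeg:
 assumes "length u = 2*n" "u ~= zeros (2*n)" shows "EX v. length v = 2*n & sympl n u v"
proof -
 have z: "zeros (2*n) = zeros n @ zeros n" by (simp add: zeros_def replicate_add[symmetric] mult_2)
 have u: "u = take n u @ drop n u" "length (take n u) = n" "length (drop n u) = n" using assms by auto
 hence "take n u ~= zeros n | drop n u ~= zeros n" using assms(2) unfolding z by metis
 thus ?thesis
 proof
  assume "take n u ~= zeros n"
  then obtain v where "length v = n" "dotp (take n u) v" using dotp_nondeg[of "take n u"] u by auto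
  thus ?thesis by (intro exI[of _ "zeros n @ v"]) (simp add: sympl_def)
 next
  assume "drop n u ~= zeros n"
  then obtain v where "length v = n" "dotp (drop n u) v" using dotp_nondeg[of "drop n u"] u by auto
  thus ?thesis by (intro exI[of _ "v @ zeros n"]) (simp add: sympl_def dotp_comm[of v] dotp_comm[of "take n u"])
 qed
qed

subsection \<open>Matrices and spans\<close>

abbreviation mx :: "nat => bits list => bits => bits" where "mx n == mat_vec (2*n)"

lemma mat_vec_Nil [simp]: "mat_vec m [] x = zeros m" "mat_vec m M [] = zeros m"
 by (simp_all add: mat_vec_def zeros_def)

lemma mat_vec_Cons [simp]: "mat_vec m (c # M) (b # x) = (if b then vadd c (mat_vec m M x) else mat_vec m M x)"
 by (simp add: mat_vec_def)

lemma length_mat_vec [simp]: "colen m M ==> length (mat_vec m M x) = m"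
proof (induction M arbitrary: x)
 case (Cons c M)
 thus ?case by (cases x) auto
qed simp

lemma addcols_mat_vec:
 "colen m M ==> length a = m ==> addcols a M x = vadd a (mat_vec m M x)"
proof (induction a M x rule: addcols.induct)
 case (1 a c cs b bs)
 thus ?case by (auto simp: vadd_ac)
qed auto

lemma mat_vec_vadd:
 "colen m M ==> length x = length M ==> length y = length M ==>
  mat_vec m M (vadd x y) = vadd (mat_vec m M x) (mat_vec m M y)"
proof (induction M arbitrary: x y)
 case (Cons c M)
 then obtain a x' b y' where "x = a # x'" "y = b # y'" by (metis length_Suc_conv)
 moreover have "vadd (vadd c p) (vadd c q) = vadd p q" if "length p = m" "length q = m" for p q
 proof -
  have "vadd (vadd c p) (vadd c q) = vadd c (vadd c (vadd p q))" by (simp add: vadd_ac)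
  thus ?thesis using Cons.prems that by simp
 qed
 ultimately show ?case using Cons by (auto simp: vadd_ac)
qed simp

lemma mat_vec_zeros [simp]: "mat_vec m M (zeros k) = zeros m"
proof (induction M arbitrary: k)
 case (Cons c M)
 thus ?case by (cases k) auto
qed simp

definition span::"nat => bits list => bits set" where
 "span m M = {mat_vec m M x | x. length x = length M}"

abbreviation sp2 :: "nat => bits list => bits set" where "sp2 n == span (2*n)"

lemma span_Nil [simp]: "span m [] = {zeros m}"
 by (auto simp: span_def)

lemma span_Cons: "span m (c # M) = span m M \<union> vadd c ` span m M"
proof
 show "span m (c # M) \<subseteq> span m M \<union> vadd c ` span m M"
 proof
  fix v assume "v : span m (c # M)"
  then obtain x where x: "v = mat_vec m (c # M) x" "length x = Suc (length M)" by (auto simp: span_def)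
  then obtain b y where "x = b # y" "length y = length M" by (auto simp: length_Suc_conv)
  thus "v : span m M \<union> vadd c ` span m M" using x by (auto simp: span_def)
 qed
next
 show "span m M \<union> vadd c ` span m M \<subseteq> span m (c # M)"
 proof
  fix v assume "v : span m M \<union> vadd c ` span m M"
  then obtain x b where "length x = length M" "v = mat_vec m (c # M) (b # x)"
   by (auto simp: span_def) (metis mat_vec_Cons, metis mat_vec_Cons)
  thus "v : span m (c # M)" unfolding span_def by (metis (mono_tags, lifting) length_Cons mem_Collect_eq)
 qed
qed

lemma span_length: "colen m M ==> v : span m M ==> length v = m"
 by (auto simp: span_def)

lemma zeros_in_span [simp]: "zeros m : span m M"
 by (induction M) (auto simp: span_Cons)

lemma span_vadd: "colen m M ==> u : span m M ==> v : span m M ==> vadd u v : span m M"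
proof -
 assume M: "colen m M" and "u : span m M" "v : span m M"
 then obtain x y where "u = mat_vec m M x" "v = mat_vec m M y" "length x = length M" "length y = length M"
  by (auto simp: span_def)
 thus ?thesis unfolding span_def
  using M by (auto simp: mat_vec_vadd intro!: exI[of _ "vadd x y"])
qed

lemma col_in_span: "colen m M ==> c : set M ==> c : span m M"
proof (induction M)
 case (Cons a M)
 thus ?case
 proof (cases "c = a")
  case True
  hence "vadd c (zeros m) = c" using Cons by auto
  thus ?thesis using True by (auto simp: span_Cons intro: image_eqI[where x = "zeros m"])
 qed (auto simp: span_Cons)
qed simp

lemma span_subset:
 assumes "colen m M'" "set M \<subseteq> span m M'" shows "span m M \<subseteq> span m M'"
 using assms(2)
proof (induction M)
 case (Cons c M)
 thus ?case using span_vadd[OF assms(1)] by (auto simp: span_Cons)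
qed simp

lemma finite_span [simp]: "finite (span m M)"
 by (induction M) (auto simp: span_Cons)

lemma full_rank_zeros: "full_rank m M \<longleftrightarrow> (ALL x. length x = length M & mat_vec m M x = zeros m --> x = zeros (length M))"
 by (simp add: full_rank_def zeros_def)

lemma full_rank_Nil [simp]: "full_rank m []" by (simp add: full_rank_def)

lemma full_rank_Cons:
 assumes "length c = m" "colen m M"
 shows "full_rank m (c # M) \<longleftrightarrow> full_rank m M & c \<notin> span m M"
proof
 assume fr: "full_rank m (c # M)"
 have "x = zeros (length M)" if "length x = length M" "mat_vec m M x = zeros m" for x
  using fr[unfolded full_rank_zeros, rule_format, of "False # x"] that by simp
 moreover have "c \<notin> span m M"
 proof
  assume "c : span m M"
  then obtain x where "length x = length M" "mat_vec m M x = c" by (auto simp: span_def)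
  thus False using fr[unfolded full_rank_zeros, rule_format, of "True # x"] assms by simp
 qed
 ultimately show "full_rank m M & c \<notin> span m M" by (auto simp: full_rank_zeros)
next
 assume h: "full_rank m M & c \<notin> span m M"
 show "full_rank m (c # M)"
  unfolding full_rank_zeros
 proof (intro allI impI)
  fix x assume x: "length x = length (c # M) & mat_vec m (c # M) x = zeros m"
  then obtain b y where y: "x = b # y" "length y = length M" by (auto simp: length_Suc_conv)
  have "~ b"
  proof
   assume b
   hence "vadd c (mat_vec m M y) = zeros m" using x y by simp
   hence "c = mat_vec m M y" using vadd_eq_zeros[of c m "mat_vec m M y"] assms by auto
   thus False using h y by (auto simp: span_def)
  qed
  thus "x = zeros (length (c # M))" using x y h by (auto simp: full_rank_zeros)
 qed
qed

lemma mat_vec_inj: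
 assumes "colen m M" "full_rank m M" "length x = length M" "length y = length M" "mat_vec m M x = mat_vec m M y"
 shows "x = y"
proof -
 have "mat_vec m M (vadd x y) = zeros m" using assms by (simp add: mat_vec_vadd)
 hence "vadd x y = zeros (length M)" using assms(2,3,4) by (auto simp: full_rank_zeros)
 thus ?thesis using vadd_eq_zeros[of x "length M" y] assms(3,4) by simp
qed

lemma span_image: "span m M = mat_vec m M ` {x. length x = length M}"
 by (auto simp: span_def)

lemma card_span: assumes "colen m M" "full_rank m M" shows "card (span m M) = 2^length M"
 unfolding span_image using mat_vec_inj[OF assms] by (subst card_image) (auto simp: inj_on_def card_len)

text \<open>Rank becomes a matter of the size of the span, which lets it pass between lists of equal
  length with the same span.\<close>

lemma full_rank_card: assumes "colen m M" shows "full_rank m M \<longleftrightarrow> card (span m M) = 2^length M"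
proof
 assume "card (span m M) = 2^length M"
 hence "inj_on (mat_vec m M) {x. length x = length M}"
  unfolding span_image by (intro eq_card_imp_inj_on) (auto simp: finite_len card_len)
 thus "full_rank m M" unfolding full_rank_zeros inj_on_def
  by (metis (mono_tags, lifting) length_zeros mat_vec_zeros mem_Collect_eq)
qed (rule card_span[OF assms])

subsection \<open>Orthogonal complements\<close>

definition perp::"nat => bits list => bits set" where
 "perp n M = {v. length v = 2*n & (ALL c:set M. ~ sympl n c v)}"

text \<open>The characters of Z_2^2n, indexed by vectors through the symplectic form.\<close>

definition chi::"nat => bits => bits => real" where
 "chi n u v = (if sympl n u v then -1 else 1)"

abbreviation vecs_of::"nat => bits set" where "vecs_of m == {v. length v = m}"

lemma chi_vadd: "length u = 2*n ==> length v = 2*n ==> length w = 2*n ==> chi n (vadd u v) w = chi n u w*chi n v w"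
 by (auto simp: chi_def sympl_vadd)

lemma perp_span: "colen (2*n) M ==> v : perp n M ==> w : sp2 n M ==> ~ sympl n w v"
proof (induction M arbitrary: w)
 case (Cons c M)
 hence v: "v : perp n M" "length v = 2*n" "~ sympl n c v" by (auto simp: perp_def)
 from Cons.prems(3) consider "w : sp2 n M" | u where "u : sp2 n M" "w = vadd c u" by (auto simp: span_Cons)
 thus ?case
 proof cases
  case 2
  thus ?thesis using Cons v span_length[of M "2*n" u] by (auto simp: sympl_vadd)
 qed (use Cons v in auto)
qed simp

lemma finite_perp [simp]: "finite (perp n M)"
 by (rule finite_subset[OF _ finite_len[of "2*n"]]) (auto simp: perp_def)

lemma perp_vadd: "colen (2*n) M ==> u : perp n M ==> v : perp n M ==> vadd u v : perp n M"
 by (auto simp: perp_def sympl_vadd2)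

lemma sum_flip_zero:
 fixes f::"bits => real"
 assumes "finite X" "!!v. v : X ==> vadd w v : X" "!!v. v : X ==> length v = length w" "!!v. v : X ==> f (vadd w v) = - f v"
 shows "sum f X = 0"
proof -
 have "sum f X = sum (%v. f (vadd w v)) X"
  by (rule sum.reindex_bij_witness[where i = "vadd w" and j = "vadd w"]) (use assms in auto)
 also have "... = - sum f X" using assms(4) by (simp add: sum_negf)
 finally show ?thesis by simp
qed

lemma sum_chi:
 assumes "length u = 2*n"
 shows "(\<Sum>v\<in>vecs_of (2*n). chi n u v) = (if u = zeros (2*n) then 4^n else 0)"
proof (cases "u = zeros (2*n)")
 case True
 thus ?thesis by (simp add: chi_def card_len power_mult)
next
 case False
 then obtain w where w: "length w = 2*n" "sympl n u w" using sympl_nondeg assms by blast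
 have "(\<Sum>v\<in>vecs_of (2*n). chi n u v) = 0"
  by (rule sum_flip_zero[where w = w]) (use w assms in "auto simp: finite_len chi_def sympl_vadd2")
 thus ?thesis using False by simp
qed

lemma sum_len_Suc:
 fixes f::"bits => real"
 shows "(\<Sum>x\<in>vecs_of (Suc k). f x) = (\<Sum>x\<in>vecs_of k. f (False # x) + f (True # x))"
proof -
 have "vecs_of (Suc k) = (%(b, xs). b # xs) ` (UNIV \<times> vecs_of k)" by (rule set_lists_length_Suc)
 hence "(\<Sum>x\<in>vecs_of (Suc k). f x) = (\<Sum>p\<in>UNIV \<times> vecs_of k. f (fst p # snd p))"
  by (simp add: sum.reindex inj_on_def case_prod_beta')
 also have "... = (\<Sum>b\<in>UNIV. \<Sum>x\<in>vecs_of k. f (b # x))"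
  by (subst sum.Sigma) (auto simp: finite_len case_prod_beta')
 finally show ?thesis by (simp add: UNIV_bool sum.distrib)
qed

lemma sum_chi_span:
 assumes "colen (2*n) M" "length v = 2*n"
 shows "(\<Sum>x\<in>vecs_of (length M). chi n (mx n M x) v) = (if v : perp n M then 2^length M else 0)"
 using assms(1)
proof (induction M)
 case Nil
 thus ?case using assms(2) by (simp add: chi_def perp_def)
next
 case (Cons c M)
 have "(\<Sum>x\<in>vecs_of (length (c # M)). chi n (mx n (c # M) x) v) =
   (\<Sum>x\<in>vecs_of (length M). (1 + chi n c v)*chi n (mx n M x) v)"
  using Cons.prems assms(2) by (simp add: sum_len_Suc chi_vadd distrib_right)
 also have "... = (1 + chi n c v)*(if v : perp n M then 2^length M else 0)"
  using Cons by (simp add: sum_distrib_left[symmetric])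
 also have "... = (if v : perp n (c # M) then 2^length (c # M) else 0)"
  by (auto simp: perp_def chi_def)
 finally show ?case .
qed

text \<open>The double sum of chi(Mx, v) over x and v is evaluated in both orders: summing over x
  first leaves the v in the complement, summing over v first leaves only x = 0, by full
  rank.\<close>

lemma card_perp:
 assumes M: "is_mat (2*n) j M" "full_rank (2*n) M"
 shows "card (perp n M)*2^j = 4^n"
proof -
 have l: "colen (2*n) M" "length M = j" using M by (auto simp: is_mat_def)
 have "(\<Sum>v\<in>vecs_of (2*n). \<Sum>x\<in>vecs_of j. chi n (mx n M x) v) = (\<Sum>v\<in>vecs_of (2*n). if v : perp n M then 2^j else 0)"
  using sum_chi_span[OF l(1)] l(2) by (intro sum.cong) auto
 also have "... = (\<Sum>v\<in>perp n M. 2^j)"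
  by (subst sum.inter_filter[symmetric]) (auto simp: finite_len perp_def intro!: sum.cong)
 finally have "(\<Sum>v\<in>vecs_of (2*n). \<Sum>x\<in>vecs_of j. chi n (mx n M x) v) = real (card (perp n M))*2^j" by simp
 moreover have "(\<Sum>v\<in>vecs_of (2*n). \<Sum>x\<in>vecs_of j. chi n (mx n M x) v) = (\<Sum>x\<in>vecs_of j. \<Sum>v\<in>vecs_of (2*n). chi n (mx n M x) v)"
  by (rule sum.swap)
 also have "... = (\<Sum>x\<in>vecs_of j. if x = zeros j then 4^n else 0)"
 proof (intro sum.cong refl)
  fix x assume "x : vecs_of j"
  hence "mx n M x = zeros (2*n) \<longleftrightarrow> x = zeros j" using M(2) l by (metis (mono_tags, lifting) full_rank_zeros mat_vec_zeros mem_Collect_eq)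
  thus "(\<Sum>v\<in>vecs_of (2*n). chi n (mx n M x) v) = (if x = zeros j then 4^n else 0)"
   using sum_chi[of "mx n M x" n] l by simp
 qed
 also have "... = 4^n" by (simp add: finite_len)
 finally have "real (card (perp n M)*2^j) = real (4^n)" by simp
 thus ?thesis by (simp only: of_nat_eq_iff)
qed

subsection \<open>Isotropic frames\<close>

definition frames::"nat => nat => bits list set" where
 "frames n j = {M. is_mat (2*n) j M & isotropic n M & full_rank (2*n) M}"

abbreviation lag :: "nat => bits list set" where "lag n == frames n n"

definition ext::"nat => bits list => bits set" where
 "ext n M = perp n M - sp2 n M"

lemma lagr_frames: "lagr_mats n = lag n"
 by (simp add: lagr_mats_def frames_def)

lemma isotropic_iff: "isotropic n M \<longleftrightarrow> (ALL u:set M. ALL v:set M. ~ sympl n u v)"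
 unfolding isotropic_def by (metis in_set_conv_nth)

lemma frames_len: "M : frames n j ==> (colen (2*n) M) & length M = j"
 by (auto simp: frames_def is_mat_def)

lemma frames_Cons: "v # M : frames n (Suc j) \<longleftrightarrow> M : frames n j & v : ext n M"
proof -
 have "isotropic n (v # M) \<longleftrightarrow> isotropic n M & (ALL c:set M. ~ sympl n c v)"
  by (auto simp: isotropic_iff sympl_sym[of n v])
 thus ?thesis using full_rank_Cons[of v "2*n" M]
  by (auto simp: frames_def ext_def perp_def is_mat_def)
qed

lemma frames_Suc: "frames n (Suc j) = (\<Union>M\<in>frames n j. (%v. v # M) ` ext n M)"
proof -
 have "M' : frames n (Suc j) \<longleftrightarrow> (EX M v. M' = v # M & M : frames n j & v : ext n M)" for M'
  using frames_Cons by (cases M') (auto simp: frames_def is_mat_def)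
 thus ?thesis by (intro set_eqI) blast
qed

lemma frames_0 [simp]: "frames n 0 = {[]}"
 by (auto simp: frames_def is_mat_def isotropic_def)

lemma finite_ext [simp]: "finite (ext n M)" by (simp add: ext_def)

lemma finite_frames [simp]: "finite (frames n j)"
 by (induction j) (auto simp: frames_Suc)

lemma span_sub_perp:
 assumes "M : frames n j" shows "sp2 n M \<subseteq> perp n M"
proof
 fix w assume w: "w : sp2 n M"
 have l: "colen (2*n) M" using frames_len[OF assms] by auto
 have "c : perp n M" if "c : set M" for c
  using assms that l by (auto simp: frames_def perp_def isotropic_iff)
 hence "~ sympl n c w" if "c : set M" for c
  using perp_span[OF l _ w] that sympl_sym by blast
 thus "w : perp n M" using span_length[OF l w] by (auto simp: perp_def)
qed

lemma card_span_frames: "M : frames n j ==> card (sp2 n M) = 2^j"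
 using card_span[of M "2*n"] frames_len[of M n j] by (simp add: frames_def)

lemma card_perp_frames:
 assumes "M : frames n j" "j <= n" shows "card (perp n M) = 2^(2*n - j)"
proof -
 have "card (perp n M)*2^j = 2^(2*n - j)*2^j"
  using card_perp[of n j M] assms by (simp add: frames_def power_mult[symmetric] flip: power_add) (simp add: power_mult)
 thus ?thesis by simp
qed

lemma card_ext:
 assumes "M : frames n j" "j <= n" shows "card (ext n M) = 2^(2*n - j) - 2^j"
 unfolding ext_def using span_sub_perp[OF assms(1)] card_span_frames[OF assms(1)] card_perp_frames[OF assms]
 by (simp add: card_Diff_subset)

lemma sum_frames_Suc:
 fixes f::"bits list => real"
 shows "(\<Sum>M\<in>frames n (Suc j). f M) = (\<Sum>M\<in>frames n j. \<Sum>v\<in>ext n M. f (v # M))"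
 unfolding frames_Suc
 by (subst sum.UNION_disjoint) (auto simp: sum.reindex inj_on_def)

lemma card_frames_Suc:
 assumes "j <= n" shows "real (card (frames n (Suc j))) = real (card (frames n j))*(2^(2*n - j) - 2^j)"
proof -
 have e: "2^j <= (2::nat)^(2*n - j)" using assms by (intro power_increasing) auto
 have "real (card (frames n (Suc j))) = (\<Sum>M\<in>frames n (Suc j). 1)" by simp
 also have "... = (\<Sum>M\<in>frames n j. real (card (ext n M)))" by (simp only: sum_frames_Suc) simp
 also have "... = (\<Sum>M\<in>frames n j. 2^(2*n - j) - 2^j)"
  using card_ext[OF _ assms] e by (intro sum.cong) (auto simp: of_nat_diff)
 finally show ?thesis by simp
qed

lemma card_frames_pos: "j <= n ==> card (frames n j) > 0"
proof (induction j)
 case (Suc j)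
 have "2^j < (2::real)^(2*n - j)" using Suc.prems by (intro power_strict_increasing) auto
 hence "real (card (frames n (Suc j))) > 0"
  using Suc by (simp add: card_frames_Suc)
 thus ?case by simp
qed simp

text \<open>Isotropy passes from a frame to its whole span, and by counting a generating list of the
  right length is independent.\<close>

lemma frames_span_eq:
 assumes M: "M : frames n j" and M': "length M' = j" "set M' \<subseteq> sp2 n M" "set M \<subseteq> sp2 n M'"
 shows "M' : frames n j & sp2 n M' = sp2 n M"
proof -
 have l: "colen (2*n) M" "length M = j" using frames_len[OF M] by auto
 have l': "colen (2*n) M'" using M'(2) span_length[OF l(1)] by auto
 have eq: "sp2 n M' = sp2 n M"
  using span_subset[OF l(1) M'(2)] span_subset[OF l' M'(3)] by auto
 have "full_rank (2*n) M'"
  using full_rank_card[OF l'] card_span_frames[OF M] eq M'(1) by simp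
 moreover have "isotropic n M'"
  unfolding isotropic_iff
 proof (intro ballI)
  fix u v assume "u : set M'" "v : set M'"
  hence "u : sp2 n M" "v : perp n M" using M'(2) span_sub_perp[OF M] by auto
  thus "~ sympl n u v" using perp_span[OF l(1)] by blast
 qed
 ultimately show ?thesis using l' M'(1) eq by (auto simp: frames_def is_mat_def)
qed

lemma perp_span_eq:
 assumes "colen (2*n) M" "colen (2*n) M'" "sp2 n M = sp2 n M'"
 shows "perp n M = perp n M'"
proof -
 have "perp n N \<subseteq> perp n N'" if "colen (2*n) N" "colen (2*n) N'" "sp2 n N = sp2 n N'" for N N'
 proof
  fix v assume v: "v : perp n N"
  hence "~ sympl n c v" if "c : set N'" for c
   using perp_span[OF \<open>ALL c:set N. length c = 2*n\<close> v, of c] col_in_span[OF \<open>ALL c:set N'. length c = 2*n\<close>] that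
   \<open>sp2 n N = sp2 n N'\<close> by auto
  thus "v : perp n N'" using v by (auto simp: perp_def)
 qed
 thus ?thesis using assms by blast
qed

section \<open>Expansion of Lagrangian frames\<close>

definition span_inv::"nat => nat => (bits list => real) => bool" where
 "span_inv n j f \<longleftrightarrow> (ALL M:frames n j. ALL M':frames n j. sp2 n M = sp2 n M' --> f M = f M')"

definition avg::"'a set => ('a => real) => real" where
 "avg X f = sum f X/card X"

text \<open>The conditional expectation of \<open>f\<close> given the frame without its head, for a
  uniform random frame.\<close>

definition down::"nat => (bits list => real) => bits list => real" where
 "down n f M = avg (ext n M) (%v. f (v # M))"

lemma avg_frames_Suc:
 assumes "j <= n" shows "avg (frames n (Suc j)) f = avg (frames n j) (down n f)"
proof -
 have e: "2^j <= (2::nat)^(2*n - j)" using assms by (intro power_increasing) auto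
 have "down n f M = (\<Sum>v\<in>ext n M. f (v # M))/(2^(2*n - j) - 2^j)" if "M : frames n j" for M
  using card_ext[OF that assms] e by (simp add: down_def avg_def of_nat_diff)
 hence "sum (down n f) (frames n j) = (\<Sum>M\<in>frames n j. \<Sum>v\<in>ext n M. f (v # M))/(2^(2*n - j) - 2^j)"
  by (simp add: sum_divide_distrib)
 thus ?thesis using assms by (simp add: avg_def sum_frames_Suc card_frames_Suc mult.commute)
qed

lemma span_Cons_eq: "span m M = span m M' ==> span m (v # M) = span m (v # M')"
 by (simp add: span_Cons)

lemma ext_span_eq: "M : frames n j ==> M' : frames n j ==> sp2 n M = sp2 n M' ==> ext n M = ext n M'"
 using perp_span_eq[of M n M'] frames_len[of M n j] frames_len[of M' n j] by (simp add: ext_def)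

lemma span_inv_down: assumes "span_inv n (Suc j) f" shows "span_inv n j (down n f)"
 unfolding span_inv_def
proof (intro ballI impI)
 fix M M' assume M: "M : frames n j" "M' : frames n j" "sp2 n M = sp2 n M'"
 have "f (v # M) = f (v # M')" if "v : ext n M" for v
  using assms M that ext_span_eq[OF M] span_Cons_eq[OF M(3)] unfolding span_inv_def
  by (auto simp: frames_Cons)
 thus "down n f M = down n f M'" by (simp add: down_def avg_def ext_span_eq[OF M])
qed

text \<open>The local estimate. For a fixed frame \<open>M\<close> let \<open>g a b = f (b # a # M)\<close> and let \<open>h\<close> be its average over \<open>b\<close>.
 As \<open>f\<close> depends on spans only, \<open>g\<close> is symmetric in the three nonzero vectors \<open>a, b, a + b\<close> of a plane,
 so \<open>3 E h\<^sup>2 = E (h a + h b + h (a + b)) g\<close>, and \<open>E (h a) (h b)\<close> is small by a character estimate.\<close>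

locale link =
 fixes n j::nat and M::"bits list" and f::"bits list => real"
 assumes M: "M : frames n j" and j: "j + 2 <= n" and f: "span_inv n (Suc (Suc j)) f"
begin

definition "X = ext n M"
definition "E a = ext n (a # M)"
definition "g a b = f (b # a # M)"
definition "h a = down n f (a # M)"
definition "S = sp2 n M"
definition "c1 = (2::real)^(2*n - j) - 2^j"
definition "c2 = (2::real)^(2*n - Suc j) - 2^Suc j"
definition "PP = Sigma X E"

lemma lens: "colen (2*n) M" "length M = j"
 using frames_len[OF M] by auto

lemma aM: "a : X ==> a # M : frames n (Suc j)"
 using M by (simp add: frames_Cons X_def)

lemma baM: "a : X ==> b : E a ==> b # a # M : frames n (Suc (Suc j))"
 using aM by (simp add: frames_Cons E_def)

lemma X_len: "a : X ==> length a = 2*n" by (simp add: X_def ext_def perp_def)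

lemma finX [simp]: "finite X" and finE [simp]: "finite (E a)" and finPP [simp]: "finite PP"
 by (simp_all add: X_def E_def PP_def)

lemma cardX: "real (card X) = c1"
proof -
 have "2^j <= (2::nat)^(2*n - j)" using j by (intro power_increasing) auto
 thus ?thesis using card_ext[OF M] j by (simp add: X_def c1_def of_nat_diff)
qed

lemma cardE: "a : X ==> real (card (E a)) = c2"
proof -
 assume a: "a : X"
 have "2^Suc j <= (2::nat)^(2*n - Suc j)" using j by (intro power_increasing) auto
 thus ?thesis using card_ext[OF aM[OF a]] j by (simp add: E_def c2_def of_nat_diff)
qed

lemma c_pos: "c1 > 0" "c2 > 0"
 using j power_strict_increasing[of j "2*n - j" "2::real"] power_strict_increasing[of "Suc j" "2*n - Suc j" "2::real"]
 by (auto simp: c1_def c2_def)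

lemma S_span: "sp2 n (a # M) = S \<union> vadd a ` S" by (simp add: span_Cons S_def)

lemma mem_E: "a : X ==> b : E a \<longleftrightarrow> b : X & ~ sympl n a b & vadd a b \<notin> S"
proof -
 assume a: "a : X"
 have "b : vadd a ` S \<longleftrightarrow> vadd a b : S" if "length b = 2*n"
  using X_len[OF a] that span_length[OF lens(1)] unfolding S_def
  by (auto intro: image_eqI[where x = "vadd a b"])
 moreover have "b : E a ==> length b = 2*n" "b : X ==> length b = 2*n"
  by (simp_all add: E_def X_def ext_def perp_def)
 ultimately show ?thesis
  using a by (auto simp: E_def X_def ext_def S_span) (auto simp: perp_def S_def)
qed

lemma E_sym: "a : X ==> b : E a ==> b : X & a : E b"
 using mem_E[of a b] mem_E[of b a] by (auto simp: sympl_sym vadd_comm)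

lemma E_add:
 assumes "a : X" "b : E a" shows "vadd a b : X & vadd a b : E a & b : E (vadd a b)"
proof -
 have b: "b : X" "~ sympl n a b" "vadd a b \<notin> S" using assms mem_E by auto
 have l: "length a = 2*n" "length b = 2*n" using assms(1) b X_len by auto
 have ab: "vadd a b : X" using assms(1) b perp_vadd[OF lens(1), of a b] by (auto simp: X_def ext_def S_def)
 moreover have "vadd a b : E a" using assms(1) ab b l by (auto simp: mem_E sympl_vadd2) (simp add: X_def ext_def S_def)
 moreover have "b : E (vadd a b)"
 proof -
  have "vadd (vadd a b) b = a" using l by (simp add: vadd_assoc)
  thus ?thesis using assms(1) ab b l by (auto simp: mem_E sympl_vadd) (simp add: X_def ext_def S_def)
 qed
 ultimately show ?thesis by blast
qed

lemma g_sym: "a : X ==> b : E a ==> g b a = g a b"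
proof -
 assume ab: "a : X" "b : E a"
 have "sp2 n (a # b # M) = sp2 n (b # a # M)"
  by (auto simp: span_Cons image_Un image_image vadd_left_comm)
 thus ?thesis using f baM[OF ab] baM[of b a] E_sym[OF ab] unfolding span_inv_def g_def by blast
qed

lemma g_add: "a : X ==> b : E a ==> g a (vadd a b) = g a b"
proof -
 assume ab: "a : X" "b : E a"
 have l: "length a = 2*n" "length b = 2*n" using X_len[OF ab(1)] X_len E_sym[OF ab] by auto
 have fr: "b # a # M : frames n (Suc (Suc j))" "vadd a b # a # M : frames n (Suc (Suc j))"
  using baM ab E_add[OF ab] by auto
 have l': "colen (2*n) (b # a # M)" "colen (2*n) (vadd a b # a # M)" using lens l by auto
 have "b = vadd a (vadd a b)" using l by simp
 hence "b : sp2 n (vadd a b # a # M)"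
  using span_vadd[OF l'(2), of a "vadd a b"] col_in_span[OF l'(2), of a] col_in_span[OF l'(2), of "vadd a b"] by auto
 moreover have "vadd a b : sp2 n (b # a # M)"
  using span_vadd[OF l'(1), of a b] col_in_span[OF l'(1), of a] col_in_span[OF l'(1), of b] by auto
 ultimately have "sp2 n (vadd a b # a # M) = sp2 n (b # a # M)"
  using frames_span_eq[OF fr(1), of "vadd a b # a # M"] lens(2) col_in_span[OF l'(1)] col_in_span[OF l'(2)] by auto
 thus ?thesis using f fr unfolding span_inv_def g_def by blast
qed

text \<open>The two vectors differ by an element of the span of \<open>M\<close>, so they prolong
  \<open>M\<close> to the same subspace.\<close>

lemma h_inv: "a : X ==> b : X ==> vadd a b : S ==> h a = h b"
proof -
 assume ab: "a : X" "b : X" "vadd a b : S"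
 have l: "length a = 2*n" "length b = 2*n" using ab X_len by auto
 have l': "colen (2*n) (a # M)" "colen (2*n) (b # M)" using lens l by auto
 have "b : sp2 n (a # M)" "a : sp2 n (b # M)"
 proof -
  have "b = vadd a (vadd a b)" using l by simp
  moreover have "a = vadd b (vadd a b)" using l vadd_cancel[of b a] by (simp only: vadd_comm[of a b])
  ultimately show "b : sp2 n (a # M)" "a : sp2 n (b # M)"
   using ab(3) unfolding span_Cons S_def by blast+
 qed
 hence "sp2 n (a # M) = sp2 n (b # M)"
  using frames_span_eq[OF aM[OF ab(1)], of "b # M"] lens(2) col_in_span[OF l'(1)] col_in_span[OF l'(2)] by auto
 thus ?thesis using span_inv_down[OF f] aM ab unfolding span_inv_def h_def by blast
qed

lemma h_sum: "a : X ==> (\<Sum>b\<in>E a. g a b) = c2*h a"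
 using cardE[of a] c_pos by (simp add: h_def down_def avg_def E_def g_def)

lemma sum_PP: "(\<Sum>p\<in>PP. \<phi> (fst p) (snd p)) = (\<Sum>a\<in>X. \<Sum>b\<in>E a. \<phi> a b)" for \<phi>::"bits => bits => real"
 unfolding PP_def by (subst sum.Sigma) (auto simp: case_prod_beta')

lemma sum_swap: "(\<Sum>a\<in>X. \<Sum>b\<in>E a. \<phi> b a) = (\<Sum>a\<in>X. \<Sum>b\<in>E a. \<phi> a b)" for \<phi>::"bits => bits => real"
 unfolding sum_PP[symmetric]
 by (rule sum.reindex_bij_witness[where i = "%p. (snd p, fst p)" and j = "%p. (snd p, fst p)"])
   (auto simp: PP_def dest: E_sym)

lemma sum_shift: "(\<Sum>a\<in>X. \<Sum>b\<in>E a. \<phi> a (vadd a b)) = (\<Sum>a\<in>X. \<Sum>b\<in>E a. \<phi> a b)" for \<phi>::"bits => bits => real"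
proof (rule sum.cong[OF refl])
 fix a assume a: "a : X"
 show "(\<Sum>b\<in>E a. \<phi> a (vadd a b)) = (\<Sum>b\<in>E a. \<phi> a b)"
  by (rule sum.reindex_bij_witness[where i = "vadd a" and j = "vadd a"])
   (use a E_add[OF a] E_sym[OF a] X_len in auto)
qed

text \<open>\<open>H\<close> is the symplectic Fourier transform of \<open>h\<close>, and
  \<open>h\<close> is constant on cosets of \<open>S\<close>. Orthogonality of characters on
  \<open>perp n M\<close> gives the Parseval identity \<open>H2\<close>, so the transform has norm
  2^n, and Cauchy-Schwarz finishes, here as a weighted arithmetic-geometric mean inequality.\<close>

lemma char_bound: "(\<Sum>a\<in>X. \<Sum>b\<in>X. chi n a b*h a*h b) <= 2^n*(\<Sum>a\<in>X. (h a)\<^sup>2)"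
proof -
 define H where "H b = (\<Sum>a\<in>X. chi n a b*h a)" for b
 let ?N = "\<Sum>a\<in>X. (h a)\<^sup>2"
 have Xp: "X \<subseteq> perp n M" by (auto simp: X_def ext_def)
 have ch: "(\<Sum>b\<in>perp n M. chi n a b*chi n a' b) = (if vadd a a' : S then 4^n/2^j else 0)" if a: "a : X" "a' : X" for a a'
 proof -
  have l: "length a = 2*n" "length a' = 2*n" using a X_len by auto
  have "(\<Sum>b\<in>perp n M. chi n a b*chi n a' b) = (\<Sum>b\<in>perp n M. chi n (vadd a a') b)"
   using l by (intro sum.cong) (auto simp: chi_vadd perp_def)
  also have "... = (if vadd a a' : S then 4^n/2^j else 0)"
  proof (cases "vadd a a' : S")
   case True
   have "(\<Sum>b\<in>perp n M. chi n (vadd a a') b) = real (card (perp n M))"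
   using perp_span[OF lens(1) _ True[unfolded S_def]] by (simp add: chi_def)
   moreover have "real (card (perp n M))*2^j = 4^n"
   using arg_cong[OF card_perp[of n j M], of real] M by (simp add: frames_def)
   ultimately show ?thesis using True by (simp add: field_simps)
  next
   case False
   let ?w = "vadd a a'"
   have w: "?w : X" using a False perp_vadd[OF lens(1), of a a'] by (auto simp: X_def ext_def S_def)
   have "perp n (?w # M) ~= perp n M"
   proof
   assume "perp n (?w # M) = perp n M"
   hence "(2::nat)^(2*n - Suc j) = 2^(2*n - j)"
   using card_perp_frames[OF M] card_perp_frames[OF aM[OF w]] j by simp
   hence "2*n - Suc j = 2*n - j" by simp
   thus False using j by linarith
   qed
   then obtain v where v: "v : perp n M" "sympl n ?w v" by (auto simp: perp_def)
   have "(\<Sum>b\<in>perp n M. chi n ?w b) = 0"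
   proof (rule sum_flip_zero[where w = v])
   show "vadd v b : perp n M" if "b : perp n M" for b using perp_vadd[OF lens(1) v(1) that] .
   show "finite (perp n M)" by simp
   qed (use v l in "auto simp: chi_def sympl_vadd2 perp_def")
   thus ?thesis using False by simp
  qed
  finally show ?thesis .
 qed
 have "(\<Sum>b\<in>perp n M. (H b)\<^sup>2) = (\<Sum>b\<in>perp n M. \<Sum>a\<in>X. \<Sum>a'\<in>X. (chi n a b*chi n a' b)*(h a*h a'))"
  by (simp add: H_def power2_eq_square sum_product mult_ac)
 also have "... = (\<Sum>a\<in>X. \<Sum>b\<in>perp n M. \<Sum>a'\<in>X. (chi n a b*chi n a' b)*(h a*h a'))"
  by (rule sum.swap)
 also have "... = (\<Sum>a\<in>X. \<Sum>a'\<in>X. \<Sum>b\<in>perp n M. (chi n a b*chi n a' b)*(h a*h a'))"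
  by (rule sum.cong[OF refl], rule sum.swap)
 also have "... = (\<Sum>a\<in>X. \<Sum>a'\<in>X. if vadd a a' : S then 4^n/2^j*(h a)\<^sup>2 else 0)"
  using h_inv by (intro sum.cong refl) (auto simp: sum_distrib_right[symmetric] ch power2_eq_square)
 also have "... = (\<Sum>a\<in>X. 4^n*(h a)\<^sup>2)"
 proof (intro sum.cong refl)
  fix a assume a: "a : X"
  have "{a':X. vadd a a' : S} = vadd a ` S"
  proof (intro set_eqI iffI)
   fix b assume "b : {a':X. vadd a a' : S}"
   thus "b : vadd a ` S" using X_len a by (auto intro: image_eqI[where x = "vadd a b"])
  next
   fix b assume "b : vadd a ` S"
   then obtain s where s: "b = vadd a s" "s : S" by auto
   have l: "length a = 2*n" "length s = 2*n" using X_len a s span_length[OF lens(1)] by (auto simp: S_def)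
   have "vadd a s \<notin> S"
   proof
   assume "vadd a s : S"
   hence "vadd (vadd a s) s : S" using span_vadd[OF lens(1)] s by (simp add: S_def)
   thus False using a l by (simp add: vadd_assoc X_def ext_def S_def)
   qed
   moreover have "vadd a s : perp n M" using a s span_sub_perp[OF M] perp_vadd[OF lens(1)] by (auto simp: X_def ext_def S_def)
   ultimately show "b : {a':X. vadd a a' : S}" using s l by (auto simp: X_def ext_def S_def)
  qed
  moreover have "inj_on (vadd a) S"
   using X_len[OF a] span_length[OF lens(1)] by (intro inj_onI) (metis S_def vadd_cancel)
  ultimately have "card {a':X. vadd a a' : S} = 2^j"
   using card_span_frames[OF M] by (simp add: card_image S_def)
  thus "(\<Sum>a'\<in>X. if vadd a a' : S then 4^n/2^j*(h a)\<^sup>2 else 0) = 4^n*(h a)\<^sup>2"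
   by (simp add: sum.inter_filter[symmetric])
 qed
 finally have H2: "(\<Sum>b\<in>perp n M. (H b)\<^sup>2) = 4^n*?N" by (simp add: sum_distrib_left)
 have "(\<Sum>a\<in>X. \<Sum>b\<in>X. chi n a b*h a*h b) = (\<Sum>b\<in>X. \<Sum>a\<in>X. chi n a b*h a*h b)" by (rule sum.swap)
 also have "... = (\<Sum>b\<in>X. H b*h b)" by (simp add: H_def sum_distrib_right)
 also have "... <= (\<Sum>b\<in>X. (H b)\<^sup>2/(2*2^n) + 2^n*(h b)\<^sup>2/2)"
 proof (intro sum_mono)
  fix b
  have "0 <= (H b - 2^n*h b)\<^sup>2/(2*2^n)" by simp
  thus "H b*h b <= (H b)\<^sup>2/(2*2^n) + 2^n*(h b)\<^sup>2/2"
   by (simp add: power2_diff field_simps power2_eq_square)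
 qed
 also have "... = (\<Sum>b\<in>X. (H b)\<^sup>2)/(2*2^n) + 2^n*?N/2"
  by (simp add: sum.distrib sum_divide_distrib sum_distrib_left)
 also have "... <= (\<Sum>b\<in>perp n M. (H b)\<^sup>2)/(2*2^n) + 2^n*?N/2"
  using Xp by (intro add_right_mono divide_right_mono sum_mono2) auto
 also have "... = 2^n*?N"
 proof -
  have "(4::real)^n = 2^n*2^n" by (simp add: power_mult_distrib[symmetric])
  thus ?thesis by (simp add: H2 field_simps)
 qed
 finally show ?thesis .
qed

text \<open>(1 + chi)/2 is the indicator of orthogonality, and \<open>E a\<close> consists of the
  vectors orthogonal to \<open>a\<close> outside the coset of \<open>a\<close>. Mean zero kills the
  constant part; the rest is \<open>char_bound\<close> minus the contribution of the coset.\<close>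

lemma pair_bound:
 assumes z: "(\<Sum>a\<in>X. h a) = 0"
 shows "(\<Sum>a\<in>X. \<Sum>b\<in>E a. h a*h b) <= c2/6*(\<Sum>a\<in>X. (h a)\<^sup>2)"
proof -
 let ?N = "\<Sum>a\<in>X. (h a)\<^sup>2"
 have in': "(\<Sum>b\<in>E a. h a*h b) = (\<Sum>b\<in>X. (1 + chi n a b)/2*(h a*h b)) - 2^j*(h a)\<^sup>2" if a: "a : X" for a
 proof -
  let ?Y = "{b:X. ~ sympl n a b}" and ?Z = "vadd a ` S"
  have l: "length a = 2*n" using X_len a by simp
  have ZY: "b : ?Z \<longleftrightarrow> b : ?Y & vadd a b : S" for b
  proof
   assume "b : ?Z"
   then obtain s where s: "b = vadd a s" "s : S" by auto
   have ls: "length s = 2*n" using s span_length[OF lens(1)] by (auto simp: S_def)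
   have "vadd a s \<notin> S"
   proof
   assume "vadd a s : S"
   hence "vadd (vadd a s) s : S" using span_vadd[OF lens(1)] s by (simp add: S_def)
   thus False using a l ls by (simp add: vadd_assoc X_def ext_def S_def)
   qed
   moreover have "vadd a s : perp n M" using a s span_sub_perp[OF M] perp_vadd[OF lens(1)] by (auto simp: X_def ext_def S_def)
   moreover have "~ sympl n a s" using perp_span[OF lens(1), of a s] a s sympl_sym by (auto simp: X_def ext_def S_def)
   ultimately show "b : ?Y & vadd a b : S" using s l ls by (auto simp: X_def ext_def S_def sympl_vadd2)
  next
   assume "b : ?Y & vadd a b : S"
   thus "b : ?Z" using l X_len by (auto intro: image_eqI[where x = "vadd a b"])
  qed
  have Ea: "E a = ?Y - ?Z" using ZY mem_E[OF a] by auto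
  have "inj_on (vadd a) S" using l span_length[OF lens(1)] by (intro inj_onI) (metis S_def vadd_cancel)
  hence cZ: "card ?Z = 2^j" using card_span_frames[OF M] by (simp add: card_image S_def)
  have "(\<Sum>b\<in>E a. h a*h b) = (\<Sum>b\<in>?Y. h a*h b) - (\<Sum>b\<in>?Z. h a*h b)"
   unfolding Ea using ZY by (subst sum_diff) auto
  also have "(\<Sum>b\<in>?Z. h a*h b) = (\<Sum>b\<in>?Z. (h a)\<^sup>2)"
   using ZY h_inv[OF a] by (intro sum.cong refl) (auto simp: power2_eq_square)
  also have "... = 2^j*(h a)\<^sup>2" by (simp add: cZ)
  also have "(\<Sum>b\<in>?Y. h a*h b) = (\<Sum>b\<in>X. (1 + chi n a b)/2*(h a*h b))"
   by (subst sum.inter_filter) (auto simp: chi_def intro!: sum.cong)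
  finally show ?thesis .
 qed
 have "(\<Sum>a\<in>X. \<Sum>b\<in>E a. h a*h b) = (\<Sum>a\<in>X. \<Sum>b\<in>X. (1 + chi n a b)/2*(h a*h b)) - 2^j*?N"
  by (simp add: in' sum_subtractf sum_distrib_left)
 also have "(\<Sum>a\<in>X. \<Sum>b\<in>X. (1 + chi n a b)/2*(h a*h b)) =
   ((\<Sum>a\<in>X. \<Sum>b\<in>X. h a*h b) + (\<Sum>a\<in>X. \<Sum>b\<in>X. chi n a b*h a*h b))/2"
  by (simp add: sum.distrib[symmetric] sum_divide_distrib) (intro sum.cong refl, simp add: field_simps)
 also have "(\<Sum>a\<in>X. \<Sum>b\<in>X. h a*h b) = 0" using z by (simp add: sum_distrib_left[symmetric])
 finally have "(\<Sum>a\<in>X. \<Sum>b\<in>E a. h a*h b) <= (2^n/2 - 2^j)*?N"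
  using char_bound by (simp add: algebra_simps)
 also have "... <= c2/6*?N"
 proof (intro mult_right_mono sum_nonneg)
  \<comment> \<open>With t = 2^m the claim becomes 6(2t - 1) <= 8t^2 - 2, that is (t - 1)(8t - 4) >=
    0. Equality holds for m = 0, so the constant 1/6 is dictated by frames of codimension
    two.\<close>
  obtain m where m: "n = j + 2 + m" using j le_Suc_ex by blast
  let ?t = "(2::real)^m" and ?q = "(2::real)^j"
  have t: "?t >= 1" by simp
  have e: "2*n - Suc j = j + 3 + (m + m)" using m by simp
  have "(2::real)^n/2 - 2^j = ?q*(2*?t - 1)" using m by (simp add: power_add algebra_simps)
  moreover have "c2 = ?q*(8*(?t*?t) - 2)" unfolding c2_def e power_add by (simp add: algebra_simps)
  moreover have "6*(2*?t - 1) <= 8*(?t*?t) - 2"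
  proof -
   have "0 <= (?t - 1)*(8*?t - 4)" using t by (intro mult_nonneg_nonneg) linarith+
   thus ?thesis by (simp add: algebra_simps)
  qed
  ultimately show "(2::real)^n/2 - 2^j <= c2/6"
   by (simp add: mult_left_mono)
 qed simp
 finally show ?thesis .
qed

text \<open>Put N' = c2 times the sum of h^2. Symmetry in the plane a, b, a + b gives <H, g> = 3N',
  and \<open>pair_bound\<close> gives <H, H> <= 3N' + 6N'/6 = 4N'. Cauchy-Schwarz then yields N' <=
  4/9 <g, g>.\<close>

lemma local_mean_zero:
 assumes z: "(\<Sum>a\<in>X. h a) = 0"
 shows "c2*(\<Sum>a\<in>X. (h a)\<^sup>2) <= 4/9*(\<Sum>a\<in>X. \<Sum>b\<in>E a. (g a b)\<^sup>2)"
proof -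
 let ?N = "\<Sum>a\<in>X. (h a)\<^sup>2"
 let ?D = "%\<phi>::bits => bits => real. \<Sum>a\<in>X. \<Sum>b\<in>E a. \<phi> a b"
 let ?H = "%a b. h a + h b + h (vadd a b)"
 have aa: "?D (%a b. (h a)\<^sup>2) = c2*?N" using cardE by (simp add: sum_distrib_left)
 have bb: "?D (%a b. (h b)\<^sup>2) = c2*?N" using sum_swap[of "%a b. (h a)\<^sup>2"] aa by simp
 have cc: "?D (%a b. (h (vadd a b))\<^sup>2) = c2*?N" using sum_shift[of "%a b. (h b)\<^sup>2"] bb by simp
 have ac: "?D (%a b. h a*h (vadd a b)) = ?D (%a b. h a*h b)" using sum_shift[of "%a b. h a*h b"] by simp
 have bc: "?D (%a b. h b*h (vadd a b)) = ?D (%a b. h a*h b)"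
  using sum_swap[of "%a b. h a*h (vadd a b)"] ac by (simp add: vadd_comm)
 have ag: "?D (%a b. h a*g a b) = c2*?N"
 proof -
  have "?D (%a b. h a*g a b) = (\<Sum>a\<in>X. h a*(c2*h a))"
   unfolding sum_distrib_left[symmetric] using h_sum by (intro sum.cong) auto
  thus ?thesis by (simp add: sum_distrib_left power2_eq_square mult_ac)
 qed
 have bg: "?D (%a b. h b*g a b) = c2*?N"
  using sum_swap[of "%a b. h a*g a b"] ag g_sym by (simp cong: sum.cong)
 have cg: "?D (%a b. h (vadd a b)*g a b) = c2*?N"
  using sum_shift[of "%a b. h b*g a b"] bg g_add by (simp cong: sum.cong)
 have HH: "?D (%a b. (?H a b)\<^sup>2) = 3*(c2*?N) + 6*?D (%a b. h a*h b)"
 proof -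
  have "(?H a b)\<^sup>2 = (h a)\<^sup>2 + (h b)\<^sup>2 + (h (vadd a b))\<^sup>2 + 2*(h a*h b) + 2*(h a*h (vadd a b)) + 2*(h b*h (vadd a b))" for a b
   by (simp add: power2_eq_square algebra_simps)
  hence "?D (%a b. (?H a b)\<^sup>2) = ?D (%a b. (h a)\<^sup>2) + ?D (%a b. (h b)\<^sup>2) + ?D (%a b. (h (vadd a b))\<^sup>2) +
   2*?D (%a b. h a*h b) + 2*?D (%a b. h a*h (vadd a b)) + 2*?D (%a b. h b*h (vadd a b))"
   by (simp only: sum.distrib sum_distrib_left[symmetric])
  thus ?thesis unfolding aa bb cc ac bc by simp
 qed
 have Hg: "?D (%a b. ?H a b*g a b) = 3*(c2*?N)"
  using ag bg cg by (simp add: distrib_right sum.distrib)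
 \<comment> \<open>The multiple 4/3 = 4N'/3N' of \<open>g\<close> is the optimal one when <H, H> =
   4N'.\<close>
 have "0 <= ?D (%a b. (?H a b - 4/3*g a b)\<^sup>2)" by (intro sum_nonneg) auto
 also have "... = ?D (%a b. (?H a b)\<^sup>2) - 8/3*?D (%a b. ?H a b*g a b) + 16/9*?D (%a b. (g a b)\<^sup>2)"
 proof -
  have e: "(x - 4/3*y)\<^sup>2 = x\<^sup>2 - 8/3*(x*y) + 16/9*y\<^sup>2" for x y::real
   by (simp add: power2_eq_square algebra_simps)
  show ?thesis unfolding e by (simp only: sum.distrib sum_subtractf sum_distrib_left[symmetric])
 qed
 finally show ?thesis using HH Hg pair_bound[OF z] by simp
qed

end

section \<open>Averages and variances\<close>

lemma avg_const [simp]: "finite X ==> X ~= {} ==> avg X (%_. c) = c" by (simp add: avg_def)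
lemma avg_add: "avg X (%x. f x + g x) = avg X f + avg X g" by (simp add: avg_def sum.distrib add_divide_distrib)
lemma avg_diff: "avg X (%x. f x - g x) = avg X f - avg X g" by (simp add: avg_def sum_subtractf diff_divide_distrib)
lemma avg_mult: "avg X (%x. c*f x) = c*avg X f" by (simp add: avg_def sum_distrib_left)
lemma avg_mono: "(!!x. x : X ==> f x <= g x) ==> avg X f <= avg X g" by (simp add: avg_def divide_right_mono sum_mono)
lemma avg_cong: "(!!x. x : X ==> f x = g x) ==> avg X f = avg X g" by (simp add: avg_def)

lemma avg_var: "finite X ==> X ~= {} ==> avg X (%x. (f x - m)\<^sup>2) = avg X (%x. (f x)\<^sup>2) - 2*m*avg X f + m\<^sup>2"
proof -
 assume X: "finite X" "X ~= {}"
 have "avg X (%x. (f x - m)\<^sup>2) = avg X (%x. (f x)\<^sup>2 - 2*m*f x + m\<^sup>2)"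
  by (intro avg_cong) (simp add: power2_eq_square algebra_simps)
 thus ?thesis using X by (simp add: avg_add avg_diff avg_mult)
qed

lemma ext_nonempty: "M : frames n j ==> j < n ==> ext n M ~= {}"
proof -
 assume M: "M : frames n j" "j < n"
 have "(2::nat)^j < 2^(2*n - j)" using M by (intro power_strict_increasing) auto
 hence "card (ext n M) ~= 0" using card_ext[OF M(1)] M by simp
 thus ?thesis by force
qed

lemma down_diff: "M : frames n j ==> j < n ==> down n (%M. f M - c) M = down n f M - c"
 unfolding down_def by (simp add: avg_diff ext_nonempty)

abbreviation av :: "nat => (bits => real) => real" where "av m == avg (vecs_of m)"

text \<open>The local bound is applied to \<open>f - m\<close>, whose mean over the link of
  \<open>M\<close> vanishes. In terms of variances, averaging out the last vector of a two-step
  extension leaves at most 4/9 of the variance.\<close>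

lemma local_estimate:
 assumes M: "M : frames n j" and j: "j + 2 <= n" and f: "span_inv n (Suc (Suc j)) f"
 defines "m == down n (down n f) M"
 shows "down n (%M. (down n f M)\<^sup>2) M - m\<^sup>2 <= 4/9*(down n (down n (%M. (f M)\<^sup>2)) M - m\<^sup>2)"
proof -
 define f' where "f' M = f M - m" for M
 have "span_inv n (Suc (Suc j)) f'"
  unfolding span_inv_def f'_def
 proof (intro ballI impI)
  fix N N' assume "N : frames n (Suc (Suc j))" "N' : frames n (Suc (Suc j))" "sp2 n N = sp2 n N'"
  hence "f N = f N'" using f unfolding span_inv_def by blast
  thus "f N - m = f N' - m" by simp
 qed
 then interpret link n j M f' using M j by unfold_locales
 have X: "X ~= {}" using ext_nonempty[OF M] j by (simp add: X_def)
 have E: "E a ~= {}" if "a : X" for a using ext_nonempty[OF aM[OF that]] j by (simp add: E_def)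
 have h: "h a = down n f (a # M) - m" if "a : X" for a
  unfolding h_def f'_def using down_diff[OF aM[OF that]] j by simp
 have m: "avg X (%a. down n f (a # M)) = m" by (simp add: m_def down_def[of n "down n f"] X_def)
 have "avg X h = avg X (%a. down n f (a # M) - m)" by (intro avg_cong h)
 also have "... = 0" using X m by (simp add: avg_diff)
 finally have "(\<Sum>a\<in>X. h a) = 0" using cardX c_pos by (simp add: avg_def)
 from local_mean_zero[OF this] have le: "c2*(\<Sum>a\<in>X. (h a)\<^sup>2) <= 4/9*(\<Sum>a\<in>X. \<Sum>b\<in>E a. (g a b)\<^sup>2)" .
 have l: "down n (%M. (down n f M)\<^sup>2) M - m\<^sup>2 = (\<Sum>a\<in>X. (h a)\<^sup>2)/c1"
 proof -
  have "(\<Sum>a\<in>X. (h a)\<^sup>2)/c1 = avg X (%a. (down n f (a # M) - m)\<^sup>2)"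
   using h cardX by (simp add: avg_def)
  also have "... = avg X (%a. (down n f (a # M))\<^sup>2) - m\<^sup>2"
   using avg_var[of X "%a. down n f (a # M)" m] X m by (simp add: power2_eq_square)
  finally show ?thesis by (simp add: down_def[of n "%M. (down n f M)\<^sup>2"] X_def)
 qed
 have r: "down n (down n (%M. (f M)\<^sup>2)) M - m\<^sup>2 = (\<Sum>a\<in>X. \<Sum>b\<in>E a. (g a b)\<^sup>2)/(c1*c2)"
 proof -
  have "(\<Sum>a\<in>X. \<Sum>b\<in>E a. (g a b)\<^sup>2)/(c1*c2) = avg X (%a. avg (E a) (%b. (f (b # a # M) - m)\<^sup>2))"
   using cardE cardX by (simp add: avg_def g_def f'_def sum_divide_distrib mult.commute)
  also have "... = avg X (%a. avg (E a) (%b. (f (b # a # M))\<^sup>2) - 2*m*down n f (a # M) + m\<^sup>2)"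
   using E by (intro avg_cong) (simp add: avg_var down_def E_def)
  also have "... = avg X (%a. avg (E a) (%b. (f (b # a # M))\<^sup>2)) - m\<^sup>2"
   using X by (simp add: avg_add avg_diff avg_mult m power2_eq_square)
  finally show ?thesis by (simp add: down_def X_def E_def)
 qed
 show ?thesis unfolding l r using le c_pos by (simp add: field_simps)
qed

fun downs::"nat => (bits list => real) => nat => bits list => real" where
 "downs n f 0 = f" | "downs n f (Suc i) = down n (downs n f i)"

text \<open>\<open>V i\<close> is the second moment after the last i vectors have been averaged out.
  The local bound compares consecutive losses: each step loses at least 5/4 of what the next one
  loses. Summation over the chain down to the empty frame, where only the mean zero is left, turns
  this into a bound on the first step.\<close>

lemma hyperplane_contraction:
 assumes n: "n >= 1" and f: "span_inv n n f" and z: "avg (lag n) f = 0"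
 shows "avg (frames n (n - 1)) (%M. (down n f M)\<^sup>2) <= 4/5*avg (lag n) (%M. (f M)\<^sup>2)"
proof -
 define V where "V i = avg (frames n (n - i)) (%M. (downs n f i M)\<^sup>2)" for i
 have inv: "span_inv n (n - i) (downs n f i)" if "i <= n" for i using that
 proof (induction i)
  case (Suc i)
  hence "Suc (n - Suc i) = n - i" by simp
  thus ?case using Suc span_inv_down[of n "n - Suc i" "downs n f i"] by simp
 qed (use f in auto)
 have mean: "avg (frames n (n - i)) (downs n f i) = 0" if "i <= n" for i using that
 proof (induction i)
  case (Suc i)
  hence "Suc (n - Suc i) = n - i" by simp
  thus ?case using Suc avg_frames_Suc[of "n - Suc i" n "downs n f i"] by simp
 qed (use z in auto)
 have step: "V (Suc i) - V (Suc (Suc i)) <= 4/9*(V i - V (Suc (Suc i)))" if i: "Suc (Suc i) <= n" for i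
 proof -
  define j where "j = n - Suc (Suc i)"
  have j: "n - Suc i = Suc j" "n - i = Suc (Suc j)" "j + 2 <= n" using i by (auto simp: j_def)
  let ?F = "downs n f i"
  have "avg (frames n j) (%M. down n (%M. (down n ?F M)\<^sup>2) M - (down n (down n ?F) M)\<^sup>2)
   <= avg (frames n j) (%M. 4/9*(down n (down n (%M. (?F M)\<^sup>2)) M - (down n (down n ?F) M)\<^sup>2))"
   using inv[of i] i j by (intro avg_mono local_estimate) auto
  moreover have "V (Suc i) = avg (frames n j) (down n (%M. (down n ?F M)\<^sup>2))"
   unfolding V_def j using j by (simp add: avg_frames_Suc)
  moreover have "V i = avg (frames n j) (down n (down n (%M. (?F M)\<^sup>2)))"
   unfolding V_def j using j by (simp add: avg_frames_Suc)
  moreover have "V (Suc (Suc i)) = avg (frames n j) (%M. (down n (down n ?F) M)\<^sup>2)"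
   by (simp add: V_def j_def)
  ultimately show ?thesis by (simp only: avg_diff avg_mult)
 qed
 have "V i - V (Suc i) >= 5/4*(V (Suc i) - V (Suc (Suc i)))" if "Suc (Suc i) <= n" for i
  using step[OF that] by simp
 hence "V 0 - V i >= 5/4*(V 1 - V (Suc i))" if "Suc i <= n" for i
  using that by (induction i) (auto, force)
 \<comment> \<open>Telescoped inequality for the whole chain; with V n = 0 it reads 5/4 V 1 <= V
   0.\<close>
 from this[of "n - 1"] n have "5/4*(V 1 - V n) <= V 0 - V (n - 1)" by simp
 also have "V n = 0" using mean[of n] by (simp add: V_def avg_def)
 also have "V 0 - V (n - 1) <= V 0" by (simp add: V_def avg_def sum_nonneg)
 finally show ?thesis by (simp add: V_def)
qed

subsection \<open>Symplectic maps\<close>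

definition sp::"nat => (bits => bits) => bool" where
 "sp n g \<longleftrightarrow> (ALL c. length c = 2*n --> length (g c) = 2*n) &
   (ALL c d. length c = 2*n --> length d = 2*n --> g (vadd c d) = vadd (g c) (g d) & sympl n (g c) (g d) = sympl n c d)"

lemma sp_length: "sp n g ==> length c = 2*n ==> length (g c) = 2*n"
 and sp_vadd: "sp n g ==> length c = 2*n ==> length d = 2*n ==> g (vadd c d) = vadd (g c) (g d)"
 and sp_sympl: "sp n g ==> length c = 2*n ==> length d = 2*n ==> sympl n (g c) (g d) = sympl n c d"
 by (auto simp: sp_def)

lemma sp_zeros: assumes "sp n g" shows "g (zeros (2*n)) = zeros (2*n)"
proof -
 have "g (zeros (2*n)) = vadd (g (zeros (2*n))) (g (zeros (2*n)))"
  using sp_vadd[OF assms, of "zeros (2*n)" "zeros (2*n)"] by simp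
 thus ?thesis using sp_length[OF assms, of "zeros (2*n)"] by simp
qed

text \<open>If c and d had the same image, c + d would be mapped to zero although the form is
  preserved and nondegenerate.\<close>

lemma sp_inj: assumes "sp n g" shows "inj_on g (vecs_of (2*n))"
proof (rule inj_onI)
 fix c d assume cd: "c : vecs_of (2*n)" "d : vecs_of (2*n)" "g c = g d"
 have "vadd c d = zeros (2*n)"
 proof (rule ccontr)
  assume "vadd c d ~= zeros (2*n)"
  then obtain v where v: "length v = 2*n" "sympl n (vadd c d) v" using sympl_nondeg[of "vadd c d" n] cd by auto
  have "sympl n (g (vadd c d)) (g v)" using sp_sympl[OF assms, of "vadd c d" v] v cd by simp
  moreover have "g (vadd c d) = zeros (2*n)" using sp_vadd[OF assms, of c d] sp_length[OF assms, of d] cd by simp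
  ultimately show False by simp
 qed
 thus "c = d" using vadd_eq_zeros[of c "2*n" d] cd by simp
qed

lemma sp_bij: assumes "sp n g" shows "bij_betw g (vecs_of (2*n)) (vecs_of (2*n))"
 unfolding bij_betw_def
proof
 show "g ` vecs_of (2*n) = vecs_of (2*n)"
  using sp_length[OF assms] sp_inj[OF assms] by (intro endo_inj_surj) (auto simp: finite_len)
qed (rule sp_inj[OF assms])

lemma sp_mat_vec: "sp n g ==> colen (2*n) M ==> mx n (map g M) x = g (mx n M x)"
proof (induction M arbitrary: x)
 case Nil
 thus ?case by (simp add: sp_zeros)
next
 case (Cons c M)
 thus ?case by (cases x) (auto simp: sp_zeros sp_vadd)
qed

lemma sp_span: "sp n g ==> colen (2*n) M ==> sp2 n (map g M) = g ` sp2 n M"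
 by (auto simp: span_def sp_mat_vec)

lemma sp_full_rank:
 assumes "sp n g" "colen (2*n) M" shows "full_rank (2*n) (map g M) \<longleftrightarrow> full_rank (2*n) M"
proof -
 have "g v = zeros (2*n) \<longleftrightarrow> v = zeros (2*n)" if "length v = 2*n" for v
  using inj_onD[OF sp_inj[OF assms(1)], of v "zeros (2*n)"] sp_zeros[OF assms(1)] that by auto
 thus ?thesis using assms by (simp add: full_rank_zeros sp_mat_vec)
qed

lemma sp_isotropic: "sp n g ==> colen (2*n) M ==> isotropic n (map g M) \<longleftrightarrow> isotropic n M"
 by (auto simp: isotropic_iff sp_sympl)

lemma sp_is_mat: "sp n g ==> is_mat (2*n) j M ==> is_mat (2*n) j (map g M)"
 by (auto simp: is_mat_def sp_length)

lemma sp_frames: "sp n g ==> M : frames n j ==> map g M : frames n j"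
 using frames_len[of M n j] by (auto simp: frames_def sp_isotropic sp_full_rank sp_is_mat)

lemma sp_map_inj: "sp n g ==> inj_on (map g) {M. ALL c:set M. length c = 2*n}"
 by (rule inj_onI, rule map_inj_on) (auto intro: inj_on_subset[OF sp_inj])

lemma sp_frames_bij: "sp n g ==> bij_betw (map g) (frames n j) (frames n j)"
proof -
 assume g: "sp n g"
 have i: "inj_on (map g) (frames n j)"
  by (rule inj_on_subset[OF sp_map_inj[OF g]]) (use frames_len in auto)
 show ?thesis unfolding bij_betw_def using i sp_frames[OF g] endo_inj_surj[OF finite_frames, of "map g" n j] by auto
qed

lemma sp_avg: "sp n g ==> avg (frames n j) (%A. f (map g A)) = avg (frames n j) f"
 unfolding avg_def using sum.reindex_bij_betw[OF sp_frames_bij, of n g f j] by simp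

lemma span_inv_sp:
 assumes g: "sp n g" and f: "span_inv n j f" shows "span_inv n j (%A. f (map g A))"
 unfolding span_inv_def
proof (intro ballI impI)
 fix M M' assume "M : frames n j" "M' : frames n j" "sp2 n M = sp2 n M'"
 moreover from this have "sp2 n (map g M) = sp2 n (map g M')"
  using sp_span[OF g, of M] sp_span[OF g, of M'] frames_len[of M n j] frames_len[of M' n j] by simp
 ultimately show "f (map g M) = f (map g M')"
  using f sp_frames[OF g] unfolding span_inv_def by blast
qed

lemma sp_comp: "sp n g ==> sp n g' ==> sp n (g \<circ> g')"
 by (simp add: sp_def)

subsection \<open>The transvection walk\<close>

lemma dotp_append: "length a = length c ==> dotp (a @ b) (c @ d) = (dotp a c ~= dotp b d)"
 by (induction a c rule: list_induct2) (auto)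

lemma tvf_sympl: "length c = 2*n ==> length u = 2*n ==> tvf n u c = (if sympl n c u then vadd u c else c)"
proof -
 assume l: "length c = 2*n" "length u = 2*n"
 have "dotp (take n c @ drop n c) (drop n u @ take n u) = sympl n c u"
  using l by (subst dotp_append) (auto simp: sympl_def dotp_comm[of "drop n c"])
 thus ?thesis by (simp add: tvf_def)
qed

lemma sp_tvf: assumes "length u = 2*n" shows "sp n (tvf n u)"
 unfolding sp_def
proof (intro conjI allI impI)
 fix c d::"bits" assume l: "length c = 2*n" "length d = 2*n"
 have "vadd (vadd u c) (vadd u d) = vadd c d"
  using assms l by (metis vadd_assoc vadd_cancel vadd_comm length_vadd min.idem)
 thus "tvf n u (vadd c d) = vadd (tvf n u c) (tvf n u d)"
  using assms l by (auto simp: tvf_sympl sympl_vadd vadd_ac)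
 show "sympl n (tvf n u c) (tvf n u d) = sympl n c d"
  using assms l by (auto simp: tvf_sympl sympl_vadd sympl_vadd2 sympl_sym[of n u])
qed (use assms in simp)

lemma tvf_tvf: "length c = 2*n ==> length u = 2*n ==> tvf n u (tvf n u c) = c"
 by (auto simp: tvf_sympl sympl_vadd)

lemma tvf_zeros: "length c = 2*n ==> tvf n (zeros (2*n)) c = c"
 by (simp add: tvf_sympl)

abbreviation tv::"nat => bits => bits list => bits list" where "tv n u A == map (tvf n u) A"

lemma tv_tv: "A : frames n j ==> length u = 2*n ==> tv n u (tv n u A) = A"
 using frames_len[of A n j] by (auto simp: tvf_tvf comp_def intro: map_idI)

section \<open>The Dirichlet form of the transvections\<close>

definition dir::"nat => (bits list => real) => bits list => bits => real" where
 "dir n f A u = (f A - f (tv n u A))\<^sup>2"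

lemma dir_span: 
 assumes "span_inv n n f" "A : lag n" "A' : lag n" "sp2 n A = sp2 n A'" "length u = 2*n"
 shows "dir n f A u = dir n f A' u"
 using assms span_inv_sp[OF sp_tvf assms(1), of u] unfolding span_inv_def dir_def by metis

text \<open>Records the action of the transvection along \<open>u\<close> on a frame:
  \<open>u\<close> is added to exactly those columns whose bit is set.\<close>

definition sig::"nat => bits list => bits => bits" where
 "sig n A u = map (%c. sympl n c u) A"

abbreviation sdir :: "nat => (bits list => real) => bits => real" where
 "sdir n f w == (\<Sum>A\<in>lag n. \<Sum>u\<in>{u\<in>vecs_of (2*n). sig n A u = w}. dir n f A u)"

text \<open>A change of basis \<open>b\<close> inside each Lagrangian leaves the energy of every
  direction unchanged, because \<open>f\<close> sees only spans, but it changes the signature of the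
  direction. So the energies of two signatures related by \<open>b\<close> agree.\<close>

lemma reframe:
 assumes f: "span_inv n n f"
  and b: "!!A. A : lag n ==> length (b A) = length A & set (b A) \<subseteq> sp2 n A & set A \<subseteq> sp2 n (b A) & b (b A) = A"
  and s: "!!A u. A : lag n ==> length u = 2*n ==> sig n (b A) u = w' \<longleftrightarrow> sig n A u = w"
 shows "sdir n f w =
  sdir n f w'"
proof -
 have bf: "b A : lag n & sp2 n (b A) = sp2 n A" if "A : lag n" for A
  using frames_span_eq[OF that, of "b A"] b[OF that] frames_len[OF that] by auto
 have "sdir n f w =
   (\<Sum>A\<in>lag n. \<Sum>u\<in>{u:vecs_of (2*n). sig n (b A) u = w'}. dir n f (b A) u)"
 proof (rule sum.cong[OF refl])
  fix A assume A: "A : lag n"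
  show "(\<Sum>u\<in>{u:vecs_of (2*n). sig n A u = w}. dir n f A u) = (\<Sum>u\<in>{u:vecs_of (2*n). sig n (b A) u = w'}. dir n f (b A) u)"
   using s[OF A] dir_span[OF f A, of "b A"] bf[OF A] by (intro sum.cong) auto
 qed
 also have "... = sdir n f w'"
  by (rule sum.reindex_bij_witness[where i = b and j = b]) (use b bf in auto)
 finally show ?thesis .
qed

definition e1::"nat => bits" where "e1 n = True # zeros (n - 1)"

definition shear::"bits => bits list => bits list" where
 "shear w A = hd A # map (%(b, c). if b then vadd (hd A) c else c) (zip (tl w) (tl A))"

text \<open>All nonzero signatures carry the same energy. If the first bit is set, adding the first
  column to the other columns with a set bit reduces the signature to \<open>e1\<close>; otherwise
  some column with a set bit is first added to the head. Both changes of basis are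
  involutions.\<close>

lemma sig_sum:
 assumes n: "n >= 1" and f: "span_inv n n f" and w: "length w = n" "w ~= zeros n"
 shows "sdir n f w =
  sdir n f (e1 n)"
proof -
 have main: "sdir n f w =
  sdir n f (e1 n)"
  if w: "length w = n" "hd w" for w
 proof (rule reframe[OF f, where b = "shear w"])
  obtain ws where ws: "w = True # ws" "length ws = n - 1" using w n by (cases w) auto
  fix A assume A: "A : lag n"
  then obtain a M where AM: "A = a # M" "length M = n - 1" using frames_len[OF A] n by (cases A) auto
  have l: "length a = 2*n" "colen (2*n) M" "colen (2*n) A" using frames_len[OF A] AM by auto
  define M' where "M' = map (%(b, c). if b then vadd a c else c) (zip ws M)"
  have sh: "shear w A = a # M'" by (auto simp: shear_def AM ws M'_def)
  have nth: "M' ! i = (if ws ! i then vadd a (M ! i) else M ! i)" if "i < n - 1" for i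
   using that ws AM by (simp add: M'_def)
  have lM': "length M' = n - 1" using ws AM by (simp add: M'_def)
  have lM'': "colen (2*n) (shear w A)"
   using l by (auto simp: sh M'_def dest!: set_zip_rightD split: if_splits)
  have s1: "c : sp2 n A" if "c : set (a # M)" for c using col_in_span[OF l(3)] that AM by auto
  have s2: "c : sp2 n (shear w A)" if "c : set (a # M')" for c using col_in_span[OF lM''] that sh by auto
  have "set M' \<subseteq> sp2 n A"
   using s1 span_vadd[OF l(3)] by (auto simp: M'_def dest!: set_zip_rightD split: if_splits)
  moreover have "set M \<subseteq> sp2 n (shear w A)"
  proof
   fix c assume "c : set M"
   then obtain i where i: "i < n - 1" "c = M ! i" using AM by (auto simp: in_set_conv_nth)
   have "c = M' ! i | c = vadd a (M' ! i)" using nth[OF i(1)] i l AM by auto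
   moreover have "M' ! i : set (a # M')" using i lM' by simp
   ultimately show "c : sp2 n (shear w A)" using s2 span_vadd[OF lM''] by auto
  qed
  moreover have "shear w (shear w A) = A"
  proof -
   have "map (%(b, c). if b then vadd a c else c) (zip ws M') = M"
   using nth lM' AM ws l by (intro nth_equalityI) auto
   moreover have "shear w (a # N) = a # map (%(b, c). if b then vadd a c else c) (zip ws N)" for N
   by (auto simp: shear_def ws)
   ultimately show ?thesis unfolding sh unfolding AM(1) by simp
  qed
  ultimately show "length (shear w A) = length A & set (shear w A) \<subseteq> sp2 n A & set A \<subseteq> sp2 n (shear w A) & shear w (shear w A) = A"
   using s1 s2 lM' AM(2) unfolding sh unfolding AM(1) by auto
  fix u::"bits" assume u: "length u = 2*n"
  have e: "sig n A u = w \<longleftrightarrow> sympl n a u & (ALL i<n-1. sympl n (M ! i) u = ws ! i)"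
  proof -
   have "map (%c. sympl n c u) M = ws \<longleftrightarrow> (ALL i<n-1. sympl n (M ! i) u = ws ! i)"
   using AM(2) ws(2) by (auto simp: list_eq_iff_nth_eq)
   thus ?thesis by (simp add: sig_def AM(1) ws(1))
  qed
  have e': "sig n (shear w A) u = e1 n \<longleftrightarrow> sympl n a u & (ALL i<n-1. ~ sympl n (M' ! i) u)"
  proof -
   have "map (%c. sympl n c u) M' = zeros (n - 1) \<longleftrightarrow> (ALL i<n-1. ~ sympl n (M' ! i) u)"
   using lM' by (auto simp: list_eq_iff_nth_eq zeros_def)
   thus ?thesis by (simp add: sig_def sh e1_def)
  qed
  have "~ sympl n (M' ! i) u \<longleftrightarrow> sympl n (M ! i) u = ws ! i" if "i < n - 1" "sympl n a u" for i
   using nth[OF that(1)] that l AM u by (auto simp: sympl_vadd)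
  thus "sig n (shear w A) u = e1 n \<longleftrightarrow> sig n A u = w" unfolding e e' by auto
 qed
 show ?thesis
 proof (cases "hd w")
  case False
  then obtain ws where ws: "w = False # ws" "length ws = n - 1" using w n by (cases w) auto
  have "ws ~= zeros (n - 1)" using w ws n by (cases n) auto
  then obtain i where i: "i < n - 1" "ws ! i" using ws by (auto simp: zeros_def list_eq_iff_nth_eq)
  \<comment> \<open>Column i of the tail has a set bit, so adding it to the head sets the first
    bit.\<close>
  let ?b = "%A. vadd (hd A) (tl A ! i) # tl A"
  have "sdir n f w =
   sdir n f (True # ws)"
  proof (rule reframe[OF f, where b = ?b])
   fix A assume A: "A : lag n"
   then obtain a M where AM: "A = a # M" "length M = n - 1" using frames_len[OF A] n by (cases A) auto
   have l: "length a = 2*n" "colen (2*n) M" "colen (2*n) A" using frames_len[OF A] AM by auto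
   have Mi: "M ! i : set M" "length (M ! i) = 2*n" using i AM l by auto
   have l': "colen (2*n) (?b A)" using l AM Mi by auto
   have "vadd a (M ! i) : sp2 n A" using span_vadd[OF l(3)] col_in_span[OF l(3)] AM Mi by auto
   moreover have "vadd (M ! i) (vadd a (M ! i)) : sp2 n (?b A)"
   by (rule span_vadd[OF l']; rule col_in_span[OF l']) (use AM Mi in auto)
   moreover have "vadd (M ! i) (vadd a (M ! i)) = a" using l Mi by (metis vadd_cancel vadd_comm)
   moreover have "vadd (vadd a (M ! i)) (M ! i) = a" using l Mi by (simp add: vadd_assoc)
   ultimately show "length (?b A) = length A & set (?b A) \<subseteq> sp2 n A & set A \<subseteq> sp2 n (?b A) & ?b (?b A) = A"
   using col_in_span[OF l(3)] col_in_span[OF l'] AM by auto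
   fix u::"bits" assume u: "length u = 2*n"
   have "sig n (?b A) u = True # ws \<longleftrightarrow> sympl n (vadd a (M ! i)) u & sig n M u = ws" by (simp add: sig_def AM)
   moreover have "sig n A u = w \<longleftrightarrow> ~ sympl n a u & sig n M u = ws" by (simp add: sig_def AM ws)
   moreover have "sympl n (M ! i) u" if "sig n M u = ws"
   using i that AM by (auto simp: sig_def)
   ultimately show "sig n (?b A) u = True # ws \<longleftrightarrow> sig n A u = w" using l Mi u by (auto simp: sympl_vadd)
  qed
  also have "... = sdir n f (e1 n)"
   using ws n by (intro main) auto
  finally show ?thesis .
 qed (use main w in simp)
qed

lemma sum_diff_squares:
 fixes f::"'a => real"
 assumes "finite X" "X ~= {}"
 shows "(\<Sum>x\<in>X. \<Sum>y\<in>X. (f x - f y)\<^sup>2) = 2*(real (card X))\<^sup>2*(avg X (%x. (f x)\<^sup>2) - (avg X f)\<^sup>2)"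
proof -
 have "(\<Sum>x\<in>X. \<Sum>y\<in>X. (f x - f y)\<^sup>2) = (\<Sum>x\<in>X. \<Sum>y\<in>X. (f x)\<^sup>2 + (f y)\<^sup>2 - 2*f x*f y)"
  by (simp add: power2_diff)
 also have "... = 2*real (card X)*(\<Sum>x\<in>X. (f x)\<^sup>2) - 2*(sum f X * sum f X)"
  by (simp add: sum.distrib sum_subtractf sum_distrib_left[symmetric] sum_distrib_right[symmetric] mult.assoc)
 also have "... = 2*(real (card X))\<^sup>2*((\<Sum>x\<in>X. (f x)\<^sup>2)/card X - (sum f X/card X)\<^sup>2)"
 proof -
  have "2*c*Q - 2*(F*F) = 2*c\<^sup>2*(Q/c - (F/c)\<^sup>2)" if "c ~= 0" for c Q F::real
   using that by (simp add: field_simps power2_eq_square)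
  thus ?thesis using assms by simp
 qed
 finally show ?thesis by (simp add: avg_def)
qed

lemma lagr_perp: assumes "A : lag n" shows "perp n A = sp2 n A"
proof -
 have "card (sp2 n A) = card (perp n A)"
  using card_span_frames[OF assms] card_perp_frames[OF assms] by (simp add: mult_2)
 thus ?thesis using span_sub_perp[OF assms] card_subset_eq[of "perp n A" "sp2 n A"] by auto
qed

text \<open>A direction of signature \<open>e1\<close> changes only the head, so it resamples the
  Lagrangian among those containing the tail. Its energy is at least 2C^2 times the variance over
  the C = 3 * 2^m possible heads. As \<open>hyperplane_contraction\<close> leaves at most 4/5 of the
  second moment to the tail, that variance is on average at least 1/5 of it, and 2C/5 = 3/5 *
  2^n.\<close>

lemma dirichlet_e1:
 assumes n: "n >= 1" and f: "span_inv n n f" and z: "avg (lag n) f = 0"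
 shows "3/5*2^n*(\<Sum>A\<in>lag n. (f A)\<^sup>2) <= sdir n f (e1 n)"
proof -
 obtain m where m: "n = Suc m" using n by (cases n) auto
 define C where "C = (3::real)*2^m"
 have cE: "real (card (ext n M)) = C" if M: "M : frames n m" for M
 proof -
  have "card (ext n M) = 2^(m + 2) - 2^m" using card_ext[OF M] m by (simp add: mult_2)
  also have "... = 3*2^m" by simp
  finally show ?thesis by (simp add: C_def)
 qed
 have loc: "2*C\<^sup>2*(down n (%A. (f A)\<^sup>2) M - (down n f M)\<^sup>2) <=
   (\<Sum>v\<in>ext n M. \<Sum>u\<in>{u:vecs_of (2*n). sig n (v # M) u = e1 n}. dir n f (v # M) u)" if M: "M : frames n m" for M
 proof -
  have "2*C\<^sup>2*(down n (%A. (f A)\<^sup>2) M - (down n f M)\<^sup>2) = (\<Sum>v\<in>ext n M. \<Sum>v'\<in>ext n M. (f (v # M) - f (v' # M))\<^sup>2)"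
   using sum_diff_squares[of "ext n M" "%v. f (v # M)"] ext_nonempty[OF M] m cE[OF M] by (simp add: down_def)
  also have "... <= (\<Sum>v\<in>ext n M. \<Sum>u\<in>{u:vecs_of (2*n). sig n (v # M) u = e1 n}. dir n f (v # M) u)"
  proof (rule sum_mono)
   fix v assume v: "v : ext n M"
   have A: "v # M : lag n" using M v m by (simp add: frames_Cons)
   have l: "length v = 2*n" "colen (2*n) M" "length M = m" using frames_len[OF A] frames_len[OF M] by auto
   \<comment> \<open>Orthogonal heads give the same Lagrangian: each lies in the complement of the
     other frame, which equals its span. Only pairs with symplectic product one contribute.\<close>
   have zero: "f (v' # M) = f (v # M)" if v': "v' : ext n M" "~ sympl n v v'" for v'
   proof -
   have A': "v' # M : lag n" using M v' m by (simp add: frames_Cons)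
   have l': "colen (2*n) (v' # M)" "colen (2*n) (v # M)" using frames_len[OF A'] frames_len[OF A] by auto
   have "v' : perp n (v # M)" using v' by (auto simp: ext_def perp_def)
   moreover have "v : perp n (v' # M)" using v v' by (auto simp: ext_def perp_def sympl_sym)
   ultimately have "v' : sp2 n (v # M)" "v : sp2 n (v' # M)" using lagr_perp A A' by auto
   hence "sp2 n (v' # M) = sp2 n (v # M)"
   using frames_span_eq[OF A, of "v' # M"] l(3) m col_in_span[OF l'(1)] col_in_span[OF l'(2)] by auto
   thus ?thesis using f A A' unfolding span_inv_def by blast
   qed
   have eq: "(f (v # M) - f (v' # M))\<^sup>2 = dir n f (v # M) (vadd v v')" and mem: "sig n (v # M) (vadd v v') = e1 n"
   if v': "v' : ext n M" "sympl n v v'" for v'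
   proof -
   have l': "length v' = 2*n" using v' by (simp add: ext_def perp_def)
   have s: "sympl n v (vadd v v')" "ALL c:set M. ~ sympl n c (vadd v v')"
   using v v' l l' by (auto simp: sympl_vadd2 ext_def perp_def)
   have "tvf n (vadd v v') v = v'" using l l' s(1) by (simp add: tvf_sympl vadd_comm[of "vadd v v'" v])
   moreover have "tv n (vadd v v') M = M" using l l' s(2) by (intro map_idI) (simp add: tvf_sympl)
   ultimately show "(f (v # M) - f (v' # M))\<^sup>2 = dir n f (v # M) (vadd v v')" by (simp add: dir_def)
   show "sig n (v # M) (vadd v v') = e1 n"
   using s l m by (auto simp: sig_def e1_def zeros_def intro: map_replicate_const[symmetric] nth_equalityI)
   qed
   have "(\<Sum>v'\<in>ext n M. (f (v # M) - f (v' # M))\<^sup>2) = (\<Sum>v'\<in>{v':ext n M. sympl n v v'}. (f (v # M) - f (v' # M))\<^sup>2)"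
   using zero by (intro sum.mono_neutral_right) auto
   also have "... = (\<Sum>u\<in>vadd v ` {v':ext n M. sympl n v v'}. dir n f (v # M) u)"
   proof (subst sum.reindex)
   show "inj_on (vadd v) {v':ext n M. sympl n v v'}"
   by (rule inj_on_inverseI[of _ "vadd v"]) (simp add: l ext_def perp_def)
   qed (use eq in simp)
   also have "... <= (\<Sum>u\<in>{u:vecs_of (2*n). sig n (v # M) u = e1 n}. dir n f (v # M) u)"
   proof (rule sum_mono2)
   show "vadd v ` {v':ext n M. sympl n v v'} \<subseteq> {u:vecs_of (2*n). sig n (v # M) u = e1 n}"
   using mem l by (auto simp: ext_def perp_def)
   qed (simp_all add: finite_len dir_def)
   finally show "(\<Sum>v'\<in>ext n M. (f (v # M) - f (v' # M))\<^sup>2) <= (\<Sum>u\<in>{u:vecs_of (2*n). sig n (v # M) u = e1 n}. dir n f (v # M) u)" .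
  qed
  finally show ?thesis .
 qed
 let ?I = "real (card (lag n))" and ?I' = "real (card (frames n m))"
 have pos: "?I > 0" "?I' > 0" using card_frames_pos[of n n] card_frames_pos[of m n] m by auto
 have II: "?I = ?I'*C" 
 proof -
  have "(2::real)^(2*n - m) - 2^m = C"
  proof -
   have "2*n - m = m + 2" using m by simp
   thus ?thesis by (simp add: C_def power_add)
  qed
  thus ?thesis using card_frames_Suc[of m n] m by (metis le_SucI order_refl)
 qed
 have "avg (frames n m) (%M. (down n f M)\<^sup>2) <= 4/5*avg (lag n) (%M. (f M)\<^sup>2)"
  using hyperplane_contraction[OF n f z] m by simp
 moreover have "avg (lag n) (%M. (f M)\<^sup>2) = avg (frames n m) (down n (%A. (f A)\<^sup>2))"
  using avg_frames_Suc[of m n "%A. (f A)\<^sup>2"] m by simp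
 ultimately have "1/5*avg (lag n) (%M. (f M)\<^sup>2) <= avg (frames n m) (%M. down n (%A. (f A)\<^sup>2) M - (down n f M)\<^sup>2)"
  unfolding avg_diff by linarith
 hence "2*C\<^sup>2*?I'*(1/5*avg (lag n) (%M. (f M)\<^sup>2)) <= 2*C\<^sup>2*?I'*avg (frames n m) (%M. down n (%A. (f A)\<^sup>2) M - (down n f M)\<^sup>2)"
  by (intro mult_left_mono) auto
 also have "... = (\<Sum>M\<in>frames n m. 2*C\<^sup>2*(down n (%A. (f A)\<^sup>2) M - (down n f M)\<^sup>2))"
  unfolding avg_def sum_distrib_left[symmetric] using pos by simp
 also have "... <= (\<Sum>M\<in>frames n m. \<Sum>v\<in>ext n M. \<Sum>u\<in>{u:vecs_of (2*n). sig n (v # M) u = e1 n}. dir n f (v # M) u)"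
  by (intro sum_mono loc)
 also have "... = sdir n f (e1 n)"
  using sum_frames_Suc[of "%A. \<Sum>u\<in>{u:vecs_of (2*n). sig n A u = e1 n}. dir n f A u" n m] m by simp
 finally have "2*C\<^sup>2*?I'*(1/5*avg (lag n) (%M. (f M)\<^sup>2)) <= sdir n f (e1 n)" .
 moreover have "2*C\<^sup>2*?I'*(1/5*avg (lag n) (%M. (f M)\<^sup>2)) = 3/5*2^n*(\<Sum>A\<in>lag n. (f A)\<^sup>2)"
 proof -
  have "avg (lag n) (%M. (f M)\<^sup>2)*(?I'*C) = (\<Sum>A\<in>lag n. (f A)\<^sup>2)"
   unfolding avg_def II[symmetric] using pos(1) by simp
  hence "2*C\<^sup>2*?I'*(1/5*avg (lag n) (%M. (f M)\<^sup>2)) = 2/5*C*(\<Sum>A\<in>lag n. (f A)\<^sup>2)"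
   by (simp add: power2_eq_square mult_ac)
  thus ?thesis by (simp add: C_def m)
 qed
 ultimately show ?thesis by metis
qed

text \<open>The 2^n - 1 nonzero signatures each carry at least 3/5 * 2^n times the second moment,
  against 4^n directions in all; 2^n - 1 >= 2^n/2 gives 3/10.\<close>

lemma dirichlet:
 assumes n: "n >= 1" and f: "span_inv n n f" and z: "avg (lag n) f = 0"
 shows "3/10*(\<Sum>A\<in>lag n. (f A)\<^sup>2) <= av (2*n) (%u. \<Sum>A\<in>lag n. dir n f A u)"
proof -
 let ?W = "vecs_of n - {zeros n}"
 let ?F = "\<Sum>A\<in>lag n. (f A)\<^sup>2"
 have cW: "real (card ?W) = 2^n - 1" by (simp add: finite_len card_Diff_singleton card_len of_nat_diff)
 have "3/10*4^n*?F <= (2^n - 1)*(3/5*2^n*?F)"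
 proof -
  have "(2::real)^n >= 2" using n power_increasing[of 1 n "2::real"] by simp
  hence "2^n*(1/2) <= (2::real)^n - 1" by simp
  hence "2^n*(1/2)*(3/5*2^n*?F) <= (2^n - 1)*(3/5*2^n*?F)"
   by (rule mult_right_mono) (simp add: sum_nonneg)
  moreover have "(4::real)^n = 2^n*2^n" by (simp add: power_mult_distrib[symmetric])
  ultimately show ?thesis by simp
 qed
 also have "... <= (2^n - 1) * sdir n f (e1 n)"
  by (intro mult_left_mono dirichlet_e1[OF n f z]) simp
 also have "... = (\<Sum>w\<in>?W. \<Sum>A\<in>lag n. \<Sum>u\<in>{u:vecs_of (2*n). sig n A u = w}. dir n f A u)"
  using sig_sum[OF n f] cW by simp
 also have "... = (\<Sum>A\<in>lag n. \<Sum>w\<in>?W. \<Sum>u\<in>{u:vecs_of (2*n). sig n A u = w}. dir n f A u)"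
  by (rule sum.swap)
 also have "... <= (\<Sum>A\<in>lag n. \<Sum>u\<in>vecs_of (2*n). dir n f A u)"
 proof (rule sum_mono)
  fix A assume A: "A : lag n"
  have "(\<Sum>w\<in>?W. \<Sum>u\<in>{u:vecs_of (2*n). sig n A u = w}. dir n f A u) <=
   (\<Sum>w\<in>vecs_of n. \<Sum>u\<in>{u:vecs_of (2*n). sig n A u = w}. dir n f A u)"
   by (intro sum_mono2) (auto simp: finite_len dir_def sum_nonneg)
  also have "... = (\<Sum>u\<in>vecs_of (2*n). dir n f A u)"
   using frames_len[OF A] by (intro sum.group) (auto simp: finite_len sig_def)
  finally show "(\<Sum>w\<in>?W. \<Sum>u\<in>{u:vecs_of (2*n). sig n A u = w}. dir n f A u) <= (\<Sum>u\<in>vecs_of (2*n). dir n f A u)" .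
 qed
 also have "... = (\<Sum>u\<in>vecs_of (2*n). \<Sum>A\<in>lag n. dir n f A u)" by (rule sum.swap)
 finally have "3/10*4^n*?F <= (\<Sum>u\<in>vecs_of (2*n). \<Sum>A\<in>lag n. dir n f A u)" .
 moreover have "real (card (vecs_of (2*n))) = 4^n" by (simp add: card_len power_mult)
 ultimately show ?thesis unfolding avg_def by (simp add: le_divide_eq mult_ac)
qed

section \<open>The lazy transvection kernel and its spectral gap\<close>

definition KK::"nat => (bits list => real) => bits list => real" where
 "KK n f A = (f A + av (2*n) (%u. f (tv n u A)))/2"

definition inn::"nat => (bits list => real) => (bits list => real) => real" where
 "inn n f g = (\<Sum>A\<in>lag n. f A*g A)"

lemma sum_tv: "length u = 2*n ==> (\<Sum>A\<in>lag n. f (tv n u A)) = (\<Sum>A\<in>lag n. f A)" for f::"bits list => real"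
 using sum.reindex_bij_betw[OF sp_frames_bij[OF sp_tvf], of u n f n] by simp

text \<open>Transvections are involutions that permute the Lagrangian frames, so the substitution by
  \<open>tv n u\<close> moves each of them to the other factor.\<close>

lemma KK_sym: "inn n f (KK n g) = inn n (KK n f) g"
proof -
 have swap: "inn n f (KK n g) = (inn n f g + av (2*n) (%u. \<Sum>A\<in>lag n. f A*g (tv n u A)))/2" for f g
  unfolding inn_def KK_def avg_def
  by (subst sum.swap) (simp add: sum_divide_distrib[symmetric] distrib_left sum.distrib sum_distrib_left[symmetric])
 have "(\<Sum>A\<in>lag n. f A*g (tv n u A)) = (\<Sum>A\<in>lag n. g A*f (tv n u A))" if u: "length u = 2*n" for u
 proof -
  have "(\<Sum>A\<in>lag n. f A*g (tv n u A)) = (\<Sum>A\<in>lag n. f (tv n u A)*g (tv n u (tv n u A)))"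
   using sum_tv[OF u, of "%A. f A*g (tv n u A)"] by simp
  also have "... = (\<Sum>A\<in>lag n. g A*f (tv n u A))"
  proof (rule sum.cong[OF refl])
   fix A assume "A : lag n"
   thus "f (tv n u A)*g (tv n u (tv n u A)) = g A*f (tv n u A)" by (simp only: tv_tv[OF _ u] mult.commute)
  qed
  finally show ?thesis .
 qed
 hence "av (2*n) (%u. \<Sum>A\<in>lag n. f A*g (tv n u A)) = av (2*n) (%u. \<Sum>A\<in>lag n. g A*f (tv n u A))"
  by (intro avg_cong) auto
 hence "inn n f (KK n g) = inn n g (KK n f)" unfolding swap by (simp add: inn_def mult.commute)
 thus ?thesis by (simp add: inn_def mult.commute)
qed

lemma KK_dir: "inn n f (KK n f) = inn n f f - av (2*n) (%u. \<Sum>A\<in>lag n. dir n f A u)/4"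
proof -
 have swap: "inn n f (KK n f) = (inn n f f + av (2*n) (%u. \<Sum>A\<in>lag n. f A*f (tv n u A)))/2"
  unfolding inn_def KK_def avg_def
  by (subst sum.swap) (simp add: sum_divide_distrib[symmetric] distrib_left sum.distrib sum_distrib_left[symmetric])
 have "(\<Sum>A\<in>lag n. dir n f A u) = 2*inn n f f - 2*(\<Sum>A\<in>lag n. f A*f (tv n u A))" if u: "length u = 2*n" for u
 proof -
  have "(\<Sum>A\<in>lag n. dir n f A u) = (\<Sum>A\<in>lag n. (f A)\<^sup>2) + (\<Sum>A\<in>lag n. (f (tv n u A))\<^sup>2) - 2*(\<Sum>A\<in>lag n. f A*f (tv n u A))"
   by (simp add: dir_def power2_diff sum.distrib sum_subtractf sum_distrib_left mult.assoc)
  thus ?thesis using sum_tv[OF u, of "%A. (f A)\<^sup>2"] by (simp add: inn_def power2_eq_square)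
 qed
 hence "av (2*n) (%u. \<Sum>A\<in>lag n. dir n f A u) =
  av (2*n) (%u. 2*inn n f f - 2*(\<Sum>A\<in>lag n. f A*f (tv n u A)))"
  by (intro avg_cong) auto
 also have "... = 2*inn n f f - 2*av (2*n) (%u. \<Sum>A\<in>lag n. f A*f (tv n u A))"
  by (simp only: avg_diff avg_mult avg_const[OF finite_len len_nonempty])
 finally show ?thesis unfolding swap by (simp add: field_simps)
qed

lemma inn_lin: "inn n (%A. f A - t*g A) h = inn n f h - t*inn n g h" "inn n h (%A. f A - t*g A) = inn n h f - t*inn n h g"
 by (simp_all add: inn_def algebra_simps sum_subtractf sum_distrib_left)

text \<open>Laziness at work: the energy is at most 4<f, f> by (x - y)^2 <= 2x^2 + 2y^2, and
  \<open>KK_dir\<close> subtracts a quarter of it.\<close>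

lemma KK_psd: "inn n f (KK n f) >= 0"
proof -
 have "(\<Sum>A\<in>lag n. dir n f A u) <= 4*inn n f f" if u: "length u = 2*n" for u
 proof -
  have "(\<Sum>A\<in>lag n. dir n f A u) <= (\<Sum>A\<in>lag n. 2*(f A)\<^sup>2 + 2*(f (tv n u A))\<^sup>2)"
  proof (rule sum_mono)
   fix A
   have "0 <= (f A + f (tv n u A))\<^sup>2" by simp
   thus "dir n f A u <= 2*(f A)\<^sup>2 + 2*(f (tv n u A))\<^sup>2" unfolding dir_def power2_diff power2_sum by linarith
  qed
  also have "... = 4*inn n f f" using sum_tv[OF u, of "%A. (f A)\<^sup>2"]
   by (simp add: sum.distrib sum_distrib_left[symmetric] inn_def power2_eq_square)
  finally show ?thesis .
 qed
 hence "av (2*n) (%u. \<Sum>A\<in>lag n. dir n f A u) <= av (2*n) (%u. 4*inn n f f)"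
  by (intro avg_mono) auto
 also have "... = 4*inn n f f" using finite_len len_nonempty by (rule avg_const)
 finally show ?thesis by (simp add: KK_dir)
qed

definition meanzero::"nat => (bits list => real) => bool" where
 "meanzero n f \<longleftrightarrow> span_inv n n f & avg (lag n) f = 0"

lemma KK_span_inv: assumes "span_inv n n f" shows "span_inv n n (KK n f)"
 unfolding span_inv_def
proof (intro ballI impI)
 fix M M' assume M: "M : lag n" "M' : lag n" "sp2 n M = sp2 n M'"
 have "f (tv n u M) = f (tv n u M')" if "length u = 2*n" for u
  using span_inv_sp[OF sp_tvf[OF that] assms] M unfolding span_inv_def by blast
 moreover have "f M = f M'" using assms M unfolding span_inv_def by blast
 ultimately show "KK n f M = KK n f M'" by (simp add: KK_def cong: avg_cong) (simp add: avg_def)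
qed

lemma KK_avg: "avg (lag n) (KK n f) = avg (lag n) f"
proof -
 have "(\<Sum>A\<in>lag n. KK n f A) = inn n (%_. 1) (KK n f)" by (simp add: inn_def)
 also have "... = inn n (KK n (%_. 1)) f" by (rule KK_sym)
 also have "KK n (%_. 1) = (%_. 1)" unfolding KK_def using finite_len[of "2*n"] len_nonempty[of "2*n"] by (subst avg_const) auto
 finally show ?thesis by (simp add: avg_def inn_def)
qed

lemma KK_meanzero: "meanzero n f ==> meanzero n (KK n f)"
 by (simp add: meanzero_def KK_span_inv KK_avg)

text \<open>1 - (3/10)/4, from the constant of \<open>dirichlet\<close> and the quarter in
  \<open>KK_dir\<close>.\<close>

abbreviation \<kappa>::real where "\<kappa> == 37/40"

text \<open>The gap bounds the quadratic form <f, Kf>; what is needed is a bound on the norm of Kf.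
  Nonnegativity of the form at f - Kf/\<kappa> provides it without diagonalisation: expanding leaves
  \<kappa><f, f> - <Kf, Kf>/\<kappa>, after the gap has been used for f and for Kf.\<close>

lemma KK_contract:
 assumes n: "n >= 1" and f: "meanzero n f"
 shows "inn n (KK n f) (KK n f) <= \<kappa>\<^sup>2*inn n f f"
proof -
 have q: "inn n g (KK n g) <= \<kappa> * inn n g g" if "meanzero n g" for g
  using dirichlet[OF n, of g] that by (simp add: KK_dir meanzero_def) (simp add: inn_def power2_eq_square)
 let ?g = "KK n f" and ?t = "1/\<kappa>"
 have "0 <= inn n (%A. f A - ?t*?g A) (KK n (%A. f A - ?t*?g A))" by (rule KK_psd)
 also have "... = inn n f (KK n (%A. f A - ?t*?g A)) - ?t*inn n ?g (KK n (%A. f A - ?t*?g A))"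
  by (rule inn_lin)
 also have "... = inn n f ?g - ?t*inn n ?g ?g - ?t*(inn n ?g ?g - ?t*inn n ?g (KK n ?g))"
 proof -
  have "inn n h (KK n (%A. f A - ?t*?g A)) = inn n h (KK n f) - ?t*inn n h (KK n ?g)" for h
   unfolding KK_sym[of n h] by (rule inn_lin)
  thus ?thesis using KK_sym[of n f ?g] by simp
 qed
 also have "... <= \<kappa> * inn n f f - ?t*inn n ?g ?g - ?t*(inn n ?g ?g - ?t*(\<kappa> * inn n ?g ?g))"
 proof -
  have "a - b - t*(b' - t*c) <= x - b - t*(b' - t*y)" if "a <= x" "c <= y" for a b b' c x y t::real
   using that mult_left_mono[of c y "t*t"] by (simp add: algebra_simps)
  from this[OF q[OF f] q[OF KK_meanzero[OF f]], of "?t*inn n ?g ?g" ?t "inn n ?g ?g"] show ?thesis .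
 qed
 finally have "0 <= \<kappa> * inn n f f - ?t*inn n ?g ?g - ?t*(inn n ?g ?g - ?t*(\<kappa> * inn n ?g ?g))" .
 hence "inn n ?g ?g <= \<kappa> * \<kappa> * inn n f f" by (simp add: algebra_simps)
 thus ?thesis by (simp only: power2_eq_square)
qed

lemma KK_iter:
 assumes n: "n >= 1" and f: "meanzero n f"
 shows "meanzero n ((KK n ^^ s) f) & inn n ((KK n ^^ s) f) ((KK n ^^ s) f) <= \<kappa> ^ (2 * s)*inn n f f"
proof (induction s)
 case (Suc s)
 hence "inn n ((KK n ^^ Suc s) f) ((KK n ^^ Suc s) f) <= \<kappa>\<^sup>2*inn n ((KK n ^^ s) f) ((KK n ^^ s) f)"
  using KK_contract[OF n, of "(KK n ^^ s) f"] by simp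
 also have "... <= \<kappa>\<^sup>2*(\<kappa> ^ (2 * s)*inn n f f)" using Suc by (intro mult_left_mono) auto
 also have "... = \<kappa> ^ (2*Suc s)*inn n f f" by (simp add: power2_eq_square)
 finally show ?case using Suc KK_meanzero by simp
qed (use f in auto)

lemma KK_shift: "(KK n ^^ s) (%A. f A - c) = (%A. (KK n ^^ s) f A - c)"
proof (induction s)
 case (Suc s)
 have "KK n (%A. g A - c) = (%A. KK n g A - c)" for g
  unfolding KK_def using finite_len[of "2*n"] len_nonempty[of "2*n"] by (auto simp: avg_diff field_simps)
 thus ?case by (simp add: Suc)
qed simp

text \<open>Subtracting its mean from \<open>q\<close> leaves a span-invariant function of mean
  zero, which the walk contracts in norm. As \<open>p\<close> enters only through Cauchy-Schwarz, it
  may depend on the basis.\<close>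

theorem mixing:
 assumes n: "n >= 1" and q: "span_inv n n q" "!!A. A : lag n ==> 0 <= q A & q A <= 1"
  and p: "!!A. A : lag n ==> 0 <= p A & p A <= 1"
 shows "avg (lag n) p*avg (lag n) q - \<kappa> ^ s <= avg (lag n) (%A. p A*(KK n ^^ s) q A)"
proof -
 have F: "finite (lag n)" "lag n ~= {}" "real (card (lag n)) > 0" using card_frames_pos[of n n] by auto
 define m where "m = avg (lag n) q"
 define f where "f = (%A. q A - m)"
 have f: "meanzero n f"
  unfolding meanzero_def f_def using F by (simp add: avg_diff m_def span_inv_def) (metis q(1) span_inv_def)
 have m1: "0 <= m" "m <= 1"
  using avg_mono[of "lag n" "%_. 0" q] avg_mono[of "lag n" q "%_. 1"] q(2) F by (auto simp: m_def)
 have ff: "inn n f f <= card (lag n)"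
 proof -
  have "\<bar>f A\<bar> <= 1" if "A : lag n" for A using q(2)[OF that] m1 by (simp add: f_def abs_le_iff)
  hence "(f A)\<^sup>2 <= 1" if "A : lag n" for A using that by (simp add: abs_square_le_1)
  hence "inn n f f <= (\<Sum>A\<in>lag n. 1)" unfolding inn_def by (intro sum_mono) (simp add: power2_eq_square)
  thus ?thesis by simp
 qed
 let ?h = "(KK n ^^ s) f"
 have "\<kappa> ^ (2 * s)*inn n f f <= \<kappa> ^ (2 * s)*card (lag n)" by (intro mult_left_mono ff) simp
 hence hh: "inn n ?h ?h <= \<kappa> ^ (2 * s)*card (lag n)"
  using KK_iter[OF n f, of s] by linarith
 have "- (\<kappa> ^ s)*card (lag n) <= (\<Sum>A\<in>lag n. p A*?h A)"
 proof -
  \<comment> \<open>Cauchy-Schwarz termwise: weight \<kappa>^s is the size at which both halves of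
    the arithmetic-geometric mean bound contribute equally.\<close>
  have "- (\<kappa> ^ s/2) - (?h A)\<^sup>2/(2*\<kappa> ^ s) <= p A*?h A" if A: "A : lag n" for A
  proof -
   have k: "\<kappa> ^ s > 0" by simp
   have p2: "(p A)\<^sup>2 <= 1" using p[OF A] by (simp add: power_le_one)
   have "0 <= (\<kappa> ^ s*p A + ?h A)\<^sup>2/(2*\<kappa> ^ s)" using k by (intro divide_nonneg_pos) auto
   also have "... = \<kappa> ^ s/2*(p A)\<^sup>2 + p A*?h A + (?h A)\<^sup>2/(2*\<kappa> ^ s)"
   using k by (simp add: power2_sum field_simps power2_eq_square)
   finally show ?thesis using p2 mult_left_mono[OF p2, of "\<kappa> ^ s/2"] k by linarith
  qed
  hence "(\<Sum>A\<in>lag n. - (\<kappa> ^ s/2) - (?h A)\<^sup>2/(2*\<kappa> ^ s)) <= (\<Sum>A\<in>lag n. p A*?h A)"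
   by (rule sum_mono)
  moreover have "(\<Sum>A\<in>lag n. - (\<kappa> ^ s/2) - (?h A)\<^sup>2/(2*\<kappa> ^ s)) = - (\<kappa> ^ s/2)*card (lag n) - inn n ?h ?h/(2*\<kappa> ^ s)"
   by (simp add: sum_subtractf sum_divide_distrib inn_def power2_eq_square)
  moreover have "inn n ?h ?h/(2*\<kappa> ^ s) <= \<kappa> ^ s/2*card (lag n)"
  proof -
   have "h/(2*K) <= K/2*c" if "h <= K*K*c" "K > 0" for h K c::real
   using that by (simp add: field_simps)
   moreover have "\<kappa> ^ (2 * s) = \<kappa> ^ s*\<kappa> ^ s" by (simp only: mult_2 power_add)
   hence "inn n ?h ?h <= \<kappa> ^ s*\<kappa> ^ s*card (lag n)" using hh by (simp only:)
   moreover have "\<kappa> ^ s > 0" by simp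
   ultimately show ?thesis by blast
  qed
  ultimately show ?thesis by linarith
 qed
 hence "- (\<kappa> ^ s) <= avg (lag n) (%A. p A*?h A)"
  using F by (simp add: avg_def field_simps)
 also have "avg (lag n) (%A. p A*?h A) = avg (lag n) (%A. p A*(KK n ^^ s) q A) - m*avg (lag n) p"
 proof -
  have "(%A. p A*?h A) = (%A. p A*(KK n ^^ s) q A - m*p A)" unfolding f_def KK_shift by (auto simp: algebra_simps)
  thus ?thesis by (simp only: avg_diff avg_mult)
 qed
 finally show ?thesis by (simp add: m_def mult.commute)
qed

text \<open>Invariance makes the energy vanish, and the spectral gap then forces the function to
  equal its mean. This replaces a transitivity argument for the symplectic group.\<close>

lemma tv_invariant_const:
 assumes n: "n >= 1" and f: "span_inv n n f" and inv: "!!A u. A : lag n ==> length u = 2*n ==> f (tv n u A) = f A"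
  and A: "A : lag n"
 shows "f A = avg (lag n) f"
proof -
 have F: "finite (lag n)" "lag n ~= {}" using A by auto
 define g where "g = (%A. f A - avg (lag n) f)"
 have "span_inv n n g" using f unfolding span_inv_def g_def by (metis)
 moreover have "avg (lag n) g = 0" using F by (simp add: g_def avg_diff)
 moreover have "dir n g A u = 0" if "A : lag n" "length u = 2*n" for A u using inv[OF that] by (simp add: dir_def g_def)
 ultimately have "3/10*(\<Sum>A\<in>lag n. (g A)\<^sup>2) <= 0"
  using dirichlet[OF n, of g] by (simp add: avg_def)
 hence "(\<Sum>A\<in>lag n. (g A)\<^sup>2) = 0" using sum_nonneg[of "lag n" "%A. (g A)\<^sup>2"] by simp
 hence "(g A)\<^sup>2 = 0" using A by (subst (asm) sum_nonneg_eq_0_iff) auto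
 thus ?thesis by (simp add: g_def)
qed

section \<open>Mixing of the noise\<close>

subsection \<open>Finitely supported expectations\<close>

abbreviation ex::"'a pmf => ('a => real) => real" where "ex D f == measure_pmf.expectation D f"

lemma ex_sum: "fsup D ==> ex D f = (\<Sum>x\<in>set_pmf D. pmf D x*f x)"
 by (subst integral_measure_pmf[of "set_pmf D"]) auto

lemma ex_bind: 
 assumes "fsup D" "!!x. x : set_pmf D ==> finite (set_pmf (g x))"
 shows "ex (bind_pmf D g) f = ex D (%x. ex (g x) f)"
 using assms by (subst pmf_expectation_bind[of "set_pmf D"]) (auto simp: ex_sum)

lemma ex_mono: "fsup D ==> (!!x. x : set_pmf D ==> f x <= g x) ==> ex D f <= ex D g"
 by (simp add: ex_sum mult_left_mono sum_mono)

lemma ex_cong: "fsup D ==> (!!x. x : set_pmf D ==> f x = g x) ==> ex D f = ex D g"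
 by (simp add: ex_sum)

lemma ex_nonneg: "(!!x. 0 <= f x) ==> 0 <= ex D f" by simp

lemma ex_add: "fsup D ==> ex D (%x. f x + g x) = ex D f + ex D g"
 by (simp add: ex_sum distrib_left sum.distrib)

lemma ex_swap: "fsup D ==> finite (set_pmf D') ==> ex D (%x. ex D' (f x)) = ex D' (%y. ex D (%x. f x y))"
 by (simp add: ex_sum sum_distrib_left) (subst sum.swap, simp add: mult_ac)

lemma ex_set: "finite S ==> S ~= {} ==> ex (pmf_of_set S) f = avg S f"
 by (simp add: integral_pmf_of_set avg_def)

lemma ex_coin: "ex coin f = (f True + f False)/2"
 by (simp add: ex_set avg_def UNIV_bool)

lemma ex_uniform: "ex (unif n) f = av n f"
 using ex_set[OF finite_len len_nonempty] by (simp add: uniform_vec_def)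

lemma fin_uniform [simp]: "finite (set_pmf (unif n))" by (simp add: set_uniform_vec finite_len)
lemma fin_vecs [simp]: "finite (set_pmf (vecs k n))" by (induction k) auto

lemma ex_uniform_Suc: "ex (unif (Suc n)) f = (ex (unif n) (%v. f (True # v)) + ex (unif n) (%v. f (False # v)))/2"
 by (simp add: uniform_vec_Suc ex_bind ex_coin)

lemma ex_vecs_Suc: "ex (vecs (Suc k) n) f = ex (unif n) (%v. ex (vecs k n) (%vs. f (v # vs)))"
 by (simp add: ex_bind)

lemma ex_vecs_rev: "ex (vecs k n) (%ms. f (map rev ms)) = ex (vecs k n) f"
proof (induction k arbitrary: f)
 case (Suc k)
 have "ex (vecs (Suc k) n) (%ms. f (map rev ms)) = ex (unif n) (%v. ex (vecs k n) (%vs. f (rev v # vs)))"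
  using Suc[of "%vs. f (_ # vs)"] by (simp add: ex_vecs_Suc del: vecs.simps)
 also have "... = ex (map_pmf rev (unif n)) (%v. ex (vecs k n) (%vs. f (v # vs)))" by simp
 finally show ?case by (simp only: uniform_vec_rev ex_vecs_Suc)
qed simp

text \<open>Reading r masks site by site: the r coins of the first site are independent of the masks
  on the other sites, which allows induction on the number of sites.\<close>

lemma ex_vecs_split:
 "ex (vecs r (Suc n)) F = ex (unif r) (%cs. ex (vecs r n) (%ms. F (map2 Cons cs ms)))"
proof (induction r arbitrary: F)
 case (Suc r)
 have "ex (unif n) (%v. ex (unif r) (%cs. ex (vecs r n) (%ms. F ((b # v) # map2 Cons cs ms)))) =
   ex (unif r) (%cs. ex (vecs (Suc r) n) (%ms. F (map2 Cons (b # cs) ms)))" for b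
  by (subst ex_swap) (simp_all add: ex_vecs_Suc del: vecs.simps)
 thus ?case by (simp add: ex_vecs_Suc ex_uniform_Suc Suc del: vecs.simps)
qed (simp add: uniform_vec_0)

subsection \<open>Sites\<close>

text \<open>A column is determined by its list of sites (pairs \<open>(e\<^sub>j, e\<^bsub>n+j\<^esub>)\<close>).\<close>

type_synonym site = "bool \<times> bool"

definition col::"site list => bits" where "col ps = map fst ps @ map snd ps"
definition nz::"site => bool" where "nz p \<longleftrightarrow> fst p | snd p"
definition wt::"site list => nat" where "wt ps = length (filter nz ps)"
definition X::"nat => nat => site list set" where "X n w = {ps. length ps = n & wt ps = w}"
definition px::"site => site => site" where "px p q = (fst p ~= fst q, snd p ~= snd q)"
definition om::"site => site => bool" where "om p q = ((fst p & snd q) ~= (fst q & snd p))"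

lemma wt_simps [simp]: "wt [] = 0" "wt (p # ps) = of_bool (nz p) + wt ps" by (simp_all add: wt_def)

lemma wt_rev [simp]: "wt (rev ps) = wt ps" by (simp add: wt_def rev_filter[symmetric])

lemma length_col [simp]: "length (col ps) = 2*length ps" by (simp add: col_def)

lemma colE: assumes "length c = 2*n" obtains ps where "c = col ps" "length ps = n"
 using assms that[of "zip (take n c) (drop n c)"] by (simp add: col_def)

lemma col_inj: "inj col"
proof (rule injI)
 fix ps qs assume e: "col ps = col qs"
 hence "length ps = length qs" using length_col by (metis mult_cancel1 zero_neq_numeral)
 hence "map fst ps = map fst qs" "map snd ps = map snd qs" using e by (simp_all add: col_def)
 thus "ps = qs" by (metis zip_map_fst_snd)
qed

lemma vadd_col: "length ps = length qs ==> vadd (col ps) (col qs) = col (map2 px ps qs)"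
 by (induction ps qs rule: list_induct2) (auto simp: col_def px_def vadd_append)

lemma sympl_col: "length ps = n ==> length qs = n ==> sympl n (col ps) (col qs) = odd (length (filter id (map2 om ps qs)))"
proof -
 have "(dotp (map fst ps) (map snd qs) ~= dotp (map fst qs) (map snd ps)) = odd (length (filter id (map2 om ps qs)))"
  if "length ps = length qs" using that by (induction ps qs rule: list_induct2) (auto simp: om_def)
 thus "length ps = n ==> length qs = n ==> ?thesis" by (simp add: sympl_def col_def)
qed

lemma weight_col: "length ps = n ==> weight n (col ps) = wt ps"
proof (induction ps arbitrary: n)
 case (Cons p ps)
 have "{j. j < Suc (length ps) & nz ((p # ps) ! j)} = (if nz p then {0} else {}) \<union> Suc ` {j. j < length ps & nz (ps ! j)}"
  by (auto simp: less_Suc_eq_0_disj)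
 hence "card {j. j < Suc (length ps) & nz ((p # ps) ! j)} = of_bool (nz p) + card {j. j < length ps & nz (ps ! j)}"
  by (simp add: card_image card_insert_if)
 moreover have e: "weight (length qs) (col qs) = card {j. j < length qs & nz (qs ! j)}" for qs
  unfolding weight_def by (intro arg_cong[where f = card]) (auto simp: col_def nth_append nz_def)
 ultimately show ?case using Cons e[of "p # ps"] e[of ps] by simp
qed (simp add: weight_def)

lemma length_part' : "length m = n ==> length xs = n ==> length (part m xs) = n" by (simp add: length_part)

lemma part_map: "part m (map h xs) = map h (part m xs)"
 by (simp add: part_def zip_map2 filter_map comp_def case_prod_beta')

lemma part_zip: assumes "length xs = length ys" shows "part m (zip xs ys) = zip (part m xs) (part m ys)"
proof -
 have "part m xs = map fst (part m (zip xs ys))" "part m ys = map snd (part m (zip xs ys))"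
  using assms by (simp_all add: part_map[symmetric])
 thus ?thesis by (simp add: zip_map_fst_snd)
qed

lemma mset_part: assumes "length m = length xs" shows "mset (part m xs) = mset xs"
proof -
 have "mset (part m xs) = image_mset snd (mset (filter fst (zip m xs))) + image_mset snd (mset (filter (%x. ~ fst x) (zip m xs)))"
  by (simp add: part_def comp_def)
 also have "... = image_mset snd (mset (zip m xs))" by (simp only: image_mset_union[symmetric] mset_filter multiset_partition[symmetric])
 finally show ?thesis using assms by (simp flip: mset_map)
qed

definition rot::"bool => site => site" where "rot m p = (if m then (snd p, fst p ~= snd p) else p)"

abbreviation rotl::"bits => site list => site list" where "rotl m ps == map2 rot m ps"

lemma rifc_col: "length ps = n ==> rifc n m (col ps) = col (part m ps)"
 by (simp add: rifc_def col_def part_map)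

lemma rotc_col: "length ps = n ==> length m = n ==> rotc n m (col ps) = col (rotl (rev m) ps)"
 by (simp add: rotc_def col_def zip_map_fst_snd rot_def rotate_a_def rotate_b_def comp_def case_prod_beta')

text \<open>The symplectic form is a sum over sites, so it suffices that the map is additive and
  permutes the local products.\<close>

lemma sp_col:
 assumes "!!ps. length ps = n ==> g (col ps) = col (h ps) & length (h ps) = n"
  "!!ps qs. length ps = n ==> length qs = n ==> h (map2 px ps qs) = map2 px (h ps) (h qs) & mset (map2 om (h ps) (h qs)) = mset (map2 om ps qs)"
 shows "sp n g"
 unfolding sp_def
proof (intro conjI allI impI)
 fix c d::"bits" assume "length c = 2*n" "length d = 2*n"
 then obtain ps qs where *: "c = col ps" "length ps = n" "d = col qs" "length qs = n" by (metis colE)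
 show "g (vadd c d) = vadd (g c) (g d)" using*assms by (simp add: vadd_col)
 have "mset (filter id (map2 om (h ps) (h qs))) = mset (filter id (map2 om ps qs))"
  using assms(2)[of ps qs]*by (simp only: mset_filter)
 hence "length (filter id (map2 om (h ps) (h qs))) = length (filter id (map2 om ps qs))" by (metis size_mset)
 thus "sympl n (g c) (g d) = sympl n c d" using*assms(1)[of ps] assms(1)[of qs] by (simp add: sympl_col)
next
 fix c::"bits" assume "length c = 2*n"
 thus "length (g c) = 2*n" using assms(1) by (metis colE length_col)
qed

lemma sp_rifc: assumes "length m = n" shows "sp n (rifc n m)"
proof (rule sp_col[where h = "part m"])
 fix ps qs::"site list" assume l: "length ps = n" "length qs = n"
 have e: "map2 f (part m ps) (part m qs) = part m (map2 f ps qs)" for f::"site => site => 'z"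
  using l by (simp add: part_zip[symmetric] part_map)
 show "part m (map2 px ps qs) = map2 px (part m ps) (part m qs) & mset (map2 om (part m ps) (part m qs)) = mset (map2 om ps qs)"
  unfolding e using l assms by (simp add: mset_part)
qed (use assms in "simp add: rifc_col length_part")

lemma sp_rotc: assumes "length m = n" shows "sp n (rotc n m)"
proof (rule sp_col[where h = "rotl (rev m)"])
 fix ps qs::"site list" assume l: "length ps = n" "length qs = n"
 have "rotl (rev m) (map2 px ps qs) = map2 px (rotl (rev m) ps) (rotl (rev m) qs)"
  using l assms by (intro nth_equalityI) (auto simp: rot_def px_def)
 moreover have "map2 om (rotl (rev m) ps) (rotl (rev m) qs) = map2 om ps qs"
  using l assms by (intro nth_equalityI) (auto simp: rot_def om_def)
 ultimately show "rotl (rev m) (map2 px ps qs) = map2 px (rotl (rev m) ps) (rotl (rev m) qs) &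
  mset (map2 om (rotl (rev m) ps) (rotl (rev m) qs)) = mset (map2 om ps qs)" by simp
qed (use assms in "simp add: rotc_col")

lemma sp_fold: "(!!m. m : set ms ==> sp n (g m)) ==> sp n (fold g ms)"
proof (induction ms)
 case (Cons m ms)
 thus ?case using sp_comp[of n "fold g ms" "g m"] by (simp add: comp_def)
qed (simp add: sp_def)

lemma sp_shuf: assumes "ms : set_pmf (vecs j n)" "ms' : set_pmf (vecs j' n)" shows "sp n (shuf n ms ms')"
proof -
 have "sp n (fold (rifc n) ms' \<circ> fold (rotc n) ms)"
  using set_vecs[OF assms(1)] set_vecs[OF assms(2)] by (intro sp_comp sp_fold sp_rifc sp_rotc) auto
 thus ?thesis by (simp add: shuf_def[abs_def] comp_def)
qed

lemma shuf_col:
 assumes "length ps = n" "colen n ms" "colen n ms'"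
 shows "shuf n ms ms' (col ps) = col (fold part ms' (fold rotl (map rev ms) ps))"
proof -
 have 1: "length (fold rotl (map rev ms) ps) = n & fold (rotc n) ms (col ps) = col (fold rotl (map rev ms) ps)"
  using assms(1,2) by (induction ms arbitrary: ps) (simp_all add: rotc_col)
 have "fold (rifc n) ms' (col qs) = col (fold part ms' qs)" if "length qs = n" for qs
  using that assms(3) by (induction ms' arbitrary: qs) (simp_all add: rifc_col length_part')
 with 1 show ?thesis by (simp add: shuf_def)
qed

subsection \<open>The riffle\<close>

definition msym::"('a list => real) => bool" where
 "msym f \<longleftrightarrow> (ALL xs ys. mset xs = mset ys --> f xs = f ys)"

lemma msymD: "msym f ==> mset xs = mset ys ==> f xs = f ys" unfolding msym_def by blast

lemma permute_list_inj:
 assumes p: "p permutes {..<n}" shows "inj_on (permute_list p) {xs. length xs = n}"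
proof (rule inj_onI)
 fix xs ys::"'a list" assume l: "xs : {xs. length xs = n}" "ys : {xs. length xs = n}" and e: "permute_list p xs = permute_list p ys"
 have "xs ! i = ys ! i" if "i < n" for i
 proof -
  have "i : p ` {..<n}" unfolding permutes_image[OF p] using that by simp
  then obtain j where "j < n" "p j = i" by blast
  thus ?thesis using arg_cong[OF e, of "%xs. xs ! j"] l p by (simp add: permute_list_nth)
 qed
 thus "xs = ys" using l by (intro nth_equalityI) auto
qed

text \<open>A permutation that relates the two lists can be applied to the mask as well, which stays
  uniform.\<close>

lemma msym_map2:
 assumes f: "msym f" and e: "mset xs = mset ys" and n: "length xs = n"
 shows "ex (unif n) (%m. f (map2 h m xs)) = ex (unif n) (%m. f (map2 h m ys))"
proof -
 obtain p where p: "p permutes {..<length ys}" "permute_list p ys = xs" using mset_eq_permutation[OF e] .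
 have l: "length ys = n" using e n by (metis size_mset)
 have bij: "bij_betw (permute_list p) (vecs_of n) (vecs_of n)"
  unfolding bij_betw_def
 proof
  show "permute_list p ` vecs_of n = vecs_of n"
   using permute_list_inj[of p n] p l by (intro endo_inj_surj finite_len) auto
 qed (use permute_list_inj p l in auto)
 have "f (map2 h (permute_list p m) xs) = f (map2 h m ys)" if "length m = n" for m
 proof -
  have "map2 h (permute_list p m) xs = permute_list p (map2 h m ys)"
   using p l that by (subst permute_list_map) (auto simp: permute_list_zip[of p "{..<n}"])
  moreover have "mset (permute_list p (map2 h m ys)) = mset (map2 h m ys)" using p l that by (intro mset_permute_list) simp
  ultimately show ?thesis using msymD[OF f, of "permute_list p (map2 h m ys)" "map2 h m ys"] by simp
 qed
 thus ?thesis
  unfolding ex_uniform avg_def using sum.reindex_bij_betw[OF bij, of "%m. f (map2 h m xs)"] by simp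
qed

text \<open>Every item carries a key that collects the masks it met, the latest mask being the most significant bit
 (with \<open>True\<close> first), so that the list always stays sorted by its keys.\<close>

definition tag::"nat => bool => 'a \<times> nat => 'a \<times> nat" where
 "tag c b x = (fst x, if b then snd x else snd x + c)"

fun rk::"nat => bits list => ('a \<times> nat) list => ('a \<times> nat) list" where
 "rk c [] xs = xs"
| "rk c (m # ms) xs = rk (2*c) ms (part m (map2 (tag c) m xs))"

lemma rk_fst: "ALL m:set ms. length m = length xs ==> map fst (rk c ms xs) = fold part ms (map fst xs)"
proof (induction ms arbitrary: c xs)
 case (Cons m ms)
 have "map fst (map2 (tag c) m xs) = map fst xs" using Cons.prems by (intro nth_equalityI) (auto simp: tag_def)
 thus ?case using Cons by (simp add: length_part part_map[symmetric])
qed simp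

lemma rk_map: "rk c ms (map (map_prod h id) xs) = map (map_prod h id) (rk c ms xs)"
proof (induction ms arbitrary: c xs)
 case (Cons m ms)
 have "map2 (tag c) m (map (map_prod h id) xs) = map (map_prod h id) (map2 (tag c) m xs)"
  by (auto simp: zip_map2 tag_def)
 thus ?case by (simp only: rk.simps part_map Cons)
qed simp

lemma rk_sorted:
 "ALL m:set ms. length m = length xs ==> sorted (map snd xs) ==> ALL x:set xs. snd x < c ==> sorted (map snd (rk c ms xs))"
proof (induction ms arbitrary: c xs)
 case (Cons m ms)
 let ?Y = "map2 (tag c) m xs"
 have l: "length m = length xs" using Cons.prems by simp
 have 1: "map snd (filter fst (zip m ?Y)) = map snd (filter fst (zip m xs))"
  and 2: "map snd (filter (Not \<circ> fst) (zip m ?Y)) = map (%x. (fst x, snd x + c)) (map snd (filter (Not \<circ> fst) (zip m xs)))"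
  using l by (induction m xs rule: list_induct2) (auto simp: tag_def)
 have s: "sorted (map snd (map snd (filter P (zip m xs))))" for P
  using sorted_filter[of "snd \<circ> snd" "zip m xs" P] l Cons.prems(2) by (simp add: map_map[symmetric] del: map_map)
 have lt: "snd x < c" if "x : set (map snd (filter P (zip m xs)))" for x P
  using that Cons.prems(3) by (auto dest!: set_zip_rightD)
 have "sorted (map (%x. snd x + c) (map snd (filter (Not \<circ> fst) (zip m xs))))"
  using s[of "Not \<circ> fst"] by (simp add: sorted_map)
 hence "sorted (map snd (part m ?Y))"
  unfolding part_def 1 2 map_append sorted_append using s[of fst] lt[of _ fst] by (force simp: comp_def)
 moreover have "ALL x:set (part m ?Y). snd x < 2*c"
 proof
  fix x assume "x : set (part m ?Y)"
  hence "x : set (map snd (filter fst (zip m xs))) | (EX y:set (map snd (filter (Not \<circ> fst) (zip m xs))). snd x = snd y + c)"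
   unfolding part_def 1 2 set_append set_map[of "%x. (fst x, snd x + c)"] by force
  thus "snd x < 2*c"
  proof
   assume "x : set (map snd (filter fst (zip m xs)))"
   from lt[OF this] show ?thesis by simp
  next
   assume "EX y:set (map snd (filter (Not \<circ> fst) (zip m xs))). snd x = snd y + c"
   then obtain y where y: "y : set (map snd (filter (Not \<circ> fst) (zip m xs)))" "snd x = snd y + c" by blast
   from lt[OF y(1)] y(2) show ?thesis by simp
  qed
 qed
 ultimately show ?case using Cons.IH[of "part m ?Y" "2*c"] Cons.prems(1) by (simp add: length_part)
qed simp

text \<open>The masks are uniform in every round, so the keyed list, up to order, has a law that
  depends only on the multiset it started from.\<close>

lemma msym_rk:
 assumes "msym f" shows "mset xs = mset ys ==> length xs = n ==> ex (vecs r n) (%ms. f (rk c ms xs)) = ex (vecs r n) (%ms. f (rk c ms ys))"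
proof (induction r arbitrary: c xs ys)
 case 0
 thus ?case using msymD[OF assms 0(1)] by simp
next
 case (Suc r)
 define F where "F zs = (if length zs = n then ex (vecs r n) (%ms. f (rk (2*c) ms zs)) else 0)" for zs
 have F: "msym F" unfolding msym_def
 proof (intro allI impI)
  fix xs ys::"('a \<times> nat) list" assume e: "mset xs = mset ys"
  hence "length xs = length ys" by (rule mset_eq_length)
  thus "F xs = F ys" using Suc.IH[OF e] by (simp add: F_def)
 qed
 have "ex (vecs (Suc r) n) (%ms. f (rk c ms zs)) = ex (unif n) (%m. F (map2 (tag c) m zs))" if l: "length zs = n" for zs
 proof -
  have "ex (vecs r n) (%ms. f (rk c (m # ms) zs)) = F (map2 (tag c) m zs)" if "length m = n" for m
   using that l Suc.IH[OF mset_part[of m "map2 (tag c) m zs"]] by (simp add: F_def length_part')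
  thus ?thesis unfolding ex_vecs_Suc by (intro ex_cong fin_uniform) (simp add: set_uniform_vec)
 qed
 moreover have "length ys = n" using Suc.prems by (metis size_mset)
 ultimately show ?case using msym_map2[OF F Suc.prems] Suc.prems by simp
qed

fun cx::"nat => ('a \<times> nat) list => real" where
 "cx k [] = 0" | "cx k (y # ys) = of_bool (k = snd y) + cx k ys"

text \<open>A further mask halves the expectation of \<open>cn\<close>.\<close>
fun cn::"('a \<times> nat) list => real" where
 "cn [] = 0" | "cn (x # xs) = cx (snd x) xs + cn xs"

lemma cx_mset: "cx k xs = (\<Sum>y\<in>#mset xs. of_bool (k = snd y))" by (induction xs) auto

text \<open>Counting ordered pairs instead of pairs in list order shows that the number of
  collisions depends on the multiset only.\<close>

lemma cn_mset: "2*cn xs + real (length xs) = (\<Sum>x\<in>#mset xs. \<Sum>y\<in>#mset xs. of_bool (snd x = snd y))"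
proof (induction xs)
 case (Cons x xs)
 have "(\<Sum>y\<in>#mset xs. of_bool (snd y = snd x)::real) = cx (snd x) xs"
  unfolding cx_mset by (intro arg_cong[where f = sum_mset] image_mset_cong) (auto simp: eq_commute)
 thus ?case using Cons by (simp add: sum_mset.distrib cx_mset)
qed simp

lemma msym_cn: "msym cn"
 unfolding msym_def using cn_mset by (metis add_right_cancel mult_left_cancel size_mset zero_neq_numeral)

lemma cx_nonneg: "0 <= cx k xs" and cn_nonneg: "0 <= cn xs"
proof -
 show 1: "0 <= cx k xs" for k and xs::"('a \<times> nat) list" by (induction xs) auto
 show "0 <= cn xs" using 1 by (induction xs) (auto simp: add_nonneg_nonneg)
qed

lemma cn_distinct: "of_bool (~ distinct (map snd xs)) <= cn xs"
proof (induction xs)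
 case (Cons x xs)
 have "of_bool (k : snd ` set xs) <= cx k xs" for k
 proof (induction xs)
  case (Cons y ys)
  thus ?case using cx_nonneg[of k ys] by (auto simp: of_bool_def split: if_splits)
 qed simp
 from this[of "snd x"] show ?case using Cons cn_nonneg[of xs] cx_nonneg[of "snd x" xs] by (auto simp: of_bool_def split: if_splits)
qed simp

text \<open>Below \<open>c\<close> and from \<open>c\<close> on keys do not meet, so two equal keys
  stay equal exactly if both items draw the same bit.\<close>

lemma ex_cx: "k < c ==> ALL x:set xs. snd x < c ==> length xs = n ==>
 ex (unif n) (%m. cx (if b then k else k + c) (map2 (tag c) m xs)) = cx k xs/2"
proof (induction xs arbitrary: n)
 case (Cons y ys)
 thus ?case
  by (cases n) (auto simp: ex_uniform_Suc ex_add tag_def of_bool_def)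
qed (simp add: uniform_vec_0)

lemma ex_cn: "ALL x:set xs. snd x < c ==> length xs = n ==> ex (unif n) (%m. cn (map2 (tag c) m xs)) = cn xs/2"
proof (induction xs arbitrary: n)
 case (Cons x xs)
 have "ex (unif (length xs)) (%m. cn (map2 (tag c) (b # m) (x # xs))) = cx (snd x) xs/2 + cn xs/2" for b
 proof -
  have "cn (map2 (tag c) (b # m) (x # xs)) = cx (if b then snd x else snd x + c) (map2 (tag c) m xs) + cn (map2 (tag c) m xs)" for m
   by (simp add: tag_def)
  thus ?thesis using ex_cx[of "snd x" c xs "length xs" b] Cons by (simp add: ex_add)
 qed
 thus ?case using Cons.prems by (cases n) (simp_all add: ex_uniform_Suc)
qed (simp add: uniform_vec_0)

lemma ex_cn_rk: "ALL x:set xs. snd x < c ==> length xs = n ==> ex (vecs r n) (%ms. cn (rk c ms xs)) = cn xs/2^r"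
proof (induction r arbitrary: c xs)
 case (Suc r)
 have "ex (vecs r n) (%ms. cn (rk c (m # ms) xs)) = cn (map2 (tag c) m xs)/2^r" if m: "length m = n" for m
 proof -
  have ms: "mset (part m (map2 (tag c) m xs)) = mset (map2 (tag c) m xs)" using m Suc.prems by (intro mset_part) simp
  have "ALL x:set (map2 (tag c) m xs). snd x < 2*c" using Suc.prems by (fastforce simp: tag_def dest: set_zip_rightD)
  hence "ALL x:set (part m (map2 (tag c) m xs)). snd x < 2*c" using ms by (metis set_mset_mset)
  thus ?thesis using Suc.IH[of "part m (map2 (tag c) m xs)" "2*c"] m Suc.prems msymD[OF msym_cn ms] by (simp add: length_part')
 qed
 hence "ex (vecs (Suc r) n) (%ms. cn (rk c ms xs)) = ex (unif n) (%m. cn (map2 (tag c) m xs)/2^r)"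
  unfolding ex_vecs_Suc by (intro ex_cong fin_uniform) (simp add: set_uniform_vec)
 thus ?case using ex_cn[OF Suc.prems] by simp
qed simp

text \<open>Keys depend on the masks alone, so anonymous items can stand in for the sites.\<close>

definition dst::"nat => bits list => bool" where
 "dst n ms \<longleftrightarrow> distinct (map snd (rk 1 ms (replicate n ((), 0))))"

text \<open>The birthday bound: at most n^2 pairs start with equal keys, each round halves the
  expected number, and a repeated key means at least one collision.\<close>

lemma dst_prob: "1 - real n^2/2^r <= ex (vecs r n) (%ms. of_bool (dst n ms))"
proof -
 let ?xs = "replicate n ((), 0)"
 have "cx 0 (replicate k ((), 0)) = real k" for k by (induction k) auto
 hence "cn (replicate k ((), 0)) <= real k^2" for k
  by (induction k) (auto simp: power2_eq_square algebra_simps)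
 hence "cn ?xs/2^r <= real n^2/2^r" by (intro divide_right_mono) auto
 moreover have "ex (vecs r n) (%ms. 1 - of_bool (dst n ms)) <= ex (vecs r n) (%ms. cn (rk 1 ms ?xs))"
 proof (rule ex_mono[OF fin_vecs])
  fix ms::"bits list"
  show "1 - of_bool (dst n ms) <= cn (rk 1 ms ?xs)"
   using cn_distinct[of "rk 1 ms ?xs"] unfolding dst_def by (cases "distinct (map snd (rk 1 ms ?xs))") simp_all
 qed
 moreover have "... = cn ?xs/2^r" by (rule ex_cn_rk) auto
 moreover have "ex (vecs r n) (%ms. 1 - of_bool (dst n ms)) + ex (vecs r n) (%ms. of_bool (dst n ms)) = 1"
  by (subst ex_add[symmetric]) auto
 ultimately show ?thesis by linarith
qed

definition G::"nat => nat => (site list => real) => site list => real" where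
 "G r n f ps = ex (vecs r n) (%ms. of_bool (dst n ms)*f (fold part ms ps))"

text \<open>The shuffled list is always sorted by its keys. If these are distinct, the list is
  determined by the multiset of keyed items, whose law depends only on the multiset of sites by
  \<open>msym_rk\<close>.\<close>

lemma G_sym:
 assumes "mset ps = mset qs" "length ps = n" shows "G r n f ps = G r n f qs"
proof -
 \<comment> \<open>Sorting by keys makes a symmetric function out of one that reads the order; on
   the actual output it changes nothing.\<close>
 define \<psi> where "\<psi> ks = of_bool (distinct (map snd ks))*f (map fst (sort_key snd ks))" for ks::"(site \<times> nat) list"
 have "msym \<psi>"
  unfolding msym_def
 proof (intro allI impI)
  fix xs ys::"(site \<times> nat) list" assume e: "mset xs = mset ys"
  have d: "distinct (map snd xs) = distinct (map snd ys)" by (intro mset_eq_imp_distinct_iff) (simp add: e)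
  show "\<psi> xs = \<psi> ys"
  proof (cases "distinct (map snd xs)")
   case True
   have "sort_key snd xs = sort_key snd ys"
   using True e by (intro sort_key_inj_key_eq) (auto simp: distinct_map)
   thus ?thesis using d by (simp add: \<psi>_def)
  qed (simp add: \<psi>_def d)
 qed
 moreover have "G r n f ps = ex (vecs r n) (%ms. \<psi> (rk 1 ms (map (%p. (p, 0)) ps)))" if l: "length ps = n" for ps
  unfolding G_def
 proof (rule ex_cong[OF fin_vecs])
  fix ms assume ms: "ms : set_pmf (vecs r n)"
  let ?xs = "map (%p. (p, 0::nat)) ps"
  have "sorted (map snd ?xs)" by (simp add: sorted_iff_nth_mono)
  hence "sorted (map snd (rk 1 ms ?xs))" using set_vecs[OF ms] l by (intro rk_sorted) auto
  hence s: "sort_key snd (rk 1 ms ?xs) = rk 1 ms ?xs" by (rule sort_key_id_if_sorted)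
  have "map snd (rk 1 ms (map (map_prod (%_. ()) id) ?xs)) = map snd (rk 1 ms ?xs)" unfolding rk_map by simp
  moreover have "replicate n ((), 0) = map (map_prod (%_. ()) id) ?xs" using l by (intro nth_equalityI) auto
  ultimately have "map snd (rk 1 ms (replicate n ((), 0))) = map snd (rk 1 ms ?xs)" by (simp only:)
  moreover have "map fst (rk 1 ms ?xs) = fold part ms ps" using set_vecs[OF ms] l by (subst rk_fst) (auto simp: comp_def)
  ultimately show "of_bool (dst n ms)*f (fold part ms ps) = \<psi> (rk 1 ms ?xs)" unfolding \<psi>_def dst_def s by (simp only:)
 qed
 moreover have "length qs = n" using assms by (metis size_mset)
 ultimately show ?thesis
  using msym_rk[of \<psi> "map (%p. (p, 0)) ps" "map (%p. (p, 0)) qs" n r 1] assms by simp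
qed

lemma fold_part: "ALL m:set ms. length m = length xs ==> mset (fold part ms xs) = mset xs & length (fold part ms xs) = length xs"
 by (induction ms arbitrary: xs) (auto simp: mset_part length_part)

text \<open>The steps permute positions regardless of contents, as their action on the list 0, ...,
  n - 1 shows.\<close>

lemma fold_part_inj: assumes ms: "colen n ms" shows "inj_on (fold part ms) {xs. length xs = n}"
proof (rule inj_onI)
 fix xs ys::"'a list" assume l: "xs : {xs. length xs = n}" "ys : {xs. length xs = n}" and e: "fold part ms xs = fold part ms ys"
 have m: "fold part ms (map h zs) = map h (fold part ms zs)" for h::"nat => 'a" and zs
  by (induction ms arbitrary: zs) (auto simp: part_map)
 have "set (fold part ms [0..<n]) = {..<n}"
  using fold_part[of ms "[0..<n]"] ms by (metis atLeast_upt diff_zero length_upt set_mset_mset)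
 moreover have "map ((!) xs) (fold part ms [0..<n]) = map ((!) ys) (fold part ms [0..<n])"
  using e l unfolding m[symmetric] by (metis (mono_tags) map_nth mem_Collect_eq)
 ultimately show "xs = ys" using l by (intro nth_equalityI) auto
qed

lemma finite_X [simp]: "finite (X n w)"
proof -
 have "finite {ps::site list. set ps \<subseteq> UNIV & length ps = n}" by (rule finite_lists_length_eq) simp
 thus ?thesis by (rule finite_subset[rotated]) (auto simp: X_def)
qed

lemma wt_mset: "mset ps = mset qs ==> wt ps = wt qs" unfolding wt_def by (metis mset_filter size_mset)

lemma sum_G: "(\<Sum>ps\<in>X n w. G r n f ps) = ex (vecs r n) (%ms. of_bool (dst n ms))*(\<Sum>ps\<in>X n w. f ps)"
proof -
 have "(\<Sum>ps\<in>X n w. G r n f ps) = ex (vecs r n) (%ms. \<Sum>ps\<in>X n w. of_bool (dst n ms)*f (fold part ms ps))"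
  unfolding G_def by (rule Bochner_Integration.integral_sum[symmetric]) (simp add: integrable_measure_pmf_finite)
 also have "... = ex (vecs r n) (%ms. of_bool (dst n ms)*(\<Sum>ps\<in>X n w. f ps))"
 proof (rule ex_cong[OF fin_vecs])
  fix ms assume "ms : set_pmf (vecs r n)"
  hence ms: "colen n ms" using set_vecs by auto
  have inj: "inj_on (fold part ms) (X n w)" by (rule inj_on_subset[OF fold_part_inj[OF ms]]) (auto simp: X_def)
  have "fold part ms ps : X n w" if "ps : X n w" for ps
   using fold_part[of ms ps] wt_mset[of "fold part ms ps" ps] ms that by (simp add: X_def)
  hence "fold part ms ` X n w \<subseteq> X n w" by blast
  hence "fold part ms ` X n w = X n w" using inj by (intro endo_inj_surj) auto
  thus "(\<Sum>ps\<in>X n w. of_bool (dst n ms)*f (fold part ms ps)) = of_bool (dst n ms)*(\<Sum>ps\<in>X n w. f ps)"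
   using sum.reindex[OF inj, of f] by (simp add: sum_distrib_left[symmetric])
 qed
 finally show ?thesis by simp
qed

subsection \<open>The label rotation\<close>

definition Z::"site list => site list set" where "Z ps = {qs. map nz qs = map nz ps}"

lemma Z_length: "qs : Z ps ==> length qs = length ps" by (auto simp: Z_def dest: map_eq_imp_length_eq)

lemma Z_wt: "qs : Z ps ==> wt qs = wt ps"
proof -
 have W: "wt ps = length (filter id (map nz ps))" for ps by (simp add: wt_def filter_map)
 show "qs : Z ps ==> wt qs = wt ps" unfolding W by (simp add: Z_def)
qed

lemma finite_Z [simp]: "finite (Z ps)"
 by (rule finite_subset[OF _ finite_X[of "length ps" "wt ps"]]) (auto simp: X_def Z_length Z_wt)

lemma Z_Nil [simp]: "Z [] = {[]}" by (simp add: Z_def)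

lemma sum_Z_Cons: "(\<Sum>qs\<in>Z (p # ps). f qs) = (\<Sum>q | nz q = nz p. \<Sum>qs\<in>Z ps. f (q # qs))"
proof -
 have "(\<Sum>qs\<in>Z (p # ps). f qs) = (\<Sum>(q, qs)\<in>{q. nz q = nz p} \<times> Z ps. f (q # qs))"
  by (rule sum.reindex_bij_witness[where i = "%(q, qs). q # qs" and j = "%qs. (hd qs, tl qs)"]) (auto simp: Z_def map_eq_Cons_conv)
 thus ?thesis by (simp add: sum.cartesian_product)
qed

lemma sum_nz: "(\<Sum>q | nz q = b. f q) = (if b then f (True, False) + f (False, True) + f (True, True) else f (False, False))" for f::"site => real"
proof -
 have "{q. nz q = b} = (if b then {(True, False), (False, True), (True, True)} else {(False, False)})"
  by (auto simp: nz_def)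
 thus ?thesis by simp
qed

lemma card_Z: "real (card (Z ps)) = 3^wt ps"
proof -
 have "(\<Sum>qs\<in>Z ps. 1::real) = 3^wt ps"
  by (induction ps) (auto simp: sum_Z_Cons sum_nz simp del: sum_constant)
 thus ?thesis by simp
qed

text \<open>Random powers of an order-three map: after r fair steps the three powers have weights
  that each tend to 1/3.\<close>

lemma rot_coeffs:
 "EX a b c::real. a + b + c = 1 & (ALL t:{a, b, c}. \<bar>t - 1/3\<bar> <= 2/3*(1/2)^r) &
  (ALL f p. ex (unif r) (%cs. f (fold rot cs p)) = a*f p + b*f (rot True p) + c*f (rot True (rot True p)))"
proof (induction r)
 case 0
 show ?case by (intro exI[of _ 1] exI[of _ 0]) (simp add: uniform_vec_0)
next
 case (Suc r)
 then obtain a b c where s: "a + b + c = 1" and d: "ALL t:{a, b, c}. \<bar>t - 1/3\<bar> <= 2/3*(1/2)^r"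
  and e: "!!f p. ex (unif r) (%cs. f (fold rot cs p)) = a*f p + b*f (rot True p) + c*f (rot True (rot True p))"
  by blast
 have rrr: "rot True (rot True (rot True p)) = p" and rF: "rot False p = p" for p by (auto simp: rot_def prod_eq_iff)
 \<comment> \<open>The weights sum to one, so the mean of two deviations is minus half of the third:
   every round halves the distance to 1/3.\<close>
 have "(a + c)/2 - 1/3 = - (b - 1/3)/2" "(a + b)/2 - 1/3 = - (c - 1/3)/2" "(b + c)/2 - 1/3 = - (a - 1/3)/2"
  using s by (simp_all add: field_simps)
 moreover have "\<bar>t - 1/3\<bar> <= 2/3*(1/2*y)" if "t - 1/3 = - (u - 1/3)/2" "\<bar>u - 1/3\<bar> <= 2/3*y" for t u y::real
  unfolding that(1) using that(2) by (simp only: abs_divide abs_minus_cancel) simp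
 ultimately have "ALL t:{(a + c)/2, (a + b)/2, (b + c)/2}. \<bar>t - 1/3\<bar> <= 2/3*(1/2)^Suc r"
  using d unfolding power_Suc by blast
 moreover have "ex (unif (Suc r)) (%cs. f (fold rot cs p)) = (a + c)/2*f p + (a + b)/2*f (rot True p) + (b + c)/2*f (rot True (rot True p))" for f p
  by (simp add: ex_uniform_Suc e rrr rF field_simps)
 moreover have "(a + c)/2 + (a + b)/2 + (b + c)/2 = 1" using s by (simp add: field_simps)
 ultimately show ?case by blast
qed

text \<open>Each weight is at least 1/3 - 2/3 * 2^-r. For nonnegative \<open>f\<close> this suffices
  as a lower bound; a zero label is fixed by the rotation.\<close>

lemma rot_site:
 assumes f: "!!q. 0 <= f q"
 shows "(1 - 2*(1/2)^r)/3 ^ of_bool (nz p)*(\<Sum>q | nz q = nz p. f q) <= ex (unif r) (%cs. f (fold rot cs p))"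
proof -
 obtain a b c::real where s: "a + b + c = 1" and d: "ALL t:{a, b, c}. \<bar>t - 1/3\<bar> <= 2/3*(1/2)^r"
  and e: "!!f p. ex (unif r) (%cs. f (fold rot cs p)) = a*f p + b*f (rot True p) + c*f (rot True (rot True p))"
  using rot_coeffs[of r] by blast
 let ?t = "(1 - 2*(1/2::real)^r)/3"
 have "\<bar>x - 1/3\<bar> <= 2/3*y ==> (1 - 2*y)/3 <= x" for x y::real by (simp add: abs_le_iff field_simps)
 hence t: "?t <= a" "?t <= b" "?t <= c" using d by blast+
 have le: "?t*f p + ?t*f (rot True p) + ?t*f (rot True (rot True p)) <= ex (unif r) (%cs. f (fold rot cs p))"
  unfolding e by (intro add_mono mult_right_mono t f)
 show ?thesis
 proof (cases "nz p")
  case True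
  hence "f p + f (rot True p) + f (rot True (rot True p)) = (\<Sum>q | nz q. f q)"
   using sum_nz[of f True] by (cases p; cases "fst p"; cases "snd p") (auto simp: nz_def rot_def)
  moreover have "?t*(f p + f (rot True p) + f (rot True (rot True p))) <= ex (unif r) (%cs. f (fold rot cs p))"
   using le by (simp only: distrib_left)
  ultimately show ?thesis using True by simp
 next
  case False
  hence "p = (False, False)" by (auto simp: nz_def prod_eq_iff)
  moreover have "(1 - 2*(1/2)^r)*f (False, False) <= 1*f (False, False)" by (intro mult_right_mono f) simp
  ultimately show ?thesis using sum_nz[of f False] s e[of f p]
   by (simp add: nz_def rot_def distrib_right[symmetric])
 qed
qed

lemma rot_lower:
 assumes r: "r >= 1" and f: "!!qs. 0 <= f qs"
 shows "(1 - 2*(1/2)^r)^length ps/3^wt ps*(\<Sum>qs\<in>Z ps. f qs) <= ex (vecs r (length ps)) (%ms. f (fold rotl ms ps))"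
 using f
proof (induction ps arbitrary: f)
 case Nil
 have "fold rotl ms [] = []" for ms by (induction ms) auto
 thus ?case by simp
next
 case (Cons p ps)
 let ?t = "1 - 2*(1/2::real)^r"
 have t: "?t >= 0" using power_decreasing[of 1 r "1/2::real"] r by simp
 have step: "fold rotl (map2 Cons cs ms) (p # ps) = fold rot cs p # fold rotl ms ps" if "length cs = length ms" for cs ms p ps
  using that by (induction cs ms arbitrary: p ps rule: list_induct2) auto
 let ?c = "?t^length ps/3^wt ps"
 have "?t^length (p # ps)/3^wt (p # ps)*(\<Sum>qs\<in>Z (p # ps). f qs) =
   ?t/3 ^ of_bool (nz p)*(\<Sum>q | nz q = nz p. ?c*(\<Sum>qs\<in>Z ps. f (q # qs)))"
  unfolding sum_distrib_left[symmetric] sum_Z_Cons by (simp add: power_add)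
 also have "... <= ex (unif r) (%cs. ?c*(\<Sum>qs\<in>Z ps. f (fold rot cs p # qs)))"
 proof (intro rot_site mult_nonneg_nonneg sum_nonneg Cons.prems)
  show "0 <= ?c" by (intro divide_nonneg_nonneg zero_le_power t) simp
 qed
 also have "... <= ex (unif r) (%cs. ex (vecs r (length ps)) (%ms. f (fold rot cs p # fold rotl ms ps)))"
  using Cons.IH[of "%qs. f (fold rot _ p # qs)"] Cons.prems by (intro ex_mono fin_uniform) auto
 also have "... = ex (vecs r (length (p # ps))) (%ms. f (fold rotl ms (p # ps)))"
  unfolding length_Cons ex_vecs_split
  by (intro ex_cong fin_uniform fin_vecs) (auto simp: step set_uniform_vec dest: set_vecs)
 finally show ?case .
qed

text \<open>Equal length and weight make the two support patterns permutations of one another, and a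
  symmetric \<open>f\<close> does not see this permutation. Used in both directions it gives
  equality.\<close>

lemma sum_Z_le:
 assumes "msym f" "!!qs. 0 <= f qs" "length ps = length ps'" "wt ps = wt ps'"
 shows "(\<Sum>qs\<in>Z ps. f qs) <= (\<Sum>qs\<in>Z ps'. f qs)"
proof -
 have "mset (map nz ps) = replicate_mset (wt ps) True + replicate_mset (length ps - wt ps) False" for ps
 proof (induction ps)
  case (Cons p ps)
  have "wt ps <= length ps" by (simp add: wt_def)
  thus ?case using Cons by (simp add: Suc_diff_le)
 qed simp
 hence "mset (map nz ps') = mset (map nz ps)" using assms by simp
 then obtain p where p: "p permutes {..<length ps}" "permute_list p (map nz ps) = map nz ps'"
  by (metis mset_eq_permutation length_map)
 have "permute_list p qs : Z ps' & f (permute_list p qs) = f qs" if "qs : Z ps" for qs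
  using p that Z_length[OF that] msymD[OF assms(1) mset_permute_list, of p qs]
  by (simp add: Z_def permute_list_map[symmetric])
 moreover have inj: "inj_on (permute_list p) (Z ps)"
  by (rule inj_on_subset[OF permute_list_inj[OF p(1)]]) (auto simp: Z_length)
 ultimately have "(\<Sum>qs\<in>Z ps. f qs) = (\<Sum>qs\<in>permute_list p ` Z ps. f qs)" by (simp add: sum.reindex)
 also have "... <= (\<Sum>qs\<in>Z ps'. f qs)" using calculation \<open>!!qs. qs : Z ps ==> _\<close> assms(2) by (intro sum_mono2) auto
 finally show ?thesis .
qed

definition XW::"nat => nat => bits set" where "XW n w = {e. length e = 2*n & weight n e = w}"

lemma XW_col: "XW n w = col ` X n w"
 by (auto simp: XW_def X_def weight_col elim!: colE)

lemma avg_XW: "avg (XW n w) f = avg (X n w) (%ps. f (col ps))"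
 unfolding avg_def XW_col using inj_on_subset[OF col_inj] by (subst card_image sum.reindex; simp)+

lemma finite_XW [simp]: "finite (XW n w)" by (simp add: XW_col)

lemma X_nonempty: "w <= n ==> X n w ~= {}"
proof -
 assume "w <= n"
 hence "replicate w (True, True) @ replicate (n - w) (False, False) : X n w" by (simp add: X_def wt_def nz_def)
 thus ?thesis by blast
qed

text \<open>The rotations lose one factor per site, the riffle loses the event that two keys
  coincide.\<close>

definition shconst::"nat => real" where
 "shconst n = (1 - 2*(1/2)^n)^n*ex (vecs n n) (%ms. of_bool (dst n ms))"

text \<open>The keys make the riffled list a uniformly random rearrangement whenever they are distinct, and the rotations
 make the nonzero labels nearly uniform: up to the constant, the shuffle forgets everything but the weight.\<close>
lemma shuf_lower:
 assumes n: "n >= 1" and e: "e : XW n w" and f: "!!e. 0 <= f e"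
 shows "shconst n*avg (XW n w) f <= ex (vecs n n) (%ms. ex (vecs n n) (%ms'. f (shuf n ms ms' e)))"
proof -
 obtain ps where ps: "e = col ps" "ps : X n w" using e by (auto simp: XW_col)
 hence l: "length ps = n" "wt ps = w" by (auto simp: X_def)
 define g where "g qs = (if length qs = n then G n n (%ps. f (col ps)) qs else 0)" for qs
 define P where "P = ex (vecs n n) (%ms. of_bool (dst n ms)::real)"
 let ?t = "1 - 2*(1/2::real)^n"
 have g0: "0 <= g qs" for qs unfolding g_def G_def using f by simp
 have gs: "msym g" unfolding msym_def g_def using G_sym by (metis mset_eq_length)
 define H where "H ps = (\<Sum>qs\<in>Z ps. g qs)" for ps
 have Hc: "H qs = H ps" if "qs : X n w" for qs
  using sum_Z_le[OF gs g0, of qs ps] sum_Z_le[OF gs g0, of ps qs] that l by (simp add: H_def X_def)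
 \<comment> \<open>\<open>H\<close> is constant on errors of weight w, hence equal to its average.
   In the double sum every error is counted once for each of the 3^w errors with the same support,
   which cancels the 3^w of \<open>rot_lower\<close>.\<close>
 have "real (card (X n w))*H ps = (\<Sum>qs\<in>X n w. H qs)" using Hc by simp
 also have "... = (\<Sum>qs\<in>X n w. \<Sum>rs | rs : X n w & rs : Z qs. g rs)"
  unfolding H_def by (intro sum.cong refl) (auto simp: X_def Z_length Z_wt)
 also have "... = (\<Sum>rs\<in>X n w. \<Sum>qs | qs : X n w & rs : Z qs. g rs)" by (rule sum.swap_restrict) auto
 also have "... = (\<Sum>rs\<in>X n w. 3^w*g rs)"
 proof (rule sum.cong[OF refl])
  fix rs assume rs: "rs : X n w"
  have "{qs. qs : X n w & rs : Z qs} = Z rs"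
  proof (rule set_eqI)
   fix qs
   have "rs : Z qs \<longleftrightarrow> qs : Z rs" unfolding Z_def by auto
   thus "qs : {qs. qs : X n w & rs : Z qs} \<longleftrightarrow> qs : Z rs"
   using rs Z_length[of qs rs] Z_wt[of qs rs] by (auto simp: X_def)
  qed
  thus "(\<Sum>qs | qs : X n w & rs : Z qs. g rs) = 3^w*g rs" using rs card_Z[of rs] by (simp add: X_def)
 qed
 also have "... = 3^w*(P*(\<Sum>qs\<in>X n w. f (col qs)))"
  using sum_G[of n n "%ps. f (col ps)" w] by (simp add: g_def P_def sum_distrib_left[symmetric] X_def)
 finally have H: "H ps = 3^w*P*avg (X n w) (%ps. f (col ps))"
  using ps(2) by (cases "card (X n w) = 0") (auto simp: avg_def field_simps)
 have "shconst n*avg (XW n w) f = ?t^n/3^w*H ps"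
  unfolding H avg_XW shconst_def P_def[symmetric] by simp
 also have "... <= ex (vecs n n) (%ms. g (fold rotl ms ps))"
  using rot_lower[of n g ps] n g0 l by (simp add: H_def)
 also have "... = ex (vecs n n) (%ms. g (fold rotl (map rev ms) ps))" by (rule ex_vecs_rev[symmetric])
 also have "... <= ex (vecs n n) (%ms. ex (vecs n n) (%ms'. f (shuf n ms ms' e)))"
 proof (rule ex_mono[OF fin_vecs])
  fix ms assume ms: "ms : set_pmf (vecs n n)"
  have "g qs <= ex (vecs n n) (%ms'. f (col (fold part ms' qs)))" for qs
   unfolding g_def G_def using f by (auto intro!: ex_mono simp: of_bool_def)
  also have "ex (vecs n n) (%ms'. f (col (fold part ms' (fold rotl (map rev ms) ps)))) = ex (vecs n n) (%ms'. f (shuf n ms ms' e))"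
   using set_vecs[OF ms] l ps by (intro ex_cong fin_vecs) (simp add: shuf_col set_vecs)
  finally show "g (fold rotl (map rev ms) ps) <= ex (vecs n n) (%ms'. f (shuf n ms ms' e))" .
 qed
 finally show ?thesis .
qed

lemma shconst_nonneg: "n >= 1 ==> 0 <= shconst n"
 unfolding shconst_def using power_decreasing[of 1 n "1/2::real"] by (intro mult_nonneg_nonneg) auto

text \<open>Both factors are at least 3/4, the power by Bernoulli's inequality.\<close>

lemma shconst_lower: assumes n: "n >= 1" "2*real n + real n^2 <= 2^n/4" shows "1/2 <= shconst n"
proof -
 let ?x = "2*(1/2::real)^n"
 have h: "(1/2::real)^n = 1/2^n" by (simp add: power_one_over)
 have a: "real n*?x <= 1/4" "real n^2/2^n <= 1/4" using n(2) unfolding h by (simp_all add: field_simps) (use zero_le_power2[of "real n"] in linarith)+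
 have "1*?x <= real n*?x" using n by (intro mult_right_mono) auto
 hence "?x <= 1" using a(1) by linarith
 hence "1 + real n*(- ?x) <= (1 + - ?x)^n" using a by (intro Bernoulli_inequality) auto
 hence "3/4 <= (1 - ?x)^n" using a by simp
 moreover have "3/4 <= ex (vecs n n) (%ms. of_bool (dst n ms)::real)" using dst_prob[of n n] a by linarith
 ultimately have "3/4*(3/4) <= shconst n" unfolding shconst_def by (intro mult_mono) auto
 thus ?thesis by simp
qed

subsection \<open>Reaching a given weight\<close>

lemma fin_nzl [simp]: "finite (set_pmf (nzl l n fl))"
 by (induction n arbitrary: fl) (auto simp: coin2_def)

lemma fin_nzv [simp]: "finite (set_pmf (nzv l n))" by (simp add: nzv_def)

lemma map2_px_zero: "length xs = length ps ==> set xs \<subseteq> {(False, False)} ==> map2 px xs ps = ps"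
 by (induction xs ps rule: list_induct2) (auto simp: px_def)

lemma set_nzl_False: "xs : set_pmf (nzl l n False) ==> set xs \<subseteq> {(False, False)}"
 by (induction n arbitrary: xs) (fastforce simp: coin2_def)+

lemma prob_all_ones: "ex (unif l) (%v. f (list_all id v)) = f True/2^l + (1 - 1/2^l)*f False"
 by (induction l) (auto simp: uniform_vec_0 ex_uniform_Suc field_simps)

lemma ex_nzl_True: "ex (nzl l (Suc n) True) f = ex (nzl l n False) (%xs. f ((False, False) # xs))/2^l +
  (1 - 1/2^l)*((\<Sum>q\<in>UNIV. ex (nzl l n True) (%xs. f (q # xs)))/4)"
proof -
 have "ex (nzl l (Suc n) True) f = ex (unif l) (%v. ex (coin2 (~ list_all id v)) (%x. ex (nzl l n (~ list_all id v)) (%xs. f (x # xs))))"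
  by (simp add: ex_bind coin2_def)
 also have "... = ex (coin2 False) (%x. ex (nzl l n False) (%xs. f (x # xs)))/2^l +
  (1 - 1/2^l)*ex (coin2 True) (%x. ex (nzl l n True) (%xs. f (x # xs)))"
  using prob_all_ones[of l "%b. ex (coin2 (~ b)) (%x. ex (nzl l n (~ b)) (%xs. f (x # xs)))"] by simp
 also have "ex (coin2 True) g = (\<Sum>q\<in>UNIV. g q)/4" for g::"site => real"
  by (simp add: coin2_def ex_bind ex_coin) (simp add: UNIV_bool UNIV_Times_UNIV[symmetric] del: UNIV_Times_UNIV)
 finally show ?thesis by (simp add: coin2_def)
qed

text \<open>The probability that a binomial variable with n trials of success probability 3/4 is at
  least w; truncated subtraction keeps a reached threshold at 0. It is the chance that uniform
  labels on n sites have weight at least w.\<close>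

fun bt::"nat => nat => real" where
 "bt 0 w = of_bool (w = 0)" | "bt (Suc n) w = bt n w/4 + 3/4*bt n (w - 1)"

lemma bt_01: "0 <= bt n w & bt n w <= 1"
proof (induction n w rule: bt.induct)
 case (2 n w)
 thus ?case by auto
qed simp

text \<open>A reverse Markov inequality: Bin - w + 1 has mean 3n/4 - w + 1, is at most K if the
  threshold is reached and at most 0 otherwise.\<close>

lemma bt_markov: "K > 0 ==> K >= real n - real w + 1 ==> real n*3/4 - real w + 1 <= K*bt n w"
proof (induction n arbitrary: w)
 case (Suc n)
 have b0: "bt m 0 = 1" for m by (induction m) auto
 show ?case
 proof (cases w)
  case 0
  thus ?thesis using Suc.prems of_nat_0_le_iff[of n, where 'a = real] by (simp add: b0 field_simps)
 next
  case (Suc v)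
  have "real n*3/4 - real w + 1 <= K*bt n w" "real n*3/4 - real v + 1 <= K*bt n v"
   using Suc.IH[of w] Suc.IH[of v] Suc.prems Suc by auto
  thus ?thesis using Suc by (simp add: algebra_simps)
 qed
qed (auto simp: of_bool_def)

lemma bt_lower: assumes "3*w <= 2*n" shows "1/4 <= bt n w"
proof -
 let ?K = "real n - real w + 1"
 have w: "3*real w <= 2*real n" using assms by linarith
 have K: "?K > 0" using w by linarith
 have "?K*(1/4) <= real n*3/4 - real w + 1" using w by (simp add: field_simps)
 also have "... <= ?K*bt n w" using K by (intro bt_markov) auto
 finally show ?thesis using K by (simp only: mult_le_cancel_left_pos)
qed

text \<open>As the noise reaches one more site, the weight changes by at most one, so a path that starts at
 weight at most \<open>w\<close> and ends at weight at least \<open>w\<close> passes through \<open>w\<close>, where the noise stops with probability \<open>2\<^sup>-\<^sup>l\<close>.\<close>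
lemma nzl_hit:
 "wt ps <= w ==> 1/2^l*(1 - 1/2^l)^length ps*bt (length ps) w <= ex (nzl l (length ps) True) (%xs. of_bool (wt (map2 px xs ps) = w))"
proof (induction ps arbitrary: w)
 case (Cons p ps)
 let ?q = "1/2^l::real" and ?n = "length ps"
 have q: "0 <= ?q" "?q <= 1" by simp_all
 let ?N = "%w. ex (nzl l ?n True) (%xs. of_bool (wt (map2 px xs ps) = w))"
 have N0: "0 <= ?N w" for w by simp
 have zero: "ex (nzl l ?n False) (%xs. of_bool (wt (map2 px ((False, False) # xs) (p # ps)) = w)) = of_bool (wt (p # ps) = w)"
 proof -
  have "ex (nzl l ?n False) (%xs. of_bool (wt (map2 px ((False, False) # xs) (p # ps)) = w)) = ex (nzl l ?n False) (%xs. of_bool (wt (p # ps) = w))"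
  proof (rule ex_cong[OF fin_nzl])
   fix xs assume xs: "xs : set_pmf (nzl l ?n False)"
   have "map2 px xs ps = ps" using set_nzl[OF xs] set_nzl_False[OF xs] by (rule map2_px_zero)
   thus "of_bool (wt (map2 px ((False, False) # xs) (p # ps)) = w) = (of_bool (wt (p # ps) = w)::real)" by (simp add: px_def)
  qed
  thus ?thesis by simp
 qed
 show ?case
 proof (cases "wt (p # ps) = w")
  \<comment> \<open>The current weight is already the target, so it is enough that the noise stops
    before this site.\<close>
  case True
  have "?q*(1 - ?q)^length (p # ps)*bt (length (p # ps)) w <= ?q*1*1"
  proof (intro mult_mono)
   show "(1 - ?q)^length (p # ps) <= 1" by (rule power_le_one) (use q in auto)
  qed (use q bt_01 in "auto simp del: bt.simps")
  also have "... <= ex (nzl l (length (p # ps)) True) (%xs. of_bool (wt (map2 px xs (p # ps)) = w))"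
   unfolding length_Cons ex_nzl_True zero using q True by (auto intro!: mult_nonneg_nonneg sum_nonneg)
  finally show ?thesis .
 next
  \<comment> \<open>The weight is below the target, so both w and w - 1 still dominate the weight of
    the remaining sites and the induction applies after this site is randomised.\<close>
  case False
  hence w: "wt ps <= w - 1" "wt ps <= w" "w >= 1" using Cons.prems by (auto split: if_splits)
  \<comment> \<open>Adding a uniform label makes the site uniform whatever it was: one zero and
    three nonzero outcomes.\<close>
  have sum: "(\<Sum>q\<in>UNIV. ex (nzl l ?n True) (%xs. of_bool (wt (map2 px (q # xs) (p # ps)) = w))) = ?N w + 3*?N (w - 1)"
  proof -
   have "ex (nzl l ?n True) (%xs. of_bool (wt (map2 px (q # xs) (p # ps)) = w)) = ?N (w - of_bool (nz (px q p)))" for q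
   using w by (intro ex_cong fin_nzl) (auto simp: of_bool_def)
   hence "(\<Sum>q\<in>UNIV. ex (nzl l ?n True) (%xs. of_bool (wt (map2 px (q # xs) (p # ps)) = w))) = (\<Sum>q\<in>UNIV. ?N (w - of_bool (nz (px q p))))"
   by (simp only:)
   also have "... = (\<Sum>q\<in>UNIV. ?N (w - of_bool (nz q)))"
   by (rule sum.reindex_bij_witness[where i = "%q. px q p" and j = "%q. px q p"]) (auto simp: px_def)
   also have "... = ?N w + 3*?N (w - 1)"
   by (simp add: UNIV_bool UNIV_Times_UNIV[symmetric] nz_def del: UNIV_Times_UNIV)
   finally show ?thesis .
  qed
  let ?c = "?q*(1 - ?q)^?n"
  have "?q*(1 - ?q)^length (p # ps)*bt (length (p # ps)) w = (1 - ?q)*((?c*bt ?n w + 3*(?c*bt ?n (w - 1)))/4)"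
   by (simp add: field_simps)
  also have "... <= (1 - ?q)*((?N w + 3*?N (w - 1))/4)"
   using Cons.IH[OF w(1)] Cons.IH[OF w(2)] q by (intro mult_left_mono divide_right_mono add_mono) auto
  also have "... <= ex (nzl l (length (p # ps)) True) (%xs. of_bool (wt (map2 px xs (p # ps)) = w))"
   unfolding length_Cons ex_nzl_True zero sum by simp
  finally show ?thesis .
 qed
qed simp

lemma nzv_hit:
 assumes e: "length e = 2*n" "weight n e <= w" and w: "3*w <= 2*n"
 shows "1/2^l*(1 - 1/2^l)^n/4 <= ex (nzv l n) (%f. of_bool (vadd f e : XW n w))"
proof -
 obtain ps where ps: "e = col ps" "length ps = n" using e(1) by (rule colE)
 have wp: "wt (rev ps) <= w" using e ps by (simp add: weight_col)
 let ?c = "1/2^l*(1 - 1/2^l)^n::real"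
 have "?c/4 = ?c*(1/4)" by simp
 also have "... <= ?c*bt n w" by (intro mult_left_mono bt_lower w) auto
 also have "... <= ex (nzl l n True) (%xs. of_bool (wt (map2 px xs (rev ps)) = w))"
  using nzl_hit[OF wp, of l] ps by simp
 also have "... = ex (nzl l n True) (%xs. of_bool (vadd (rev (map fst xs) @ rev (map snd xs)) e : XW n w))"
 proof (rule ex_cong[OF fin_nzl])
  fix xs assume "xs : set_pmf (nzl l n True)"
  hence l: "length xs = n" by (rule set_nzl)
  have "rev (map fst xs) @ rev (map snd xs) = col (rev xs)" by (simp add: col_def rev_map)
  hence "vadd (rev (map fst xs) @ rev (map snd xs)) e = col (map2 px (rev xs) ps)" using l ps by (simp add: vadd_col)
  moreover have "map2 px (rev xs) ps = rev (map2 px xs (rev ps))" using l ps by (simp add: rev_map zip_rev[symmetric])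
  ultimately show "of_bool (wt (map2 px xs (rev ps)) = w) = (of_bool (vadd (rev (map fst xs) @ rev (map snd xs)) e : XW n w)::real)"
   using l ps by (simp add: XW_def weight_col)
 qed
 finally show ?thesis by (simp add: nzv_def)
qed

subsection \<open>The depolarising noise\<close>

lemma fin_noise_pair [simp]: "finite (set_pmf (noise_pair p))"
 by (simp add: noise_pair_def finite_subset[OF subset_UNIV])
lemma fin_noise_pairs [simp]: "finite (set_pmf (noise_pairs p n))" by (induction n) auto
lemma fin_noise [simp]: "finite (set_pmf (noise p n))" by (simp add: noise_def)

lemma length_noise: "e : set_pmf (noise p n) ==> length e = 2*n"
proof -
 have "ps : set_pmf (noise_pairs p n) ==> length ps = n" for ps by (induction n arbitrary: ps) auto
 thus "e : set_pmf (noise p n) ==> length e = 2*n" by (auto simp: noise_def)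
qed

context
 fixes p::real assumes p: "0 <= p" "p <= 1"
begin

definition pw::"nat => nat => real" where "pw n w = (p/3)^w*(1 - p)^(n - w)"

lemma ex_noise_pair: "ex (noise_pair p) f = (1 - p)*f (False, False) + p/3*(\<Sum>q | nz q. f q)"
proof -
 have "ex (noise_pair p) f = ex (bernoulli_pmf p) (%b. ex (if b then pmf_of_set {(False, True), (True, False), (True, True)} else ret (False, False)) f)"
  unfolding noise_pair_def by (rule ex_bind) (auto simp: finite_subset[OF subset_UNIV])
 also have "... = p*((\<Sum>q | nz q. f q)/3) + (1 - p)*f (False, False)"
  using p sum_nz[of f True] by (simp add: integral_pmf_of_set)
 finally show ?thesis by simp
qed

lemma ex_noise_pairs: "ex (noise_pairs p n) f = (\<Sum>ps | length ps = n. pw n (wt ps)*f ps)"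
proof (induction n arbitrary: f)
 case (Suc n)
 have "ex (noise_pairs p (Suc n)) f = ex (noise_pair p) (%x. ex (noise_pairs p n) (%xs. f (x # xs)))"
  by (simp add: ex_bind)
 also have "... = (\<Sum>q\<in>UNIV. (if nz q then p/3 else 1 - p)*(\<Sum>ps | length ps = n. pw n (wt ps)*f (q # ps)))"
 proof -
  have "(\<Sum>q\<in>UNIV. (if nz q then p/3 else 1 - p)*h q) = (1 - p)*h (False, False) + p/3*(\<Sum>q | nz q. h q)" for h::"site => real"
   using sum_nz[of h True] by (simp add: UNIV_bool UNIV_Times_UNIV[symmetric] nz_def distrib_left del: UNIV_Times_UNIV)
  thus ?thesis unfolding ex_noise_pair Suc by simp
 qed
 also have "... = (\<Sum>q\<in>UNIV. \<Sum>ps | length ps = n. pw (Suc n) (wt (q # ps))*f (q # ps))"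
 proof -
  have "wt ps <= length ps" for ps by (simp add: wt_def)
  thus ?thesis unfolding sum_distrib_left
   by (intro sum.cong refl) (auto simp: pw_def Suc_diff_le)
 qed
 also have "... = (\<Sum>(q, ps)\<in>UNIV \<times> {ps. length ps = n}. pw (Suc n) (wt (q # ps))*f (q # ps))"
  by (simp add: sum.cartesian_product)
 also have "... = (\<Sum>ps | length ps = Suc n. pw (Suc n) (wt ps)*f ps)"
  by (rule sum.reindex_bij_witness[where i = "%ps. (hd ps, tl ps)" and j = "%(q, ps). q # ps"]) (auto simp: length_Suc_conv)
 finally show ?case .
qed (simp add: pw_def)

definition bet::"nat => nat => real" where "bet n w = real (card (X n w))*pw n w"

lemma bet_nonneg: "0 <= bet n w" using p by (simp add: bet_def pw_def)

lemma finite_pairs_len: "finite {ps::site list. length ps = n}"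
 using finite_lists_length_eq[of "UNIV::site set" n] by simp

lemma ex_noise_pairs_bet: "ex (noise_pairs p n) f = (\<Sum>w\<le>n. bet n w*avg (X n w) f)"
proof -
 have "ex (noise_pairs p n) f = (\<Sum>w\<le>n. \<Sum>ps | ps : {ps. length ps = n} & wt ps = w. pw n (wt ps)*f ps)"
  unfolding ex_noise_pairs by (rule sum.group[symmetric]) (auto simp: finite_pairs_len wt_def)
 also have "... = (\<Sum>w\<le>n. bet n w*avg (X n w) f)"
 proof (rule sum.cong[OF refl])
  fix w assume "w : {..n}"
  hence "card (X n w) ~= 0" using X_nonempty by auto
  moreover have "(\<Sum>ps | ps : {ps. length ps = n} & wt ps = w. pw n (wt ps)*f ps) = pw n w*(\<Sum>ps\<in>X n w. f ps)"
   by (simp add: X_def sum_distrib_left)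
  ultimately show "(\<Sum>ps | ps : {ps. length ps = n} & wt ps = w. pw n (wt ps)*f ps) = bet n w*avg (X n w) f"
   by (simp add: bet_def avg_def)
 qed
 finally show ?thesis .
qed

lemma ex_noise: "ex (noise p n) f = (\<Sum>w\<le>n. bet n w*avg (XW n w) f)"
 by (simp add: noise_def ex_noise_pairs_bet avg_XW flip: col_def)

text \<open>The mean of 2^wt is (1 + p)^n, and one weight class contributes no more than the whole.
  This exponential moment bound is what excludes large weights later.\<close>

lemma bet_mgf: assumes "w <= n" shows "bet n w*2^w <= (1 + p)^n"
proof -
 have "(\<Sum>w\<le>n. bet n w*avg (X n w) (%ps. 2^wt ps)) = ex (noise_pairs p n) (%ps. 2^wt ps)"
  by (simp add: ex_noise_pairs_bet)
 also have "... = (1 + p)^n"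
 proof (induction n)
  case (Suc n)
  have "ex (noise_pairs p (Suc n)) (%ps. 2^wt ps) = ex (noise_pair p) (%x. 2 ^ of_bool (nz x)*ex (noise_pairs p n) (%xs. 2^wt xs))"
   by (simp add: ex_bind power_add)
  thus ?case using sum_nz[of "%x. 2 ^ of_bool (nz x)*(1 + p)^n" True]
   by (simp only: Suc ex_noise_pair) (simp add: nz_def algebra_simps)
 qed simp
 finally have "(\<Sum>w\<le>n. bet n w*avg (X n w) (%ps. 2^wt ps)) = (1 + p)^n" .
 moreover have "bet n w*avg (X n w) (%ps. 2^wt ps) <= (\<Sum>w\<le>n. bet n w*avg (X n w) (%ps. 2^wt ps))"
  using assms bet_nonneg by (intro member_le_sum) (auto intro!: mult_nonneg_nonneg sum_nonneg divide_nonneg_nonneg simp: avg_def)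
 moreover have "avg (X n w) (%ps. 2^wt ps) = (2::real)^w"
  using X_nonempty[OF assms] by (simp add: avg_def X_def card_eq_0_iff finite_X[unfolded X_def])
 ultimately show ?thesis by simp
qed

lemma bet_le_1: assumes "w <= n" shows "bet n w <= 1"
proof -
 have "(\<Sum>w\<le>n. bet n w) = 1"
 proof -
  have "(\<Sum>w\<le>n. bet n w*avg (X n w) (%_. 1)) = 1" unfolding ex_noise_pairs_bet[symmetric] by simp
  moreover have "bet n w*avg (X n w) (%_. 1) = bet n w" if "w <= n" for w using X_nonempty[OF that] by simp
  ultimately show ?thesis by simp
 qed
 thus ?thesis using member_le_sum[of w "{..n}" "bet n"] assms bet_nonneg by simp
qed

end

section \<open>The success probability\<close>

subsection \<open>Averages\<close>

lemma avg_nonneg: "(!!x. x : S ==> 0 <= f x) ==> 0 <= avg S f" by (simp add: avg_def sum_nonneg)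

lemma avg_le_1: "(!!x. x : S ==> f x <= 1) ==> avg S f <= 1"
 using sum_bounded_above[of S f 1] by (cases "card S = 0") (auto simp: avg_def)

lemma avg_swap: "avg S (%x. avg S' (f x)) = avg S' (%y. avg S (%x. f x y))"
 by (simp add: avg_def sum_divide_distrib[symmetric]) (subst sum.swap, simp add: mult.commute)

lemma avg_ex: "avg S (%x. ex D (f x)) = ex D (%d. avg S (%x. f x d))" if "fsup D"
 unfolding avg_def using that by (simp add: integrable_measure_pmf_finite Bochner_Integration.integral_sum)

lemma avg_bij: "bij_betw h S S' ==> avg S (%x. f (h x)) = avg S' f"
 unfolding avg_def using sum.reindex_bij_betw[of h S S' f] bij_betw_same_card[of h S S'] by simp

lemma ex_point: "fsup D ==> (!!x. 0 <= f x) ==> pmf D a*f a <= ex D f"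
proof (cases "a : set_pmf D")
 case True
 thus "fsup D ==> (!!x. 0 <= f x) ==> pmf D a*f a <= ex D f"
  by (simp add: ex_sum) (rule member_le_sum[of a "set_pmf D" "%x. pmf D x*f x"], auto)
qed (simp add: set_pmf_iff)

subsection \<open>Bases of a Lagrangian subspace\<close>

text \<open>All ordered bases of one Lagrangian subspace.\<close>

definition cl::"nat => bits list => bits list set" where
 "cl n A = {M : lag n. sp2 n M = sp2 n A}"

definition tup::"bits set => nat => bits list set" where "tup S j = {M. set M \<subseteq> S & length M = j}"

lemma sum_tup_Suc: "(\<Sum>M\<in>tup S (Suc j). f M) = (\<Sum>v\<in>S. \<Sum>M\<in>tup S j. f (v # M))"
proof -
 have "(\<Sum>M\<in>tup S (Suc j). f M) = (\<Sum>(v, M)\<in>S \<times> tup S j. f (v # M))"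
  by (rule sum.reindex_bij_witness[where i = "%(v, M). v # M" and j = "%M. (hd M, tl M)"]) (auto simp: tup_def length_Suc_conv)
 thus ?thesis by (simp add: sum.cartesian_product)
qed

text \<open>For \<open>h\<close> the coordinate map of a frame: coefficient vectors drawn by the
  machine become independent uniform vectors of the span.\<close>

lemma ex_mix: "bij_betw h (vecs_of n) S ==> ex (vecs j n) (%us. f (map h us)) = (\<Sum>M\<in>tup S j. f M)/2^(j*n)"
proof (induction j arbitrary: f)
 case 0
 have "tup S 0 = {[]}" by (auto simp: tup_def)
 thus ?case by simp
next
 case (Suc j)
 have "ex (vecs (Suc j) n) (%us. f (map h us)) = av n (%v. (\<Sum>M\<in>tup S j. f (h v # M))/2^(j*n))"
  by (simp only: ex_vecs_Suc ex_uniform list.map Suc.IH[OF Suc.prems, of "%M. f (h _ # M)"])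
 also have "... = avg S (%v. (\<Sum>M\<in>tup S j. f (v # M))/2^(j*n))" by (rule avg_bij[OF Suc.prems])
 also have "... = (\<Sum>M\<in>tup S (Suc j). f M)/2^(Suc j*n)"
  using bij_betw_same_card[OF Suc.prems] by (simp add: avg_def card_len sum_tup_Suc sum_divide_distrib[symmetric] power_add mult.commute)
 finally show ?case .
qed

context
 fixes n::nat and A::"bits list"
 assumes A: "A : lag n"
begin

lemma A_len: "colen (2*n) A" "length A = n" using frames_len[OF A] by auto

lemma mat_vec_bij: "bij_betw (mx n A) (vecs_of n) (sp2 n A)"
proof -
 have "full_rank (2*n) A" using A by (simp add: frames_def)
 thus ?thesis unfolding bij_betw_def inj_on_def using mat_vec_inj[OF A_len(1)] A_len(2) by (auto simp: span_image)
qed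

lemma cl_tup: "M : tup (sp2 n A) n ==> full_rank (2*n) M ==> M : cl n A"
proof -
 assume M: "M : tup (sp2 n A) n" "full_rank (2*n) M"
 have l: "colen (2*n) M" using M span_length[OF A_len(1)] by (auto simp: tup_def)
 have "sp2 n M \<subseteq> sp2 n A" using M by (intro span_subset A_len) (simp add: tup_def)
 moreover have "card (sp2 n M) = card (sp2 n A)"
  using card_span[OF l M(2)] card_span_frames[OF A] M by (simp add: tup_def)
 ultimately have "sp2 n M = sp2 n A" by (intro card_subset_eq) auto
 thus ?thesis using frames_span_eq[OF A, of M] M col_in_span[OF A_len(1)] by (auto simp: cl_def tup_def)
qed

lemma cl_sub: "cl n A \<subseteq> tup (sp2 n A) n"
proof
 fix M assume "M : cl n A"
 thus "M : tup (sp2 n A) n" using frames_len[of M n n] col_in_span[of M "2*n"] by (auto simp: cl_def tup_def)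
qed

lemma finite_tup [simp]: "finite (tup (sp2 n A) j)" unfolding tup_def by (rule finite_lists_length_eq) simp
lemma finite_cl [simp]: "finite (cl n A)" using cl_sub by (rule finite_subset) simp

lemma card_cl_le: "real (card (cl n A)) <= 2^(n*n)"
proof -
 have "card (cl n A) <= card (tup (sp2 n A) n)" using cl_sub by (intro card_mono) auto
 also have "... = 2^(n*n)" unfolding tup_def using card_span_frames[OF A] by (subst card_lists_length_eq) (auto simp: power_mult)
 finally show ?thesis by (metis of_nat_le_iff of_nat_numeral of_nat_power)
qed

lemma card_indep: "j <= n ==> (\<Sum>M\<in>tup (sp2 n A) j. of_bool (full_rank (2*n) M)) = (\<Prod>i<j. (2::real)^n - 2^i)"
proof (induction j)
 case 0
 have "tup (sp2 n A) 0 = {[]}" by (auto simp: tup_def)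
 thus ?case by simp
next
 case (Suc j)
 let ?S = "sp2 n A"
 have "(\<Sum>M\<in>tup ?S (Suc j). of_bool (full_rank (2*n) M)) = (\<Sum>M\<in>tup ?S j. \<Sum>v\<in>?S. of_bool (full_rank (2*n) (v # M))::real)"
  unfolding sum_tup_Suc by (rule sum.swap)
 also have "... = (\<Sum>M\<in>tup ?S j. (2^n - 2^j) * of_bool (full_rank (2*n) M))"
 proof (rule sum.cong[OF refl])
  fix M assume M: "M : tup ?S j"
  have l: "colen (2*n) M" "length M = j" using M span_length[OF A_len(1)] by (auto simp: tup_def)
  show "(\<Sum>v\<in>?S. of_bool (full_rank (2*n) (v # M))::real) = (2^n - 2^j) * of_bool (full_rank (2*n) M)"
  proof (cases "full_rank (2*n) M")
   case True
   have sub: "sp2 n M \<subseteq> ?S" using M by (intro span_subset A_len) (simp add: tup_def)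
   have "(\<Sum>v\<in>?S. of_bool (full_rank (2*n) (v # M))::real) = (\<Sum>v\<in>?S. of_bool (v \<notin> sp2 n M))"
   using full_rank_Cons[OF _ l(1)] span_length[OF A_len(1)] True by (intro sum.cong) auto
   also have "... = real (card (?S - sp2 n M))" by (simp add: Diff_eq Compl_eq)
   also have "... = 2^n - 2^j"
   using sub card_span[OF l(1) True] card_span_frames[OF A] l(2) Suc.prems
   by (simp add: card_Diff_subset of_nat_diff)
   finally show ?thesis using True by simp
  next
   case False
   thus ?thesis using full_rank_Cons[OF _ l(1)] span_length[OF A_len(1)] by auto
  qed
 qed
 also have "... = (\<Prod>i<Suc j. 2^n - 2^i)" using Suc by (simp add: sum_distrib_left[symmetric])
 finally show ?case .
qed

lemma card_cl_ge: "2^(n*n)/4 <= real (card (cl n A))"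
proof -
 \<comment> \<open>The extra summand makes the bound inductive; for m = 1 it is an equality.\<close>
 have q: "1/4 + 1/2^Suc m <= (\<Prod>i<m. 1 - 1/2^Suc i::real)" if "m >= 1" for m
  using that
 proof (induction m rule: dec_induct)
  case (step m)
  let ?y = "1/2^m::real"
  have y: "0 <= ?y" "?y <= 1/2" using power_increasing[of 1 m "2::real"] step(1) by (auto simp: field_simps)
  have "1/4 + ?y/4 <= (1/4 + ?y/2)*(1 - ?y/2)" using mult_left_mono[OF y(2) y(1)] by (simp add: field_simps)
  also have "... <= (\<Prod>i<m. 1 - 1/2^Suc i)*(1 - ?y/2)" using step y by (intro mult_right_mono) (auto simp: mult.commute)
  finally show ?case by (simp add: mult.commute)
 qed simp
 have "1/4 <= (\<Prod>i<n. 1 - 1/2^Suc i::real)"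
 proof (cases "n = 0")
  case False
  hence "1/4 + 1/2^Suc n <= (\<Prod>i<n. 1 - 1/2^Suc i::real)" by (intro q) simp
  moreover have "(0::real) <= 1/2^Suc n" by simp
  ultimately show ?thesis by linarith
 qed simp
 also have "(\<Prod>i<n. 1 - 1/2^Suc i::real) = (\<Prod>i<n. (2^n - 2^i)/2^n)"
 proof -
  have "(1::real) - 1/2^Suc (n - Suc i) = (2^n - 2^i)/2^n" if "i < n" for i
  proof -
   have "Suc (n - Suc i) = n - i" using that by simp
   thus ?thesis using that by (simp add: power_diff diff_divide_distrib)
  qed
  thus ?thesis by (subst prod.nat_diff_reindex[symmetric]) simp
 qed
 also have "... = (\<Prod>i<n. 2^n - 2^i)/2^(n*n)" by (simp add: prod_dividef power_mult)
 finally have "2^(n*n)/4 <= (\<Prod>i<n. (2::real)^n - 2^i)" by (simp add: field_simps)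
 also have "... = (\<Sum>M\<in>tup (sp2 n A) n. of_bool (full_rank (2*n) M))" using card_indep by simp
 also have "... <= (\<Sum>M\<in>tup (sp2 n A) n. of_bool (M : cl n A))" using cl_tup by (intro sum_mono) (auto simp: of_bool_def)
 also have "... = card (cl n A)" using cl_sub by (simp add: Int_absorb1)
 finally show ?thesis .
qed

lemma cl_map: assumes "sp n g" shows "cl n (map g A) = map g ` cl n A"
proof
 show "map g ` cl n A \<subseteq> cl n (map g A)"
  using sp_frames[OF assms] sp_span[OF assms] frames_len A by (fastforce simp: cl_def)
 show "cl n (map g A) \<subseteq> map g ` cl n A"
 proof
  fix M' assume M': "M' : cl n (map g A)"
  then obtain M where M: "M' = map g M" "M : lag n"
   using sp_frames_bij[OF assms, of n] by (auto simp: cl_def bij_betw_def)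
  have "g ` sp2 n M = g ` sp2 n A"
   using M' M sp_span[OF assms] frames_len[OF M(2)] A_len by (simp add: cl_def)
  moreover have "sp2 n M \<subseteq> vecs_of (2*n)" "sp2 n A \<subseteq> vecs_of (2*n)"
   using span_length frames_len[OF M(2)] A_len by blast+
  ultimately have "sp2 n M = sp2 n A" using inj_on_image_eq_iff[OF sp_inj[OF assms]] by blast
  thus "M' : map g ` cl n A" using M by (simp add: cl_def)
 qed
qed

lemma span_avg: assumes "M : cl n A" shows "av n (%x. f (mx n A x)) = av n (%x. f (mx n M x))"
proof -
 have M: "M : lag n" "sp2 n M = sp2 n A" using assms by (auto simp: cl_def)
 have "bij_betw (mx n M) (vecs_of n) (sp2 n A)"
 proof -
  have "full_rank (2*n) M" using M by (simp add: frames_def)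
  thus ?thesis unfolding bij_betw_def inj_on_def M(2)[symmetric] using mat_vec_inj frames_len[OF M(1)] by (auto simp: span_image)
 qed
 thus ?thesis using avg_bij[OF mat_vec_bij, of f] avg_bij[of "mx n M" _ _ f] by simp
qed

end

subsection \<open>The second matrix\<close>

definition Bs::"nat => nat => bits list => bits list set" where
 "Bs k n A = {B. is_mat (2*n) k B & isotropic n B & full_rank (2*n) (A @ B)}"

lemma span_append: "colen m (A @ B) ==> span m (A @ B) = (\<Union>a\<in>span m A. vadd a ` span m B)"
proof (induction A)
 case Nil
 thus ?case using span_length[of B m] by (auto simp: image_iff)
next
 case (Cons c A)
 thus ?case by (simp add: span_Cons image_Un image_UN image_image UN_Un vadd_assoc)
qed

lemma span_eq_full_rank:
 assumes "colen m (A @ B)" "colen m A'" "length A' = length A" "span m A' = span m A"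
 shows "full_rank m (A @ B) \<longleftrightarrow> full_rank m (A' @ B)"
proof -
 have l: "colen m (A' @ B)" using assms by auto
 have "span m (A' @ B) = span m (A @ B)" unfolding span_append[OF l] span_append[OF assms(1)] assms(4) ..
 thus ?thesis unfolding full_rank_card[OF l] full_rank_card[OF assms(1)] using assms(3) by simp
qed

lemma finite_Bs [simp]: "finite (Bs k n A)"
proof (rule finite_subset)
 show "finite {B. set B \<subseteq> vecs_of (2*n) & length B = k}" by (rule finite_lists_length_eq[OF finite_len])
qed (auto simp: Bs_def is_mat_def)

lemma Bs_span:
 assumes "A : lag n" "A' : lag n" "sp2 n A' = sp2 n A" shows "Bs k n A' = Bs k n A"
proof -
 have "full_rank (2*n) (A @ B) \<longleftrightarrow> full_rank (2*n) (A' @ B)" if "is_mat (2*n) k B" for B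
  using span_eq_full_rank[of A B "2*n" A'] assms frames_len[OF assms(1)] frames_len[OF assms(2)] that by (auto simp: is_mat_def)
 thus ?thesis by (auto simp: Bs_def)
qed

lemma Bs_map: assumes g: "sp n g" and A: "A : lag n" shows "bij_betw (map g) (Bs k n A) (Bs k n (map g A))"
proof -
 have in_iff: "map g B : Bs k n (map g A) \<longleftrightarrow> B : Bs k n A" if B: "colen (2*n) B" for B
  using B frames_len[OF A] sp_isotropic[OF g B] sp_full_rank[OF g, of "A @ B"] sp_length[OF g] by (auto simp: Bs_def is_mat_def)
 have l: "B : Bs k n M ==> colen (2*n) B" for B M by (auto simp: Bs_def is_mat_def)
 have "B' : map g ` Bs k n A" if B': "B' : Bs k n (map g A)" for B'
 proof -
  let ?B = "map (inv_into (vecs_of (2*n)) g) B'"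
  have im: "c : g ` vecs_of (2*n)" if "c : set B'" for c
   using l[OF B'] that bij_betw_imp_surj_on[OF sp_bij[OF g]] by blast
  have "map g ?B = B'" using im by (auto intro!: map_idI simp: f_inv_into_f)
  moreover have "ALL c:set ?B. length c = 2*n" using inv_into_into[OF im] by simp
  ultimately have "?B : Bs k n A" using in_iff[of ?B] B' by (simp only:)
  hence "map g ?B : map g ` Bs k n A" by (rule imageI)
  thus ?thesis by (simp only: \<open>map g ?B = B'\<close>)
 qed
 moreover have "map g ` Bs k n A \<subseteq> Bs k n (map g A)" using in_iff l by blast
 moreover have "inj_on (map g) (Bs k n A)" by (rule inj_on_subset[OF sp_map_inj[OF g]]) (use l in blast)
 ultimately show ?thesis by (auto simp: bij_betw_def)
qed

text \<open>The number of admissible second blocks depends on the span only and is invariant under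
  transvections, so the spectral gap makes it constant.\<close>

lemma card_Bs_const:
 assumes n: "n >= 1" and A: "A : lag n" "A' : lag n" shows "card (Bs k n A) = card (Bs k n A')"
proof -
 let ?f = "%A. real (card (Bs k n A))"
 have "span_inv n n ?f" unfolding span_inv_def
 proof (intro ballI impI)
  fix M M' assume "M : lag n" "M' : lag n" "sp2 n M = sp2 n M'"
  from Bs_span[OF this(1,2) this(3)[symmetric], of k] show "?f M = ?f M'" by simp
 qed
 moreover have "?f (tv n u M) = ?f M" if "M : lag n" "length u = 2*n" for M u
  using bij_betw_same_card[OF Bs_map[OF sp_tvf[OF that(2)] that(1), of k]] by simp
 ultimately show ?thesis using tv_invariant_const[OF n, of ?f A] tv_invariant_const[OF n, of ?f A'] A by simp
qed

section \<open>Block matrices and existence of instances\<close>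

lemma mat_vec_append: "length x = length A ==> colen m (A @ B) ==> mat_vec m (A @ B) (x @ y) = vadd (mat_vec m A x) (mat_vec m B y)"
proof (induction x A rule: list_induct2)
 case (Cons b x c A)
 thus ?case by (simp add: vadd_assoc)
qed simp

lemma full_rank_prefix: assumes "full_rank m (A @ B)" "colen m (A @ B)" shows "full_rank m A"
 unfolding full_rank_zeros
proof (intro allI impI)
 fix x assume x: "length x = length A & mat_vec m A x = zeros m"
 hence "mat_vec m (A @ B) (x @ zeros (length B)) = zeros m" using assms(2) by (simp add: mat_vec_append)
 moreover have "length (x @ zeros (length B)) = length (A @ B)" using x by (simp add: zeros_def)
 ultimately have "x @ zeros (length B) = zeros (length (A @ B))" using assms(1) unfolding full_rank_zeros by blast
 moreover have "zeros (length (A @ B)) = zeros (length A) @ zeros (length B)" by (simp add: zeros_def replicate_add)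
 ultimately show "x = zeros (length A)" using x by (simp add: zeros_def)
qed

lemma lsn_Sigma: "lsn_mats k n = Sigma (lag n) (Bs k n)"
proof -
 have "full_rank (2*n) A" if "is_mat (2*n) n A" "is_mat (2*n) k B" "full_rank (2*n) (A @ B)" for A B
  using full_rank_prefix[OF that(3)] that by (auto simp: is_mat_def)
 thus ?thesis by (auto simp: lsn_mats_def frames_def Bs_def)
qed

fun idm::"nat => bits list" where
 "idm 0 = []" | "idm (Suc n) = (True # zeros n) # map (Cons False) (idm n)"

lemma idm_props: "length (idm n) = n & (colen n (idm n)) & (ALL x. length x = n --> mat_vec n (idm n) x = x)"
proof (induction n)
 case (Suc n)
 have c: "mat_vec (Suc n) (map (Cons False) M) x = False # mat_vec n M x" for M x
  by (induction M x rule: list_induct2') auto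
 have z: "length (zeros n) = n" by (simp add: zeros_def)
 show ?case
 proof (intro conjI allI impI)
  fix x::"bits" assume "length x = Suc n"
  then obtain b y where x: "x = b # y" "length y = n" by (cases x) auto
  thus "mat_vec (Suc n) (idm (Suc n)) x = x" using Suc by (auto simp: c)
 qed (use Suc z in auto)
qed simp

text \<open>The two coordinate Lagrangians, the second cut down to k columns, form an
  instance.\<close>

lemma lsn_nonempty: assumes "k <= n" shows "lsn_mats k n ~= {}"
proof -
 let ?A = "map (%c. c @ zeros n) (idm n)" and ?B = "map (%c. zeros n @ c) (idm n)"
 have lz: "length (zeros n) = n" by (simp add: zeros_def)
 have zz: "zeros n @ zeros n = zeros (2*n)" by (simp add: zeros_def replicate_add[symmetric] mult_2)
 have l: "colen (2*n) (?A @ ?B)" using idm_props[of n] lz by auto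
 have "mx n (map (%c. c @ zeros n) M) x = mat_vec n M x @ zeros n & mx n (map (%c. zeros n @ c) M) x = zeros n @ mat_vec n M x"
  if "colen n M" for M x
  using that by (induction M x rule: list_induct2') (auto simp: zz[symmetric] vadd_append lz)
 hence mv: "mx n ?A x = x @ zeros n" "mx n ?B x = zeros n @ x" if "length x = n" for x
  using idm_props[of n] that by auto
 have "full_rank (2*n) (?A @ ?B)"
  unfolding full_rank_zeros
 proof (intro allI impI)
  fix w assume w: "length w = length (?A @ ?B) & mx n (?A @ ?B) w = zeros (2*n)"
  let ?x = "take n w" and ?y = "drop n w"
  have lw: "length w = 2*n" using w idm_props[of n] by simp
  hence "mx n (?A @ ?B) (?x @ ?y) = vadd (?x @ zeros n) (zeros n @ ?y)"
   using l idm_props[of n] mv by (subst mat_vec_append) auto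
  hence "mx n (?A @ ?B) w = w" using lw lz by (simp add: vadd_append)
  thus "w = zeros (length (?A @ ?B))" using w lw by simp
 qed
 hence "full_rank (2*n) (?A @ take k ?B)"
  using full_rank_prefix[of "2*n" "?A @ take k ?B" "drop k ?B"] l by (simp del: set_append)
 moreover have s1: "~ sympl n u v" if uv: "u : set ?A" "v : set ?A" for u v
 proof -
  obtain a b where "u = a @ zeros n" "v = b @ zeros n" "a : set (idm n)" "b : set (idm n)" using uv unfolding set_map by blast
  moreover from this(3,4) have "length a = n" "length b = n" using idm_props[of n] by simp_all
  ultimately show ?thesis by (simp add: sympl_def dotp_comm[of _ "zeros n"])
 qed
 moreover have s2: "~ sympl n u v" if uv: "u : set (take k ?B)" "v : set (take k ?B)" for u v
 proof -
  obtain a b where "u = zeros n @ a" "v = zeros n @ b" using uv by (auto dest!: in_set_takeD)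
  thus ?thesis by (simp add: sympl_def lz)
 qed
 ultimately have "(?A, take k ?B) : lsn_mats k n"
  using l idm_props[of n] assms unfolding lsn_mats_def by (auto simp: is_mat_def isotropic_iff dest: in_set_takeD)
 thus ?thesis by blast
qed

lemma finite_lsn [simp]: "finite (lsn_mats k n)" unfolding lsn_Sigma by (intro finite_SigmaI) auto

text \<open>All fibres over \<open>A\<close> have the same size, so a uniform pair is a uniform
  \<open>A\<close> followed by a uniform \<open>B\<close>. In particular \<open>A\<close> alone is a
  uniform Lagrangian frame, as in the other problem.\<close>

lemma avg_lsn: assumes n: "n >= 1"
 shows "avg (lsn_mats k n) (%(A, B). f A B) = avg (lag n) (%A. avg (Bs k n A) (f A))"
proof -
 obtain C where C: "!!A. A : lag n ==> card (Bs k n A) = C" using card_Bs_const[OF n] by blast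
 have "card (lsn_mats k n) = card (lag n)*C" unfolding lsn_Sigma using C by (simp add: card_SigmaI)
 moreover have "(\<Sum>(A, B)\<in>lsn_mats k n. f A B) = (\<Sum>A\<in>lag n. \<Sum>B\<in>Bs k n A. f A B)"
  unfolding lsn_Sigma by (rule sum.Sigma[symmetric]) auto
 moreover have "(\<Sum>A\<in>lag n. avg (Bs k n A) (f A)) = (\<Sum>A\<in>lag n. \<Sum>B\<in>Bs k n A. f A B)/C"
  unfolding sum_divide_distrib[of "%A. sum (f A) (Bs k n A)"] using C by (intro sum.cong) (auto simp: avg_def)
 ultimately show ?thesis by (simp add: avg_def)
qed

subsection \<open>One call of each solver\<close>

lemma ex_diff: "fsup D ==> ex D (%x. f x - g x) = ex D f - ex D g"
 by (simp add: ex_sum right_diff_distrib sum_subtractf)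

lemma avg_sum: "avg S (%x. (\<Sum>y\<in>C. h x y)/c) = (\<Sum>y\<in>C. avg S (%x. h x y))/c"
 unfolding avg_def by (simp add: sum_divide_distrib[symmetric]) (subst sum.swap, simp add: mult.commute)

definition rnd::"nat => nat => ((bits => bits) \<times> bits) pmf" where
 "rnd l n = do { f <- nzv l n; ms <- vecs n n; ms' <- vecs n n; ret (shuf n ms ms', f) }"

lemma ex_rnd: "ex (rnd l n) F = ex (nzv l n) (%f. ex (vecs n n) (%ms. ex (vecs n n) (%ms'. F (shuf n ms ms', f))))"
 by (simp add: rnd_def ex_bind)

lemma fin_rnd [simp]: "finite (set_pmf (rnd l n))" by (simp add: rnd_def)

lemma set_rnd: "gf : set_pmf (rnd l n) ==> sp n (fst gf) & length (snd gf) = 2*n"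
 by (auto simp: rnd_def sp_shuf length_nzv)

lemma rnd_hit:
 assumes "n >= 1" "!!e. 0 <= f e"
 shows "ex (nzv l n) (%u. of_bool (vadd u e : XW n w))*(shconst n*avg (XW n w) f) <=
  ex (rnd l n) (%gu. of_bool (vadd (snd gu) e : XW n w)*f (fst gu (vadd (snd gu) e)))"
proof -
 have "ex (nzv l n) (%u. of_bool (vadd u e : XW n w))*(shconst n*avg (XW n w) f) =
  ex (nzv l n) (%u. of_bool (vadd u e : XW n w)*(shconst n*avg (XW n w) f))" by simp
 also have "... <= ex (rnd l n) (%gu. of_bool (vadd (snd gu) e : XW n w)*f (fst gu (vadd (snd gu) e)))"
  unfolding ex_rnd using shuf_lower[OF assms(1) _ assms(2)] by (intro ex_mono fin_nzv) (auto simp: of_bool_def)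
 finally show ?thesis .
qed

text \<open>Conjugating the transvection along u by a symplectic map gives the one along the image
  of u, and images of uniform vectors are uniform. So the walk commutes with the site maps.\<close>

lemma KK_map1: assumes g: "sp n g" and A: "A : lag n" shows "KK n f (map g A) = KK n (%A. f (map g A)) A"
proof -
 have eq: "tv n (g u) (map g A) = map g (tv n u A)" if "length u = 2*n" for u
  using frames_len[OF A] that by (auto simp: tvf_sympl sp_length[OF g] sp_sympl[OF g] sp_vadd[OF g])
 have "av (2*n) (%u. f (tv n (g u) (map g A))) = av (2*n) (%u. f (map g (tv n u A)))"
  by (rule avg_cong) (simp only: eq mem_Collect_eq)
 thus ?thesis using avg_bij[OF sp_bij[OF g], of "%u. f (tv n u (map g A))"] by (simp add: KK_def)
qed

lemma KK_cong: "A : lag n ==> (!!A. A : lag n ==> f A = f' A) ==> KK n f A = KK n f' A"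
proof -
 assume A: "A : lag n" and f: "!!A. A : lag n ==> f A = f' A"
 have "av (2*n) (%u. f (tv n u A)) = av (2*n) (%u. f' (tv n u A))"
  by (rule avg_cong) (simp add: f sp_frames[OF sp_tvf A])
 thus ?thesis by (simp add: KK_def f[OF A])
qed

lemma KK_map: "sp n g ==> A : lag n ==> (KK n ^^ s) f (map g A) = (KK n ^^ s) (%A. f (map g A)) A"
proof (induction s arbitrary: A)
 case (Suc s)
 hence "(KK n ^^ Suc s) f (map g A) = KK n (%A. (KK n ^^ s) f (map g A)) A" by (simp add: KK_map1)
 also have "... = KK n ((KK n ^^ s) (%A. f (map g A))) A" using Suc by (intro KK_cong) auto
 finally show ?case by simp
qed simp

lemma KK_pos: "(!!A. 0 <= f A) ==> 0 <= (KK n ^^ s) f A"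
 by (induction s arbitrary: A) (auto simp: KK_def avg_nonneg)

lemma fin_luz [simp]: "finite (set_pmf (luz n))" by (simp add: luz_def)

lemma ex_luz: "ex (luz n) f = (av (2*n) f + f (zeros (2*n)))/2"
proof -
 have "ex (luz n) f = (av n (%p. av n (%q. f (p @ q))) + f (zeros (2*n)))/2"
  by (simp add: luz_def ex_bind ex_coin ex_uniform zeros_def)
 also have "av n (%p. av n (%q. f (p @ q))) = av (2*n) f"
 proof -
  have "(\<Sum>(p, q)\<in>vecs_of n \<times> vecs_of n. f (p @ q)) = (\<Sum>v\<in>vecs_of (2*n). f v)"
   by (rule sum.reindex_bij_witness[where i = "%v. (take n v, drop n v)" and j = "%(p, q). p @ q"]) auto
  thus ?thesis
   by (simp add: avg_def card_len sum_divide_distrib[symmetric] sum.cartesian_product mult_2 power_add)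
 qed
 finally show ?thesis .
qed

lemma fin_tvr [simp]: "finite (set_pmf (tvr n s Az))"
 by (induction s arbitrary: Az) auto

text \<open>A transvection maps \<open>Ar\<close> to \<open>Ar\<close> or \<open>Ar + u\<close>; guessing which one costs a factor two per round.\<close>
lemma tvr_lower:
 assumes "!!x. 0 <= f x"
 shows "A : lag n ==> length e = 2*n ==>
  (1/2) ^ s*(KK n ^^ s) (%A. f (A, vadd (mx n A r) e)) A <= ex (tvr n s (A, vadd (mx n A r) e)) f"
proof (induction s arbitrary: A)
 case (Suc s)
 let ?h = "(KK n ^^ s) (%A. f (A, vadd (mx n A r) e))" and ?z = "vadd (mx n A r) e"
 have "(1/2)^Suc s*(KK n ^^ Suc s) (%A. f (A, vadd (mx n A r) e)) A = ex (luz n) (%u. (1/2)^Suc s*?h (tv n u A))"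
 proof -
  have "tv n (zeros (2*n)) A = A" using frames_len[OF Suc.prems(1)] by (auto intro!: map_idI tvf_zeros)
  hence "(KK n ^^ Suc s) (%A. f (A, vadd (mx n A r) e)) A = ex (luz n) (%u. ?h (tv n u A))"
   by (simp add: ex_luz) (simp add: KK_def)
  thus ?thesis by simp
 qed
 also have "... <= ex (luz n) (%u. ex coin (%c. ex (tvr n s (tv n u A, if c then vadd u ?z else ?z)) f))"
 proof (rule ex_mono[OF fin_luz])
  fix u assume "u : set_pmf (luz n)"
  hence u: "length u = 2*n" by (rule set_luz)
  have "mx n (tv n u A) r = tvf n u (mx n A r)"
   using frames_len[OF Suc.prems(1)] by (intro sp_mat_vec sp_tvf u) auto
  hence z: "vadd (mx n (tv n u A) r) e = (if sympl n (mx n A r) u then vadd u ?z else ?z)"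
   using u frames_len[OF Suc.prems(1)] by (simp add: tvf_sympl vadd_assoc)
  have "(1/2)^Suc s*?h (tv n u A) <= ex (tvr n s (tv n u A, vadd (mx n (tv n u A) r) e)) f/2"
   using Suc.IH[OF sp_frames[OF sp_tvf[OF u] Suc.prems(1)] Suc.prems(2)] by simp
  also have "... <= ex coin (%c. ex (tvr n s (tv n u A, if c then vadd u ?z else ?z)) f)"
   unfolding z ex_coin using assms by simp
  finally show "(1/2)^Suc s*?h (tv n u A) <= ex coin (%c. ex (tvr n s (tv n u A, if c then vadd u ?z else ?z)) f)" .
 qed
 also have "... = ex (tvr n (Suc s) (A, ?z)) f" by (simp add: ex_bind cong: if_cong)
 finally show ?case .
qed simp

text \<open>The value s arises from s heads followed by a tail; all other outcomes are
  dropped.\<close>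

lemma ex_geol: "s < n ==> (!!l. 0 <= f l) ==> (1/2)^Suc s*f s <= ex (geol True n) f"
proof (induction n arbitrary: s f)
 case (Suc n)
 have F: "geol False m = ret 0" for m by (induction m) (auto simp: bind_ret map_pmf_def)
 have fin: "finite (set_pmf (geol True m))" for m by (rule finite_subset[of _ "{..m}"]) (auto dest: set_geol)
 have e: "ex (geol True (Suc n)) f = (ex (geol True n) (%l. f (Suc l)) + f 0)/2"
  by (simp add: ex_bind fin F ex_coin)
 show ?case
 proof (cases s)
  case 0
  thus ?thesis unfolding e using Suc.prems by simp
 next
  case (Suc t)
  have "(1/2)^Suc t*f (Suc t) <= ex (geol True n) (%l. f (Suc l))" using Suc Suc.prems by (intro Suc.IH) auto
  hence "(1/2)^Suc t*f (Suc t) <= ex (geol True n) (%l. f (Suc l)) + f 0" by (intro add_increasing2 Suc.prems)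
  hence "(1/2)^Suc t*f (Suc t)/2 <= (ex (geol True n) (%l. f (Suc l)) + f 0)/2" by (rule divide_right_mono) simp
  moreover have "(1/2)^Suc s*f s = (1/2)^Suc t*f (Suc t)/2" by (simp add: Suc)
  ultimately show ?thesis unfolding e by (simp only:)
 qed
qed simp

context
 fixes n k::nat and O1 O2::"bits => bits pmf"
 assumes n: "n >= 1" and k: "k <= n" and fin1 [simp]: "!!i. finite (set_pmf (O1 i))" and fin2 [simp]: "!!i. finite (set_pmf (O2 i))"
begin

definition q1::"bits list => bits => bits => real" where
 "q1 A r e = pmf (O1 (enc_mat A @ enc_bits (vadd (mx n A r) e))) (enc_bits r)"

definition q2::"bits list => bits list => bits => bits => bits => real" where
 "q2 A B x y e = pmf (O2 (enc_mat A @ enc_mat B @ enc_bits (vadd (vadd (mx n A x) (mx n B y)) e))) (enc_bits y)"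

definition Q2::"bits list => bits => real" where
 "Q2 A e = avg (Bs k n A) (%B. av k (%y. av n (%x. q2 A B x y e)))"

text \<open>Division is by the number of all n-tuples of the span, not of its bases: this is the
  chance that the random tuple is a basis and the second solver then succeeds. It depends on the
  span of \<open>A\<close> only.\<close>

definition G2::"bits list => bits => real" where
 "G2 A e = (\<Sum>M\<in>cl n A. Q2 M e)/2^(n*n)"

lemma Q2_01: "0 <= Q2 A e" "Q2 A e <= 1"
 unfolding Q2_def q2_def by (intro avg_nonneg pmf_nonneg) (intro avg_le_1 pmf_le_1)

lemma G2_01: assumes "A : lag n" shows "0 <= G2 A e" "G2 A e <= 1"
proof -
 show "0 <= G2 A e" unfolding G2_def using Q2_01 by (simp add: sum_nonneg)
 have "(\<Sum>M\<in>cl n A. Q2 M e) <= real (card (cl n A))*1" by (rule sum_bounded_above) (rule Q2_01)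
 hence "(\<Sum>M\<in>cl n A. Q2 M e) <= 2^(n*n)" using card_cl_le[OF assms] by linarith
 thus "G2 A e <= 1" unfolding G2_def by (simp add: divide_le_eq)
qed

lemma G2_span: "span_inv n n (%A. G2 A e)" by (simp add: span_inv_def G2_def cl_def)

text \<open>By double counting each frame is weighted with the chance that a random tuple of its
  span is a basis, which is at least 1/4 by \<open>card_cl_ge\<close>.\<close>

lemma avg_G2: "avg (lag n) (%A. Q2 A e)/4 <= avg (lag n) (%A. G2 A e)"
proof -
 have "(\<Sum>A\<in>lag n. Q2 A e)*(1/4) <= (\<Sum>A\<in>lag n. Q2 A e*(real (card (cl n A))/2^(n*n)))"
  unfolding sum_distrib_right
 proof (rule sum_mono)
  fix A assume "A : lag n"
  hence "1/4 <= real (card (cl n A))/2^(n*n)" using card_cl_ge[of A n] by (simp add: field_simps)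
  thus "Q2 A e*(1/4) <= Q2 A e*(real (card (cl n A))/2^(n*n))" by (intro mult_left_mono Q2_01)
 qed
 also have "... = (\<Sum>A\<in>lag n. \<Sum>M | M : lag n & sp2 n M = sp2 n A. Q2 A e)/2^(n*n)"
  by (simp add: cl_def sum_divide_distrib mult.commute)
 also have "... = (\<Sum>A\<in>lag n. \<Sum>M | M : lag n & sp2 n A = sp2 n M. Q2 M e)/2^(n*n)"
  by (subst sum.swap_restrict) auto
 also have "... = (\<Sum>A\<in>lag n. G2 A e)"
  unfolding sum_divide_distrib G2_def cl_def by (intro sum.cong arg_cong2[where f = "(/)"]) auto
 finally have "(\<Sum>A\<in>lag n. Q2 A e)*(1/4)/card (lag n) <= (\<Sum>A\<in>lag n. G2 A e)/card (lag n)"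
  by (rule divide_right_mono) simp
 thus ?thesis by (simp add: avg_def mult.commute)
qed

text \<open>Each site map distributes over \<open>Ar\<close>, so the shuffled instance is again of
  the form \<open>A'r + e'\<close>; then \<open>tvr_lower\<close> applies, and \<open>KK_map\<close>
  pulls the site map out of the walk.\<close>

lemma in1_lower:
 assumes A: "A : lag n" and e: "length e = 2*n"
 shows "(1/2) ^ s*ex (rnd s n) (%gu. (KK n ^^ s) (%A. q1 (map (fst gu) A) r (fst gu (vadd (snd gu) e))) A) <=
  ex (in1 n s A (vadd (mx n A r) e)) (%i. pmf (O1 i) (enc_bits r))"
proof -
 have "in1 n s A (vadd (mx n A r) e) = do { gu <- rnd s n; Az <- tvr n s (map (fst gu) A, fst gu (vadd (snd gu) (vadd (mx n A r) e)));
   ret (enc_mat (fst Az) @ enc_bits (snd Az)) }"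
  by (simp add: in1_def rnd_def bind_pmfs case_prod_beta')
 hence E: "ex (in1 n s A (vadd (mx n A r) e)) (%i. pmf (O1 i) (enc_bits r)) =
  ex (rnd s n) (%gu. ex (tvr n s (map (fst gu) A, fst gu (vadd (snd gu) (vadd (mx n A r) e)))) (%Az. pmf (O1 (enc_mat (fst Az) @ enc_bits (snd Az))) (enc_bits r)))"
  by (simp add: ex_bind)
 have "(1/2) ^ s*ex (rnd s n) (%gu. (KK n ^^ s) (%A. q1 (map (fst gu) A) r (fst gu (vadd (snd gu) e))) A) =
  ex (rnd s n) (%gu. (1/2) ^ s*(KK n ^^ s) (%A. q1 (map (fst gu) A) r (fst gu (vadd (snd gu) e))) A)" by simp
 also have "... <= ex (in1 n s A (vadd (mx n A r) e)) (%i. pmf (O1 i) (enc_bits r))"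
  unfolding E
 proof (rule ex_mono[OF fin_rnd])
  fix gu assume "gu : set_pmf (rnd s n)"
  then obtain g u where gu: "gu = (g, u)" and g: "sp n g" and u: "length u = 2*n" using set_rnd by (cases gu) fastforce
  have lA: "colen (2*n) A" using frames_len[OF A] by simp
  have "g (vadd u (vadd (mx n A r) e)) = vadd (mx n (map g A) r) (g (vadd u e))"
   using e u lA by (simp add: vadd_left_comm[of u] sp_vadd[OF g] sp_mat_vec[OF g])
  moreover have "(1/2) ^ s*(KK n ^^ s) (%A. q1 A r (g (vadd u e))) (map g A) <=
   ex (tvr n s (map g A, vadd (mx n (map g A) r) (g (vadd u e)))) (%Az. pmf (O1 (enc_mat (fst Az) @ enc_bits (snd Az))) (enc_bits r))"
   using tvr_lower[of "%Az. pmf (O1 (enc_mat (fst Az) @ enc_bits (snd Az))) (enc_bits r)" "map g A" n "g (vadd u e)" s r] sp_frames[OF g A] sp_length[OF g] e u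
   by (simp add: q1_def)
  ultimately show "(1/2) ^ s*(KK n ^^ s) (%A. q1 (map (fst gu) A) r (fst gu (vadd (snd gu) e))) A <=
   ex (tvr n s (map (fst gu) A, fst gu (vadd (snd gu) (vadd (mx n A r) e)))) (%Az. pmf (O1 (enc_mat (fst Az) @ enc_bits (snd Az))) (enc_bits r))"
   by (simp add: gu KK_map[OF g A])
 qed
 finally show ?thesis .
qed

text \<open>Tuples that are no basis are dropped. For the others the random shift makes the
  coordinates of the first block uniform in the new basis, as a genuine instance requires.\<close>

lemma in2_lower:
 assumes A: "A : lag n" and B: "B : Bs k n A" and e: "length e = 2*n" and r: "length r = n"
 shows "ex (rnd l n) (%gu. (\<Sum>M\<in>cl n A. av n (%x. q2 (map (fst gu) M) (map (fst gu) B) x y (fst gu (vadd (snd gu) e))))/2^(n*n)) <=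
  ex (in2 n l A B (vadd (vadd (mx n A r) (mx n B y)) e)) (%i. pmf (O2 i) (enc_bits y))"
proof -
 let ?z = "vadd (vadd (mx n A r) (mx n B y)) e"
 define \<psi> where "\<psi> gu x M = pmf (O2 (enc_mat (map (fst gu) M) @ enc_mat (map (fst gu) B) @ enc_bits (fst gu (vadd (snd gu) (addcols ?z A x))))) (enc_bits y)" for gu x M
 have lA: "colen (2*n) A" "length A = n" using frames_len[OF A] by auto
 have lB: "colen (2*n) B" using B by (simp add: Bs_def is_mat_def)
 have mix: "mix n A us = map (mx n A) us" for us
  using lA by (simp add: mix_def addcols_mat_vec[where m = "2*n"])
 have "in2 n l A B ?z = do { us <- vecs n n; x <- unif n; gu <- rnd l n;
   ret (enc_mat (map (fst gu) (map (mx n A) us)) @ enc_mat (map (fst gu) B) @ enc_bits (fst gu (vadd (snd gu) (addcols ?z A x)))) }"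
  by (simp add: in2_def rnd_def mix bind_pmfs)
 hence "ex (in2 n l A B ?z) (%i. pmf (O2 i) (enc_bits y)) =
  ex (vecs n n) (%us. ex (unif n) (%x. ex (rnd l n) (%gu. \<psi> gu x (map (mx n A) us))))"
  by (simp add: ex_bind \<psi>_def)
 also have "... = ex (rnd l n) (%gu. ex (vecs n n) (%us. ex (unif n) (%x. \<psi> gu x (map (mx n A) us))))"
  unfolding ex_swap[OF fin_uniform fin_rnd] ex_swap[OF fin_vecs fin_rnd] ..
 finally have E: "ex (in2 n l A B ?z) (%i. pmf (O2 i) (enc_bits y)) =
  ex (rnd l n) (%gu. (\<Sum>M\<in>tup (sp2 n A) n. av n (%x. \<psi> gu x M))/2^(n*n))"
  using ex_mix[OF mat_vec_bij[OF A], of n "%M. av n (%x. \<psi> _ x M)"] by (simp only: ex_uniform)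
 show ?thesis unfolding E
 proof (rule ex_mono[OF fin_rnd])
  fix gu assume "gu : set_pmf (rnd l n)"
  then obtain g u where gu: "gu = (g, u)" and g: "sp n g" and u: "length u = 2*n" using set_rnd by (cases gu) fastforce
  have "av n (%x. q2 (map g M) (map g B) x y (g (vadd u e))) = av n (%x. \<psi> gu x M)" if M: "M : cl n A" for M
  proof -
   define \<theta> where "\<theta> v = pmf (O2 (enc_mat (map g M) @ enc_mat (map g B) @ enc_bits (g (vadd u (vadd (vadd v (mx n B y)) e))))) (enc_bits y)" for v
   have lM: "colen (2*n) M" "length M = n" using M frames_len[of M n n] by (auto simp: cl_def)
   have "q2 (map g M) (map g B) x y (g (vadd u e)) = \<theta> (mx n M x)" for x
   proof -
   have "g (vadd u (vadd (vadd (mx n M x) (mx n B y)) e)) =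
   vadd (vadd (mx n (map g M) x) (mx n (map g B) y)) (g (vadd u e))"
   using e u lM lB by (simp add: vadd_left_comm[of u] sp_vadd[OF g] sp_mat_vec[OF g])
   thus ?thesis by (simp add: q2_def \<theta>_def)
   qed
   hence "av n (%x. q2 (map g M) (map g B) x y (g (vadd u e))) = av n (%x. \<theta> (mx n A x))"
   by (simp add: span_avg[OF A M])
   \<comment> \<open>Translation by the unknown \<open>r\<close> preserves the uniform distribution,
     so the fixed \<open>r\<close> is masked by the random shift.\<close>
   also have "... = av n (%x. \<theta> (mx n A (vadd r x)))"
   proof (rule avg_bij[symmetric])
   show "bij_betw (vadd r) (vecs_of n) (vecs_of n)"
   by (rule bij_betw_byWitness[where f' = "vadd r"]) (use r in auto)
   qed
   also have "... = av n (%x. \<psi> gu x M)"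
   proof (rule avg_cong)
   fix x::"bits" assume x: "x : vecs_of n"
   have "addcols ?z A x = vadd ?z (mx n A x)" using lA lB e by (intro addcols_mat_vec) auto
   also have "... = vadd (vadd (mx n A (vadd r x)) (mx n B y)) e"
   using lA r x by (simp add: mat_vec_vadd vadd_ac)
   finally show "\<theta> (mx n A (vadd r x)) = \<psi> gu x M" by (simp add: \<theta>_def \<psi>_def gu)
   qed
   finally show ?thesis .
  qed
  hence "(\<Sum>M\<in>cl n A. av n (%x. q2 (map g M) (map g B) x y (g (vadd u e)))) = (\<Sum>M\<in>cl n A. av n (%x. \<psi> gu x M))"
   by (intro sum.cong) auto
  also have "... <= (\<Sum>M\<in>tup (sp2 n A) n. av n (%x. \<psi> gu x M))"
   using cl_sub[OF A] finite_tup[OF A] by (intro sum_mono2) (auto intro!: avg_nonneg simp: \<psi>_def)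
  finally show "(\<Sum>M\<in>cl n A. av n (%x. q2 (map (fst gu) M) (map (fst gu) B) x y (fst gu (vadd (snd gu) e))))/2^(n*n) <=
   (\<Sum>M\<in>tup (sp2 n A) n. av n (%x. \<psi> gu x M))/2^(n*n)"
   by (simp add: gu divide_right_mono)
 qed
qed

text \<open>A site map carries the second blocks admissible for \<open>A\<close> bijectively to
  those admissible for its image, so averaging over \<open>B\<close> absorbs it.\<close>

lemma in2_lower_avg:
 assumes A: "A : lag n" and e: "length e = 2*n" and r: "length r = n"
 shows "ex (rnd l n) (%gu. G2 (map (fst gu) A) (fst gu (vadd (snd gu) e))) <= avg (Bs k n A) (%B. av k (%y.
  ex (in2 n l A B (vadd (vadd (mx n A r) (mx n B y)) e)) (%i. pmf (O2 i) (enc_bits y))))"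
proof -
 let ?f = "%gu M B y x. q2 (map (fst gu) M) (map (fst gu) B) x y (fst gu (vadd (snd gu) e))"
 have "ex (rnd l n) (%gu. G2 (map (fst gu) A) (fst gu (vadd (snd gu) e))) =
  ex (rnd l n) (%gu. avg (Bs k n A) (%B. av k (%y. (\<Sum>M\<in>cl n A. av n (?f gu M B y))/2^(n*n))))"
 proof (rule ex_cong[OF fin_rnd])
  fix gu assume "gu : set_pmf (rnd l n)"
  then obtain g u where gu: "gu = (g, u)" and g: "sp n g" using set_rnd by (cases gu) fastforce
  have "Q2 (map g M) e' = avg (Bs k n A) (%B. av k (%y. av n (%x. q2 (map g M) (map g B) x y e')))" if "M : cl n A" for M e'
  proof -
   have "Bs k n (map g M) = Bs k n (map g A)"
   using that sp_frames[OF g] sp_span[OF g, of M] sp_span[OF g, of A] frames_len A by (intro Bs_span) (auto simp: cl_def)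
   thus ?thesis unfolding Q2_def using avg_bij[OF Bs_map[OF g A, of k], of "%B. av k (%y. av n (%x. q2 (map g M) B x y e'))"] by simp
  qed
  moreover have "inj_on (map g) (cl n A)" by (rule inj_on_subset[OF sp_map_inj[OF g]]) (use frames_len in "auto simp: cl_def")
  ultimately have "G2 (map g A) e' = (\<Sum>M\<in>cl n A. avg (Bs k n A) (%B. av k (%y. av n (%x. q2 (map g M) (map g B) x y e'))))/2^(n*n)" for e'
   unfolding G2_def cl_map[OF A g] by (simp add: sum.reindex)
  thus "G2 (map (fst gu) A) (fst gu (vadd (snd gu) e)) =
   avg (Bs k n A) (%B. av k (%y. (\<Sum>M\<in>cl n A. av n (?f gu M B y))/2^(n*n)))"
   by (simp only: gu fst_conv snd_conv avg_sum)
 qed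
 also have "... = avg (Bs k n A) (%B. av k (%y. ex (rnd l n) (%gu. (\<Sum>M\<in>cl n A. av n (?f gu M B y))/2^(n*n))))"
  by (simp only: avg_ex[OF fin_rnd])
 also have "... <= avg (Bs k n A) (%B. av k (%y.
  ex (in2 n l A B (vadd (vadd (mx n A r) (mx n B y)) e)) (%i. pmf (O2 i) (enc_bits y))))"
  by (intro avg_mono in2_lower A e r)
 finally show ?thesis .
qed

text \<open>The two calls see independently shuffled copies of \<open>A\<close>; the mixing of the transvection walk decouples
 the events that the first solver succeeds and that the second one does.\<close>
lemma decoupled:
 assumes e: "length e = 2*n" and r: "length r = n"
 defines "h s w == ex (nzv s n) (%u. of_bool (vadd u e : XW n w))"
 shows "ex (rnd s n) (%gu. of_bool (vadd (snd gu) e : XW n w1)*avg (lag n) (%A. q1 A r (fst gu (vadd (snd gu) e)))) *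
   (h s w2*(shconst n*avg (XW n w2) (%e. avg (lag n) (%A. G2 A e)))) - \<kappa> ^ s*(h s w1*h s w2) <=
  avg (lag n) (%A. ex (rnd s n) (%gu. (KK n ^^ s) (%A. q1 (map (fst gu) A) r (fst gu (vadd (snd gu) e))) A) *
   ex (rnd s n) (%gu. G2 (map (fst gu) A) (fst gu (vadd (snd gu) e))))" (is "?L <= ?R")
proof -
 define I where "I w gu = (of_bool (vadd (snd gu) e : XW n w)::real)" for w and gu::"(bits => bits) \<times> bits"
 define v where "v gu = fst gu (vadd (snd gu) e)" for gu::"(bits => bits) \<times> bits"
 define p where "p gu A = q1 (map (fst gu) A) r (v gu)" for gu A
 define q where "q gu A = G2 (map (fst gu) A) (v gu)" for gu A
 define P where "P gu = avg (lag n) (%A. q1 A r (v gu))" for gu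
 define Q where "Q gu = avg (lag n) (%A. G2 A (v gu))" for gu
 have I: "0 <= I w gu" "I w gu <= 1" for w gu by (simp_all add: I_def)
 have h: "h s w = ex (rnd s n) (I w)" for w by (simp add: h_def I_def ex_rnd)
 have P0: "0 <= P gu" for gu by (auto simp: P_def q1_def intro!: avg_nonneg)
 have "h s w2*(shconst n*avg (XW n w2) (%e. avg (lag n) (%A. if A : lag n then G2 A e else 0))) <= ex (rnd s n) (%gu. I w2 gu*avg (lag n) (%A. if A : lag n then G2 A (v gu) else 0))"
  unfolding h_def I_def v_def using G2_01 by (intro rnd_hit n avg_nonneg) auto
 hence "h s w2*(shconst n*avg (XW n w2) (%e. avg (lag n) (%A. G2 A e))) <= ex (rnd s n) (%gu. I w2 gu*Q gu)"
  by (simp add: Q_def cong: avg_cong)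
 hence "ex (rnd s n) (%gu. I w1 gu*P gu)*(h s w2*(shconst n*avg (XW n w2) (%e. avg (lag n) (%A. G2 A e)))) <=
  ex (rnd s n) (%gu. I w1 gu*P gu)*ex (rnd s n) (%gu. I w2 gu*Q gu)"
  using I P0 by (intro mult_left_mono ex_nonneg) auto
 hence "?L <= ex (rnd s n) (%gu. I w1 gu*P gu)*ex (rnd s n) (%gu. I w2 gu*Q gu) - \<kappa> ^ s*(ex (rnd s n) (I w1)*ex (rnd s n) (I w2))"
  unfolding h I_def P_def v_def by linarith
 also have "... = ex (rnd s n) (%gu. ex (rnd s n) (%gu'. I w1 gu*I w2 gu'*(P gu*Q gu' - \<kappa> ^ s)))"
 proof -
  have "I w1 gu*I w2 gu'*(P gu*Q gu' - \<kappa> ^ s) = (I w1 gu*P gu)*(I w2 gu'*Q gu') - (\<kappa> ^ s*I w1 gu)*I w2 gu'" for gu gu'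
   by (simp add: algebra_simps)
  thus ?thesis by (simp only: ex_diff[OF fin_rnd] integral_mult_right_zero integral_mult_left_zero)
 qed
 \<comment> \<open>The two calls use independent site maps and noises \<open>gu\<close> and
   \<open>gu'\<close>, so the comparison can be made for each fixed pair.\<close>
 also have "... <= ex (rnd s n) (%gu. ex (rnd s n) (%gu'. avg (lag n) (%A. (KK n ^^ s) (p gu) A*q gu' A)))"
 proof (intro ex_mono fin_rnd)
  fix gu gu' assume gu: "gu : set_pmf (rnd s n)" "gu' : set_pmf (rnd s n)"
  have sp: "sp n (fst gu)" "sp n (fst gu')" using set_rnd gu by auto
  have q01: "0 <= q gu' A & q gu' A <= 1" if "A : lag n" for A using G2_01[OF sp_frames[OF sp(2) that]] by (simp add: q_def)
  have p01: "0 <= p gu A & p gu A <= 1" for A by (simp add: p_def q1_def pmf_le_1)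
  have sq: "span_inv n n (q gu')" unfolding q_def by (rule span_inv_sp[OF sp(2) G2_span])
  \<comment> \<open>The algorithm walks in the first call, but the contraction holds for the
    span-invariant factor of the second; self-adjointness moves the walk across.\<close>
  have it: "inn n ((KK n ^^ s) f) g = inn n f ((KK n ^^ s) g)" for f g
  proof (induction s arbitrary: g)
   case (Suc s)
   show ?case using Suc[of "KK n g"] KK_sym[of n "(KK n ^^ s) f" g] by (simp add: funpow_swap1)
  qed simp
  have "P gu*Q gu' - \<kappa> ^ s = avg (lag n) (p gu)*avg (lag n) (q gu') - \<kappa> ^ s"
   using sp_avg[OF sp(1), of n "%A. q1 A r (v gu)"] sp_avg[OF sp(2), of n "%A. G2 A (v gu')"] by (simp add: P_def Q_def p_def[abs_def] q_def[abs_def])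
  also have "... <= avg (lag n) (%A. p gu A*(KK n ^^ s) (q gu') A)"
   by (rule mixing[OF n sq]) (use q01 p01 in auto)
  also have "... = avg (lag n) (%A. (KK n ^^ s) (p gu) A*q gu' A)"
   using it[of "p gu" "q gu'"] by (simp add: avg_def inn_def)
  finally have le: "P gu*Q gu' - \<kappa> ^ s <= avg (lag n) (%A. (KK n ^^ s) (p gu) A*q gu' A)" .
  \<comment> \<open>Needed for pairs that miss a target weight, where the left side is zero.\<close>
  have "0 <= avg (lag n) (%A. (KK n ^^ s) (p gu) A*q gu' A)"
   using q01 p01 by (intro avg_nonneg mult_nonneg_nonneg KK_pos) auto
  thus "I w1 gu*I w2 gu'*(P gu*Q gu' - \<kappa> ^ s) <= avg (lag n) (%A. (KK n ^^ s) (p gu) A*q gu' A)"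
   using le by (auto simp: I_def of_bool_def)
 qed
 also have "... = avg (lag n) (%A. ex (rnd s n) (%gu. ex (rnd s n) (%gu'. (KK n ^^ s) (p gu) A*q gu' A)))"
  by (simp only: avg_ex[OF fin_rnd])
 also have "... = ?R" by (simp add: p_def[abs_def] q_def v_def)
 finally show ?thesis .
qed

end

subsection \<open>The inverter on a fixed error\<close>

lemma fin_guess [simp]: "finite (set_pmf (guess j u))" by (simp add: guess_def)
lemma fin_in1 [simp]: "finite (set_pmf (in1 n l A z))" by (simp add: in1_def case_prod_beta')
lemma fin_in2 [simp]: "finite (set_pmf (in2 n l A B z))" by (simp add: in2_def)
lemma fin_geol [simp]: "finite (set_pmf (geol True m))" by (rule finite_subset[of _ "{..m}"]) (auto dest: set_geol)

lemma ex_guess: "ex (guess j u) f = (f (decode j u) + f (zeros j))/2" by (simp add: guess_def ex_coin)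

lemma ex_ge: "fsup D ==> (!!x. c <= f x) ==> c <= ex D f"
 using ex_mono[of D "%_. c" f] by simp

context
 fixes n k::nat and O1 O2::"bits => bits pmf" and p::real
 assumes n: "n >= 1" and k: "k <= n" and fin1 [simp]: "!!i. finite (set_pmf (O1 i))" and fin2 [simp]: "!!i. finite (set_pmf (O2 i))"
begin

definition enc3::"bits list => bits list => bits => bits => bits => bits" where
 "enc3 A B r y e = vadd (vadd (mx n A r) (mx n B y)) e"

definition win::"bits list => bits list => bits => real" where
 "win A B z = measure_pmf.prob (algd O1 O2 n k A B z) {out. inv_good k p n (A, B, z) out}"

abbreviation good::"bits list => bits list => bits => bits => bits => real" where
 "good A B z r y == of_bool (inv_good k p n (A, B, z) (enc_bits r @ enc_bits y @ enc_bits (addcols (addcols z B y) A r)))"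

lemma win_nonneg: "0 <= win A B z" by (simp add: win_def)

lemma win_ex: "win A B z = ex (geol True n) (%l. ex (in2 n l A B z) (%i2. ex (O2 i2) (%o2. ex (guess k o2) (%y.
  ex (in1 n l A (addcols z B y)) (%i1. ex (O1 i1) (%o1. ex (guess n o1) (%r. good A B z r y)))))))"
proof -
 have "win A B z = ex (algd O1 O2 n k A B z) (%out. of_bool (inv_good k p n (A, B, z) out))"
 proof -
  have "(%out. of_bool (inv_good k p n (A, B, z) out)) = (indicator {out. inv_good k p n (A, B, z) out}::_ => real)"
   by (auto simp: indicator_def)
  thus ?thesis by (simp add: win_def)
 qed
 thus ?thesis by (simp add: algd_def ex_bind)
qed

text \<open>The number of rounds is the required s with probability 2^-(s+1), and the two coins of
  \<open>guess\<close> keep the solvers' answers with probability 1/4. Given the correct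
  \<open>y\<close>, subtracting \<open>By\<close> leaves exactly \<open>Ar + e\<close>.\<close>

lemma win_lower:
 assumes A: "is_mat (2*n) n A" "is_mat (2*n) k B" and l: "length r = n" "length y = k" "length e = 2*n"
  and s: "s < n" and w: "real (weight n e) <= wbound p n"
 shows "(1/2)^Suc s/4*(ex (in2 n s A B (enc3 A B r y e)) (%i. pmf (O2 i) (enc_bits y)) *
  ex (in1 n s A (vadd (mx n A r) e)) (%i. pmf (O1 i) (enc_bits r))) <= win A B (enc3 A B r y e)"
proof -
 let ?z = "enc3 A B r y e"
 have lA: "colen (2*n) A" and lB: "colen (2*n) B" using A by (auto simp: is_mat_def)
 have zB: "addcols ?z B y = vadd (mx n A r) e"
 proof -
  have "addcols ?z B y = vadd ?z (mx n B y)" using lA lB l by (intro addcols_mat_vec) (auto simp: enc3_def)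
  also have "... = vadd (vadd (mx n B y) (mx n B y)) (vadd (mx n A r) e)"
   by (simp add: enc3_def vadd_ac)
  finally show ?thesis using lA lB l by simp
 qed
 have zA: "addcols (addcols ?z B y) A r = e"
 proof -
  have "addcols (addcols ?z B y) A r = vadd (vadd (mx n A r) e) (mx n A r)"
   unfolding zB using lA l by (intro addcols_mat_vec) auto
  also have "... = vadd (vadd (mx n A r) (mx n A r)) e" by (simp add: vadd_ac)
  finally show ?thesis using lA l by simp
 qed
 have g: "good A B ?z r y = 1" unfolding zA using l w by (auto simp: inv_good_def enc3_def)
 define R1 where "R1 = ex (in1 n s A (vadd (mx n A r) e)) (%i. pmf (O1 i) (enc_bits r))"
 define W where "W y' = ex (in1 n s A (addcols ?z B y')) (%i1. ex (O1 i1) (%o1. ex (guess n o1) (%r. good A B ?z r y')))" for y'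
 have W0: "0 <= W y'" for y' by (simp add: W_def)
 have "R1/2 = ex (in1 n s A (addcols ?z B y)) (%i. pmf (O1 i) (enc_bits r)*(1/2))" by (simp add: R1_def zB)
 also have "... <= W y"
  unfolding W_def
 proof (rule ex_mono[OF fin_in1])
  fix i
  have "1/2 <= ex (guess n (enc_bits r)) (%r. good A B ?z r y)"
   using decode_enc_bits[OF l(1), of "[]"] g by (simp add: ex_guess)
  hence "pmf (O1 i) (enc_bits r)*(1/2) <= pmf (O1 i) (enc_bits r)*ex (guess n (enc_bits r)) (%r. good A B ?z r y)"
   by (intro mult_left_mono) auto
  also have "... <= ex (O1 i) (%o1. ex (guess n o1) (%r. good A B ?z r y))" by (rule ex_point[OF fin1]) simp
  finally show "pmf (O1 i) (enc_bits r)*(1/2) <= ex (O1 i) (%o1. ex (guess n o1) (%r. good A B ?z r y))" .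
 qed
 finally have W: "R1/2 <= W y" .
 have "ex (in2 n s A B ?z) (%i. pmf (O2 i) (enc_bits y))*(R1/4) = ex (in2 n s A B ?z) (%i. pmf (O2 i) (enc_bits y)*(R1/4))" by simp
 also have "... <= ex (in2 n s A B ?z) (%i2. ex (O2 i2) (%o2. ex (guess k o2) W))"
 proof (rule ex_mono[OF fin_in2])
  fix i
  have "R1/4 <= ex (guess k (enc_bits y)) W"
   using decode_enc_bits[OF l(2), of "[]"] W W0[of "zeros k"] by (simp add: ex_guess)
  hence "pmf (O2 i) (enc_bits y)*(R1/4) <= pmf (O2 i) (enc_bits y)*ex (guess k (enc_bits y)) W"
   by (intro mult_left_mono) auto
  also have "... <= ex (O2 i) (%o2. ex (guess k o2) W)" by (rule ex_point[OF fin2]) (simp add: W0)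
  finally show "pmf (O2 i) (enc_bits y)*(R1/4) <= ex (O2 i) (%o2. ex (guess k o2) W)" .
 qed
 finally have "(1/2)^Suc s*(ex (in2 n s A B ?z) (%i. pmf (O2 i) (enc_bits y))*(R1/4)) <=
  (1/2)^Suc s*ex (in2 n s A B ?z) (%i2. ex (O2 i2) (%o2. ex (guess k o2) W))" by (rule mult_left_mono) simp
 also have "... <= win A B ?z"
  unfolding win_ex W_def by (rule ex_geol[OF s]) simp
 finally show ?thesis by (simp add: R1_def)
qed

text \<open>Both coins of \<open>guess\<close> choose zero with probability 1/4, and then the output
  error is \<open>z\<close> itself, which the weight bound admits.\<close>

lemma win_trivial:
 assumes A: "is_mat (2*n) n A" "is_mat (2*n) k B" and l: "length z = 2*n" and w: "real n <= wbound p n"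
 shows "1/4 <= win A B z"
proof -
 have lA: "colen (2*n) A" and lB: "colen (2*n) B" using A by (auto simp: is_mat_def)
 have "addcols (addcols z B (zeros k)) A (zeros n) = z"
  using lA lB l by (simp add: addcols_mat_vec[where m = "2*n"])
 moreover have "weight n z <= n" unfolding weight_def by (rule order_trans[OF card_mono[of "{..<n}"]]) auto
 ultimately have g: "good A B z (zeros n) (zeros k) = 1"
  unfolding inv_good_def prod.case using l w lA lB by (simp, intro exI[of _ "zeros n"] exI[of _ "zeros k"] exI[of _ z]) simp
 define W where "W l' y' = ex (in1 n l' A (addcols z B y')) (%i1. ex (O1 i1) (%o1. ex (guess n o1) (%r. good A B z r y')))" for l' y'
 have W0: "0 <= W l' y'" for l' y' by (simp add: W_def)
 have 1: "1/2 <= ex (guess n o1) (%r. good A B z r (zeros k))" for o1 using g by (simp add: ex_guess)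
 have 2: "1/2 <= W l' (zeros k)" for l' unfolding W_def by (rule ex_ge[OF fin_in1], rule ex_ge[OF fin1], rule 1)
 have 3: "1/4 <= ex (guess k o2) (W l')" for o2 l' using W0[of l' "decode k o2"] 2[of l'] by (simp add: ex_guess)
 show ?thesis unfolding win_ex W_def[symmetric] by (rule ex_ge[OF fin_geol], rule ex_ge[OF fin_in2], rule ex_ge[OF fin2], rule 3)
qed

abbreviation r1 where "r1 == q1 n O1"
abbreviation r2 where "r2 == Q2 n k O2"

text \<open>\<open>c\<close> bounds the chance of reaching a target weight, \<open>\<mu>1\<close>
  and \<open>\<mu>2\<close> are the solvers' success probabilities on uniform errors of their
  weights. The main term of the decoupling is \<open>(shconst n)\<close>^2 \<mu>1 \<mu>2/4, the
  quarter coming from \<open>avg_G2\<close>; the hypothesis lets the mixing error eat at most half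
  of it.\<close>

lemma win_avg:
 assumes e: "e : XW n w0" and w: "w0 <= w1" "w0 <= w2" "3*w1 <= 2*n" "3*w2 <= 2*n" and s: "s < n"
  and b: "real w0 <= wbound p n"
 defines "c == 1/2 ^ s*(1 - 1/2 ^ s)^n/4"
 defines "\<mu>1 == avg (XW n w1) (%e. av n (%r. avg (lag n) (%A. r1 A r e)))"
  and "\<mu>2 == avg (XW n w2) (%e. avg (lag n) (%A. r2 A e))"
 assumes big: "\<kappa> ^ s <= (shconst n)\<^sup>2*\<mu>1*\<mu>2/8"
 shows "(1/2)^Suc s/4*((1/2) ^ s*(c\<^sup>2*((shconst n)\<^sup>2*\<mu>1*\<mu>2/8))) <=
  avg (lsn_mats k n) (%(A, B). av n (%r. av k (%y. win A B (enc3 A B r y e))))"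
proof -
 have le: "length e = 2*n" "weight n e = w0" using e by (auto simp: XW_def)
 define h where "h w = ex (nzv s n) (%u. of_bool (vadd u e : XW n w))" for w
 have c0: "0 <= c" by (simp add: c_def)
 have h: "c <= h w1" "c <= h w2" unfolding c_def h_def by (rule nzv_hit; use le w in simp)+
 let ?sh = "shconst n"
 have sh: "0 <= ?sh" using n by (rule shconst_nonneg)
 define I where "I gu = (of_bool (vadd (snd gu) e : XW n w1)::real)" for gu::"(bits => bits) \<times> bits"
 define v where "v gu = fst gu (vadd (snd gu) e)" for gu::"(bits => bits) \<times> bits"
 define g2 where "g2 = avg (XW n w2) (%e. avg (lag n) (%A. G2 n k O2 A e))"
 define a where "a r A = ex (rnd s n) (%gu. (KK n ^^ s) (%A. r1 (map (fst gu) A) r (v gu)) A)" for r A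
 define b where "b A = ex (rnd s n) (%gu. G2 n k O2 (map (fst gu) A) (v gu))" for A
 define R1 where "R1 A r = ex (in1 n s A (vadd (mx n A r) e)) (%i. pmf (O1 i) (enc_bits r))" for A r
 define R2 where "R2 A B r y = ex (in2 n s A B (enc3 A B r y e)) (%i. pmf (O2 i) (enc_bits y))" for A B r y
 have m2: "0 <= \<mu>2" "\<mu>2/4 <= g2"
 proof -
  show "0 <= \<mu>2" unfolding \<mu>2_def using Q2_01[OF n k fin1 fin2] by (intro avg_nonneg) auto
  have "\<mu>2/4 = avg (XW n w2) (%e. avg (lag n) (%A. r2 A e)/4)" by (simp add: \<mu>2_def avg_def sum_divide_distrib mult_ac)
  also have "... <= g2" unfolding g2_def by (intro avg_mono avg_G2[OF n k fin1 fin2])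
  finally show "\<mu>2/4 <= g2" .
 qed
 have m1: "0 <= \<mu>1" unfolding \<mu>1_def by (intro avg_nonneg) (simp add: q1_def[OF n k fin1 fin2])
 have "h w1*(?sh*\<mu>1) <= ex (rnd s n) (%gu. I gu*av n (%r. avg (lag n) (%A. r1 A r (v gu))))"
  unfolding h_def \<mu>1_def I_def v_def by (intro rnd_hit n avg_nonneg) (simp add: q1_def[OF n k fin1 fin2])
 also have "... = av n (%r. ex (rnd s n) (%gu. I gu*avg (lag n) (%A. r1 A r (v gu))))"
  by (simp only: avg_ex[OF fin_rnd] avg_mult)
 finally have hit: "h w1*(?sh*\<mu>1) <= av n (%r. ex (rnd s n) (%gu. I gu*avg (lag n) (%A. r1 A r (v gu))))" .
 let ?X = "?sh\<^sup>2*\<mu>1*\<mu>2/8"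
 have X0: "0 <= ?X" using m1 m2 by simp
 have "c\<^sup>2*?X <= h w1*h w2*?X"
  using h c0 X0 unfolding power2_eq_square by (intro mult_right_mono mult_mono) auto
 also have "... <= h w1*h w2*(?sh\<^sup>2*\<mu>1*(\<mu>2/4) - \<kappa> ^ s)"
 proof (rule mult_left_mono)
  have "?sh\<^sup>2*\<mu>1*(\<mu>2/4) = 2*?X" by simp
  thus "?X <= ?sh\<^sup>2*\<mu>1*(\<mu>2/4) - \<kappa> ^ s" using big by linarith
 qed (use h c0 in auto)
 also have "... <= h w1*h w2*(?sh\<^sup>2*\<mu>1*g2 - \<kappa> ^ s)"
  using h c0 m1 m2 by (intro mult_left_mono diff_right_mono) auto
 also have "... = h w1*(?sh*\<mu>1)*(h w2*(?sh*g2)) - \<kappa> ^ s*(h w1*h w2)"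
  by (simp add: power2_eq_square algebra_simps)
 also have "... <= av n (%r. ex (rnd s n) (%gu. I gu*avg (lag n) (%A. r1 A r (v gu))))*(h w2*(?sh*g2)) - \<kappa> ^ s*(h w1*h w2)"
  using hit h c0 sh m2 by (intro diff_right_mono mult_right_mono) auto
 also have "... = av n (%r. ex (rnd s n) (%gu. I gu*avg (lag n) (%A. r1 A r (v gu)))*(h w2*(?sh*g2)) - \<kappa> ^ s*(h w1*h w2))"
  using finite_len len_nonempty by (simp add: avg_diff) (simp add: avg_def sum_distrib_right)
 also have "... <= av n (%r. avg (lag n) (%A. a r A*b A))"
  unfolding h_def a_def b_def g2_def I_def v_def
  by (rule avg_mono) (rule decoupled[OF n k fin1 fin2 le(1)], simp)
 finally have main: "c\<^sup>2*?X <= avg (lag n) (%A. av n (%r. a r A*b A))"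
  by (subst avg_swap)
 have inner: "(1/2) ^ s*av n (%r. a r A*b A) <=
  avg (Bs k n A) (%B. av n (%r. av k (%y. R2 A B r y*R1 A r)))" if A: "A : lag n" for A
 proof -
  have b0: "0 <= b A" unfolding b_def G2_def[OF n k fin1 fin2] using Q2_01[OF n k fin1 fin2] by (intro ex_nonneg divide_nonneg_nonneg sum_nonneg) auto
  have "(1/2) ^ s*av n (%r. a r A*b A) = av n (%r. ((1/2) ^ s*a r A)*b A)"
   by (simp only: avg_mult[symmetric] mult.assoc)
  also have "... <= av n (%r. R1 A r*avg (Bs k n A) (%B. av k (%y. R2 A B r y)))"
  proof (rule avg_mono)
   fix r::"bits" assume r: "r : vecs_of n"
   have "(1/2) ^ s*a r A <= R1 A r" unfolding a_def R1_def v_def by (rule in1_lower[OF n k fin1 fin2 A le(1)])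
   moreover have "b A <= avg (Bs k n A) (%B. av k (%y. R2 A B r y))"
   unfolding b_def R2_def v_def enc3_def using r by (intro in2_lower_avg[OF n k fin1 fin2 A le(1)]) simp
   moreover have "0 <= R1 A r" by (simp add: R1_def)
   ultimately show "((1/2) ^ s*a r A)*b A <= R1 A r*avg (Bs k n A) (%B. av k (%y. R2 A B r y))"
   using b0 by (intro mult_mono) auto
  qed
  also have "... = av n (%r. avg (Bs k n A) (%B. av k (%y. R2 A B r y*R1 A r)))"
   by (simp only: avg_mult[symmetric] mult.commute[of "R1 _ _"])
  also have "... = avg (Bs k n A) (%B. av n (%r. av k (%y. R2 A B r y*R1 A r)))" by (rule avg_swap)
  finally show ?thesis .
 qed
 have "(1/2)^Suc s/4*((1/2) ^ s*(c\<^sup>2*?X)) <=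
  (1/2)^Suc s/4*((1/2) ^ s*avg (lag n) (%A. av n (%r. a r A*b A)))"
  by (intro mult_left_mono main) auto
 also have "... <= (1/2)^Suc s/4*avg (lag n) (%A. avg (Bs k n A) (%B. av n (%r. av k (%y. R2 A B r y*R1 A r))))"
  unfolding avg_mult[of "lag n", symmetric] by (intro mult_left_mono avg_mono inner) auto
 also have "... <= avg (lag n) (%A. avg (Bs k n A) (%B. av n (%r. av k (%y. win A B (enc3 A B r y e)))))"
  unfolding avg_mult[symmetric]
 proof (intro avg_mono)
  fix A B and r y::"bits" assume "A : lag n" "B : Bs k n A" "r : vecs_of n" "y : vecs_of k"
  thus "(1/2)^Suc s/4*(R2 A B r y*R1 A r) <= win A B (enc3 A B r y e)"
   unfolding R1_def R2_def using s le \<open>real w0 <= wbound p n\<close> by (intro win_lower) (auto simp: frames_def Bs_def)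
 qed
 finally show ?thesis unfolding avg_lsn[OF n] .
qed

end

subsection \<open>All errors together\<close>

context
 fixes n k::nat and O1 O2::"bits => bits pmf" and p::real
 assumes n: "n >= 1" and k: "k <= n" and fin1: "!!i. finite (set_pmf (O1 i))" and fin2: "!!i. finite (set_pmf (O2 i))"
  and p: "0 <= p" "p <= 1"
begin

definition clip::"bits => bits" where
 "clip e = (if real (weight n e) > wbound p n then replicate (2*n) False else e)"

definition total::real where
 "total = avg (lsn_mats k n) (%(A, B). av n (%r. av k (%y.
   ex (noise p n) (%e. win n k O1 O2 p A B (enc3 n A B r y (clip e))))))"

lemma length_clip: "length e = 2*n ==> length (clip e) = 2*n" by (simp add: clip_def)

lemma total_ge_quarter: assumes "p >= 1/2" shows "1/4 <= total"
proof -
 have "real n*(1/2) <= real n*p" using assms by (intro mult_left_mono) auto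
 hence "real n <= 201/100*(real n*p)" by linarith
 hence w: "real n <= wbound p n" by (simp add: wbound_def mult.assoc)
 have pt: "1/4 <= ex (noise p n) (%e. win n k O1 O2 p A B (enc3 n A B r y (clip e)))" if AB: "(A, B) : lsn_mats k n" for A B r y
 proof -
  have m: "is_mat (2*n) n A" "is_mat (2*n) k B" using AB by (auto simp: lsn_mats_def)
  have "ex (noise p n) (%_. 1/4) <= ex (noise p n) (%e. win n k O1 O2 p A B (enc3 n A B r y (clip e)))"
  proof (rule ex_mono[OF fin_noise])
   fix e assume "e : set_pmf (noise p n)"
   hence "length (enc3 n A B r y (clip e)) = 2*n"
   using m length_clip[OF length_noise] by (auto simp: enc3_def[OF n k fin1 fin2] is_mat_def)
   thus "1/4 <= win n k O1 O2 p A B (enc3 n A B r y (clip e))" by (intro win_trivial[OF n k fin1 fin2 m _ w])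
  qed
  thus ?thesis by simp
 qed
 have "avg (lsn_mats k n) (%_. av n (%_. av k (%_. 1/4))) <= total"
  unfolding total_def by (rule avg_mono, clarify, intro avg_mono pt)
 thus ?thesis using finite_len len_nonempty lsn_nonempty[OF k] by simp
qed

text \<open>Only errors of weight \<open>w0\<close> are kept; they pass the clipping
  unchanged.\<close>

lemma total_lower:
 assumes w0: "w0 <= n" "real w0 <= wbound p n"
  and lb: "!!e. e : XW n w0 ==> lb <= avg (lsn_mats k n) (%(A, B). av n (%r. av k (%y. win n k O1 O2 p A B (enc3 n A B r y e))))"
 shows "bet p n w0*lb <= total"
proof -
 define F where "F e = avg (lsn_mats k n) (%(A, B). av n (%r. av k (%y. win n k O1 O2 p A B (enc3 n A B r y e))))" for e
 have F0: "0 <= F e" for e unfolding F_def using win_nonneg[OF n k fin1 fin2] by (auto intro!: avg_nonneg)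
 have T: "total = ex (noise p n) (%e. F (clip e))"
  unfolding total_def F_def by (simp add: case_prod_beta' avg_ex)
 have "XW n w0 ~= {}" using X_nonempty[OF w0(1)] by (simp add: XW_col)
 hence "lb = avg (XW n w0) (%_. lb)" by simp
 also have "... <= avg (XW n w0) (%e. F (clip e))"
  using lb w0(2) by (intro avg_mono) (auto simp: F_def clip_def XW_def)
 finally have "bet p n w0*lb <= bet p n w0*avg (XW n w0) (%e. F (clip e))"
  by (rule mult_left_mono) (rule bet_nonneg[OF p])
 also have "... <= (\<Sum>w\<le>n. bet p n w*avg (XW n w) (%e. F (clip e)))"
  using w0 F0 bet_nonneg[OF p] by (intro member_le_sum mult_nonneg_nonneg avg_nonneg) auto
 also have "... = total" unfolding T by (rule ex_noise[OF p, symmetric])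
 finally show ?thesis .
qed

text \<open>There are n + 1 weights, so one of them contributes at least \<delta>. Both factors of
  its contribution are at most one, so each of them is at least \<delta>.\<close>

lemma heavy_weight:
 assumes f: "!!e. 0 <= f e" "!!e. f e <= 1" and d: "0 <= \<delta>" "(real n + 1)*\<delta> <= ex (noise p n) f"
 shows "EX w<=n. \<delta> <= bet p n w & \<delta> <= avg (XW n w) f"
proof -
 have "EX w<=n. \<delta> <= bet p n w*avg (XW n w) f"
 proof (rule ccontr)
  assume nt: "~ ?thesis"
  have lt: "bet p n w*avg (XW n w) f < \<delta>" if "w <= n" for w using nt that by (meson not_le)
  have "(\<Sum>w\<in>{..n}. bet p n w*avg (XW n w) f) < real (card {..n})*\<delta>"
   by (rule sum_bounded_above_strict) (auto intro: lt)
  thus False using d unfolding ex_noise[OF p] by (simp add: add.commute)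
 qed
 then obtain w where w: "w <= n" "\<delta> <= bet p n w*avg (XW n w) f" by blast
 have a: "0 <= avg (XW n w) f" "avg (XW n w) f <= 1" using f by (auto intro!: avg_nonneg avg_le_1)
 have "bet p n w*avg (XW n w) f <= bet p n w*1" using a bet_nonneg[OF p] by (intro mult_left_mono) auto
 moreover have "bet p n w*avg (XW n w) f <= 1*avg (XW n w) f" using a bet_le_1[OF p w(1)] by (intro mult_right_mono) auto
 ultimately show ?thesis using w by auto
qed

text \<open>Each solver has a weight at which it succeeds and which itself is likely. The smaller of
  the two is taken as the weight of the true error, since noise has to raise it to both
  targets.\<close>

lemma total_poly:
 fixes E L::nat
 assumes E: "E >= 1" and L: "n <= 2^L" "2^L <= 2*n" and s: "9*(2*E*L + 5) < n" and sh: "1/2 <= shconst n"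
  and lw: "!!w. w <= n ==> 1/real n^E <= bet p n w ==> 3*w <= 2*n & real w <= wbound p n"
  and s1: "(real n + 1)*(1/real n^E) <= ex (noise p n) (%e. av n (%r. avg (lag n) (%A. q1 n O1 A r e)))"
  and s2: "(real n + 1)*(1/real n^E) <= ex (noise p n) (%e. avg (lag n) (%A. Q2 n k O2 A e))"
 shows "1/(2^194*(2*real n)^(72*E)*real n^(3*E)) <= total"
proof -
 \<comment> \<open>\<open>\<kappa>\<close>^9 <= 1/2, so \<kappa>^s <= 2^-(2EL+5) <= n^(-2E)/32, the
   size of the main term when each success probability is n^-E and \<open>shconst\<close> is
   1/2.\<close>
 define s where "s = 9*(2*E*L + 5)"
 define y where "y = 1/real n^E"
 have y0: "0 <= y" by (simp add: y_def)
 have "EX w<=n. y <= bet p n w & y <= avg (XW n w) (%e. av n (%r. avg (lag n) (%A. q1 n O1 A r e)))"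
  using s1 y0 unfolding y_def by (intro heavy_weight avg_nonneg avg_le_1) (auto simp: q1_def[OF n k fin1 fin2] pmf_le_1)
 then obtain w1 where w1: "w1 <= n" "y <= bet p n w1" "y <= avg (XW n w1) (%e. av n (%r. avg (lag n) (%A. q1 n O1 A r e)))"
  (is "_ <= ?m1") by blast
 have "EX w<=n. y <= bet p n w & y <= avg (XW n w) (%e. avg (lag n) (%A. Q2 n k O2 A e))"
  using s2 y0 Q2_01[OF n k fin1 fin2] unfolding y_def by (intro heavy_weight avg_nonneg avg_le_1) auto
 then obtain w2 where w2: "w2 <= n" "y <= bet p n w2" "y <= avg (XW n w2) (%e. avg (lag n) (%A. Q2 n k O2 A e))"
  (is "_ <= ?m2") by blast
 define w0 where "w0 = min w1 w2"
 have w0: "w0 <= n" "y <= bet p n w0" using w1 w2 by (auto simp: w0_def min_def)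
 have ww: "3*w1 <= 2*n" "3*w2 <= 2*n" "real w0 <= wbound p n"
  using lw[OF w1(1)] lw[OF w2(1)] lw[OF w0(1)] w1 w2 w0 by (auto simp: y_def)
 let ?q = "1/2 ^ s::real" and ?sh = "shconst n"
 define c where "c = ?q*(1 - ?q)^n/4"
 have n0: "real n > 0" using n by simp
 have yL: "(1/2^L)^E <= y"
 proof -
  have "real n <= 2^L" using L(1) by (metis of_nat_le_iff of_nat_numeral of_nat_power)
  hence "1/2^L <= 1/real n" using n0 by (intro divide_left_mono) auto
  hence "(1/2^L)^E <= (1/real n)^E" by (intro power_mono) auto
  thus ?thesis by (simp add: y_def power_one_over)
 qed
 have shm: "y*y/32 <= ?sh\<^sup>2*?m1*?m2/8"
 proof -
  have "1/4 <= ?sh\<^sup>2" using power_mono[OF sh, of 2] by (simp add: power2_eq_square)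
  hence "1/4*y*y <= ?sh\<^sup>2*?m1*?m2" using w1 w2 y0 by (intro mult_mono) auto
  thus ?thesis by simp
 qed
 have "\<kappa> ^ s <= y*y/32"
 proof -
  have "\<kappa> ^ s = (\<kappa> ^ 9)^(2*E*L + 5)" unfolding s_def by (rule power_mult)
  also have "... <= (1/2)^(2*E*L + 5)" by (intro power_mono) (simp_all add: power_divide)
  also have "... = (1/2^L)^E*(1/2^L)^E/32"
  proof -
   have "(1/2^L)^E = (1/2::real)^(E*L)" by (simp add: power_one_over power_mult[symmetric] mult.commute)
   moreover have "2*E*L + 5 = E*L + E*L + 5" by simp
   ultimately show ?thesis by (simp only: power_add) (simp add: power_divide)
  qed
  also have "... <= y*y/32" using yL y0 by (intro divide_right_mono mult_mono) auto
  finally show ?thesis .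
 qed
 hence big: "\<kappa> ^ s <= ?sh\<^sup>2*?m1*?m2/8" using shm by linarith
 \<comment> \<open>As 2^s >= 2n, the noise survives n stopping trials with probability at least
   1/2.\<close>
 have c: "?q/8 <= c"
 proof -
  have "L + 1 <= s" using E by (cases E) (auto simp: s_def)
  hence "(2::real)^(L + 1) <= 2 ^ s" by (intro power_increasing) auto
  moreover have "real n <= 2^L" using L(1) by (metis of_nat_le_iff of_nat_numeral of_nat_power)
  moreover have "(2::real)^(L + 1) = 2*2^L" by simp
  ultimately have "real n <= 1/2*2 ^ s" by linarith
  hence nq: "real n*?q <= 1/2" by (simp add: divide_le_eq)
  have "1 + real n*(- ?q) <= (1 + - ?q)^n" by (rule Bernoulli_inequality) simp
  hence "1 - real n*?q <= (1 - ?q)^n" by simp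
  hence "1/2 <= (1 - ?q)^n" using nq by linarith
  hence "?q*(1/2)/4 <= c" unfolding c_def by (intro divide_right_mono mult_left_mono) auto
  thus ?thesis by simp
 qed
 let ?lb = "(1/2)^Suc s/4*((1/2) ^ s*(c\<^sup>2*(?sh\<^sup>2*?m1*?m2/8)))"
 have lb: "?q/8*(?q*((?q/8)\<^sup>2*(y*y/32))) <= ?lb"
 proof -
  have "?q/8 = (1/2)^Suc s/4" "?q = (1/2) ^ s" by (simp_all add: power_one_over)
  moreover have "(?q/8)\<^sup>2*(y*y/32) <= c\<^sup>2*(?sh\<^sup>2*?m1*?m2/8)"
   using c shm y0 by (intro mult_mono power_mono) auto
  ultimately show ?thesis by (metis (no_types, lifting) mult_left_mono zero_le_divide_1_iff zero_le_numeral zero_le_power divide_nonneg_nonneg)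
 qed
 have "y*(?q/8*(?q*((?q/8)\<^sup>2*(y*y/32)))) <= bet p n w0*?lb"
  by (rule mult_mono[OF w0(2) lb bet_nonneg[OF p]]) (use y0 in simp)
 also have "... <= total"
 proof (rule total_lower[OF w0(1) ww(3)])
  fix e assume "e : XW n w0"
  thus "?lb <= avg (lsn_mats k n) (%(A, B). av n (%r. av k (%y. win n k O1 O2 p A B (enc3 n A B r y e))))"
   unfolding c_def using s ww big by (intro win_avg[OF n k fin1 fin2]) (auto simp: w0_def s_def)
 qed
 \<comment> \<open>Four factors 2^-s: two from hitting the weights, one from guessing the bits of
   the transvections, one from drawing s. The three factors y come from the true weight and the two
   solvers, and 2^14 is 8 * 8^2 * 32.\<close>
 finally have "(y*y*y)*(?q^4)/2^14 <= total" by (simp add: power2_eq_square power4_eq_xxxx)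
 moreover have "1/(2^194*(2*real n)^(72*E)*real n^(3*E)) <= (y*y*y)*(?q^4)/2^14"
 proof -
  have "s = 45 + L*(18*E)" by (simp add: s_def algebra_simps)
  hence "(2::real) ^ s = 2^45*(2^L)^(18*E)" by (simp only: power_add power_mult)
  also have "... <= 2^45*(2*real n)^(18*E)"
   using L(2) by (intro mult_left_mono power_mono) (metis of_nat_le_iff of_nat_mult of_nat_numeral of_nat_power, auto)
  finally have "(2 ^ s)^4 <= (2^45*(2*real n)^(18*E))^4" by (intro power_mono) auto
  also have "... = 2^180*(2*real n)^(72*E)" by (simp add: power_mult_distrib power_mult[symmetric])
  finally have "2^14*(2 ^ s)^4*real n^(3*E) <= 2^14*(2^180*(2*real n)^(72*E))*real n^(3*E)"
   by (intro mult_left_mono mult_right_mono) auto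
  hence "1/(2^14*(2^180*(2*real n)^(72*E))*real n^(3*E)) <= 1/(2^14*(2 ^ s)^4*real n^(3*E))"
   using n0 by (intro divide_left_mono mult_pos_pos) auto
  also have "... = (y*y*y)*(?q^4)/2^14"
  proof -
   have "3*E = E + E + E" by simp
   hence "real n^(3*E) = real n^E*real n^E*real n^E" by (simp only: power_add)
   thus ?thesis by (simp add: y_def power_one_over mult.commute)
  qed
  finally show ?thesis by (simp add: mult_ac)
 qed
 ultimately show ?thesis by linarith
qed

end

section \<open>Success probabilities as averages over the noise\<close>

lemma fin_outd [simp]: "finite (set_pmf (outd P t x))" by (simp add: outd_def)

lemma frames_nonempty: "lag n ~= {}" using card_frames_pos[of n n] by auto

lemma success_symplpn:
 assumes n: "n >= 1" and B: "runs_in_time B T symplpn_inputs"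
 shows "success_prob B (T n) (symplpn_dist p n) (%x out. out = enc_bits x) =
  ex (noise p n) (%e. av n (%r. avg (lag n) (%A. q1 n (outd B (T n)) A r e)))"
proof -
 let ?D = "symplpn_dist p n"
 have S: "set_pmf (pmf_of_set (lagr_mats n)) = lag n"
  by (simp add: lagr_frames frames_nonempty)
 have "success_prob B (T n) ?D (%x out. out = enc_bits x) = ex ?D (%(x, s). measure_pmf.prob (outd B (T n) x) {out. out = enc_bits s})"
 proof (rule success_prob_outd)
  fix x s tp assume "(x, s) : set_pmf ?D"
  then obtain A e where "A : lag n" "e : set_pmf (noise p n)" "x = enc_mat A @ enc_bits (vadd (mx n A s) e)"
   by (auto simp: symplpn_dist_def S)
  hence "x : symplpn_inputs n"
   using length_noise frames_len[of A n n] unfolding symplpn_inputs_def by (fastforce simp: frames_def)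
  thus "exec B (T n) (init x tp) ~= None" using B by (simp add: runs_in_time_def)
 qed
 also have "... = avg (lag n) (%A. av n (%r. ex (noise p n) (%e. q1 n (outd B (T n)) A r e)))"
  by (simp add: symplpn_dist_def ex_bind S measure_pmf_single q1_def[OF n le0 fin_outd fin_outd] ex_uniform)
   (simp add: lagr_frames ex_set frames_nonempty)
 also have "... = av n (%r. avg (lag n) (%A. ex (noise p n) (%e. q1 n (outd B (T n)) A r e)))" by (rule avg_swap)
 finally show ?thesis by (simp add: avg_ex)
qed

lemma success_lsn:
 assumes n: "n >= 1" "k n <= n" and B: "runs_in_time B T (%n. lsn_inputs (k n) n)"
 shows "success_prob B (T n) (lsn_dist (k n) p n) (%y out. out = enc_bits y) =
  ex (noise p n) (%e. avg (lag n) (%A. Q2 n (k n) (outd B (T n)) A e))"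
proof -
 let ?D = "lsn_dist (k n) p n"
 have S: "set_pmf (pmf_of_set (lsn_mats (k n) n)) = lsn_mats (k n) n" using lsn_nonempty[OF n(2)] by simp
 have "success_prob B (T n) ?D (%y out. out = enc_bits y) = ex ?D (%(x, s). measure_pmf.prob (outd B (T n) x) {out. out = enc_bits s})"
 proof (rule success_prob_outd)
  fix x s tp assume "(x, s) : set_pmf ?D"
  then obtain A M r e where *: "(A, M) : lsn_mats (k n) n" "e : set_pmf (noise p n)"
   "x = enc_mat A @ enc_mat M @ enc_bits (vadd (vadd (mx n A r) (mx n M s)) e)"
   by (auto simp: lsn_dist_def S)
  hence "is_mat (2*n) n A" "is_mat (2*n) (k n) M" by (auto simp: lsn_mats_def)
  moreover from this have "length (vadd (vadd (mx n A r) (mx n M s)) e) = 2*n"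
   using length_noise[OF *(2)] by (simp add: is_mat_def)
  ultimately have "x : lsn_inputs (k n) n" unfolding lsn_inputs_def *(3) by blast
  thus "exec B (T n) (init x tp) ~= None" using B by (simp add: runs_in_time_def)
 qed
 also have "... = avg (lsn_mats (k n) n) (%(A, M). av n (%r. avg (vecs_of (k n)) (%y. ex (noise p n) (%e. q2 n (outd B (T n)) A M r y e))))"
  using lsn_nonempty[OF n(2)]
  by (simp add: lsn_dist_def ex_bind S measure_pmf_single q2_def[OF n fin_outd fin_outd] ex_uniform case_prod_beta') (simp add: ex_set)
 also have "... = avg (lag n) (%A. avg (Bs (k n) n A) (%M. avg (vecs_of (k n)) (%y. av n (%r. ex (noise p n) (%e. q2 n (outd B (T n)) A M r y e)))))"
  unfolding avg_lsn[OF n(1)] by (intro avg_cong avg_swap)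
 finally show ?thesis by (simp add: Q2_def[OF n fin_outd fin_outd] avg_ex)
qed

lemma success_inverter:
 assumes n: "n >= 1" "k <= n"
  and P: "!!A B z. is_mat (2*n) n A ==> is_mat (2*n) k B ==> length z = 2*n ==>
   (ALL tp. exec P t (init (enc_mat A @ enc_mat B @ enc_bits z) tp) ~= None) &
   outd P t (enc_mat A @ enc_mat B @ enc_bits z) = algd O1 O2 n k A B z"
  and fin: "!!i. finite (set_pmf (O1 i))" "!!i. finite (set_pmf (O2 i))" and p: "0 <= p" "p <= 1"
 shows "success_prob P t (inv_dist k p n) (inv_good k p n) = total n k O1 O2 p"
proof -
 let ?D = "inv_dist k p n"
 have S: "set_pmf (pmf_of_set (lsn_mats k n)) = lsn_mats k n" using lsn_nonempty[OF n(2)] by simp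
 note defs = clip_def[OF n fin p] enc3_def[OF n fin]
 have D: "?D = do { AB <- pmf_of_set (lsn_mats k n); r <- unif n; y <- unif k; e <- noise p n;
   ret (enc_mat (fst AB) @ enc_mat (snd AB) @ enc_bits (enc3 n (fst AB) (snd AB) r y (clip n p e)), (fst AB, snd AB, enc3 n (fst AB) (snd AB) r y (clip n p e))) }"
  by (simp add: inv_dist_def defs Let_def case_prod_beta')
 have run: "(ALL tp. exec P t (init (enc_mat A @ enc_mat B @ enc_bits (enc3 n A B r y (clip n p e))) tp) ~= None) &
   measure_pmf.prob (outd P t (enc_mat A @ enc_mat B @ enc_bits (enc3 n A B r y (clip n p e)))) {out. inv_good k p n (A, B, enc3 n A B r y (clip n p e)) out} =
   win n k O1 O2 p A B (enc3 n A B r y (clip n p e))"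
  if "(A, B) : lsn_mats k n" "e : set_pmf (noise p n)" for A B r y e
 proof -
  have m: "is_mat (2*n) n A" "is_mat (2*n) k B" using that(1) by (auto simp: lsn_mats_def)
  hence "length (enc3 n A B r y (clip n p e)) = 2*n"
   using length_noise[OF that(2)] by (auto simp: defs is_mat_def)
  thus ?thesis using P[OF m] by (simp add: win_def[OF n fin])
 qed
 have "success_prob P t ?D (inv_good k p n) = ex ?D (%(x, s). measure_pmf.prob (outd P t x) {out. inv_good k p n s out})"
 proof (rule success_prob_outd)
  fix x s tp assume "(x, s) : set_pmf ?D"
  thus "exec P t (init x tp) ~= None" using run unfolding D by (auto simp: S)
 qed
 also have "... = ex (pmf_of_set (lsn_mats k n)) (%AB. ex (unif n) (%r. ex (unif k) (%y. ex (noise p n) (%e.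
   win n k O1 O2 p (fst AB) (snd AB) (enc3 n (fst AB) (snd AB) r y (clip n p e))))))"
  unfolding D by (simp add: ex_bind S) (intro ex_cong, auto simp: S run)
 finally show ?thesis unfolding total_def[OF n fin p] using lsn_nonempty[OF n(2)]
  by (simp add: ex_uniform case_prod_beta') (simp add: ex_set)
qed

text \<open>A weight of probability at least n^-E satisfies w ln 2 <= n ln(1 + p) + E ln n by
  \<open>bet_mgf\<close>. For p < 1/2 the right side is too small for w > 2n/3. With ln(1 + p) <= p,
  ln 2 >= 2/3 and E ln n <= np/3 it also gives w <= 2np, just inside 2.01np.\<close>

lemma weight_bounds:
 fixes E::nat
 assumes n: "n >= 2" and p: "0 <= p" "p < 1/2" and w: "w <= n" "1/real n^E <= bet p n w"
  and big: "real E*ln (real n) < 5/96*real n" and np: "3*(real E*ln (real n)) <= real n*p"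
 shows "3*w <= 2*n & real w <= wbound p n"
proof -
 let ?l = "real E*ln (real n)"
 have n0: "real n > 0" using n by simp
 have "1/real n^E*2^w <= bet p n w*2^w" using w by (intro mult_right_mono) auto
 also have "... <= (1 + p)^n" using p w by (intro bet_mgf) auto
 finally have "2^w <= (1 + p)^n*real n^E" using n0 by (simp add: field_simps)
 hence "ln (2^w) <= ln ((1 + p)^n*real n^E)" using p n0 by (subst ln_le_cancel_iff) auto
 hence main: "real w*ln 2 <= real n*ln (1 + p) + ?l"
  using p n0 by (simp add: ln_mult ln_realpow)
 have "3*real w <= 2*real n"
 proof (rule ccontr)
  assume "~ ?thesis"
  hence "2/3*real n*ln 2 <= real w*ln 2" by (intro mult_right_mono) auto
  also have "... <= real n*ln (3/2) + ?l"
  proof -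
   have "real n*ln (1 + p) <= real n*ln (3/2)" using p n0 by (intro mult_left_mono) auto
   thus ?thesis using main by linarith
  qed
  finally have "real n*(2/3*ln 2 - ln (3/2)) <= ?l" by (simp add: algebra_simps)
  \<comment> \<open>Three times the right side is ln(32/27), which is at least 1 - 27/32 =
    5/32.\<close>
  moreover have "5/96 <= 2/3*ln 2 - ln (3/2::real)"
  proof -
   have "3*(2/3*ln 2 - ln (3/2::real)) = ln (2^2) - ln ((3/2)^3)" by (simp only: ln_realpow) simp
   also have "... = ln (2^2/(3/2)^3)" by (subst ln_div) auto
   also have "(2::real)^2/(3/2)^3 = inverse (27/32)" by (simp add: power_divide)
   also have "ln ... = - ln (27/32)" by (rule ln_inverse)
   finally show ?thesis using ln_le_minus_one[of "27/32::real"] by simp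
  qed
  hence "real n*(5/96) <= real n*(2/3*ln 2 - ln (3/2))" by (intro mult_left_mono) auto
  ultimately show False using big by linarith
 qed
 moreover have "real w <= 201/100*(real n*p)"
 proof (rule ccontr)
  assume "~ ?thesis"
  hence "201/100*(real n*p) < real w" by simp
  moreover have "real w*(2/3) <= real w*ln 2" using ln2_ge_two_thirds by (intro mult_left_mono) auto
  moreover have "real n*ln (1 + p) <= real n*p" using p by (intro mult_left_mono ln_add_one_self_le_self) auto
  moreover have "0 <= ?l" using n by simp
  ultimately show False using main np by argo
 qed
 ultimately show ?thesis by (simp add: wbound_def mult.assoc)
qed

text \<open>One more factor n absorbs the constant. Allowing every larger exponent lets both solvers
  share one.\<close>

lemma inv_poly_power:
 assumes "inv_poly f" shows "EX D. ALL D'>=D. \<forall>\<^sub>F n in sequentially. 1/real n^D' <= f n"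
proof -
 obtain c::real and d where c: "c > 0" "\<forall>\<^sub>F n in sequentially. 1/(c*real n^d) <= f n"
  using assms unfolding inv_poly_def by blast
 have "\<forall>\<^sub>F n in sequentially. 1/real n^D' <= f n" if "D' >= d + 1" for D'
  using c(2) eventually_ge_at_top[of "nat \<lceil>c\<rceil> + 1"]
 proof eventually_elim
  case (elim n)
  have "c <= real n" using elim(2) by linarith
  hence "c*real n^d <= real n*real n^d" by (intro mult_right_mono) auto
  also have "... <= real n^D'" using power_increasing[of "d + 1" D' "real n"] that elim(2) by simp
  finally have "1/real n^D' <= 1/(c*real n^d)" using c(1) elim(2) by (intro divide_left_mono) auto
  thus ?case using elim(1) by linarith
 qed
 thus ?thesis by blast
qed

theorem theoremB4:
  fixes k :: "nat \<Rightarrow> nat" and p :: "nat \<Rightarrow> real"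
    and T1 T2 :: "nat \<Rightarrow> nat" and B1 B2 :: "instr list"
  assumes k_le: "\<forall>n. k n \<le> n"
    and p_range: "\<forall>n. 0 \<le> p n \<and> p n \<le> 1"
    and k_omega: "(\<lambda>n. ln (real n)) \<in> o(\<lambda>n. real (k n))"
    and p_omega: "(\<lambda>n. ln (real n) / real n) \<in> o(p)"
    and B1_time: "runs_in_time B1 T1 symplpn_inputs"
    and B1_succ: "inv_poly (\<lambda>n. success_prob B1 (T1 n) (symplpn_dist (p n) n) (\<lambda>x out. out = enc_bits x))"
    and B2_time: "runs_in_time B2 T2 (\<lambda>n. lsn_inputs (k n) n)"
    and B2_succ: "inv_poly (\<lambda>n. success_prob B2 (T2 n) (lsn_dist (k n) (p n) n) (\<lambda>y out. out = enc_bits y))"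
  shows "\<exists>Alg :: instr list. \<exists>c d :: nat.
     runs_in_time Alg (\<lambda>n. T1 n + T2 n + c * n ^ d + c) (\<lambda>n. lsn_inputs (k n) n)
     \<and> inv_poly (\<lambda>n. success_prob Alg (T1 n + T2 n + c * n ^ d + c) (inv_dist (k n) (p n) n)
                      (inv_good (k n) (p n) n))"
proof -
 obtain P c d where P: "!!n A B z. is_mat (2*n) n A ==> is_mat (2*n) (k n) B ==> length z = 2*n ==>
   (ALL tp. exec P (T1 n + T2 n + c*n^d + c) (init (enc_mat A @ enc_mat B @ enc_bits z) tp) ~= None) &
   outd P (T1 n + T2 n + c*n^d + c) (enc_mat A @ enc_mat B @ enc_bits z) = algd (outd B1 (T1 n)) (outd B2 (T2 n)) n (k n) A B z"
  using alg_correct[OF B1_time B2_time k_le] by blast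
 obtain D1 D2 where D: "ALL D'>=D1. \<forall>\<^sub>F n in sequentially. 1/real n^D' <= success_prob B1 (T1 n) (symplpn_dist (p n) n) (%x out. out = enc_bits x)"
  "ALL D'>=D2. \<forall>\<^sub>F n in sequentially. 1/real n^D' <= success_prob B2 (T2 n) (lsn_dist (k n) (p n) n) (%y out. out = enc_bits y)"
  using inv_poly_power[OF B1_succ] inv_poly_power[OF B2_succ] by blast
 \<comment> \<open>The two extra powers of n pay for the n + 1 weights among which
   \<open>heavy_weight\<close> selects.\<close>
 define F E where "F = max D1 D2" and "E = F + 2"
 have s1: "\<forall>\<^sub>F n in sequentially. 1/real n^F <= success_prob B1 (T1 n) (symplpn_dist (p n) n) (%x out. out = enc_bits x)"
  and s2: "\<forall>\<^sub>F n in sequentially. 1/real n^F <= success_prob B2 (T2 n) (lsn_dist (k n) (p n) n) (%y out. out = enc_bits y)"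
  using D by (auto simp: F_def)
 \<comment> \<open>This is where p is asked to dominate log n / n: it gives 3E ln n <= np, so the
   logarithmic term in \<open>weight_bounds\<close> costs at most a third of np.\<close>
 have np: "\<forall>\<^sub>F n in sequentially. norm (ln (real n)/real n) <= 1/(3*real E)*norm (p n)"
  using p_omega by (rule landau_o.smallD) (simp add: E_def)
 define R where "R = real E"
 \<comment> \<open>The number of rounds must stay below n to be a possible value of
   \<open>geol\<close>; its logarithm is rounded up, hence the + 1.\<close>
 have "\<forall>\<^sub>F n in sequentially. 9*(2*R*(log 2 (real n) + 1) + 5) < real n" by real_asymp
 moreover have "\<forall>\<^sub>F n in sequentially. R*ln (real n) < 5/96*real n" by real_asymp
 moreover have "\<forall>\<^sub>F n in sequentially. 2*real n + real n^2 <= 2^n/4" by real_asymp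
 ultimately have "\<forall>\<^sub>F n in sequentially. 1/(2^194*2^(72*E)*real n^(75*E)) <=
   success_prob P (T1 n + T2 n + c*n^d + c) (inv_dist (k n) (p n) n) (inv_good (k n) (p n) n)"
  using s1 s2 np eventually_ge_at_top[of 2]
 proof eventually_elim
  case (elim n)
  let ?O1 = "outd B1 (T1 n)" and ?O2 = "outd B2 (T2 n)"
  have n: "n >= 1" "k n <= n" "n >= 2" and pn: "0 <= p n" "p n <= 1" and n0: "real n > 0"
   using elim(7) k_le p_range by auto
  have "success_prob P (T1 n + T2 n + c*n^d + c) (inv_dist (k n) (p n) n) (inv_good (k n) (p n) n) = total n (k n) ?O1 ?O2 (p n)"
   by (rule success_inverter[OF n(1,2) P fin_outd fin_outd pn])
  moreover have "1/(2^194*(2*real n)^(72*E)*real n^(3*E)) <= total n (k n) ?O1 ?O2 (p n)"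
  proof (cases "p n >= 1/2")
   case True
   have "4*1 <= (2::real)^194*((2*real n)^(72*E)*real n^(3*E))"
   using n by (intro mult_mono mult_ge1_I one_le_power) auto
   hence "1/(2^194*(2*real n)^(72*E)*real n^(3*E)) <= 1/4"
   using n0 by (intro divide_left_mono) (auto simp: mult.assoc)
   also have "... <= total n (k n) ?O1 ?O2 (p n)" by (rule total_ge_quarter[OF n(1,2) fin_outd fin_outd pn True])
   finally show ?thesis .
  next
   case False
   define L where "L = nat \<lceil>log 2 (real n)\<rceil>"
   have lg: "0 <= log 2 (real n)" using n by simp
   have L: "log 2 (real n) <= real L" "real L <= log 2 (real n) + 1" using lg unfolding L_def by linarith+
   have "real n = 2 powr log 2 (real n)" using n0 by simp
   also have "... <= 2 powr real L" using L by (intro powr_mono) auto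
   finally have L1: "real n <= 2^L" by (simp add: powr_realpow)
   have "2^L = 2 powr real L" by (simp add: powr_realpow)
   also have "... <= 2 powr (log 2 (real n) + 1)" using L by (intro powr_mono) auto
   also have "... = 2*real n" using n0 by (simp add: powr_add)
   finally have L2: "(2::real)^L <= 2*real n" .
   have "9*(2*R*real L + 5) <= 9*(2*R*(log 2 (real n) + 1) + 5)"
   using L by (intro mult_left_mono add_right_mono) (auto simp: R_def)
   hence "real (9*(2*E*L + 5)) < real n" using elim(1) by (simp add: R_def)
   hence s: "9*(2*E*L + 5) < n" by (simp only: of_nat_less_iff)
   \<comment> \<open>For n >= 2 the n + 1 weights cost at most a factor n^2.\<close>
   have d: "(real n + 1)*(1/real n^E) <= 1/real n^F"
   proof -
   have "2*real n <= real n*real n" using n by (intro mult_right_mono) auto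
   hence "real n + 1 <= real n*real n" using n0 n(3) by linarith
   hence "(real n + 1)*(1/real n^E) <= real n*real n*(1/real n^E)" by (intro mult_right_mono) auto
   also have "... = 1/real n^F" using n0 by (simp add: E_def power_add power2_eq_square)
   finally show ?thesis .
   qed
   have lw: "3*w <= 2*n & real w <= wbound (p n) n" if "w <= n" "1/real n^E <= bet (p n) n w" for w
   proof (rule weight_bounds[OF n(3) pn(1) _ that])
   show "p n < 1/2" using False by simp
   show "real E*ln (real n) < 5/96*real n" using elim(2) by (simp add: R_def)
   have "ln (real n)/real n <= 1/(3*real E)*p n" using elim(6) n pn by simp
   thus "3*(real E*ln (real n)) <= real n*p n" using n0 by (simp add: E_def field_simps)
   qed
   show ?thesis
   proof (rule total_poly[OF n(1,2) fin_outd fin_outd pn _ _ _ s shconst_lower[OF n(1) elim(3)] lw])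
   show "E >= 1" by (simp add: E_def)
   show "n <= 2^L" using L1 by (metis of_nat_le_iff of_nat_numeral of_nat_power)
   show "2^L <= 2*n" using L2 by (metis of_nat_le_iff of_nat_mult of_nat_numeral of_nat_power)
   show "(real n + 1)*(1/real n^E) <= ex (noise (p n) n) (%e. av n (%r. avg (lag n) (%A. q1 n ?O1 A r e)))"
   using d elim(4) unfolding success_symplpn[OF n(1) B1_time] by linarith
   show "(real n + 1)*(1/real n^E) <= ex (noise (p n) n) (%e. avg (lag n) (%A. Q2 n (k n) ?O2 A e))"
   using d elim(5) unfolding success_lsn[of n k, OF n(1,2) B2_time] by linarith
   qed
  qed
  moreover have "(2*real n)^(72*E)*real n^(3*E) = 2^(72*E)*real n^(75*E)"
   by (simp add: power_mult_distrib power_add[symmetric])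
  ultimately show ?case by (simp add: mult.assoc)
 qed
 hence "inv_poly (%n. success_prob P (T1 n + T2 n + c*n^d + c) (inv_dist (k n) (p n) n) (inv_good (k n) (p n) n))"
  unfolding inv_poly_def by (intro exI[of _ "2^194*2^(72*E)"] exI[of _ "75*E"]) simp
 moreover have "runs_in_time P (%n. T1 n + T2 n + c*n^d + c) (%n. lsn_inputs (k n) n)"
  using P unfolding runs_in_time_def lsn_inputs_def by blast
 ultimately show ?thesis by blast
qed

end
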